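(* Let $\Omega\subset\mathbb{C}$ be a region in which $\mathcal{T}(\lambda)$ is Fredholm of index $0$ with $i_{\mathrm{M}}(A_+(\lambda))=i_{\mathrm{M}}(A_-(\lambda))=i_{\mathrm{M}}$, and in which analytic bases of $E^{\mathrm{u}}_-(0;\lambda)$ and $E^{\mathrm{s}}_+(0;\lambda)$ have been chosen to define $\iota(\lambda)$. Then the nonlinear eigenvalue problems $\mathcal{T}(\lambda)$ and $\iota(\lambda)$ are equivalent in $\Omega$ in the sense that geometric and algebraic multiplicities agree: for every $\lambda_*\in\Omega$, $\dim\ker\mathcal{T}(\lambda_* )=\dim\ker\iota(\lambda_* )$, and the algebraic multiplicity of $\lambda_*$ for $\mathcal{T}$ equals its algebraic multiplicity for $\iota$. In particular, the algebraic multiplicity of an eigenvalue $\lambda_*\in\Omega$ of $\mathcal{T}(\lambda)$ equals the order of $\lambda_*$ as a root of the Evans function $\mathcal{E}(\lambda)=\det\iota(\lambda)$.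
   Context: Setting. Let $A(x;\lambda)\in\mathbb{C}^{N\times N}$, $x\in\mathbb{R}$, be continuous in $x$ and analytic in $\lambda$, with limits $A_\pm(\lambda)=\lim_{x\to\pm\infty}A(x;\lambda)$. Let $\mathcal{T}(\lambda)=\frac{\mathrm{d}}{\mathrm{d}x}-A(x;\lambda)$, a closed operator on $L^2(\mathbb{R},\mathbb{C}^N)$ with domain $H^1(\mathbb{R},\mathbb{C}^N)$, understood as an analytic pencil of bounded operators $H^1\to L^2$. $\mathcal{T}(\lambda)$ is Fredholm if and only if $A_\pm(\lambda)$ have no purely imaginary eigenvalues, and then its index is $i_{\mathrm{M}}(A_-(\lambda))-i_{\mathrm{M}}(A_+(\lambda))$, where $i_{\mathrm{M}}(B)$ counts eigenvalues of $B$ with positive real part with multiplicity. Subspaces. $E^{\mathrm{s}}_+(\lambda)$ (resp. $E^{\mathrm{u}}_-(\lambda)$) is the generalized eigenspace of $A_+(\lambda)$ to eigenvalues with negative real part (resp. of $A_-(\lambda)$ to eigenvalues with positive real part). $E^{\mathrm{s}}_+(x;\lambda)$, $E^{\mathrm{u}}_-(x;\lambda)$ are the unique families of subspaces of $\mathbb{C}^N$, continuous in $x$, transported by the flow of $u_x=A(x;\lambda)u$, converging to $E^{\mathrm{s}}_+(\lambda)$ as $x\to+\infty$ and to $E^{\mathrm{u}}_-(\lambda)$ as $x\to-\infty$, respectively; they depend analytically on $\lambda$ in $\Omega$ and have dimensions $N-i_{\mathrm{M}}$ and $i_{\mathrm{M}}$. The matrix pencil $\iota$. Let $w^{\mathrm{u}}_j(\lambda)$,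 $1\le j\le i_{\mathrm{M}}$, and $w^{\mathrm{s}}_j(\lambda)$, $i_{\mathrm{M}}+1\le j\le N$, be analytic bases of $E^{\mathrm{u}}_-(0;\lambda)$ and $E^{\mathrm{s}}_+(0;\lambda)$. Then $\iota(\lambda):\mathbb{C}^N\to\mathbb{C}^N$ is $$\iota(\lambda)u=\sum_{j=1}^{i_{\mathrm{M}}}u_jw^{\mathrm{u}}_j(\lambda)-\sum_{j=i_{\mathrm{M}}+1}^{N}u_jw^{\mathrm{s}}_j(\lambda).$$ Multiplicities. Let $T(\lambda)$ be an analytic pencil of index-$0$ Fredholm operators (either $\mathcal{T}$ or the matrix pencil $\iota$). $\lambda_*$ is an eigenvalue if $\ker T(\lambda_* )\neq\{0\}$; its geometric multiplicity is $\dim\ker T(\lambda_* )$. A polynomial $u(\lambda)=\sum_{j=0}^pu_j(\lambda-\lambda_* )^j$ (of degree at most $p$, with coefficients in the domain of $T$) is a root function of order $p$ if $T(\lambda)u(\lambda)=\mathcal{O}((\lambda-\lambda_* )^{p+1})$ as $\lambda\to\lambda_*$. The algebraic multiplicity of $\lambda_*$ is the dimension of the space of root functions of arbitrary order: with $V_p$ the linear space of root functions of order $p$, multiplication by $\lambda-\lambda_*$ embeds $V_p$ into $V_{p+1}$, and the algebraic multiplicity is $\sup_p\dim V_p\in\{0,1,2,\dots\}\cup\{\infty\}$ (a root of infinite order corresponds to $\mathcal{E}\equiv0$ near $\lambda_*$). *)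

theory Defs
  imports
    "HOL-Complex_Analysis.Complex_Analysis"
    "HOL-Library.Function_Algebras"
    "HOL-Library.Extended_Nat"
    "HOL-Library.Landau_Symbols"
begin

section \<open>Complex dimensions with values in the extended naturals\<close>

text \<open>
  The scalar multiplication of a complex vector space is passed explicitly, because the library
  has no type class of complex vector spaces. The library's dimension is 0 for
  infinite-dimensional spaces; here these get dimension \<open>\<infinity>\<close>.
\<close>

definition edim :: "(complex \<Rightarrow> 'v \<Rightarrow> 'v::ab_group_add) \<Rightarrow> 'v set \<Rightarrow> enat" where
  "edim s V = (if \<exists>B. finite B \<and> V \<subseteq> module.span s B then enat (vector_space.dim s V) else \<infinity>)"

text \<open>
  Dimension of the quotient \<open>W/V\<close>: the least size of a set of elements of \<open>W\<close> whose classes span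
  \<open>W/V\<close>. The infimum of the empty set is \<open>\<infinity>\<close>.
\<close>

definition ecodim :: "(complex \<Rightarrow> 'v \<Rightarrow> 'v::ab_group_add) \<Rightarrow> 'v set \<Rightarrow> 'v set \<Rightarrow> enat" where
  "ecodim s V W = Inf {enat (card B) | B. finite B \<and> B \<subseteq> W \<and> W \<subseteq> module.span s (V \<union> B)}"


section \<open>Multiplicities of eigenvalues of a pencil\<close>

text \<open>
  A pencil is a family \<open>T z\<close> of maps on a set \<open>X\<close> (a subspace of a complex vector space with scalar
  multiplication \<open>s\<close>), with values in a space with norm \<open>nY\<close>. We allow \<open>nY\<close> to be a seminorm, so that
  elements of \<open>L\<^sup>2\<close> can be given by representatives; \<open>f\<close> is the zero element iff \<open>nY f = 0\<close>.
\<close>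

definition pencil_ker ::
  "'u set \<Rightarrow> ('y \<Rightarrow> real) \<Rightarrow> (complex \<Rightarrow> 'u \<Rightarrow> 'y) \<Rightarrow> complex \<Rightarrow> 'u set" where
  "pencil_ker X nY T z0 = {u \<in> X. nY (T z0 u) = 0}"

definition is_eigenvalue ::
  "'u::zero set \<Rightarrow> ('y \<Rightarrow> real) \<Rightarrow> (complex \<Rightarrow> 'u \<Rightarrow> 'y) \<Rightarrow> complex \<Rightarrow> bool" where
  "is_eigenvalue X nY T z0 \<longleftrightarrow> pencil_ker X nY T z0 \<noteq> {0}"

definition geom_mult ::
  "(complex \<Rightarrow> 'u \<Rightarrow> 'u::ab_group_add) \<Rightarrow> 'u set \<Rightarrow> ('y \<Rightarrow> real) \<Rightarrow> (complex \<Rightarrow> 'u \<Rightarrow> 'y)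
    \<Rightarrow> complex \<Rightarrow> enat" where
  "geom_mult s X nY T z0 = edim s (pencil_ker X nY T z0)"

text \<open>
  The polynomial \<open>\<Sum>j\<le>p. u\<^sub>j (z - z0)^j\<close> is represented by its sequence of coefficients, extended
  by 0 beyond index \<open>p\<close>.
\<close>

definition root_functions ::
  "(complex \<Rightarrow> 'u \<Rightarrow> 'u::ab_group_add) \<Rightarrow> 'u set \<Rightarrow> ('y \<Rightarrow> real) \<Rightarrow> (complex \<Rightarrow> 'u \<Rightarrow> 'y)
    \<Rightarrow> complex \<Rightarrow> nat \<Rightarrow> (nat \<Rightarrow> 'u) set" where
  "root_functions s X nY T z0 p =
    {u. (\<forall>j. u j \<in> X) \<and> (\<forall>j>p. u j = 0) \<and>
        (\<lambda>z. nY (T z (\<Sum>j\<le>p. s ((z - z0) ^ j) (u j)))) \<in> O[at z0](\<lambda>z. norm (z - z0) ^ (p + 1))}"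

definition alg_mult ::
  "(complex \<Rightarrow> 'u \<Rightarrow> 'u::ab_group_add) \<Rightarrow> 'u set \<Rightarrow> ('y \<Rightarrow> real) \<Rightarrow> (complex \<Rightarrow> 'u \<Rightarrow> 'y)
    \<Rightarrow> complex \<Rightarrow> enat" where
  "alg_mult s X nY T z0 = (SUP p. edim (\<lambda>c u j. s c (u j)) (root_functions s X nY T z0 p))"

lemma vector_space_coefficients:
  assumes "vector_space s"
  shows "vector_space (\<lambda>c u (j::nat). s c (u j))"
proof -
  interpret vector_space s by fact
  show ?thesis
    by unfold_locales (auto simp: fun_eq_iff scale_right_distrib scale_left_distrib)
qed

definition root_order :: "(complex \<Rightarrow> complex) \<Rightarrow> complex \<Rightarrow> enat" where
  "root_order f z = (if \<forall>\<^sub>F w in nhds z. f w = 0 then \<infinity> else enat (nat (zorder f z)))"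


section \<open>The spaces \<open>L\<^sup>2(\<real>, \<complex>\<^sup>N)\<close> and \<open>H\<^sup>1(\<real>, \<complex>\<^sup>N)\<close>\<close>

text \<open>
  Elements of \<open>L\<^sup>2\<close> are given by representatives, equal in \<open>L\<^sup>2\<close> iff the seminorm of the difference
  vanishes. Note that \<open>l2norm\<close> is only meaningful on \<open>L2\<close>.
\<close>

definition L2 :: "(real \<Rightarrow> complex ^ 'n) set" where
  "L2 = {f. f \<in> borel_measurable lborel \<and> integrable lborel (\<lambda>x. (norm (f x))\<^sup>2)}"

definition l2norm :: "(real \<Rightarrow> complex ^ 'n) \<Rightarrow> real" where
  "l2norm f = sqrt (LINT x|lborel. (norm (f x))\<^sup>2)"

definition cscale :: "complex \<Rightarrow> (real \<Rightarrow> complex ^ 'n) \<Rightarrow> real \<Rightarrow> complex ^ 'n" where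
  "cscale c f = (\<lambda>x. c *s f x)"

lemma vector_space_cscale: "vector_space cscale"
  by unfold_locales
    (auto simp: cscale_def fun_eq_iff vector_add_ldistrib vector_sadd_rdistrib vector_smult_assoc)

definition has_weak_deriv :: "(real \<Rightarrow> complex ^ 'n) \<Rightarrow> (real \<Rightarrow> complex ^ 'n) \<Rightarrow> bool" where
  "has_weak_deriv u v \<longleftrightarrow> v \<in> L2 \<and> (\<forall>a b. a \<le> b \<longrightarrow> u b - u a = (LINT x:{a..b}|lborel. v x))"

text \<open>
  Each element of \<open>H\<^sup>1\<close> is given by its unique absolutely continuous representative, so \<open>H1\<close> is
  a vector space of functions and no quotient is needed. The weak derivative is determined up to
  a null set.
\<close>

definition H1 :: "(real \<Rightarrow> complex ^ 'n) set" where
  "H1 = {u \<in> L2. \<exists>v. has_weak_deriv u v}"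

definition weak_deriv :: "(real \<Rightarrow> complex ^ 'n) \<Rightarrow> real \<Rightarrow> complex ^ 'n" where
  "weak_deriv u = (SOME v. has_weak_deriv u v)"

definition h1norm :: "(real \<Rightarrow> complex ^ 'n) \<Rightarrow> real" where
  "h1norm u = sqrt ((l2norm u)\<^sup>2 + (l2norm (weak_deriv u))\<^sup>2)"

text \<open>Bounded linear operators from \<open>H\<^sup>1\<close> to \<open>L\<^sup>2\<close>; linearity holds up to equality in \<open>L\<^sup>2\<close>.\<close>

definition bounded_H1_L2 :: "((real \<Rightarrow> complex ^ 'n) \<Rightarrow> real \<Rightarrow> complex ^ 'n) \<Rightarrow> bool" where
  "bounded_H1_L2 S \<longleftrightarrow>
    (\<forall>u\<in>H1. S u \<in> L2) \<and>
    (\<forall>u\<in>H1. \<forall>v\<in>H1. \<forall>c. l2norm (S (cscale c u + v) - (cscale c (S u) + S v)) = 0) \<and>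
    (\<exists>C. \<forall>u\<in>H1. l2norm (S u) \<le> C * h1norm u)"

text \<open>Analyticity on an open set: complex differentiability in the operator norm.\<close>

definition analytic_pencil_H1_L2 ::
  "(complex \<Rightarrow> (real \<Rightarrow> complex ^ 'n) \<Rightarrow> real \<Rightarrow> complex ^ 'n) \<Rightarrow> complex set \<Rightarrow> bool" where
  "analytic_pencil_H1_L2 T \<Omega> \<longleftrightarrow>
    (\<forall>z\<in>\<Omega>. bounded_H1_L2 (T z)) \<and>
    (\<forall>z\<in>\<Omega>. \<exists>D. bounded_H1_L2 D \<and>
      (\<forall>\<epsilon>>0. \<forall>\<^sub>F \<mu> in at z. \<forall>u\<in>H1.
        l2norm (cscale (1 / (\<mu> - z)) (T \<mu> u - T z u) - D u) \<le> \<epsilon> * h1norm u))"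

definition ker_H1_L2 :: "((real \<Rightarrow> complex ^ 'n) \<Rightarrow> real \<Rightarrow> complex ^ 'n) \<Rightarrow> (real \<Rightarrow> complex ^ 'n) set" where
  "ker_H1_L2 S = {u \<in> H1. l2norm (S u) = 0}"

text \<open>All representatives of elements of the range of \<open>S\<close>.\<close>

definition range_H1_L2 :: "((real \<Rightarrow> complex ^ 'n) \<Rightarrow> real \<Rightarrow> complex ^ 'n) \<Rightarrow> (real \<Rightarrow> complex ^ 'n) set" where
  "range_H1_L2 S = {f \<in> L2. \<exists>u\<in>H1. l2norm (f - S u) = 0}"

definition fredholm_H1_L2 :: "((real \<Rightarrow> complex ^ 'n) \<Rightarrow> real \<Rightarrow> complex ^ 'n) \<Rightarrow> bool" where
  "fredholm_H1_L2 S \<longleftrightarrow>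
    bounded_H1_L2 S \<and>
    edim cscale (ker_H1_L2 S) \<noteq> \<infinity> \<and>
    ecodim cscale (range_H1_L2 S) L2 \<noteq> \<infinity> \<and>
    (\<forall>f\<in>L2. (\<forall>\<epsilon>>0. \<exists>g\<in>range_H1_L2 S. l2norm (f - g) < \<epsilon>) \<longrightarrow> f \<in> range_H1_L2 S)"

definition fredholm_index :: "((real \<Rightarrow> complex ^ 'n) \<Rightarrow> real \<Rightarrow> complex ^ 'n) \<Rightarrow> int" where
  "fredholm_index S =
    int (the_enat (edim cscale (ker_H1_L2 S))) - int (the_enat (ecodim cscale (range_H1_L2 S) L2))"

definition ode_op ::
  "(real \<Rightarrow> complex \<Rightarrow> complex ^ 'n ^ 'n) \<Rightarrow> complex \<Rightarrow> (real \<Rightarrow> complex ^ 'n) \<Rightarrow> real \<Rightarrow> complex ^ 'n" where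
  "ode_op A z u = (\<lambda>x. weak_deriv u x - A x z *v u x)"


section \<open>Spectral subspaces and their transport by the flow\<close>

definition gen_eigenspace :: "complex ^ 'n ^ 'n \<Rightarrow> complex \<Rightarrow> (complex ^ 'n) set" where
  "gen_eigenspace B \<mu> = {v. \<exists>k. ((\<lambda>w. B *v w - \<mu> *s w) ^^ k) v = 0}"

definition stable_space :: "complex ^ 'n ^ 'n \<Rightarrow> (complex ^ 'n) set" where
  "stable_space B = vec.span (\<Union>\<mu>\<in>{\<mu>. Re \<mu> < 0}. gen_eigenspace B \<mu>)"

definition unstable_space :: "complex ^ 'n ^ 'n \<Rightarrow> (complex ^ 'n) set" where
  "unstable_space B = vec.span (\<Union>\<mu>\<in>{\<mu>. Re \<mu> > 0}. gen_eigenspace B \<mu>)"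

definition morse_index :: "complex ^ 'n ^ 'n \<Rightarrow> nat" where
  "morse_index B =
    (\<Sum>\<mu> | Re \<mu> > 0 \<and> (\<exists>v. v \<noteq> 0 \<and> B *v v = \<mu> *s v). vec.dim (gen_eigenspace B \<mu>))"

text \<open>
  The gap metric on subspaces: the norm of the difference of the orthogonal projections. For a
  complex subspace, the orthogonal projection is the nearest-point map.
\<close>

definition gap :: "(complex ^ 'n) set \<Rightarrow> (complex ^ 'n) set \<Rightarrow> real" where
  "gap V W = onorm (\<lambda>v. closest_point V v - closest_point W v)"

text \<open>
  \<open>E x\<close> is a family of subspaces, continuous in \<open>x\<close>, transported by the flow of \<open>u' = B x u\<close>, and
  converging to \<open>V\<close> along the filter \<open>F\<close>.
\<close>

definition transported_family ::
  "(real \<Rightarrow> complex ^ 'n ^ 'n) \<Rightarrow> real filter \<Rightarrow> (complex ^ 'n) set \<Rightarrow> (real \<Rightarrow> (complex ^ 'n) set) \<Rightarrow> bool"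
  where
  "transported_family B F V E \<longleftrightarrow>
    (\<forall>x. vec.subspace (E x)) \<and>
    (\<forall>x. ((\<lambda>y. gap (E y) (E x)) \<longlongrightarrow> 0) (at x)) \<and>
    (\<forall>x y. E y = {u y | u. (\<forall>t. (u has_vector_derivative B t *v u t) (at t)) \<and> u x \<in> E x}) \<and>
    ((\<lambda>x. gap (E x) V) \<longlongrightarrow> 0) F"


section \<open>The matrix pencil and the Evans function\<close>

definition is_analytic_basis ::
  "complex set \<Rightarrow> nat set \<Rightarrow> (nat \<Rightarrow> complex \<Rightarrow> complex ^ 'n) \<Rightarrow> (complex \<Rightarrow> (complex ^ 'n) set) \<Rightarrow> bool"
  where
  "is_analytic_basis \<Omega> J w V \<longleftrightarrow>
    (\<forall>j\<in>J. \<forall>i. (\<lambda>z. w j z $ i) analytic_on \<Omega>) \<and>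
    (\<forall>z\<in>\<Omega>. inj_on (\<lambda>j. w j z) J \<and>
      vec.independent ((\<lambda>j. w j z) ` J) \<and> vec.span ((\<lambda>j. w j z) ` J) = V z)"

text \<open>
  \<open>e\<close> is a numbering of the coordinates by \<open>1, \<dots>, N\<close>, so that \<open>u $ e j\<close> is the \<open>j\<close>-th coordinate
  of \<open>u\<close>.
\<close>

definition iota ::
  "nat \<Rightarrow> (nat \<Rightarrow> 'n) \<Rightarrow> (nat \<Rightarrow> complex \<Rightarrow> complex ^ 'n) \<Rightarrow> (nat \<Rightarrow> complex \<Rightarrow> complex ^ 'n)
    \<Rightarrow> complex \<Rightarrow> complex ^ 'n \<Rightarrow> complex ^ 'n::finite" where
  "iota m e wu ws z u =
    (\<Sum>j=1..m. (u $ e j) *s wu j z) - (\<Sum>j=m+1..CARD('n). (u $ e j) *s ws j z)"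

definition evans ::
  "nat \<Rightarrow> (nat \<Rightarrow> 'n) \<Rightarrow> (nat \<Rightarrow> complex \<Rightarrow> complex ^ 'n) \<Rightarrow> (nat \<Rightarrow> complex \<Rightarrow> complex ^ 'n)
    \<Rightarrow> complex \<Rightarrow> complex" where
  "evans m e wu ws z = det (matrix (iota m e wu ws z) :: complex ^ 'n ^ 'n::finite)"

end

theory Submission
  imports
    Defs
    "HOL-Computational_Algebra.Fundamental_Theorem_Algebra"
    "HOL-Library.Nat_Bijection"
begin

text \<open>
  At \<open>x = 0\<close> a function on the line splits into a pair of functions on half-lines. On each half-line the
  operator has an exponential dichotomy: the traces at 0 of solutions form \<open>E\<close> (that is, \<open>E\<^sup>s\<^sub>+(0)\<close> or
  \<open>E\<^sup>u\<^sub>-(0)\<close>), the trace of an arbitrary \<open>H\<^sup>1\<close> function has distance to \<open>E\<close> bounded by the norm of its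
  residual, with a constant that is locally uniform in the spectral parameter. Hence
  \<open>u \<mapsto> u 0\<close>, applied to coefficients, identifies root functions of order \<open>p\<close> with polynomials lying in
  both bundles \<open>E\<close> up to order \<open>p + 1\<close>. Expanding these in the analytic bases gives the root functions
  of \<open>\<iota>\<close>. For an analytic matrix, splitting off one kernel vector divides the determinant by
  \<open>\<lambda> - \<lambda>\<^sub>*\<close> and lowers the dimension of the root functions by one.

  Hyperbolicity of the limit matrices is extracted from the Fredholm property: an imaginary
  eigenvalue would give infinitely many independent conditions on the range.
\<close>

section \<open>Square-integrable functions\<close>

text \<open>The Fredholm property and the index enter only through counting. No dichotomy is built
  by variation of constants: square-integrability and all bounds come from an indefinite quadratic
  form that increases along solutions, and inhomogeneous half-line problems are solved by comparing
  the codimension of the range with \<open>vec.dim (Es \<inter> Eu)\<close>, the traces of the two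
  halves being free. The other obstacle is the parameter. The pencil is differentiable in operator
  norm from \<open>H1\<close> to \<open>L2\<close>, while \<open>A\<close> is holomorphic only
  pointwise in \<open>x\<close>. Locally uniform constants therefore come from perturbing the
  estimates at the centre, with equal dimensions of the spaces \<open>E \<mu>\<close> in place of a
  perturbation theory of dichotomies, and Taylor coefficients in \<open>L2\<close> come from finite
  averages and Fatou's lemma. As no analytic dependence of solutions on the parameter is available,
  a jet of traces is lifted to a jet of half-line functions one order at a time: solve for the
  leading residual, then correct the trace by a homogeneous solution at the centre.\<close>

lemma L2_measurable [measurable_dest]: "f \<in> L2 \<Longrightarrow> f \<in> borel_measurable borel"
  by (simp add: L2_def)

lemma L2_integrable_square: "f \<in> L2 \<Longrightarrow> integrable lborel (\<lambda>x. (norm (f x))\<^sup>2)"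
  by (simp add: L2_def)

lemma L2I_bound:
  fixes f :: "real \<Rightarrow> complex ^ 'n"
  assumes "f \<in> borel_measurable borel" "integrable lborel h" "\<And>x. (norm (f x))\<^sup>2 \<le> h x"
  shows "f \<in> L2"
  unfolding L2_def
proof (safe)
  show "integrable lborel (\<lambda>x. (norm (f x))\<^sup>2)" by (rule Bochner_Integration.integrable_bound[OF assms(2)])
      (use assms in \<open>auto intro!: AE_I2 order_trans[OF _ abs_ge_self]\<close>)
qed (use assms in auto)

lemma L2_zero [simp]: "0 \<in> L2" "(\<lambda>x. 0) \<in> L2"
  by (auto simp: L2_def zero_fun_def)

lemma L2_scaled_bound:
  fixes f :: "real \<Rightarrow> complex ^ 'n" and g :: "real \<Rightarrow> complex ^ 'm"
  assumes "f \<in> borel_measurable borel" "g \<in> L2" "\<And>x. norm (f x) \<le> c * norm (g x)"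
  shows "f \<in> L2"
proof (rule L2I_bound[OF assms(1), where h = "\<lambda>x. c\<^sup>2 * (norm (g x))\<^sup>2"])
  show "(norm (f x))\<^sup>2 \<le> c\<^sup>2 * (norm (g x))\<^sup>2" for x
    using power_mono[OF assms(3) norm_ge_zero, of x 2] by (simp add: power_mult_distrib)
qed (use assms in \<open>auto simp: L2_def\<close>)

lemma L2_add:
  fixes f g :: "real \<Rightarrow> complex ^ 'n"
  assumes "f \<in> L2" "g \<in> L2" shows "(\<lambda>x. f x + g x) \<in> L2"
proof (rule L2I_bound)
  show "(norm (f x + g x))\<^sup>2 \<le> 2 * (norm (f x))\<^sup>2 + 2 * (norm (g x))\<^sup>2" for x
  proof -
    have "(norm (f x + g x))\<^sup>2 \<le> (norm (f x) + norm (g x))\<^sup>2" by (intro power_mono norm_triangle_ineq) auto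
    also have "\<dots> \<le> 2 * (norm (f x))\<^sup>2 + 2 * (norm (g x))\<^sup>2"
      using zero_le_power2[of "norm (f x) - norm (g x)"] by (simp add: power2_eq_square algebra_simps)
    finally show ?thesis .
  qed
qed (use assms in \<open>auto simp: L2_def\<close>)

lemma matrix_vector_mult_scale_left: "(c *s v :: complex ^ 'n) = mat c *v v"
  by (simp add: vec_eq_iff matrix_vector_mult_def mat_def if_distrib[where f = "\<lambda>x. x * _"] cong: if_cong)

lemma norm_vec_scale: "norm (c *s (v :: complex ^ 'n)) = norm c * norm v"
  by (simp add: norm_vec_def L2_set_def norm_mult power_mult_distrib sum_distrib_left[symmetric] real_sqrt_mult)

lemma measurable_vec_scale [measurable]:
  fixes f :: "'a \<Rightarrow> complex ^ 'n"
  assumes [measurable]: "c \<in> borel_measurable M" "f \<in> borel_measurable M"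
  shows "(\<lambda>x. c x *s f x) \<in> borel_measurable M"
proof -
  have *: "c x *s f x = (\<chi> i. c x * f x $ i)" for x by (simp add: vec_eq_iff)
  have "continuous_on UNIV (\<lambda>p :: complex \<times> (complex ^ 'n). \<chi> i. fst p * snd p $ i)" by (intro continuous_intros)
  then have "(\<lambda>p :: complex \<times> (complex ^ 'n). \<chi> i. fst p * snd p $ i) \<in> borel_measurable borel"
    by (rule borel_measurable_continuous_onI)
  from measurable_compose[OF borel_measurable_Pair[OF assms] this]
  show ?thesis by (simp add: *)
qed

lemma L2_scale:
  fixes f :: "real \<Rightarrow> complex ^ 'n"
  assumes "f \<in> L2" shows "(\<lambda>x. c *s f x) \<in> L2"
  by (rule L2_scaled_bound[OF _ assms, where c = "norm c"])
    (use assms in \<open>auto simp: norm_vec_scale intro!: measurable_vec_scale L2_measurable\<close>)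

lemma L2_diff:
  fixes f g :: "real \<Rightarrow> complex ^ 'n"
  assumes "f \<in> L2" "g \<in> L2" shows "(\<lambda>x. f x - g x) \<in> L2"
proof -
  have "(\<lambda>x. f x - g x) = (\<lambda>x. f x + (-1) *s g x)" by (auto simp: fun_eq_iff vec_eq_iff)
  then show ?thesis using L2_add[OF assms(1) L2_scale[OF assms(2), of "-1"]] by simp
qed

lemma L2_minus:
  fixes f :: "real \<Rightarrow> complex ^ 'n"
  assumes "f \<in> L2" shows "(\<lambda>x. - f x) \<in> L2"
  using L2_diff[OF L2_zero(2) assms] by simp

lemma L2_sum:
  fixes f :: "'i \<Rightarrow> real \<Rightarrow> complex ^ 'n"
  assumes "\<And>i. i \<in> I \<Longrightarrow> f i \<in> L2" shows "(\<lambda>x. \<Sum>i\<in>I. f i x) \<in> L2"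
  using assms by (induction I rule: infinite_finite_induct) (auto intro: L2_add)

lemma l2norm_nonneg [simp]: "l2norm f \<ge> 0"
  by (simp add: l2norm_def)

lemma l2norm_square: "(l2norm f)\<^sup>2 = (LINT x|lborel. (norm (f x))\<^sup>2)"
  by (simp add: l2norm_def)

lemma l2norm_zero [simp]: "l2norm 0 = 0" "l2norm (\<lambda>x. 0) = 0"
  by (simp_all add: l2norm_def zero_fun_def)

lemma l2norm_cong_norm:
  "(\<And>x. norm (f x) = norm (g x)) \<Longrightarrow> l2norm f = l2norm g" by (simp add: l2norm_def)

lemma l2norm_cong_AE:
  assumes "f \<in> L2" "g \<in> L2" "AE x in lborel. f x = g x"
  shows "l2norm f = l2norm g"
  unfolding l2norm_def by (rule arg_cong[where f = sqrt], rule integral_cong_AE) (use assms in \<open>auto simp: L2_def\<close>)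

lemma l2norm_scale: "l2norm (\<lambda>x. c *s f x) = norm c * l2norm f"
  by (simp add: l2norm_def norm_vec_scale power_mult_distrib real_sqrt_mult)

lemma l2norm_mono:
  fixes f :: "real \<Rightarrow> complex ^ 'n" and g :: "real \<Rightarrow> complex ^ 'm"
  assumes "f \<in> L2" "g \<in> L2" "AE x in lborel. norm (f x) \<le> norm (g x)"
  shows "l2norm f \<le> l2norm g"
  unfolding l2norm_def by (rule real_sqrt_le_mono, rule integral_mono_AE) (use assms in \<open>auto simp: L2_def intro!: power_mono\<close>)

lemma l2norm_bound:
  fixes f :: "real \<Rightarrow> complex ^ 'n" and g :: "real \<Rightarrow> complex ^ 'm"
  assumes "f \<in> L2" "g \<in> L2" "c \<ge> 0" "AE x in lborel. norm (f x) \<le> c * norm (g x)"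
  shows "l2norm f \<le> c * l2norm g"
  using l2norm_mono[OF assms(1) L2_scale[OF assms(2), of "of_real c"]] assms by (simp add: norm_vec_scale l2norm_scale)

lemma l2norm_eq_0_iff:
  assumes "f \<in> L2" shows "l2norm f = 0 \<longleftrightarrow> (AE x in lborel. f x = 0)"
  using integral_nonneg_eq_0_iff_AE[of lborel "\<lambda>x. (norm (f x))\<^sup>2"] L2_integrable_square[OF assms] by (simp add: l2norm_def)

lemma integrable_norm_mult:
  fixes f :: "real \<Rightarrow> complex ^ 'n" and g :: "real \<Rightarrow> complex ^ 'm"
  assumes "f \<in> L2" "g \<in> L2" shows "integrable lborel (\<lambda>x. norm (f x) * norm (g x))"
proof (rule Bochner_Integration.integrable_bound[where f = "\<lambda>x. (norm (f x))\<^sup>2 + (norm (g x))\<^sup>2"])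
  have "2 * (norm (f x) * norm (g x)) \<le> (norm (f x))\<^sup>2 + (norm (g x))\<^sup>2" for x
    using zero_le_power2[of "norm (f x) - norm (g x)"] by (simp add: power2_eq_square algebra_simps)
  moreover have "0 \<le> norm (f x) * norm (g x)" for x by simp
  ultimately show "AE x in lborel. norm (norm (f x) * norm (g x)) \<le> norm ((norm (f x))\<^sup>2 + (norm (g x))\<^sup>2)"
    by (intro AE_I2) (smt (verit, best) real_norm_def)
qed (use assms in \<open>auto simp: L2_def\<close>)

text \<open>Optimising over \<open>t\<close> is Cauchy-Schwarz in disguise. The best choice
  \<open>t = G / F\<close> breaks down when a factor vanishes, so both factors are shifted by
  \<open>e > 0\<close>, and \<open>e\<close> tends to 0.\<close>

lemma mult_le_of_weighted_AM_GM:
  fixes F G I :: real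
  assumes "F \<ge> 0" "G \<ge> 0" and *: "\<And>t. t > 0 \<Longrightarrow> 2 * I \<le> t * F\<^sup>2 + G\<^sup>2 / t"
  shows "I \<le> F * G"
proof -
  have "I \<le> (F + e) * (G + e)" if "e > 0" for e
  proof -
    have "2 * I \<le> (G + e) / (F + e) * F\<^sup>2 + G\<^sup>2 / ((G + e) / (F + e))" using that assms by (intro *) auto
    also have "(G + e) / (F + e) * F\<^sup>2 \<le> (G + e) / (F + e) * (F + e)\<^sup>2"
      using that assms by (intro mult_left_mono power_mono) auto
    also have "G\<^sup>2 / ((G + e) / (F + e)) \<le> (G + e)\<^sup>2 / ((G + e) / (F + e))"
      using that assms by (intro divide_right_mono power_mono) auto
    finally have "2 * I \<le> (G + e) / (F + e) * (F + e)\<^sup>2 + (G + e)\<^sup>2 / ((G + e) / (F + e))" by linarith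
    moreover have "(G + e) / (F + e) * (F + e)\<^sup>2 = (F + e) * (G + e)"
      "(G + e)\<^sup>2 / ((G + e) / (F + e)) = (F + e) * (G + e)" using that assms by (simp_all add: power2_eq_square)
    ultimately show ?thesis by linarith
  qed
  moreover have "((\<lambda>e. (F + e) * (G + e)) \<longlongrightarrow> (F + 0) * (G + 0)) (at_right 0)" by (intro tendsto_intros)
  ultimately show ?thesis using tendsto_lowerbound[of _ _ "at_right (0::real)" I] by (force simp: eventually_at_filter)
qed

lemma l2_Cauchy_Schwarz:
  fixes f :: "real \<Rightarrow> complex ^ 'n" and g :: "real \<Rightarrow> complex ^ 'm"
  assumes "f \<in> L2" "g \<in> L2"
  shows "(LINT x|lborel. norm (f x) * norm (g x)) \<le> l2norm f * l2norm g"
proof (rule mult_le_of_weighted_AM_GM)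
  fix t :: real assume t: "t > 0"
  have "2 * (LINT x|lborel. norm (f x) * norm (g x)) = (LINT x|lborel. 2 * (norm (f x) * norm (g x)))" by simp
  also have "\<dots> \<le> (LINT x|lborel. t * (norm (f x))\<^sup>2 + (norm (g x))\<^sup>2 / t)"
  proof (rule integral_mono)
    fix x
    have "0 \<le> (sqrt t * norm (f x) - norm (g x) / sqrt t)\<^sup>2" by simp
    also have "\<dots> = t * (norm (f x))\<^sup>2 + (norm (g x))\<^sup>2 / t - 2 * (norm (f x) * norm (g x))"
      using t by (simp add: power2_diff power_mult_distrib power_divide)
    finally show "2 * (norm (f x) * norm (g x)) \<le> t * (norm (f x))\<^sup>2 + (norm (g x))\<^sup>2 / t" by simp
  qed (use assms integrable_norm_mult[OF assms] in \<open>auto simp: L2_def\<close>)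
  also have "\<dots> = t * (l2norm f)\<^sup>2 + (l2norm g)\<^sup>2 / t" using assms by (simp add: l2norm_square L2_def)
  finally show "2 * (LINT x|lborel. norm (f x) * norm (g x)) \<le> t * (l2norm f)\<^sup>2 + (l2norm g)\<^sup>2 / t" .
qed auto

lemma l2norm_triangle:
  fixes f g :: "real \<Rightarrow> complex ^ 'n"
  assumes "f \<in> L2" "g \<in> L2"
  shows "l2norm (\<lambda>x. f x + g x) \<le> l2norm f + l2norm g"
proof (rule power2_le_imp_le)
  have "(l2norm (\<lambda>x. f x + g x))\<^sup>2 \<le> (LINT x|lborel. (norm (f x))\<^sup>2 + (norm (g x))\<^sup>2 + 2 * (norm (f x) * norm (g x)))"
    unfolding l2norm_square
  proof (rule integral_mono)
    fix x
    have "(norm (f x + g x))\<^sup>2 \<le> (norm (f x) + norm (g x))\<^sup>2" by (intro power_mono norm_triangle_ineq) auto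
    then show "(norm (f x + g x))\<^sup>2 \<le> (norm (f x))\<^sup>2 + (norm (g x))\<^sup>2 + 2 * (norm (f x) * norm (g x))" by (simp add: power2_sum)
  qed (use assms integrable_norm_mult[OF assms] L2_add[OF assms] in \<open>auto simp: L2_def\<close>)
  also have "\<dots> = (l2norm f)\<^sup>2 + (l2norm g)\<^sup>2 + 2 * (LINT x|lborel. norm (f x) * norm (g x))"
    using assms integrable_norm_mult[OF assms] by (simp add: l2norm_square L2_def)
  also have "\<dots> \<le> (l2norm f + l2norm g)\<^sup>2" using l2_Cauchy_Schwarz[OF assms] by (simp add: power2_sum)
  finally show "(l2norm (\<lambda>x. f x + g x))\<^sup>2 \<le> (l2norm f + l2norm g)\<^sup>2" .
qed auto

lemma l2norm_minus: "l2norm (\<lambda>x. - f x) = l2norm f"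
  by (simp add: l2norm_def)

lemma l2norm_triangle_diff:
  fixes f g :: "real \<Rightarrow> complex ^ 'n"
  assumes "f \<in> L2" "g \<in> L2"
  shows "l2norm (\<lambda>x. f x - g x) \<le> l2norm f + l2norm g"
  using l2norm_triangle[OF assms(1) L2_minus[OF assms(2)]] by (simp add: l2norm_minus)

lemma l2norm_sum:
  fixes f :: "'i \<Rightarrow> real \<Rightarrow> complex ^ 'n"
  assumes "\<And>i. i \<in> I \<Longrightarrow> f i \<in> L2"
  shows "l2norm (\<lambda>x. \<Sum>i\<in>I. f i x) \<le> (\<Sum>i\<in>I. l2norm (f i))"
  using assms
proof (induction I rule: infinite_finite_induct)
  case (insert i I)
  then have "l2norm (\<lambda>x. \<Sum>i\<in>insert i I. f i x) \<le> l2norm (f i) + l2norm (\<lambda>x. \<Sum>i\<in>I. f i x)" by (simp add: l2norm_triangle L2_sum)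
  with insert show ?case by simp
qed auto

text \<open>Weak compactness is not needed: Fatou's lemma passes norm bounds to pointwise limits.\<close>

lemma L2_Fatou:
  fixes f :: "nat \<Rightarrow> real \<Rightarrow> complex ^ 'n"
  assumes "\<And>n. f n \<in> L2" "\<And>n. l2norm (f n) \<le> K" "AE x in lborel. (\<lambda>n. f n x) \<longlonglongrightarrow> g x"
    "g \<in> borel_measurable borel"
  shows "g \<in> L2" "l2norm g \<le> K"
proof -
  note [measurable] = L2_measurable[OF assms(1)] assms(4)
  have K: "K \<ge> 0" using assms(2)[of 0] l2norm_nonneg[of "f 0"] by linarith
  have fn: "(\<integral>\<^sup>+x. ennreal ((norm (f n x))\<^sup>2) \<partial>lborel) \<le> ennreal (K\<^sup>2)" for n
  proof -
    have "(\<integral>\<^sup>+x. ennreal ((norm (f n x))\<^sup>2) \<partial>lborel) = ennreal (LINT x|lborel. (norm (f n x))\<^sup>2)"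
      by (rule nn_integral_eq_integral) (use assms(1) in \<open>auto simp: L2_def\<close>)
    also have "\<dots> \<le> ennreal (K\<^sup>2)" using assms(2)[of n] K by (intro ennreal_leI) (simp flip: l2norm_square add: power_mono)
    finally show ?thesis .
  qed
  have "(\<integral>\<^sup>+x. ennreal ((norm (g x))\<^sup>2) \<partial>lborel) = (\<integral>\<^sup>+x. liminf (\<lambda>n. ennreal ((norm (f n x))\<^sup>2)) \<partial>lborel)"
  proof (rule nn_integral_cong_AE, use assms(3) in eventually_elim)
    case (elim x)
    have "(\<lambda>n. ennreal ((norm (f n x))\<^sup>2)) \<longlonglongrightarrow> ennreal ((norm (g x))\<^sup>2)" using elim by (intro tendsto_intros) auto
    then show ?case by (intro lim_imp_Liminf[symmetric]) auto
  qed
  also have "\<dots> \<le> liminf (\<lambda>n. \<integral>\<^sup>+x. ennreal ((norm (f n x))\<^sup>2) \<partial>lborel)" by (rule nn_integral_liminf) auto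
  also have "\<dots> \<le> ennreal (K\<^sup>2)" using fn by (intro Liminf_le) auto
  finally have g: "(\<integral>\<^sup>+x. ennreal ((norm (g x))\<^sup>2) \<partial>lborel) \<le> ennreal (K\<^sup>2)" .
  show "g \<in> L2" unfolding L2_def using g by (auto intro!: integrableI_bounded simp: le_less_trans[OF g])
  then have "ennreal ((l2norm g)\<^sup>2) \<le> ennreal (K\<^sup>2)"
    using g by (subst (asm) nn_integral_eq_integral) (auto simp: L2_def l2norm_square)
  then show "l2norm g \<le> K" using K by (auto simp: ennreal_le_iff intro: power2_le_imp_le)
qed

lemma L2_norm_set_integrable:
  fixes f :: "real \<Rightarrow> complex ^ 'n"
  assumes "f \<in> L2" shows "set_integrable lborel {a..b} f"
proof -
  note [measurable] = L2_measurable[OF assms]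
  have "norm (f x) \<le> 1 + (norm (f x))\<^sup>2" for x
  proof -
    have "0 \<le> (norm (f x) - 1)\<^sup>2 + (norm (f x))\<^sup>2 + 1" by simp
    then show ?thesis unfolding power2_diff by simp
  qed
  then have *: "norm (indicator {a..b} x *\<^sub>R f x) \<le> norm (indicator {a..b} x + (norm (f x))\<^sup>2 :: real)" for x
    by (auto simp: indicator_def)
  have "integrable lborel (\<lambda>x. indicator {a..b} x + (norm (f x))\<^sup>2)" using L2_integrable_square[OF assms]
    by (intro Bochner_Integration.integrable_add integrable_real_indicator)
      (auto simp: emeasure_lborel_Icc_eq)
  then show ?thesis unfolding set_integrable_def by (rule Bochner_Integration.integrable_bound) (use * in auto)
qed

lemma L2_indicator_const:
  "(\<lambda>x. indicator {a..b} x *\<^sub>R (v :: complex ^ 'n)) \<in> L2"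
proof (rule L2I_bound[where h = "\<lambda>x. (norm v)\<^sup>2 * indicator {a..b} x"])
  show "integrable lborel (\<lambda>x. (norm v)\<^sup>2 * indicator {a..b} x :: real)"
    by (intro integrable_mult_right integrable_real_indicator) (auto simp: emeasure_lborel_Icc_eq)
qed (auto simp: indicator_def)

lemma l2norm_indicator_const:
  "a \<le> b \<Longrightarrow> l2norm (\<lambda>x. indicator {a..b} x *\<^sub>R (v :: complex ^ 'n)) = sqrt (b - a) * norm v"
proof -
  assume "a \<le> b"
  have "(LINT x|lborel. (norm (indicator {a..b} x *\<^sub>R v))\<^sup>2) = (LINT x|lborel. (norm v)\<^sup>2 * indicator {a..b} x)"
    by (intro Bochner_Integration.integral_cong) (auto simp: indicator_def)
  also have "\<dots> = (norm v)\<^sup>2 * (b - a)" using \<open>a \<le> b\<close> by simp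
  finally show ?thesis by (simp add: l2norm_def real_sqrt_mult)
qed

lemma norm_L1_le_l2norm:
  fixes f :: "real \<Rightarrow> complex ^ 'n"
  assumes "f \<in> L2" "a \<le> b"
  shows "(LINT x:{a..b}|lborel. norm (f x)) \<le> sqrt (b - a) * l2norm f"
proof -
  obtain v :: "complex ^ 'n" where v: "norm v = 1" using vector_choose_size[of 1] by auto
  have "(LINT x:{a..b}|lborel. norm (f x)) = (LINT x|lborel. norm (indicator {a..b} x *\<^sub>R v) * norm (f x))"
    unfolding set_lebesgue_integral_def using v by (intro Bochner_Integration.integral_cong) (auto simp: indicator_def)
  also have "\<dots> \<le> sqrt (b - a) * l2norm f"
    using l2_Cauchy_Schwarz[OF L2_indicator_const assms(1), of a b v] l2norm_indicator_const[OF assms(2), of v] v by simp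
  finally show ?thesis .
qed

text \<open>Lebesgue differentiation: outside a negligible set the one-sided means over
  \<open>{x..x + h}\<close> converge to \<open>f x\<close>, and all these means are 0.\<close>

lemma AE_eq_0_if_interval_integrals_0:
  fixes f :: "real \<Rightarrow> complex ^ 'n"
  assumes "\<And>a b. set_integrable lborel {a..b} f" "\<And>a b. a \<le> b \<Longrightarrow> (LINT x:{a..b}|lborel. f x) = 0"
  shows "AE x in lborel. f x = 0"
proof -
  have "f integrable_on cbox a b" for a b using set_borel_integral_eq_integral(1)[OF assms(1)[of a b]] by simp
  then obtain N where N: "negligible N" "\<And>x e. \<lbrakk>x \<notin> N; 0 < e\<rbrakk> \<Longrightarrow>
      \<exists>d>0. \<forall>h. 0 < h \<and> h < d \<longrightarrow> norm (integral (cbox x (x + h *\<^sub>R One)) f /\<^sub>R h ^ DIM(real) - f x) < e"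
    using integrable_ccontinuous_explicit[of f] by metis
  have int0: "integral {a..b} f = 0" for a b
    using set_borel_integral_eq_integral(2)[OF assms(1)[of a b]] assms(2)[of a b] by (cases "a \<le> b") auto
  have "f x = 0" if "x \<notin> N" for x
  proof (rule ccontr)
    assume "f x \<noteq> 0"
    with N(2)[OF that, of "norm (f x)"] obtain d where d: "d > 0"
      "\<forall>h. 0 < h \<and> h < d \<longrightarrow> norm (integral (cbox x (x + h *\<^sub>R One)) f /\<^sub>R h ^ DIM(real) - f x) < norm (f x)" by auto
    from d(2)[rule_format, of "d/2"] d(1) show False by (simp add: int0)
  qed
  moreover have "AE x in lebesgue. x \<notin> N" using N(1) by (intro AE_not_in) (simp add: negligible_iff_null_sets)
  ultimately have "AE x in lebesgue. f x = 0" by (auto elim: eventually_mono)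
  then show ?thesis by (simp add: AE_completion_iff)
qed

lemma AE_eq_if_interval_integrals_eq:
  fixes f g :: "real \<Rightarrow> complex ^ 'n"
  assumes "f \<in> L2" "g \<in> L2" "\<And>a b. a \<le> b \<Longrightarrow> (LINT x:{a..b}|lborel. f x) = (LINT x:{a..b}|lborel. g x)"
  shows "AE x in lborel. f x = g x"
proof -
  have "AE x in lborel. f x - g x = 0" by (rule AE_eq_0_if_interval_integrals_0)
       (use assms in \<open>auto simp: set_integral_diff L2_norm_set_integrable intro!: set_integral_diff\<close>)
  then show ?thesis by simp
qed

text \<open>Integration by parts for absolutely continuous functions, without pointwise derivatives.
  By Fubini the integral of \<open>prod (G s) (K t)\<close> over the square is
  \<open>prod (u b - u a) (v b - v a)\<close>; cutting the square along the diagonal and integrating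
  out one variable on each triangle gives back the primitives \<open>u\<close> and
  \<open>v\<close>.\<close>

lemma product_rule_primitives:
  fixes u g :: "real \<Rightarrow> 'a::euclidean_space" and v k :: "real \<Rightarrow> 'b::euclidean_space"
    and prod :: "'a \<Rightarrow> 'b \<Rightarrow> 'c::euclidean_space"
  assumes bb: "bounded_bilinear prod" and ab: "a \<le> b"
    and g: "set_integrable lborel {a..b} g" and k: "set_integrable lborel {a..b} k"
    and u: "\<And>x. x \<in> {a..b} \<Longrightarrow> u x - u a = (LINT t:{a..x}|lborel. g t)"
    and v: "\<And>x. x \<in> {a..b} \<Longrightarrow> v x - v a = (LINT t:{a..x}|lborel. k t)"
  shows "set_integrable lborel {a..b} (\<lambda>x. prod (u x) (k x) + prod (g x) (v x))"
    and "prod (u b) (v b) - prod (u a) (v a) = (LINT x:{a..b}|lborel. prod (u x) (k x) + prod (g x) (v x))"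
proof -
  interpret prod: bounded_bilinear prod by fact
  define G where "G \<equiv> \<lambda>x. indicator {a..b} x *\<^sub>R g x"
  define K where "K \<equiv> \<lambda>x. indicator {a..b} x *\<^sub>R k x"
  have G: "integrable lborel G" and K: "integrable lborel K" using g k by (auto simp: G_def K_def set_integrable_def)
  note [measurable] = borel_measurable_integrable[OF G] borel_measurable_integrable[OF K]
  have cont: "continuous_on UNIV (\<lambda>p. prod (fst p) (snd p))" by (intro prod.continuous_on continuous_intros)
  have F_meas [measurable]: "(\<lambda>p. prod (G (fst p)) (K (snd p))) \<in> borel_measurable (lborel \<Otimes>\<^sub>M lborel)"
    by (rule borel_measurable_continuous_Pair[OF _ _ cont]) measurable
  have H: "integrable (lborel \<Otimes>\<^sub>M lborel) (\<lambda>p. norm (G (fst p)) * norm (K (snd p)))"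
    by (rule lborel_pair.Fubini_integrable) (use G K in auto)
  obtain C where C: "C > 0" "\<And>x y. norm (prod x y) \<le> norm x * norm y * C" using prod.pos_bounded by blast
  have F: "integrable (lborel \<Otimes>\<^sub>M lborel) (\<lambda>p. prod (G (fst p)) (K (snd p)))"
  proof (rule Bochner_Integration.integrable_bound[where f = "\<lambda>p. norm (G (fst p)) * norm (K (snd p)) * C"])
    show "integrable (lborel \<Otimes>\<^sub>M lborel) (\<lambda>p. norm (G (fst p)) * norm (K (snd p)) * C)" using H by simp
    show "AE p in lborel \<Otimes>\<^sub>M lborel. norm (prod (G (fst p)) (K (snd p))) \<le> norm (norm (G (fst p)) * norm (K (snd p)) * C)"
      using C by (intro AE_I2) (simp add: abs_mult)
  qed measurable
  \<comment> \<open>\<open>F1\<close> lives on the triangle \<open>s \<le> t\<close>, where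
    \<open>s\<close> is integrated first; \<open>F2\<close> lives on \<open>s > t\<close>, where
    \<open>t\<close> is integrated first.\<close>
  define F1 where "F1 \<equiv> \<lambda>p :: real \<times> real. indicator {p. fst p \<le> snd p} p *\<^sub>R prod (G (fst p)) (K (snd p))"
  define F2 where "F2 \<equiv> \<lambda>p :: real \<times> real. indicator {p. fst p > snd p} p *\<^sub>R prod (G (fst p)) (K (snd p))"
  have F1: "integrable (lborel \<Otimes>\<^sub>M lborel) F1" and F2: "integrable (lborel \<Otimes>\<^sub>M lborel) F2"
    unfolding F1_def F2_def by (rule Bochner_Integration.integrable_bound[OF F]; auto simp: indicator_def)+
  have split: "prod (G (fst p)) (K (snd p)) = F1 p + F2 p" for p by (auto simp: F1_def F2_def indicator_def)
  have GI: "integrable lborel (\<lambda>s. indicator A s *\<^sub>R G s)" if [measurable]: "A \<in> sets borel" for A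
    by (rule Bochner_Integration.integrable_bound[OF G]) (auto simp: indicator_def)
  have KI: "integrable lborel (\<lambda>s. indicator A s *\<^sub>R K s)" if [measurable]: "A \<in> sets borel" for A
    by (rule Bochner_Integration.integrable_bound[OF K]) (auto simp: indicator_def)
  have in1: "(LINT s|lborel. F1 (s, t)) = prod (u t - u a) (K t)" for t
  proof (cases "t \<in> {a..b}")
    case True
    have "(LINT s|lborel. F1 (s, t)) = (LINT s|lborel. prod (indicator {..t} s *\<^sub>R G s) (K t))"
      by (intro Bochner_Integration.integral_cong) (auto simp: F1_def indicator_def prod.zero_left)
    also have "\<dots> = prod (LINT s|lborel. indicator {..t} s *\<^sub>R G s) (K t)"
      by (rule integral_bounded_linear[OF prod.bounded_linear_left GI]) auto
    also have "(LINT s|lborel. indicator {..t} s *\<^sub>R G s) = (LINT s:{a..t}|lborel. g s)"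
      unfolding set_lebesgue_integral_def using True
      by (intro Bochner_Integration.integral_cong) (auto simp: G_def indicator_def)
    finally show ?thesis using u[OF True] by simp
  next
    case False
    then have "K t = 0" by (simp add: K_def)
    then show ?thesis by (simp add: F1_def prod.zero_right)
  qed
  have in2: "(LINT t|lborel. F2 (s, t)) = prod (G s) (v s - v a)" for s
  proof (cases "s \<in> {a..b}")
    case True
    have "(LINT t|lborel. F2 (s, t)) = (LINT t|lborel. prod (G s) (indicator {..<s} t *\<^sub>R K t))"
      by (intro Bochner_Integration.integral_cong) (auto simp: F2_def indicator_def prod.zero_right)
    also have "\<dots> = prod (G s) (LINT t|lborel. indicator {..<s} t *\<^sub>R K t)"
      by (rule integral_bounded_linear[OF prod.bounded_linear_right KI]) auto
    also have "(LINT t|lborel. indicator {..<s} t *\<^sub>R K t) = (LINT t|lborel. indicator {..s} t *\<^sub>R K t)"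
    proof (rule integral_cong_AE)
      have "AE t in lborel. t \<noteq> s" by (rule AE_lborel_singleton)
      then show "AE t in lborel. indicator {..<s} t *\<^sub>R K t = indicator {..s} t *\<^sub>R K t"
        by eventually_elim (auto simp: indicator_def)
    qed auto
    also have "\<dots> = (LINT t:{a..s}|lborel. k t)" unfolding set_lebesgue_integral_def using True
      by (intro Bochner_Integration.integral_cong) (auto simp: K_def indicator_def)
    finally show ?thesis using v[OF True] by simp
  next
    case False
    then have "G s = 0" by (simp add: G_def)
    then show ?thesis by (simp add: F2_def prod.zero_left)
  qed
  have int1: "integrable lborel (\<lambda>t. prod (u t - u a) (K t))"
    using lborel_pair.integrable_snd[of "\<lambda>s t. F1 (s, t)"] F1 by (simp add: in1)
  have int2: "integrable lborel (\<lambda>s. prod (G s) (v s - v a))"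
    using lborel_pair.integrable_fst[of "\<lambda>s t. F2 (s, t)"] F2 by (simp add: in2)
  have "prod (LINT s|lborel. G s) (LINT t|lborel. K t) = (LINT t|lborel. (LINT s|lborel. prod (G s) (K t)))"
  proof -
    have "(LINT s|lborel. prod (G s) (K t)) = prod (LINT s|lborel. G s) (K t)" for t
      by (rule integral_bounded_linear[OF prod.bounded_linear_left G])
    then show ?thesis using integral_bounded_linear[OF prod.bounded_linear_right K] by simp
  qed
  also have "\<dots> = (LINT p|(lborel \<Otimes>\<^sub>M lborel). prod (G (fst p)) (K (snd p)))"
    using lborel_pair.integral_snd[of "\<lambda>s t. prod (G s) (K t)"] F by (simp add: case_prod_beta')
  also have "\<dots> = (LINT p|(lborel \<Otimes>\<^sub>M lborel). F1 p) + (LINT p|(lborel \<Otimes>\<^sub>M lborel). F2 p)"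
    unfolding split by (rule Bochner_Integration.integral_add[OF F1 F2])
  also have "(LINT p|(lborel \<Otimes>\<^sub>M lborel). F1 p) = (LINT t|lborel. prod (u t - u a) (K t))"
    using lborel_pair.integral_snd[of "\<lambda>s t. F1 (s, t)"] F1 by (simp add: in1)
  also have "(LINT p|(lborel \<Otimes>\<^sub>M lborel). F2 p) = (LINT s|lborel. prod (G s) (v s - v a))"
    using lborel_pair.integral_fst[of "\<lambda>s t. F2 (s, t)"] F2 by (simp add: in2)
  finally have main: "prod (LINT s|lborel. G s) (LINT t|lborel. K t) =
      (LINT t|lborel. prod (u t - u a) (K t)) + (LINT s|lborel. prod (G s) (v s - v a))" .
  have GK: "(LINT s|lborel. G s) = u b - u a" "(LINT s|lborel. K s) = v b - v a"
    using u[of b] v[of b] ab by (simp_all add: G_def K_def set_lebesgue_integral_def)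
  have i3: "integrable lborel (\<lambda>t. prod (u a) (K t))" "integrable lborel (\<lambda>t. prod (G t) (v a))"
    using integrable_bounded_linear[OF prod.bounded_linear_right K] integrable_bounded_linear[OF prod.bounded_linear_left G]
    by auto
  have eq: "indicator {a..b} x *\<^sub>R (prod (u x) (k x) + prod (g x) (v x)) =
      prod (u x - u a) (K x) + prod (u a) (K x) + (prod (G x) (v x - v a) + prod (G x) (v a))" for x
    by (auto simp: G_def K_def indicator_def prod.diff_left prod.diff_right prod.zero_left prod.zero_right)
  show "set_integrable lborel {a..b} (\<lambda>x. prod (u x) (k x) + prod (g x) (v x))"
    unfolding set_integrable_def eq using int1 int2 i3 by auto
  have "(LINT x:{a..b}|lborel. prod (u x) (k x) + prod (g x) (v x)) =
      (LINT t|lborel. prod (u t - u a) (K t)) + (LINT t|lborel. prod (u a) (K t)) +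
      ((LINT s|lborel. prod (G s) (v s - v a)) + (LINT s|lborel. prod (G s) (v a)))"
    unfolding set_lebesgue_integral_def eq using int1 int2 i3 by simp
  also have "(LINT t|lborel. prod (u a) (K t)) = prod (u a) (v b - v a)"
    using integral_bounded_linear[OF prod.bounded_linear_right K, of "u a"] GK by simp
  also have "(LINT t|lborel. prod (G t) (v a)) = prod (u b - u a) (v a)"
    using integral_bounded_linear[OF prod.bounded_linear_left G, of "v a"] GK by simp
  finally have "(LINT x:{a..b}|lborel. prod (u x) (k x) + prod (g x) (v x)) =
      prod (u b - u a) (v b - v a) + prod (u a) (v b - v a) + prod (u b - u a) (v a)"
    unfolding main[unfolded GK] by (simp only: ac_simps)
  then show "prod (u b) (v b) - prod (u a) (v a) = (LINT x:{a..b}|lborel. prod (u x) (k x) + prod (g x) (v x))"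
    by (simp add: prod.diff_left prod.diff_right)
qed

section \<open>The half-line problem\<close>

text \<open>\<open>g\<close> is the derivative of \<open>u\<close> on the half-line
  \<open>x \<ge> 0\<close>. Both are extended by 0 to the whole line so that the \<open>L2\<close>
  lemmas apply unchanged. The value \<open>u 0\<close> stays free: a jump at 0 is invisible to the
  integrals over \<open>{a..b}\<close> with \<open>0 \<le> a\<close>. Carrying \<open>g\<close>
  along avoids choosing a derivative.\<close>

definition half :: "(real \<Rightarrow> complex ^ 'n) \<Rightarrow> (real \<Rightarrow> complex ^ 'n) \<Rightarrow> bool" where
  "half u g \<longleftrightarrow> u \<in> L2 \<and> g \<in> L2 \<and> (\<forall>x<0. u x = 0 \<and> g x = 0) \<and> (\<forall>a b. 0 \<le> a \<longrightarrow> a \<le> b \<longrightarrow> u b - u a = (LINT x:{a..b}|lborel. g x))"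

lemma halfD:
  assumes "half u g"
  shows "u \<in> L2" "g \<in> L2" "x < 0 \<Longrightarrow> u x = 0" "x < 0 \<Longrightarrow> g x = 0"
    "0 \<le> a \<Longrightarrow> a \<le> b \<Longrightarrow> u b - u a = (LINT x:{a..b}|lborel. g x)" using assms by (auto simp: half_def)

lemma half_zero: "half (\<lambda>x. 0) (\<lambda>x. 0)"
  by (simp add: half_def set_lebesgue_integral_def)

lemma half_add:
  assumes "half u g" "half v k" shows "half (\<lambda>x. u x + v x) (\<lambda>x. g x + k x)"
  unfolding half_def
proof (intro conjI allI impI)
  fix a b :: real assume ab: "0 \<le> a" "a \<le> b"
  have "(u b + v b) - (u a + v a) = (u b - u a) + (v b - v a)" by simp
  also have "\<dots> = (LINT x:{a..b}|lborel. g x + k x)" using halfD(5)[OF assms(1) ab] halfD(5)[OF assms(2) ab]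
    by (simp add: set_integral_add L2_norm_set_integrable halfD[OF assms(1)] halfD[OF assms(2)])
  finally show "(u b + v b) - (u a + v a) = (LINT x:{a..b}|lborel. g x + k x)" .
qed (use assms in \<open>auto simp: half_def intro: L2_add\<close>)

lemma bounded_linear_vec_scale: "bounded_linear ((*s) c :: complex ^ 'n \<Rightarrow> _)"
  by (rule bounded_linear_intro[where K = "norm c"])
    (auto simp: vec.scale_right_distrib norm_vec_scale mult.commute vec_eq_iff)

lemma set_integral_vec_scale:
  fixes g :: "real \<Rightarrow> complex ^ 'n"
  assumes "set_integrable lborel A g"
  shows "(LINT x:A|lborel. c *s g x) = c *s (LINT x:A|lborel. g x)"
proof -
  have "indicat_real A x *\<^sub>R (c *s g x) = c *s (indicat_real A x *\<^sub>R g x)" for x by (simp add: vec_eq_iff)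
  then show ?thesis using integral_bounded_linear[OF bounded_linear_vec_scale, of lborel _ c] assms
    by (simp add: set_lebesgue_integral_def set_integrable_def)
qed

lemma half_scale:
  assumes "half u g" shows "half (\<lambda>x. c *s u x) (\<lambda>x. c *s g x)"
  unfolding half_def
proof (intro conjI allI impI)
  fix a b :: real assume ab: "0 \<le> a" "a \<le> b"
  show "c *s u b - c *s u a = (LINT x:{a..b}|lborel. c *s g x)" using halfD(5)[OF assms ab]
    by (simp add: set_integral_vec_scale L2_norm_set_integrable halfD[OF assms] flip: vec.scale_right_diff_distrib)
qed (use assms in \<open>auto simp: half_def intro: L2_scale\<close>)

lemma half_diff:
  assumes "half u g" "half v k" shows "half (\<lambda>x. u x - v x) (\<lambda>x. g x - k x)"
  using half_add[OF assms(1) half_scale[OF assms(2), of "-1"]] by simp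

lemma half_sum:
  assumes "\<And>i. i \<in> I \<Longrightarrow> half (u i) (g i)"
  shows "half (\<lambda>x. \<Sum>i\<in>I. u i x) (\<lambda>x. \<Sum>i\<in>I. g i x)"
  using assms by (induction I rule: infinite_finite_induct) (auto intro: half_add half_zero)

lemma half_increment_le:
  assumes "half u g" "0 \<le> a" "x \<in> {a..b}" "y \<in> {a..b}"
  shows "norm (u x - u y) \<le> (LINT x:{a..b}|lborel. norm (g x))"
proof -
  have gi: "set_integrable lborel {a..b} (\<lambda>x. norm (g x))"
    using set_integrable_norm[OF L2_norm_set_integrable[OF halfD(2)[OF assms(1)]]] by simp
  have "norm (u x - u y) \<le> (LINT x:{a..b}|lborel. norm (g x))" if "x \<in> {a..b}" "y \<in> {a..b}" "y \<le> x" for x y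
  proof -
    have "norm (u x - u y) = norm (LINT x:{y..x}|lborel. g x)" using halfD(5)[OF assms(1), of y x] assms that by simp
    also have "\<dots> \<le> (LINT x:{y..x}|lborel. norm (g x))"
      unfolding set_lebesgue_integral_def by (rule order_trans[OF integral_norm_bound]) simp
    also have "\<dots> \<le> (LINT x:{a..b}|lborel. norm (g x))" using that gi set_integrable_subset[OF gi, of "{y..x}"]
      unfolding set_integrable_def set_lebesgue_integral_def by (intro integral_mono) (auto simp: indicator_def)
    finally show ?thesis .
  qed
  then show ?thesis using assms(3,4) by (metis linear norm_minus_commute)
qed

text \<open>On the unit interval \<open>{x..x+1}\<close> the function changes by at most
  \<open>l2norm g\<close>, so \<open>norm (u x) - l2norm g\<close> bounds \<open>norm (u y)\<close>
  from below there, and a constant on an interval of length 1 equals its own \<open>L2\<close> norm.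
  The \<open>max 0\<close> covers a negative difference.\<close>

lemma half_Sobolev:
  assumes "half u g" "x \<ge> 0"
  shows "norm (u x) \<le> l2norm u + l2norm g"
proof -
  obtain v :: "complex ^ 'n" where v: "norm v = 1" using vector_choose_size[of 1] by auto
  have g: "(LINT x:{x..x+1}|lborel. norm (g x)) \<le> l2norm g"
    using norm_L1_le_l2norm[OF halfD(2)[OF assms(1)], of x "x+1"] by simp
  have "l2norm (\<lambda>y. indicator {x..x+1} y *\<^sub>R (of_real (max 0 (norm (u x) - l2norm g)) *s v)) \<le> l2norm u"
  proof (rule l2norm_mono[OF L2_indicator_const halfD(1)[OF assms(1)]], rule AE_I2)
    fix y
    have "norm (u x) - l2norm g \<le> norm (u y)" if "y \<in> {x..x+1}"
      using half_increment_le[OF assms(1) assms(2), of x "x+1" y] that g norm_triangle_ineq2[of "u x" "u y"] by simp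
    then show "norm (indicator {x..x+1} y *\<^sub>R (of_real (max 0 (norm (u x) - l2norm g)) *s v)) \<le> norm (u y)"
      by (simp add: norm_vec_scale v indicator_def)
  qed
  then show ?thesis by (subst (asm) l2norm_indicator_const) (auto simp: norm_vec_scale v)
qed

section \<open>Coefficient matrices, residuals and Gronwall's inequality on the half-line\<close>

lemma continuous_on_matrix_vector_mult:
  fixes B :: "'t::topological_space \<Rightarrow> complex ^ 'n ^ 'm"
  assumes "continuous_on S B" "continuous_on S v"
  shows "continuous_on S (\<lambda>x. B x *v v x)"
  unfolding matrix_vector_mult_def by (intro continuous_intros assms)

lemma measurable_matrix_vector_mult [measurable]:
  fixes B :: "'a \<Rightarrow> complex ^ 'n ^ 'm"
  assumes "B \<in> borel_measurable M" "v \<in> borel_measurable M"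
  shows "(\<lambda>x. B x *v v x) \<in> borel_measurable M"
  by (rule borel_measurable_continuous_Pair[OF assms])
    (intro continuous_on_matrix_vector_mult continuous_intros)

definition bounded_coeff :: "real \<Rightarrow> (real \<Rightarrow> complex ^ 'n ^ 'n) \<Rightarrow> bool" where
  "bounded_coeff \<beta> B \<longleftrightarrow> \<beta> \<ge> 0 \<and> continuous_on UNIV B \<and> (\<forall>x v. norm (B x *v v) \<le> \<beta> * norm v)"

definition residual :: "(real \<Rightarrow> complex ^ 'n ^ 'n) \<Rightarrow> (real \<Rightarrow> complex ^ 'n) \<Rightarrow> (real \<Rightarrow> complex ^ 'n) \<Rightarrow> real \<Rightarrow> complex ^ 'n" where
  "residual B u g = (\<lambda>x. g x - B x *v u x)"

lemma bounded_coeffD: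
  assumes "bounded_coeff \<beta> B"
  shows "\<beta> \<ge> 0" "continuous_on UNIV B" "norm (B x *v v) \<le> \<beta> * norm v" "B \<in> borel_measurable borel"
  using assms borel_measurable_continuous_onI unfolding bounded_coeff_def by auto

lemma L2_coeff_mult:
  assumes "bounded_coeff \<beta> B" "u \<in> L2"
  shows "(\<lambda>x. B x *v u x) \<in> L2"
  by (rule L2_scaled_bound[OF _ assms(2), where c = \<beta>])
    (auto intro!: measurable_matrix_vector_mult bounded_coeffD[OF assms(1)] L2_measurable[OF assms(2)])

lemma l2norm_coeff_mult:
  assumes "bounded_coeff \<beta> B" "u \<in> L2"
  shows "l2norm (\<lambda>x. B x *v u x) \<le> \<beta> * l2norm u"
  by (rule l2norm_bound[OF L2_coeff_mult[OF assms] assms(2)])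
    (auto intro!: bounded_coeffD[OF assms(1)])

lemma L2_residual:
  assumes "bounded_coeff \<beta> B" "half u g" shows "residual B u g \<in> L2"
  unfolding residual_def by (intro L2_diff L2_coeff_mult[OF assms(1)] halfD[OF assms(2)])

lemma l2norm_derivative_le:
  assumes "bounded_coeff \<beta> B" "half u g"
  shows "l2norm g \<le> l2norm (residual B u g) + \<beta> * l2norm u"
proof -
  have "l2norm g = l2norm (\<lambda>x. residual B u g x + B x *v u x)" by (simp add: residual_def)
  also have "\<dots> \<le> l2norm (residual B u g) + l2norm (\<lambda>x. B x *v u x)"
    by (intro l2norm_triangle L2_residual[OF assms] L2_coeff_mult[OF assms(1)] halfD[OF assms(2)])
  also have "\<dots> \<le> l2norm (residual B u g) + \<beta> * l2norm u" using l2norm_coeff_mult[OF assms(1) halfD(1)[OF assms(2)]] by simp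
  finally show ?thesis .
qed

text \<open>The interval is so short that the supremum \<open>M\<close> of \<open>norm (u t)\<close>
  re-enters the right-hand side with factor at most 1/2 and can be absorbed. As \<open>x\<close> and
  \<open>y\<close> are arbitrary points of the interval, the bound runs in both directions.\<close>

lemma Gronwall_step:
  assumes B: "bounded_coeff \<beta> B" and h: "half u g" and a: "0 \<le> a" "a \<le> b" "b - a \<le> 1" "\<beta> * (b - a) \<le> 1/2"
    and x: "x \<in> {a..b}" and y: "y \<in> {a..b}"
  shows "norm (u x) \<le> 2 * (norm (u y) + l2norm (residual B u g))"
proof -
  let ?r = "residual B u g"
  note si = L2_norm_set_integrable
  define M where "M = (SUP t\<in>{a..b}. norm (u t))"
  have bdd: "bdd_above ((\<lambda>t. norm (u t)) ` {a..b})"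
  proof (rule bdd_aboveI2)
    fix t assume "t \<in> {a..b}"
    then show "norm (u t) \<le> norm (u y) + (LINT x:{a..b}|lborel. norm (g x))"
      using half_increment_le[OF h a(1) _ y] norm_triangle_ineq2[of "u t" "u y"] by fastforce
  qed
  have M: "norm (u t) \<le> M" if "t \<in> {a..b}" for t unfolding M_def using that bdd by (rule cSUP_upper)
  have i1: "set_integrable lborel {a..b} (\<lambda>x. norm (g x))" using set_integrable_norm[OF si[OF halfD(2)[OF h]]] by simp
  have i2: "set_integrable lborel {a..b} (\<lambda>x. norm (?r x))" using set_integrable_norm[OF si[OF L2_residual[OF B h]]] by simp
  have i3: "set_integrable lborel {a..b} (\<lambda>x. \<beta> * M)" unfolding set_integrable_def
    by (intro integrable_scaleR_left integrable_real_indicator) (auto simp: emeasure_lborel_Icc_eq)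
  have "(LINT x:{a..b}|lborel. norm (g x)) \<le> (LINT x:{a..b}|lborel. norm (?r x) + \<beta> * M)"
  proof (rule set_integral_mono[OF i1 set_integral_add(1)[OF i2 i3]])
    fix t assume "t \<in> {a..b}"
    have "norm (g t) \<le> norm (?r t) + norm (B t *v u t)"
      unfolding residual_def using norm_triangle_ineq[of "g t - B t *v u t" "B t *v u t"] by simp
    also have "norm (B t *v u t) \<le> \<beta> * norm (u t)" by (rule bounded_coeffD[OF B])
    also have "\<dots> \<le> \<beta> * M" using M[OF \<open>t \<in> {a..b}\<close>] bounded_coeffD(1)[OF B] by (rule mult_left_mono)
    finally show "norm (g t) \<le> norm (?r t) + \<beta> * M" by simp
  qed
  also have "\<dots> = (LINT x:{a..b}|lborel. norm (?r x)) + (b - a) * (\<beta> * M)"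
    using a by (simp add: set_integral_add(2)[OF i2 i3]) (simp add: set_lebesgue_integral_def)
  also have "\<dots> \<le> l2norm ?r + 1/2 * M"
  proof (rule add_mono)
    have "(LINT x:{a..b}|lborel. norm (?r x)) \<le> sqrt (b - a) * l2norm ?r"
      by (rule norm_L1_le_l2norm[OF L2_residual[OF B h] a(2)])
    also have "\<dots> \<le> 1 * l2norm ?r" using a by (intro mult_right_mono) auto
    finally show "(LINT x:{a..b}|lborel. norm (?r x)) \<le> l2norm ?r" by simp
    have "M \<ge> 0" using M[OF x] norm_ge_zero[of "u x"] by linarith
    then show "(b - a) * (\<beta> * M) \<le> 1/2 * M" using mult_right_mono[OF a(4)] by (simp add: algebra_simps)
  qed
  finally have *: "(LINT x:{a..b}|lborel. norm (g x)) \<le> l2norm ?r + 1/2 * M" .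
  have le: "norm (u t) \<le> norm (u y) + l2norm ?r + 1/2 * M" if "t \<in> {a..b}" for t
    using half_increment_le[OF h a(1) that y] * norm_triangle_ineq2[of "u t" "u y"] by linarith
  then have "M \<le> norm (u y) + l2norm ?r + 1/2 * M" unfolding M_def using x by (intro cSUP_least) (auto simp flip: M_def)
  with M[OF x] show ?thesis by simp
qed

text \<open>Short steps are chained, each turning \<open>C\<close> into \<open>2 * C + 2\<close>.
  The backward direction matters later, to carry information from a far point to the trace at
  0.\<close>

lemma Gronwall:
  fixes B :: "real \<Rightarrow> complex ^ 'n ^ 'n"
  assumes B: "bounded_coeff \<beta> B"
  obtains C where "C \<ge> 0"
    "\<And>u g x y. half u g \<Longrightarrow> x \<in> {0..L} \<Longrightarrow> y \<in> {0..L} \<Longrightarrow> norm (u x) \<le> C * (norm (u y) + l2norm (residual B u g))"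
proof -
  \<comment> \<open>Satisfies \<open>h \<le> 1\<close> and \<open>\<beta> * h \<le> 1/2\<close>, the
    two smallness conditions of \<open>Gronwall_step\<close>.\<close>
  define h where "h = 1 / (2 * \<beta> + 1)"
  have b0: "\<beta> \<ge> 0" by (rule bounded_coeffD[OF B])
  have h: "h > 0" "h \<le> 1" "\<beta> * h \<le> 1/2" using b0 by (auto simp: h_def field_simps)
  have "\<exists>C\<ge>0. \<forall>(u :: real \<Rightarrow> complex ^ 'n) g x y. half u g \<longrightarrow> 0 \<le> x \<longrightarrow> 0 \<le> y \<longrightarrow> \<bar>x - y\<bar> \<le> n * h \<longrightarrow>
      norm (u x) \<le> C * (norm (u y) + l2norm (residual B u g))" for n :: nat
  proof (induction n)
    case 0
    then show ?case by (intro exI[of _ 1]) auto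
  next
    case (Suc n)
    then obtain C where C: "C \<ge> 0" "\<And>(u :: real \<Rightarrow> complex ^ 'n) g x y. half u g \<Longrightarrow> 0 \<le> x \<Longrightarrow> 0 \<le> y \<Longrightarrow> \<bar>x - y\<bar> \<le> n * h \<Longrightarrow>
      norm (u x) \<le> C * (norm (u y) + l2norm (residual B u g))" by blast
    show ?case
    proof (intro exI[of _ "2 * C + 2"] conjI allI impI)
      fix u g :: "real \<Rightarrow> complex ^ 'n" and x y :: real
      assume hu: "half u g" and xy: "0 \<le> x" "0 \<le> y" "\<bar>x - y\<bar> \<le> Suc n * h"
      \<comment> \<open>The point one step from \<open>x\<close> in the direction of
        \<open>y\<close>, or \<open>y\<close> itself when it is within reach.\<close>
      define c where "c = (if \<bar>x - y\<bar> \<le> h then y else if x \<le> y then x + h else x - h)"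
      have "real n * h \<ge> 0" using h by simp
      then have c: "c \<ge> 0" "\<bar>x - c\<bar> \<le> h" "\<bar>c - y\<bar> \<le> n * h"
        using xy h by (auto simp: c_def algebra_simps abs_le_iff split: if_splits)
      have "norm (u x) \<le> 2 * (norm (u c) + l2norm (residual B u g))"
      proof (rule Gronwall_step[OF B hu, where a = "min x c" and b = "max x c"])
        have "\<beta> * (max x c - min x c) \<le> \<beta> * h"
          using c b0 by (intro mult_left_mono) (auto simp: min_def max_def split: if_splits)
        then show "\<beta> * (max x c - min x c) \<le> 1/2" using h by linarith
      qed (use c xy h in \<open>auto simp: min_def max_def split: if_splits\<close>)
      also have "norm (u c) \<le> C * (norm (u y) + l2norm (residual B u g))" by (rule C(2)[OF hu c(1) xy(2) c(3)])
      also have "2 * (C * (norm (u y) + l2norm (residual B u g)) + l2norm (residual B u g))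
          \<le> (2 * C + 2) * (norm (u y) + l2norm (residual B u g))" using C(1) by (simp add: algebra_simps)
      finally show "norm (u x) \<le> (2 * C + 2) * (norm (u y) + l2norm (residual B u g))" by simp
    qed (use C in auto)
  qed
  moreover obtain n :: nat where "\<bar>L\<bar> \<le> n * h" using reals_Archimedean3[OF h(1)] less_imp_le by blast
  ultimately show ?thesis using that by (smt (verit) atLeastAtMost_iff)
qed

section \<open>Generalized eigenspaces\<close>

text \<open>The vector \<open>p(B) v\<close>, evaluated by Horner's scheme on vectors, so that no
  powers of matrices are formed.\<close>

definition mpoly_apply :: "complex ^ 'n ^ 'n \<Rightarrow> complex poly \<Rightarrow> complex ^ 'n \<Rightarrow> complex ^ 'n" where
  "mpoly_apply B p v = fold_coeffs (\<lambda>a w. a *s v + B *v w) p 0"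

lemma mpoly_apply_0 [simp]: "mpoly_apply B 0 v = 0"
  by (simp add: mpoly_apply_def)

lemma mpoly_apply_pCons [simp]: "mpoly_apply B (pCons a p) v = a *s v + B *v mpoly_apply B p v"
  by (cases "p = 0 \<and> a = 0") (auto simp: mpoly_apply_def fold_coeffs_pCons_not_0_0_eq fold_coeffs_pCons_coeff_not_0_eq)

lemma mpoly_apply_1 [simp]: "mpoly_apply B 1 v = v"
  by (simp add: one_pCons)

lemma matrix_vector_mult_vec_scale: "B *v (c *s v) = c *s (B *v (v :: complex ^ 'n))"
  by (rule vector_scalar_commute)

lemma mpoly_apply_add: "mpoly_apply B (p + q) v = mpoly_apply B p v + mpoly_apply B q v"
  by (induction p q rule: poly_induct2)
    (auto simp: matrix_vector_right_distrib vec.scale_left_distrib algebra_simps)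

lemma mpoly_apply_smult: "mpoly_apply B (smult c p) v = c *s mpoly_apply B p v"
  by (induction p) (auto simp: matrix_vector_mult_vec_scale vec.scale_right_distrib)

lemma mpoly_apply_diff: "mpoly_apply B (p - q) v = mpoly_apply B p v - mpoly_apply B q v"
  using mpoly_apply_add[of B "p - q" q v] by simp

lemma mpoly_apply_mult: "mpoly_apply B (p * q) v = mpoly_apply B p (mpoly_apply B q v)"
  by (induction p) (auto simp: mpoly_apply_add mpoly_apply_smult)

lemma mpoly_apply_vec_add: "mpoly_apply B p (v + w) = mpoly_apply B p v + mpoly_apply B p w"
  by (induction p) (auto simp: matrix_vector_right_distrib vec.scale_right_distrib algebra_simps)

lemma mpoly_apply_vec_scale: "mpoly_apply B p (c *s v) = c *s mpoly_apply B p v"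
  by (induction p)
    (auto simp: matrix_vector_mult_vec_scale vec.scale_right_distrib vec.scale_left_commute)

lemma mpoly_apply_vec_zero [simp]: "mpoly_apply B p 0 = 0"
  by (induction p) auto

lemma mpoly_apply_sum: "mpoly_apply B (\<Sum>i\<in>I. p i) v = (\<Sum>i\<in>I. mpoly_apply B (p i) v)"
  by (induction I rule: infinite_finite_induct) (auto simp: mpoly_apply_add)

lemma mpoly_apply_monom: "mpoly_apply B (monom c i) v = c *s (((*v) B ^^ i) v)"
  by (induction i) (auto simp: monom_0 monom_Suc matrix_vector_mult_vec_scale)

lemma mpoly_apply_in_subspace:
  assumes "vec.subspace W" "\<And>w. w \<in> W \<Longrightarrow> B *v w \<in> W" "v \<in> W"
  shows "mpoly_apply B p v \<in> W"
  by (induction p) (auto intro: assms vec.subspace_add vec.subspace_scale vec.subspace_0)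

lemma mpoly_apply_eigenvector:
  assumes "B *v w = \<mu> *s w" shows "mpoly_apply B p w = poly p \<mu> *s w"
  by (induction p)
    (auto simp: matrix_vector_mult_vec_scale assms vec.scale_left_distrib mult.commute)

lemma mpoly_apply_linear_power:
  "mpoly_apply B ([:- \<mu>, 1:] ^ k) v = ((\<lambda>w. B *v w - \<mu> *s w) ^^ k) v"
proof (induction k)
  case (Suc k)
  then show ?case by (simp add: mpoly_apply_mult del: mult_pCons_left)
qed simp

text \<open>\<open>N + 1\<close> Krylov vectors in dimension \<open>N\<close> are dependent.
  Dependence is a property of the set of vectors, hence the separate case of two equal iterates,
  where a difference of monomials annihilates \<open>v\<close>.\<close>

lemma exists_annihilating_poly:
  fixes v :: "complex ^ 'n"
  obtains p where "p \<noteq> 0" "mpoly_apply B p v = 0"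
proof -
  define f where "f = (\<lambda>i. ((*v) B ^^ i) v)"
  show ?thesis
  proof (cases "inj_on f {..CARD('n)}")
    case True
    have "vec.dependent (f ` {..CARD('n)})" by (rule vec.dependent_biggerset_general)
        (use dim_subset_UNIV_cart_gen[of "f ` {..CARD('n)}"] in \<open>auto simp: card_image[OF True]\<close>)
    then obtain u where u: "\<exists>v\<in>f ` {..CARD('n)}. u v \<noteq> 0" "(\<Sum>v\<in>f ` {..CARD('n)}. u v *s v) = 0"
      by (auto simp: vec.dependent_finite)
    define p where "p = (\<Sum>i\<le>CARD('n). monom (u (f i)) i)"
    have "mpoly_apply B p v = (\<Sum>i\<le>CARD('n). u (f i) *s f i)" by (simp add: p_def mpoly_apply_sum mpoly_apply_monom f_def)
    also have "\<dots> = 0" using u(2) by (simp add: sum.reindex[OF True])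
    finally have 1: "mpoly_apply B p v = 0" .
    obtain j where j: "j \<le> CARD('n)" "u (f j) \<noteq> 0" using u(1) by auto
    have "coeff p j = u (f j)" using j(1) unfolding p_def coeff_sum coeff_monom by simp
    with j 1 that show ?thesis by (metis coeff_0)
  next
    case False
    then obtain i j where ij: "i \<noteq> j" "f i = f j" by (auto simp: inj_on_def)
    have "mpoly_apply B (monom 1 i - monom 1 j) v = 0" using ij by (simp add: mpoly_apply_diff mpoly_apply_monom f_def)
    moreover have "coeff (monom 1 i - monom 1 j :: complex poly) i \<noteq> 0" using ij by simp
    ultimately show ?thesis using that by (metis coeff_0)
  qed
qed

text \<open>Take \<open>p\<close> of least degree annihilating \<open>v\<close> and a root
  \<open>a\<close> of \<open>p\<close>. The cofactor \<open>q\<close> gives a vector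
  \<open>q(B) v\<close>, nonzero by minimality and killed by \<open>B - a\<close>; it stays in
  \<open>W\<close> by invariance.\<close>

lemma exists_eigenvector_in_invariant_subspace:
  fixes W :: "(complex ^ 'n) set"
  assumes W: "vec.subspace W" "\<And>w. w \<in> W \<Longrightarrow> B *v w \<in> W" and v: "v \<in> W" "v \<noteq> 0"
  obtains \<mu> w where "w \<in> W" "w \<noteq> 0" "B *v w = \<mu> *s w"
proof -
  define P where "P = (\<lambda>d. \<exists>p. p \<noteq> 0 \<and> degree p = d \<and> mpoly_apply B p v = 0)"
  have "\<exists>d. P d" using exists_annihilating_poly[of B v] unfolding P_def by metis
  then have "P (LEAST d. P d)" by (rule LeastI_ex)
  then obtain p where p: "p \<noteq> 0" "degree p = (LEAST d. P d)" "mpoly_apply B p v = 0" by (auto simp: P_def)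
  have min: "mpoly_apply B q v \<noteq> 0" if "q \<noteq> 0" "degree q < degree p" for q
    using not_less_Least[of "degree q" P] that p by (auto simp: P_def)
  have "degree p \<noteq> 0"
  proof
    assume "degree p = 0"
    then obtain a where "p = [:a:]" by (rule degree_eq_zeroE)
    with p v show False by simp
  qed
  then have "\<not> constant (poly p)" by (simp add: constant_degree)
  then obtain a where "poly p a = 0" using Fundamental_Theorem_Algebra.fundamental_theorem_of_algebra by blast
  then obtain q where q: "p = [:-a, 1:] * q" by (auto simp: poly_eq_0_iff_dvd dvd_def)
  with p have q0: "q \<noteq> 0" by auto
  have "degree p = degree [:-a, 1:] + degree q" unfolding q by (rule degree_mult_eq) (use q0 in auto)
  then have "mpoly_apply B q v \<noteq> 0" using min[OF q0] by simp
  moreover have "B *v mpoly_apply B q v = a *s mpoly_apply B q v"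
    using p(3) unfolding q mpoly_apply_mult by (simp add: vec.scale_minus_left)
  ultimately show ?thesis using that mpoly_apply_in_subspace[OF W v(1)] by blast
qed

text \<open>Each element of the span is annihilated by a nonzero polynomial all of whose roots lie
  in \<open>M\<close>. On an eigenvector this polynomial acts as multiplication by its value at
  \<open>\<nu>\<close>, which is therefore 0.\<close>

lemma eigenvalue_in_span_gen_eigenspaces:
  assumes "w \<in> vec.span (\<Union>\<mu>\<in>M. gen_eigenspace B \<mu>)" "w \<noteq> 0" "B *v w = \<nu> *s w"
  shows "\<nu> \<in> M"
proof -
  have "\<exists>p. p \<noteq> 0 \<and> (\<forall>a. poly p a = 0 \<longrightarrow> a \<in> M) \<and> mpoly_apply B p w = 0" using assms(1)
  proof (induction rule: vec.span_induct_alt)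
    case base
    show ?case by (intro exI[of _ 1]) auto
  next
    case (step c x y)
    then obtain \<mu> k where \<mu>: "\<mu> \<in> M" "((\<lambda>w. B *v w - \<mu> *s w) ^^ k) x = 0" by (auto simp: gen_eigenspace_def)
    from step obtain q where q: "q \<noteq> 0" "\<forall>a. poly q a = 0 \<longrightarrow> a \<in> M" "mpoly_apply B q y = 0" by blast
    let ?r = "[:- \<mu>, 1:] ^ k"
    have "mpoly_apply B (?r * q) (c *s x + y) =
        c *s mpoly_apply B q (mpoly_apply B ?r x) + mpoly_apply B ?r (mpoly_apply B q y)"
      unfolding mpoly_apply_vec_add mpoly_apply_vec_scale by (subst mult.commute) (simp add: mpoly_apply_mult)
    also have "\<dots> = 0" using \<mu>(2) q(3) by (simp flip: mpoly_apply_linear_power)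
    finally show ?case using q \<mu>(1) by (intro exI[of _ "?r * q"]) (auto simp: poly_power)
  qed
  then obtain p where p: "\<forall>a. poly p a = 0 \<longrightarrow> a \<in> M" "mpoly_apply B p w = 0" by blast
  then have "poly p \<nu> *s w = 0" using mpoly_apply_eigenvector[OF assms(3)] by simp
  then show ?thesis using p(1) assms(2) by (simp add: vec.scale_eq_0_iff)
qed

text \<open>Modulo the linear factor, \<open>q\<close> is the nonzero constant
  \<open>poly q a\<close>; its inverse \<open>c\<close> allows one more linear factor to be split
  off in each step.\<close>

lemma Bezout_linear_power:
  fixes q :: "complex poly"
  assumes "poly q a \<noteq> 0"
  shows "\<exists>r s. r * [:- a, 1:] ^ k + s * q = 1"
proof (induction k)
  case 0
  show ?case by (intro exI[of _ 1] exI[of _ 0]) simp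
next
  case (Suc k)
  then obtain r s where rs: "r * [:- a, 1:] ^ k + s * q = 1" by blast
  have "poly (q - [:poly q a:]) a = 0" by simp
  then obtain h where h: "q - [:poly q a:] = [:-a, 1:] * h" unfolding poly_eq_0_iff_dvd by (rule dvdE)
  define c where "c = [:1 / poly q a:]"
  have c: "c * [:poly q a:] = 1" using assms by (simp add: c_def one_pCons)
  have q: "[:poly q a:] = q - [:-a, 1:] * h" using h by (simp add: algebra_simps)
  have "1 = (c * [:poly q a:]) * (r * [:- a, 1:] ^ k + s * q)" unfolding rs c by simp
  also have "\<dots> = (- c * h * r) * [:- a, 1:] ^ Suc k + (c * r * [:- a, 1:] ^ k + c * (q - [:-a, 1:] * h) * s) * q"
  proof -
    have "c * (q - L * h) * (r * K + s * q) = (- c * h * r) * (L * K) + (c * r * K + c * (q - L * h) * s) * q"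
      for L K :: "complex poly" by (simp add: algebra_simps)
    then show ?thesis unfolding q power_Suc .
  qed
  finally show ?case by metis
qed

text \<open>Primary decomposition by induction on the degree: the Bezout identity for one full root
  factor and its cofactor \<open>q\<close> writes \<open>v\<close> as a vector killed by
  \<open>q\<close>, of smaller degree, plus a vector of one generalized eigenspace.\<close>

lemma in_span_gen_eigenspaces:
  assumes "p \<noteq> 0" "mpoly_apply B p v = 0"
  shows "v \<in> vec.span (\<Union>\<mu>. gen_eigenspace B \<mu>)"
  using assms
proof (induction "degree p" arbitrary: p v rule: less_induct)
  case less
  show ?case
  proof (cases "degree p = 0")
    case True
    then obtain a where "p = [:a:]" by (rule degree_eq_zeroE)
    with less.prems have "v = 0" by simp
    then show ?thesis by (simp add: vec.span_zero)
  next
    case False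
    then have "\<not> constant (poly p)" by (simp add: constant_degree)
    then obtain a where a: "poly p a = 0" using Fundamental_Theorem_Algebra.fundamental_theorem_of_algebra by blast
    define k where "k = order a p"
    obtain q where q: "p = [:-a, 1:] ^ k * q" "\<not> [:-a, 1:] dvd q" using order_decomp[OF less.prems(1), of a] k_def by blast
    have q0: "q \<noteq> 0" using q less.prems by auto
    have k0: "k > 0" using a less.prems(1) by (simp add: k_def order_root)
    have "degree p = degree ([:-a, 1:] ^ k) + degree q" unfolding q(1) by (rule degree_mult_eq) (use q0 in auto)
    then have deg: "degree q < degree p" using k0 by (simp add: degree_linear_power)
    have "poly q a \<noteq> 0" using q(2) by (simp add: poly_eq_0_iff_dvd)
    then obtain r s where rs: "r * [:- a, 1:] ^ k + s * q = 1" using Bezout_linear_power by blast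
    have v: "v = mpoly_apply B (r * [:- a, 1:] ^ k) v + mpoly_apply B (s * q) v"
      using arg_cong[OF rs, of "\<lambda>p. mpoly_apply B p v"] by (simp only: mpoly_apply_add mpoly_apply_1)
    have "mpoly_apply B q (mpoly_apply B (r * [:- a, 1:] ^ k) v) = mpoly_apply B (r * p) v"
      by (simp only: mpoly_apply_mult[symmetric] q(1) ac_simps)
    also have "\<dots> = 0" using less.prems(2) by (simp add: mpoly_apply_mult)
    finally have 1: "mpoly_apply B (r * [:- a, 1:] ^ k) v \<in> vec.span (\<Union>\<mu>. gen_eigenspace B \<mu>)"
      using less.hyps[OF deg q0] by blast
    have "mpoly_apply B ([:- a, 1:] ^ k) (mpoly_apply B (s * q) v) = mpoly_apply B (s * p) v"
      by (simp only: mpoly_apply_mult[symmetric] q(1) ac_simps)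
    also have "\<dots> = 0" using less.prems(2) by (simp add: mpoly_apply_mult)
    finally have "mpoly_apply B (s * q) v \<in> gen_eigenspace B a" unfolding mpoly_apply_linear_power gen_eigenspace_def by blast
    then have 2: "mpoly_apply B (s * q) v \<in> vec.span (\<Union>\<mu>. gen_eigenspace B \<mu>)" by (intro vec.span_base) blast
    show ?thesis by (subst v) (rule vec.span_add[OF 1 2])
  qed
qed

lemma gen_eigenspace_trivial:
  assumes "\<And>v. v \<noteq> 0 \<Longrightarrow> B *v v \<noteq> \<mu> *s v" "v \<in> gen_eigenspace B \<mu>"
  shows "v = 0"
proof -
  have "v = 0" if "((\<lambda>w. B *v w - \<mu> *s w) ^^ k) v = 0" for k v using that
  proof (induction k arbitrary: v)
    case (Suc k)
    then have "B *v v - \<mu> *s v = 0" by (simp only: funpow_Suc_right o_apply)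
    then show ?case using assms(1) by auto
  qed simp
  then show ?thesis using assms(2) by (auto simp: gen_eigenspace_def)
qed

lemma gen_eigenspace_invariant:
  assumes "v \<in> gen_eigenspace B \<mu>" shows "B *v v \<in> gen_eigenspace B \<mu>"
proof -
  obtain k where k: "mpoly_apply B ([:- \<mu>, 1:] ^ k) v = 0"
    using assms by (auto simp: gen_eigenspace_def mpoly_apply_linear_power)
  have "mpoly_apply B ([:- \<mu>, 1:] ^ k) (B *v v) = mpoly_apply B ([:- \<mu>, 1:] ^ k) (mpoly_apply B [:0, 1:] v)" by simp
  also have "\<dots> = mpoly_apply B [:0, 1:] (mpoly_apply B ([:- \<mu>, 1:] ^ k) v)"
    by (simp only: mpoly_apply_mult[symmetric] mult.commute)
  finally show ?thesis using k by (auto simp: gen_eigenspace_def mpoly_apply_linear_power)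
qed

lemma span_gen_eigenspaces_invariant:
  assumes "v \<in> vec.span (\<Union>\<mu>\<in>M. gen_eigenspace B \<mu>)"
  shows "B *v v \<in> vec.span (\<Union>\<mu>\<in>M. gen_eigenspace B \<mu>)"
  using assms
proof (induction rule: vec.span_induct_alt)
  case base
  show ?case by (simp add: vec.span_zero)
next
  case (step c x y)
  then obtain \<mu> where "\<mu> \<in> M" "x \<in> gen_eigenspace B \<mu>" by blast
  then have "B *v x \<in> (\<Union>\<mu>\<in>M. gen_eigenspace B \<mu>)" using gen_eigenspace_invariant by blast
  then show ?case unfolding matrix_vector_right_distrib matrix_vector_mult_vec_scale
    by (rule vec.span_add[OF vec.span_scale[OF vec.span_base] step.IH])
qed

definition hyperbolic :: "complex ^ 'n ^ 'n \<Rightarrow> bool" where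
  "hyperbolic B \<longleftrightarrow> (\<forall>v \<mu>. v \<noteq> 0 \<longrightarrow> B *v v = \<mu> *s v \<longrightarrow> Re \<mu> \<noteq> 0)"

text \<open>The generalized eigenspaces span everything, and hyperbolicity makes those on the
  imaginary axis trivial.\<close>

lemma stable_unstable_sum:
  assumes "hyperbolic B"
  obtains s u where "s \<in> stable_space B" "u \<in> unstable_space B" "v = s + u"
proof -
  let ?S = "\<Union>\<mu>\<in>{\<mu>. Re \<mu> < 0}. gen_eigenspace B \<mu>" and ?U = "\<Union>\<mu>\<in>{\<mu>. Re \<mu> > 0}. gen_eigenspace B \<mu>"
  obtain p where p: "p \<noteq> 0" "mpoly_apply B p v = 0" by (rule exists_annihilating_poly)
  have "(\<Union>\<mu>. gen_eigenspace B \<mu>) \<subseteq> vec.span (?S \<union> ?U)"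
  proof
    fix w assume "w \<in> (\<Union>\<mu>. gen_eigenspace B \<mu>)"
    then obtain \<mu> where \<mu>: "w \<in> gen_eigenspace B \<mu>" by blast
    consider "Re \<mu> < 0" | "Re \<mu> > 0" | "Re \<mu> = 0" by linarith
    then show "w \<in> vec.span (?S \<union> ?U)"
    proof cases
      case 3
      then have "w = 0" using assms \<mu> gen_eigenspace_trivial[of B \<mu> w] unfolding hyperbolic_def by metis
      then show ?thesis by (simp add: vec.span_zero)
    qed (use \<mu> in \<open>auto intro!: vec.span_base\<close>)
  qed
  then have "v \<in> vec.span (?S \<union> ?U)" using in_span_gen_eigenspaces[OF p] vec.span_minimal[OF _ vec.subspace_span] by blast
  then show ?thesis using that unfolding vec.span_Un stable_space_def unstable_space_def by blast
qed

text \<open>A nonzero intersection would be invariant and hence contain an eigenvector, whose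
  eigenvalue would have to lie in both open half-planes.\<close>

lemma stable_unstable_Int:
  assumes "v \<in> stable_space B" "v \<in> unstable_space B" shows "v = 0"
proof (rule ccontr)
  assume "v \<noteq> 0"
  define W where "W = stable_space B \<inter> unstable_space B"
  have sub: "vec.subspace W" by (simp add: W_def stable_space_def unstable_space_def vec.subspace_inter)
  have inv: "B *v w \<in> W" if "w \<in> W" for w using that unfolding W_def stable_space_def unstable_space_def Int_iff
    by (auto intro!: span_gen_eigenspaces_invariant)
  have "v \<in> W" using assms by (simp add: W_def)
  from exists_eigenvector_in_invariant_subspace[OF sub inv this \<open>v \<noteq> 0\<close>]
  obtain \<mu> w where w: "w \<in> W" "w \<noteq> 0" "B *v w = \<mu> *s w" by metis
  have "Re \<mu> < 0" "Re \<mu> > 0" using w(1) eigenvalue_in_span_gen_eigenspaces[where M = "{\<mu>. Re \<mu> < 0}", OF _ w(2,3)]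
      eigenvalue_in_span_gen_eigenspaces[where M = "{\<mu>. Re \<mu> > 0}", OF _ w(2,3)]
    unfolding W_def stable_space_def unstable_space_def by simp_all
  then show False by simp
qed

section \<open>Lyapunov forms of hyperbolic matrices\<close>

lemma bounded_bilinear_zero: "bounded_bilinear (\<lambda>v w. 0)"
  by standard (auto intro: exI[of _ 0])

lemma bounded_bilinear_const_mult:
  fixes f :: "'a::real_normed_vector \<Rightarrow> 'b::real_normed_vector \<Rightarrow> real"
  assumes "bounded_bilinear f" shows "bounded_bilinear (\<lambda>v w. k * f v w)"
proof -
  interpret f: bounded_bilinear f by fact
  obtain K where K: "\<And>v w. norm (f v w) \<le> norm v * norm w * K" using f.bounded by blast
  show ?thesis
  proof
    show "\<exists>K. \<forall>v w. norm (k * f v w) \<le> norm v * norm w * K"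
    proof (intro exI allI)
      fix v w
      have "\<bar>k\<bar> * norm (f v w) \<le> \<bar>k\<bar> * (norm v * norm w * K)" by (intro mult_left_mono K) auto
      then show "norm (k * f v w) \<le> norm v * norm w * (\<bar>k\<bar> * K)" by (simp add: abs_mult mult_ac)
    qed
  qed (auto simp: f.add_left f.add_right f.scaleR_left f.scaleR_right algebra_simps)
qed

lemma bounded_bilinear_plus:
  fixes f g :: "'a::real_normed_vector \<Rightarrow> 'b::real_normed_vector \<Rightarrow> real"
  assumes "bounded_bilinear f" "bounded_bilinear g" shows "bounded_bilinear (\<lambda>v w. f v w + g v w)"
proof -
  interpret f: bounded_bilinear f by fact
  interpret g: bounded_bilinear g by fact
  obtain K where K: "\<And>v w. norm (f v w) \<le> norm v * norm w * K" using f.bounded by blast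
  obtain L where L: "\<And>v w. norm (g v w) \<le> norm v * norm w * L" using g.bounded by blast
  show ?thesis
  proof
    show "\<exists>K. \<forall>v w. norm (f v w + g v w) \<le> norm v * norm w * K"
    proof (intro exI allI)
      fix v w
      show "norm (f v w + g v w) \<le> norm v * norm w * (K + L)"
        using K[of v w] L[of v w] norm_triangle_ineq[of "f v w" "g v w"] by (simp add: distrib_left)
    qed
  qed (auto simp: f.add_left f.add_right f.scaleR_left f.scaleR_right
      g.add_left g.add_right g.scaleR_left g.scaleR_right algebra_simps)
qed

lemma bounded_bilinear_minus:
  fixes f :: "'a::real_normed_vector \<Rightarrow> 'b::real_normed_vector \<Rightarrow> real"
  assumes "bounded_bilinear f" shows "bounded_bilinear (\<lambda>v w. - f v w)"
  using bounded_bilinear_const_mult[OF assms, of "-1"] by simp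

lemma bounded_bilinear_diff:
  fixes f g :: "'a::real_normed_vector \<Rightarrow> 'b::real_normed_vector \<Rightarrow> real"
  assumes "bounded_bilinear f" "bounded_bilinear g" shows "bounded_bilinear (\<lambda>v w. f v w - g v w)"
  using bounded_bilinear_plus[OF assms(1) bounded_bilinear_minus[OF assms(2)]] by simp

lemma vec_subspace_imp_subspace: "vec.subspace S \<Longrightarrow> subspace (S :: (complex ^ 'n) set)"
proof -
  have *: "c *\<^sub>R x = complex_of_real c *s x" for c and x :: "complex ^ 'n"
    by (simp add: vec_eq_iff scaleR_conv_of_real[where 'a = complex])
  assume "vec.subspace S"
  then show ?thesis by (auto simp: subspace_def vec.subspace_def *)
qed

text \<open>The vector \<open>z\<close> is orthogonal to \<open>R\<close> for the real inner product
  only. As \<open>R\<close> is a complex subspace, \<open>\<i> *s r\<close> is orthogonal to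
  \<open>z\<close> as well, so the Hermitian product \<open>l\<close> with \<open>z\<close> vanishes
  on \<open>R\<close>, not just its real part.\<close>

lemma complex_functional_on_proper_subspace:
  fixes R :: "(complex ^ 'n) set"
  assumes R: "vec.subspace R" and x: "x \<notin> R" and W: "R \<subseteq> W" "x \<in> W" "vec.subspace W"
  obtains l :: "complex ^ 'n \<Rightarrow> complex" and v
  where "bounded_linear l" "\<And>c v. l (c *s v) = c * l v" "\<And>r. r \<in> R \<Longrightarrow> l r = 0" "v \<in> W" "l v \<noteq> 0"
proof -
  obtain y z where yz: "y \<in> span R" "\<And>w. w \<in> span R \<Longrightarrow> orthogonal z w" "x = y + z"
    using orthogonal_subspace_decomp_exists[of R x] by blast
  have sp: "span R = R" using vec_subspace_imp_subspace[OF R] by (simp add: span_eq_iff)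
  have yR: "y \<in> R" using yz sp by simp
  have z0: "z \<noteq> 0" using x yR yz(3) by auto
  have zW: "z \<in> W"
  proof -
    have "z = x - y" using yz(3) by simp
    then show ?thesis using vec.subspace_diff[OF W(3) W(2)] yR W(1) by auto
  qed
  define l where "l = (\<lambda>v :: complex ^ 'n. \<Sum>i\<in>UNIV. v $ i * cnj (z $ i))"
  have lin: "bounded_linear l" unfolding l_def
    by (intro bounded_linear_sum bounded_linear_mult_left[THEN bounded_linear_compose] bounded_linear_vec_nth)
  have Re_l: "Re (l v) = z \<bullet> v" for v by (simp add: l_def inner_vec_def inner_complex_def mult.commute)
  have sc: "l (c *s v) = c * l v" for c v by (simp add: l_def sum_distrib_left mult.assoc)
  have "l r = 0" if "r \<in> R" for r
  proof (rule complex_eqI)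
    show "Re (l r) = Re 0" using yz(2)[of r] that sp by (simp add: Re_l orthogonal_def)
    have "\<i> *s r \<in> R" using vec.subspace_scale[OF R that] .
    then have "Re (l (\<i> *s r)) = 0" using yz(2) sp by (simp add: Re_l orthogonal_def)
    then show "Im (l r) = Im 0" by (simp add: sc)
  qed
  moreover have "l z \<noteq> 0" using z0 Re_l[of z] by force
  ultimately show ?thesis using that lin sc zW by blast
qed

text \<open>Extend the kernel vector \<open>w\<close> to a basis of \<open>W\<close>; its image
  contributes nothing to the span.\<close>

lemma dim_image_kernel_less:
  fixes W :: "(complex ^ 'n) set"
  assumes "w \<in> W" "w \<noteq> 0" "C *v w = 0" "vec.subspace W"
  shows "vec.dim ((*v) C ` W) < vec.dim W"
proof -
  have "vec.independent {w}" using assms by simp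
  then obtain D where D: "{w} \<subseteq> D" "D \<subseteq> W" "vec.independent D" "W \<subseteq> vec.span D"
    using vec.maximal_independent_subset_extend[of "{w}" W] assms(1) by blast
  have finD: "finite D" using D(3) vec.independent_bound_general by blast
  have cardD: "card D = vec.dim W" using D by (intro vec.dim_unique[symmetric]) auto
  have "(*v) C ` W \<subseteq> vec.span ((*v) C ` (D - {w}))"
  proof -
    have "(*v) C ` W \<subseteq> (*v) C ` vec.span D" using D by blast
    also have "\<dots> = vec.span ((*v) C ` D)" by (rule vec.span_image[symmetric])
    also have "\<dots> \<subseteq> vec.span ((*v) C ` (D - {w}))"
    proof (rule vec.span_minimal[OF _ vec.subspace_span], rule subsetI)
      fix y assume "y \<in> (*v) C ` D"
      then obtain d where d: "d \<in> D" "y = C *v d" by blast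
      then show "y \<in> vec.span ((*v) C ` (D - {w}))" using assms(3) by (cases "d = w") (auto intro: vec.span_base vec.span_zero)
    qed
    finally show ?thesis .
  qed
  then have "vec.dim ((*v) C ` W) \<le> card ((*v) C ` (D - {w}))" using finD by (intro vec.dim_le_card) auto
  also have "\<dots> \<le> card (D - {w})" using finD by (intro card_image_le) auto
  also have "\<dots> < card D" using D(1) finD by (intro psubset_card_mono) auto
  finally show ?thesis using cardD by simp
qed

lemma homogeneous_pos_if_sphere_pos:
  fixes b :: "complex ^ 'n \<Rightarrow> complex ^ 'n \<Rightarrow> real"
  assumes b: "bounded_bilinear b" and W: "vec.subspace W"
    and pos: "\<And>v. v \<in> W \<Longrightarrow> norm v = 1 \<Longrightarrow> b v v > 0"
  shows "v \<in> W \<Longrightarrow> v \<noteq> 0 \<Longrightarrow> b v v > 0"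
proof -
  assume v: "v \<in> W" "v \<noteq> 0"
  interpret bounded_bilinear b by fact
  have "(1 / norm v) *\<^sub>R v \<in> W" using vec_subspace_imp_subspace[OF W] v by (simp add: subspace_def)
  then have "b ((1 / norm v) *\<^sub>R v) ((1 / norm v) *\<^sub>R v) > 0" using pos v by simp
  then show ?thesis using v by (simp add: scaleR_left scaleR_right zero_less_mult_iff zero_less_divide_iff)
qed

lemma compact_sphere_subspace:
  assumes "vec.subspace (W :: (complex ^ 'n) set)"
  shows "compact (W \<inter> sphere 0 1)"
  using closed_subspace[OF vec_subspace_imp_subspace[OF assms]] by (simp add: closed_Int_compact)

text \<open>Induction on the dimension, avoiding the Jordan form. \<open>B - \<mu>\<close> maps
  \<open>W\<close> into a proper subspace, and a functional \<open>l\<close> vanishing on that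
  subspace is a left eigenvector: \<open>l (B *v v) = \<mu> * l v\<close> on \<open>W\<close>. The
  form obtained for the smaller invariant space, the kernel of \<open>l\<close> in \<open>W\<close>,
  is corrected by a large multiple of \<open>l v \<bullet> l w\<close>, which grows with rate
  \<open>Re \<mu> > 0\<close>.\<close>

lemma Lyapunov_form_on_invariant_subspace:
  fixes B :: "complex ^ 'n ^ 'n"
  assumes "vec.subspace W" "\<And>w. w \<in> W \<Longrightarrow> B *v w \<in> W"
    "\<And>w \<mu>. w \<in> W \<Longrightarrow> w \<noteq> 0 \<Longrightarrow> B *v w = \<mu> *s w \<Longrightarrow> Re \<mu> > 0"
  shows "\<exists>b. bounded_bilinear b \<and> (\<forall>v w. b v w = b w v) \<and> (\<forall>v. b v v \<ge> (0::real)) \<and>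
    (\<forall>v\<in>W. v \<noteq> 0 \<longrightarrow> b v v > 0 \<and> b v (B *v v) > 0)" using assms
proof (induction "vec.dim W" arbitrary: W rule: less_induct)
  case less
  note W = less.prems
  show ?case
  proof (cases "W = {0}")
    case True
    then show ?thesis by (intro exI[of _ "\<lambda>v w. 0"]) (auto intro: bounded_bilinear_zero)
  next
    case False
    then obtain v0 where "v0 \<in> W" "v0 \<noteq> 0" using vec.subspace_0[OF W(1)] by blast
    then obtain \<mu> w where w: "w \<in> W" "w \<noteq> 0" "B *v w = \<mu> *s w"
      using exists_eigenvector_in_invariant_subspace[OF W(1) W(2)] by metis
    have mu: "Re \<mu> > 0" using W(3)[OF w] .
    define C where "C = B - mat \<mu>"
    have C: "C *v v = B *v v - \<mu> *s v" for v by (simp add: C_def matrix_vector_mult_diff_rdistrib matrix_vector_mult_scale_left)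
    define R where "R = (*v) C ` W"
    have R: "vec.subspace R" unfolding R_def by (rule vec.subspace_image[OF W(1)])
    have RW: "R \<subseteq> W" unfolding R_def using W(1,2) by (auto simp: C vec.subspace_diff vec.subspace_scale)
    have "vec.dim R < vec.dim W" unfolding R_def by (rule dim_image_kernel_less[OF w(1,2) _ W(1)]) (simp add: C w)
    then obtain x where x: "x \<in> W" "x \<notin> R" using RW by (metis less_irrefl subsetI subset_antisym)
    obtain l v1 where l: "bounded_linear l" "\<And>c v. l (c *s v) = c * l v" "\<And>r. r \<in> R \<Longrightarrow> l r = 0"
        and v1: "v1 \<in> W" "l v1 \<noteq> 0"
      using complex_functional_on_proper_subspace[OF R x(2) RW x(1) W(1)] by metis
    interpret l: bounded_linear l by fact
    have lB: "l (B *v v) = \<mu> * l v" if "v \<in> W" for v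
    proof -
      have "l (C *v v) = 0" using l(3) that by (auto simp: R_def)
      then show ?thesis by (simp add: C l.diff l(2))
    qed
    define W' where "W' = {v \<in> W. l v = 0}"
    have W': "vec.subspace W'" using W(1) by (auto simp: W'_def vec.subspace_def l.add l.zero l(2))
    have W'W: "W' \<subset> W" using v1 by (auto simp: W'_def)
    have dim: "vec.dim W' < vec.dim W"
    proof (rule vec.dim_psubset)
      show "vec.span W' \<subset> vec.span W"
        using W'W by (simp add: vec.span_eq_iff[THEN iffD2, OF W'] vec.span_eq_iff[THEN iffD2, OF W(1)])
    qed
    have "\<exists>b. bounded_bilinear b \<and> (\<forall>v w. b v w = b w v) \<and> (\<forall>v. b v v \<ge> (0::real)) \<and>
        (\<forall>v\<in>W'. v \<noteq> 0 \<longrightarrow> b v v > 0 \<and> b v (B *v v) > 0)"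
    proof (rule less.hyps[OF dim W'])
      show "B *v w \<in> W'" if "w \<in> W'" for w using that W(2) lB by (auto simp: W'_def)
      show "Re \<mu> > 0" if "w \<in> W'" "w \<noteq> 0" "B *v w = \<mu> *s w" for w \<mu> using that W(3) by (auto simp: W'_def)
    qed
    then obtain b where b: "bounded_bilinear b" "\<And>v w. b v w = b w v" "\<And>v. b v v \<ge> (0::real)"
      "\<And>v. v \<in> W' \<Longrightarrow> v \<noteq> 0 \<Longrightarrow> b v v > 0" "\<And>v. v \<in> W' \<Longrightarrow> v \<noteq> 0 \<Longrightarrow> b v (B *v v) > 0" by blast
    interpret b: bounded_bilinear b by fact
    have bB: "bounded_bilinear (\<lambda>v w. b v (B *v w))" by (rule b.comp[OF bounded_linear_ident matrix_vector_mul_bounded_linear])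
    define F where "F = (\<lambda>v. b v (B *v v))"
    have contF: "continuous_on UNIV F"
      unfolding F_def by (intro b.continuous_on continuous_on_matrix_vector_mult continuous_intros)
    have contl: "continuous_on S (\<lambda>v. (norm (l v))\<^sup>2)" for S by (intro continuous_intros l.continuous_on)
    let ?S = "W \<inter> sphere 0 1"
    have compS: "compact ?S" by (rule compact_sphere_subspace[OF W(1)])
    have "bounded (F ` ?S)" using compact_continuous_image[OF continuous_on_subset[OF contF] compS] compact_imp_bounded by blast
    then obtain M where M: "M > 0" "\<And>v. v \<in> ?S \<Longrightarrow> \<bar>F v\<bar> \<le> M" unfolding bounded_pos by auto
    \<comment> \<open>Where \<open>F\<close> fails to be positive on the unit sphere of
      \<open>W\<close>, \<open>l\<close> stays away from 0: the inductive form makes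
      \<open>F\<close> positive wherever \<open>l v = 0\<close>, and the bad set is compact.\<close>
    obtain \<delta> where \<delta>: "\<delta> > 0" "\<And>v. v \<in> ?S \<Longrightarrow> F v \<le> 0 \<Longrightarrow> (norm (l v))\<^sup>2 \<ge> \<delta>"
    proof (cases "\<exists>v\<in>?S. F v \<le> 0")
      case True
      have "closed {v. F v \<le> 0}" using contF by (intro closed_Collect_le) auto
      then have "compact (?S \<inter> {v. F v \<le> 0})" using compS by (rule compact_Int_closed[OF _ , rotated])
      from continuous_attains_inf[OF this _ contl]
      obtain v where v: "v \<in> ?S" "F v \<le> 0" "\<And>y. y \<in> ?S \<Longrightarrow> F y \<le> 0 \<Longrightarrow> (norm (l v))\<^sup>2 \<le> (norm (l y))\<^sup>2" using True by blast
      have "l v \<noteq> 0"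
      proof
        assume "l v = 0"
        then have "v \<in> W'" "v \<noteq> 0" using v(1) by (auto simp: W'_def)
        then show False using b(5)[of v] v(2) by (simp add: F_def)
      qed
      then show ?thesis using that[of "(norm (l v))\<^sup>2"] v(3) by simp
    qed (use that[of 1] in auto)
    \<comment> \<open>Makes \<open>K * Re \<mu> * \<delta>\<close> exceed \<open>M\<close>, so that
      on the bad set the correction outweighs the negative part of \<open>F\<close>.\<close>
    define K where "K = M / (\<delta> * Re \<mu>) + 1"
    have K: "K > 0" "K * Re \<mu> * \<delta> > M" using M(1) \<delta>(1) mu by (auto simp: K_def field_simps intro: add_pos_pos)
    define b' where "b' = (\<lambda>v w. b v w + K * (l v \<bullet> l w))"
    have b': "bounded_bilinear b'" unfolding b'_def by (intro bounded_bilinear_plus b(1) bounded_bilinear_const_mult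
          bounded_bilinear.comp[OF bounded_bilinear_inner l(1) l(1)])
    have pos: "b' v (B *v v) > 0" if "v \<in> W" "v \<noteq> 0" for v
    proof (rule homogeneous_pos_if_sphere_pos[OF _ W(1) _ that, of "\<lambda>v w. b' v (B *v w)"])
      show "bounded_bilinear (\<lambda>v w. b' v (B *v w))"
        by (rule bounded_bilinear.comp[OF b' bounded_linear_ident matrix_vector_mul_bounded_linear])
      fix v assume v: "v \<in> W" "norm v = 1"
      have "l v \<bullet> l (B *v v) = Re \<mu> * (norm (l v))\<^sup>2"
        unfolding lB[OF v(1)] by (simp add: inner_complex_def cmod_power2) (simp add: power2_eq_square algebra_simps)
      then have eq: "b' v (B *v v) = F v + K * Re \<mu> * (norm (l v))\<^sup>2" by (simp add: b'_def F_def)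
      show "b' v (B *v v) > 0"
      proof (cases "F v \<le> 0")
        case True
        have "M < K * Re \<mu> * \<delta>" by (rule K)
        also have "\<dots> \<le> K * Re \<mu> * (norm (l v))\<^sup>2" using \<delta>(2)[of v] True v K mu by (intro mult_left_mono) auto
        finally show ?thesis using M(2)[of v] v eq by simp
      next
        case False
        then show ?thesis unfolding eq using K mu by (intro add_pos_nonneg) auto
      qed
    qed
    have pos2: "b' v v > 0" if "v \<in> W" "v \<noteq> 0" for v
    proof (cases "l v = 0")
      case True
      then show ?thesis using b(4)[of v] that by (simp add: b'_def W'_def)
    next
      case False
      then show ?thesis unfolding b'_def using b(3)[of v] K by (intro add_nonneg_pos) auto
    qed
    show ?thesis using b' pos pos2 b(2,3) K by (intro exI[of _ b']) (auto simp: b'_def inner_commute intro!: add_nonneg_nonneg)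
  qed
qed

text \<open>Uniqueness of the decomposition yields linearity, and boundedness is automatic in finite
  dimension.\<close>

lemma exists_projections:
  fixes S U :: "(complex ^ 'n) set"
  assumes S: "vec.subspace S" and U: "vec.subspace U" and "\<And>v. v \<in> S \<Longrightarrow> v \<in> U \<Longrightarrow> v = 0"
    and sum: "\<And>v. \<exists>s\<in>S. \<exists>u\<in>U. v = s + u"
  obtains P Q where "bounded_linear P" "bounded_linear Q" "\<And>v. P v \<in> S" "\<And>v. Q v \<in> U" "\<And>v. v = P v + Q v"
    "\<And>s u. s \<in> S \<Longrightarrow> u \<in> U \<Longrightarrow> P (s + u) = s" "\<And>s u. s \<in> S \<Longrightarrow> u \<in> U \<Longrightarrow> Q (s + u) = u"
proof -
  have uniq: "s = s' \<and> u = u'" if "s \<in> S" "s' \<in> S" "u \<in> U" "u' \<in> U" "s + u = s' + u'" for s s' u u'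
  proof -
    have "s - s' = u' - u" using that(5) by (simp add: algebra_simps)
    moreover have "s - s' \<in> S" "u' - u \<in> U" using that S U by (auto intro: vec.subspace_diff)
    ultimately have "s - s' = 0" using assms(3) by metis
    then show ?thesis using that(5) by simp
  qed
  obtain P where P: "\<And>v. P v \<in> S \<and> (\<exists>u\<in>U. v = P v + u)" using sum by metis
  define Q where "Q = (\<lambda>v. v - P v)"
  have Q: "Q v \<in> U" "v = P v + Q v" for v using P[of v] unfolding Q_def by (metis add_diff_cancel_left') (simp add: Q_def)
  have Pu: "P (s + u) = s" "Q (s + u) = u" if "s \<in> S" "u \<in> U" for s u
    using uniq[of "P (s + u)" s "Q (s + u)" u] P Q that by auto
  have "linear P"
  proof (rule linearI)
    fix v w :: "complex ^ 'n" and r :: real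
    have "v + w = (P v + P w) + (Q v + Q w)" using Q(2)[of v] Q(2)[of w] by (metis add.assoc add.left_commute)
    then show "P (v + w) = P v + P w" using Pu(1)[of "P v + P w" "Q v + Q w"] P Q(1) S U by (simp add: vec.subspace_add)
    have "r *\<^sub>R v = r *\<^sub>R P v + r *\<^sub>R Q v" using Q(2)[of v] by (metis scaleR_add_right)
    then show "P (r *\<^sub>R v) = r *\<^sub>R P v"
      using Pu(1)[of "r *\<^sub>R P v" "r *\<^sub>R Q v"] P Q(1) vec_subspace_imp_subspace[OF S] vec_subspace_imp_subspace[OF U]
      by (simp add: subspace_scale)
  qed
  then have lin: "bounded_linear P" by (simp add: linear_conv_bounded_linear)
  moreover have "bounded_linear Q" unfolding Q_def by (intro bounded_linear_sub bounded_linear_ident lin)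
  ultimately show ?thesis using that P Q Pu by blast
qed

text \<open>Compactness of the unit sphere of \<open>W\<close> turns positivity into coercivity; an
  empty sphere means \<open>W = {0}\<close>.\<close>

lemma coercive_on_subspace:
  fixes b :: "complex ^ 'n \<Rightarrow> complex ^ 'n \<Rightarrow> real"
  assumes b: "bounded_bilinear b" and W: "vec.subspace W" and pos: "\<And>v. v \<in> W \<Longrightarrow> v \<noteq> 0 \<Longrightarrow> b v v > 0"
  obtains c where "c > 0" "\<And>v. v \<in> W \<Longrightarrow> b v v \<ge> c * (norm v)\<^sup>2"
proof (cases "W \<inter> sphere 0 1 = {}")
  case True
  have "v = 0" if "v \<in> W" for v
  proof (rule ccontr)
    assume "v \<noteq> 0"
    then have "(1 / norm v) *\<^sub>R v \<in> W \<inter> sphere 0 1" using vec_subspace_imp_subspace[OF W] that by (simp add: subspace_def)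
    with True show False by blast
  qed
  then show ?thesis using that[of 1] bounded_bilinear.zero_left[OF b] by fastforce
next
  case False
  interpret bounded_bilinear b by fact
  have "continuous_on (W \<inter> sphere 0 1) (\<lambda>v. b v v)" by (intro continuous_on continuous_intros)
  from continuous_attains_inf[OF compact_sphere_subspace[OF W] False this]
  obtain v0 where v0: "v0 \<in> W" "norm v0 = 1" "\<And>v. v \<in> W \<Longrightarrow> norm v = 1 \<Longrightarrow> b v0 v0 \<le> b v v" by auto
  have "b v v \<ge> b v0 v0 * (norm v)\<^sup>2" if "v \<in> W" for v
  proof (cases "v = 0")
    case False
    have "(1 / norm v) *\<^sub>R v \<in> W" using vec_subspace_imp_subspace[OF W] that by (simp add: subspace_def)
    from v0(3)[OF this] False show ?thesis by (simp add: scaleR_left scaleR_right field_simps power2_eq_square)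
  qed (simp add: zero_left)
  moreover have "v0 \<noteq> 0" using v0(2) by auto
  ultimately show ?thesis using that[of "b v0 v0"] pos v0(1) by blast
qed

text \<open>The form is a Lyapunov form of \<open>B\<close> on the unstable space minus one of
  \<open>- B\<close> on the stable space. Along \<open>u' = B u\<close> the derivative of
  \<open>b u u\<close> is \<open>2 * b u (B *v u)\<close>, so \<open>b u u\<close> strictly
  increases along nonzero solutions. This monotonicity replaces exponential estimates of the
  flow.\<close>

lemma hyperbolic_Lyapunov:
  fixes B :: "complex ^ 'n ^ 'n"
  assumes "hyperbolic B"
  obtains b :: "complex ^ 'n \<Rightarrow> complex ^ 'n \<Rightarrow> real" and c
  where "bounded_bilinear b" "\<And>v w. b v w = b w v" "c > 0" "\<And>v. b v (B *v v) \<ge> c * (norm v)\<^sup>2"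
    "\<And>v. v \<in> unstable_space B \<Longrightarrow> b v v \<ge> c * (norm v)\<^sup>2"
    "\<And>v. v \<in> stable_space B \<Longrightarrow> b v v \<le> - (c * (norm v)\<^sup>2)"
proof -
  let ?S = "stable_space B" and ?U = "unstable_space B"
  have subS: "vec.subspace ?S" and subU: "vec.subspace ?U" by (simp_all add: stable_space_def unstable_space_def)
  have invS: "B *v w \<in> ?S" if "w \<in> ?S" for w using that unfolding stable_space_def by (rule span_gen_eigenspaces_invariant)
  have invU: "B *v w \<in> ?U" if "w \<in> ?U" for w using that unfolding unstable_space_def by (rule span_gen_eigenspaces_invariant)
  obtain bU where bU: "bounded_bilinear bU" "\<And>v w. bU v w = bU w v" "\<And>v. v \<in> ?U \<Longrightarrow> v \<noteq> 0 \<Longrightarrow> bU v v > (0::real)"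
    "\<And>v. v \<in> ?U \<Longrightarrow> v \<noteq> 0 \<Longrightarrow> bU v (B *v v) > 0"
  proof -
    have "Re \<mu> > 0" if "w \<in> ?U" "w \<noteq> 0" "B *v w = \<mu> *s w" for w \<mu>
      using eigenvalue_in_span_gen_eigenspaces[OF that(1)[unfolded unstable_space_def] that(2,3)] by simp
    then have "\<exists>b. bounded_bilinear b \<and> (\<forall>v w. b v w = b w v) \<and> (\<forall>v. b v v \<ge> (0::real)) \<and>
        (\<forall>v\<in>?U. v \<noteq> 0 \<longrightarrow> b v v > 0 \<and> b v (B *v v) > 0)" by (intro Lyapunov_form_on_invariant_subspace subU invU) auto
    then show ?thesis using that by blast
  qed
  obtain bS where bS: "bounded_bilinear bS" "\<And>v w. bS v w = bS w v" "\<And>v. v \<in> ?S \<Longrightarrow> v \<noteq> 0 \<Longrightarrow> bS v v > (0::real)"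
    "\<And>v. v \<in> ?S \<Longrightarrow> v \<noteq> 0 \<Longrightarrow> bS v ((- B) *v v) > 0"
  proof -
    have "Re \<mu> > 0" if "w \<in> ?S" "w \<noteq> 0" "(- B) *v w = \<mu> *s w" for w \<mu>
    proof -
      have "B *v w = - ((- B) *v w)" by (simp add: matrix_vector_mult_def vec_eq_iff sum_negf)
      also have "\<dots> = (- \<mu>) *s w" unfolding that(3) by simp
      finally show ?thesis using eigenvalue_in_span_gen_eigenspaces[OF that(1)[unfolded stable_space_def] that(2)] by fastforce
    qed
    moreover have "(- B) *v w \<in> ?S" if "w \<in> ?S" for w
    proof -
      have "(- B) *v w = - (B *v w)" by (simp add: matrix_vector_mult_def vec_eq_iff sum_negf)
      then show ?thesis using vec.subspace_neg[OF subS invS[OF that]] by simp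
    qed
    ultimately have "\<exists>b. bounded_bilinear b \<and> (\<forall>v w. b v w = b w v) \<and> (\<forall>v. b v v \<ge> (0::real)) \<and>
        (\<forall>v\<in>?S. v \<noteq> 0 \<longrightarrow> b v v > 0 \<and> b v ((- B) *v v) > 0)" by (intro Lyapunov_form_on_invariant_subspace subS) auto
    then show ?thesis using that by blast
  qed
  obtain P Q where PQ: "bounded_linear P" "bounded_linear Q" "\<And>v. P v \<in> ?S" "\<And>v. Q v \<in> ?U" "\<And>v. v = P v + Q v"
    "\<And>s u. s \<in> ?S \<Longrightarrow> u \<in> ?U \<Longrightarrow> P (s + u) = s" "\<And>s u. s \<in> ?S \<Longrightarrow> u \<in> ?U \<Longrightarrow> Q (s + u) = u"
  proof -
    have i: "v = 0" if "v \<in> ?S" "v \<in> ?U" for v by (rule stable_unstable_Int[OF that])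
    have sm: "\<exists>s\<in>?S. \<exists>u\<in>?U. v = s + u" for v using stable_unstable_sum[OF assms, of v] by metis
    show ?thesis by (rule exists_projections[OF subS subU i sm]) (assumption+, rule that)
  qed
  define b where "b = (\<lambda>v w. bU (Q v) (Q w) - bS (P v) (P w))"
  have b: "bounded_bilinear b" unfolding b_def
    by (intro bounded_bilinear_diff bounded_bilinear.comp[OF bU(1)] bounded_bilinear.comp[OF bS(1)] PQ)
  interpret bU: bounded_bilinear bU by fact
  interpret bS: bounded_bilinear bS by fact
  have 0: "(0::complex ^ 'n) \<in> ?S" "(0::complex ^ 'n) \<in> ?U" using subS subU by (auto intro: vec.subspace_0)
  \<comment> \<open>Both spaces are invariant, so the projections commute with
    \<open>B\<close>.\<close>
  have PQB: "P (B *v v) = B *v P v" "Q (B *v v) = B *v Q v" for v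
    using PQ(6,7)[OF invS[OF PQ(3)[of v]] invU[OF PQ(4)[of v]]] PQ(5)[of v] by (metis matrix_vector_right_distrib)+
  have neg: "(- B) *v v = - (B *v v)" for v by (simp add: matrix_vector_mult_def vec_eq_iff sum_negf)
  have posB: "b v (B *v v) > 0" if "v \<noteq> 0" for v
  proof -
    have Q0: "bU (Q v) (B *v Q v) \<ge> 0" and Q1: "bU (Q v) (B *v Q v) > 0" if "Q v \<noteq> 0" using bU(4)[OF PQ(4) that] by simp_all
    have P0: "bS (P v) (B *v P v) \<le> 0" and P1: "bS (P v) (B *v P v) < 0" if "P v \<noteq> 0"
      using bS(4)[OF PQ(3) that] by (simp_all add: bS.minus_right neg)
    show ?thesis
    proof (cases "Q v = 0")
      case True
      then have "P v \<noteq> 0" using PQ(5)[of v] that by (metis add.left_neutral)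
      from P1[OF this] show ?thesis unfolding b_def PQB True bU.zero_left by linarith
    next
      case False
      from Q1[OF False] have q: "bU (Q v) (B *v Q v) > 0" .
      have "bS (P v) (B *v P v) \<le> 0"
      proof (cases "P v = 0")
        case True
        then show ?thesis by (simp only: bS.zero_left)
      qed (rule P0)
      then show ?thesis unfolding b_def PQB using q by linarith
    qed
  qed
  have "bounded_bilinear (\<lambda>v w. b v (B *v w))"
    by (rule bounded_bilinear.comp[OF b bounded_linear_ident matrix_vector_mul_bounded_linear])
  from coercive_on_subspace[OF this vec.subspace_UNIV posB]
  obtain c1 where c1: "c1 > 0" "\<And>v. b v (B *v v) \<ge> c1 * (norm v)\<^sup>2" by (metis UNIV_I)
  have "b v v > 0" if "v \<in> ?U" "v \<noteq> 0" for v
  proof -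
    have "P v = 0" "Q v = v" using PQ(6,7)[OF 0(1) that(1)] by (simp_all only: add_0)
    then show ?thesis using bU(3)[OF that] unfolding b_def by (simp only: bS.zero_left diff_0_right)
  qed
  from coercive_on_subspace[OF b subU this]
  obtain c2 where c2: "c2 > 0" "\<And>v. v \<in> ?U \<Longrightarrow> b v v \<ge> c2 * (norm v)\<^sup>2" by metis
  have "- b v v > 0" if "v \<in> ?S" "v \<noteq> 0" for v
  proof -
    have "P v = v" "Q v = 0" using PQ(6,7)[OF that(1) 0(2)] by (simp_all only: add_0_right)
    then show ?thesis using bS(3)[OF that] unfolding b_def by (simp only: bU.zero_left diff_0 minus_minus)
  qed
  moreover have "bounded_bilinear (\<lambda>v w. - b v w)" by (rule bounded_bilinear_minus[OF b])
  ultimately obtain c3 where c3: "c3 > 0" "\<And>v. v \<in> ?S \<Longrightarrow> - b v v \<ge> c3 * (norm v)\<^sup>2"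
    using coercive_on_subspace[of "\<lambda>v w. - b v w", OF _ subS] by metis
  define c where "c = min c1 (min c2 c3)"
  have c: "c > 0" "c * (norm v)\<^sup>2 \<le> c1 * (norm v)\<^sup>2" "c * (norm v)\<^sup>2 \<le> c2 * (norm v)\<^sup>2" "c * (norm v)\<^sup>2 \<le> c3 * (norm v)\<^sup>2"
    for v :: "complex ^ 'n" using c1 c2 c3 by (auto simp: c_def intro!: mult_right_mono)
  show ?thesis
  proof (rule that[OF b _ c(1)])
    show "b v w = b w v" for v w using bU(2) bS(2) by (simp add: b_def)
    show "b v (B *v v) \<ge> c * (norm v)\<^sup>2" for v using c1(2)[of v] c(2)[of v] by linarith
    show "b v v \<ge> c * (norm v)\<^sup>2" if "v \<in> ?U" for v using c2(2)[OF that] c(3)[of v] by linarith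
    show "b v v \<le> - (c * (norm v)\<^sup>2)" if "v \<in> ?S" for v using c3(2)[OF that] c(4)[of v] by linarith
  qed
qed

text \<open>\<open>onorm\<close> is a supremum and bounds the quotients only if these are bounded at
  all. Comparing with the point 0 bounds each projection by \<open>2 * norm v\<close>, whence the
  crude bound 4.\<close>

lemma norm_closest_point_diff_le_gap:
  fixes V W :: "(complex ^ 'n) set"
  assumes "vec.subspace V" "vec.subspace W"
  shows "norm (closest_point V v - closest_point W v) \<le> gap V W * norm v"
proof -
  have V: "norm (closest_point V v) \<le> 2 * norm v" if "vec.subspace V" for V and v :: "complex ^ 'n"
  proof -
    have sub: "subspace V" using that by (rule vec_subspace_imp_subspace)
    have "dist v (closest_point V v) \<le> dist v 0" by (rule closest_point_le[OF closed_subspace[OF sub] subspace_0[OF sub]])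
    then show ?thesis using norm_triangle_ineq3[of "closest_point V v" v] by (simp add: dist_norm norm_minus_commute)
  qed
  let ?f = "\<lambda>v. closest_point V v - closest_point W v"
  have "norm (?f v) / norm v \<le> 4" for v
  proof (cases "v = 0")
    case False
    have "norm (?f v) \<le> 4 * norm v"
      using V[OF assms(1), of v] V[OF assms(2), of v] norm_triangle_ineq4[of "closest_point V v" "closest_point W v"] by simp
    with False show ?thesis by (simp add: field_simps)
  qed auto
  then have "bdd_above (range (\<lambda>v. norm (?f v) / norm v))" by (intro bdd_aboveI2)
  then have "norm (?f v) / norm v \<le> gap V W" unfolding gap_def onorm_def by (intro cSUP_upper) auto
  then show ?thesis using V[OF assms(1), of v] V[OF assms(2), of v] by (cases "v = 0") (auto simp: field_simps)
qed

lemma closest_point_in_subspace: "vec.subspace (V :: (complex ^ 'n) set) \<Longrightarrow> closest_point V v \<in> V"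
  using closest_point_in_set[of V v] closed_subspace vec_subspace_imp_subspace vec.subspace_0 by blast

lemma bounded_bilinear_matrix_vector: "bounded_bilinear ((*v) :: complex ^ 'n ^ 'm \<Rightarrow> _)"
proof -
  have "bilinear ((*v) :: complex ^ 'n ^ 'm \<Rightarrow> _)" unfolding bilinear_def
    by (auto intro!: linearI simp: matrix_vector_mult_def vec_eq_iff algebra_simps sum.distrib scaleR_sum_right)
  then show ?thesis by (simp add: bilinear_conv_bounded_bilinear)
qed

section \<open>Dichotomies on the half-line\<close>

text \<open>A one-sided weakening of \<open>transported_family\<close>: through each vector of the
  family runs one solution that stays inside. This form survives the reflection of the line, so one
  dichotomy theorem serves both ends.\<close>

definition transported_half ::
  "(real \<Rightarrow> complex ^ 'n ^ 'n) \<Rightarrow> (real \<Rightarrow> (complex ^ 'n) set) \<Rightarrow> (complex ^ 'n) set \<Rightarrow> bool" where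
  "transported_half B E S \<longleftrightarrow> (\<forall>x. vec.subspace (E x)) \<and>
    (\<forall>x. \<forall>v\<in>E x. \<exists>w. (\<forall>t. (w has_vector_derivative B t *v w t) (at t)) \<and> w x = v \<and> (\<forall>y. w y \<in> E y)) \<and>
    ((\<lambda>x. gap (E x) S) \<longlongrightarrow> 0) at_top"

text \<open>The truncations at \<open>a + n\<close> converge pointwise, and Fatou turns their common
  bound into membership.\<close>

lemma L2_if_truncations_bounded:
  fixes w :: "real \<Rightarrow> complex ^ 'n"
  assumes w: "continuous_on UNIV w" and K: "K \<ge> 0" "\<And>y. y \<ge> a \<Longrightarrow> (LINT x:{a..y}|lborel. (norm (w x))\<^sup>2) \<le> K\<^sup>2"
  shows "(\<lambda>x. indicator {a..} x *\<^sub>R w x) \<in> L2" "l2norm (\<lambda>x. indicator {a..} x *\<^sub>R w x) \<le> K"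
proof -
  have [measurable]: "w \<in> borel_measurable borel" using w by (rule borel_measurable_continuous_onI)
  define f where "f = (\<lambda>n :: nat. \<lambda>x. indicator {a..a + n} x *\<^sub>R w x)"
  have sq: "(norm (f n x))\<^sup>2 = indicator {a..a + n} x *\<^sub>R (norm (w x))\<^sup>2" for n x by (simp add: f_def indicator_def)
  have int: "set_integrable lborel {a..a + real n} (\<lambda>x. (norm (w x))\<^sup>2)" for n by (rule borel_integrable_atLeastAtMost')
      (intro continuous_intros continuous_on_subset[OF w], auto)
  have f: "f n \<in> L2" for n unfolding L2_def using int[of n] by (auto simp: sq set_integrable_def) (simp add: f_def)
  have "(l2norm (f n))\<^sup>2 \<le> K\<^sup>2" for n using K(2)[of "a + n"] by (simp add: l2norm_square sq set_lebesgue_integral_def)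
  then have le: "l2norm (f n) \<le> K" for n using K(1) by (rule power2_le_imp_le)
  have conv: "AE x in lborel. (\<lambda>n. f n x) \<longlonglongrightarrow> indicator {a..} x *\<^sub>R w x"
  proof (rule AE_I2)
    fix x
    have "\<forall>\<^sub>F n in sequentially. f n x = indicator {a..} x *\<^sub>R w x" using eventually_ge_at_top[of "nat \<lceil>x - a\<rceil>"]
    proof eventually_elim
      case (elim n)
      then have "x \<le> a + n" by linarith
      then show ?case by (simp add: f_def indicator_def)
    qed
    then show "(\<lambda>n. f n x) \<longlonglongrightarrow> indicator {a..} x *\<^sub>R w x" by (rule tendsto_eventually)
  qed
  have meas: "(\<lambda>x. indicator {a..} x *\<^sub>R w x) \<in> borel_measurable borel" by measurable
  from L2_Fatou[OF f le conv meas] show "(\<lambda>x. indicator {a..} x *\<^sub>R w x) \<in> L2" "l2norm (\<lambda>x. indicator {a..} x *\<^sub>R w x) \<le> K"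
    by - assumption+
qed

lemma half_continuous:
  assumes "half u g" shows "continuous_on {0..} u"
proof -
  have "continuous (at x within {0..}) u" if "x \<ge> 0" for x
  proof -
    have gi: "set_integrable lborel {0..x+1} g" by (rule L2_norm_set_integrable[OF halfD(2)[OF assms]])
    have hk: "g integrable_on {0..x+1}" using set_borel_integral_eq_integral(1)[OF gi] .
    have eq: "u y = u 0 + integral {0..y} g" if "y \<in> {0..x+1}" for y using halfD(5)[OF assms, of 0 y] that
        set_borel_integral_eq_integral(2)[OF L2_norm_set_integrable[OF halfD(2)[OF assms], of 0 y]] by (simp add: algebra_simps)
    have "continuous_on {0..x+1} (\<lambda>y. u 0 + integral {0..y} g)" by (intro continuous_intros indefinite_integral_continuous_1 hk)
    then have "continuous_on {0..x+1} u" using eq by (metis (no_types, lifting) continuous_on_cong)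
    then have "continuous (at x within {0..x+1}) u" using that by (simp add: continuous_on_eq_continuous_within)
    moreover have "at x within {0..x+1} = at x within {0..}" by (rule at_within_nhd[where S = "{..<x+1}"]) (use that in auto)
    ultimately show ?thesis by simp
  qed
  then show ?thesis by (simp add: continuous_on_eq_continuous_within)
qed

lemma half_small_values:
  assumes "half u g" "\<epsilon> > 0" shows "\<exists>y\<ge>a. norm (u y) < \<epsilon>"
proof (rule ccontr)
  assume "\<not> ?thesis"
  then have ge: "norm (u y) \<ge> \<epsilon>" if "y \<ge> a" for y using that by force
  obtain v :: "complex ^ 'a" where v: "norm v = \<epsilon>" using vector_choose_size[of \<epsilon>] assms by auto
  \<comment> \<open>Length for which a function of modulus at least \<open>\<epsilon>\<close> on
    \<open>{a..a+L}\<close> would have norm at least \<open>l2norm u + \<epsilon>\<close>.\<close>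
  define L where "L = (l2norm u / \<epsilon> + 1)\<^sup>2"
  have "l2norm (\<lambda>x. indicator {a..a+L} x *\<^sub>R v) \<le> l2norm u" by (rule l2norm_mono[OF L2_indicator_const halfD(1)[OF assms(1)]])
      (auto intro!: AE_I2 simp: indicator_def v ge)
  then have "(l2norm u / \<epsilon> + 1) * \<epsilon> \<le> l2norm u"
    using assms by (subst (asm) l2norm_indicator_const) (auto simp: L_def v abs_of_nonneg)
  then show False using mult_pos_pos[OF assms(2) assms(2)] assms(2) by (simp add: field_simps)
qed

lemma weighted_product_le:
  fixes s r c K :: real
  assumes "c > 0"
  shows "2 * (K * s * r) \<le> c * s\<^sup>2 + K\<^sup>2 / c * r\<^sup>2"
proof -
  have "0 \<le> (sqrt c * s - K * r / sqrt c)\<^sup>2" by simp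
  also have "\<dots> = c * s\<^sup>2 + K\<^sup>2 / c * r\<^sup>2 - 2 * (K * s * r)"
    using assms by (simp add: power2_diff power_mult_distrib power_divide)
  finally show ?thesis by simp
qed

text \<open>The derivative \<open>2 * b u g\<close> of \<open>b u u\<close> is integrated. With
  \<open>g = B u + r\<close>, half of the coercive term \<open>2 * c\<close> absorbs the mixed term
  \<open>2 * b u r\<close> by Young's inequality, which is why the factor \<open>c\<close>
  remains.\<close>

lemma Lyapunov_increment:
  fixes u g :: "real \<Rightarrow> complex ^ 'n" and b :: "complex ^ 'n \<Rightarrow> complex ^ 'n \<Rightarrow> real"
  assumes b: "bounded_bilinear b" and sym: "\<And>v w. b v w = b w v" and c: "c > 0"
    and K: "\<And>v w. \<bar>b v w\<bar> \<le> K * norm v * norm w"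
    and coer: "\<And>x v. x \<ge> x0 \<Longrightarrow> b v (B x *v v) \<ge> c * (norm v)\<^sup>2"
    and le: "x0 \<le> y" and gi: "set_integrable lborel {x0..y} g"
    and u: "\<And>x. x \<in> {x0..y} \<Longrightarrow> u x - u x0 = (LINT t:{x0..x}|lborel. g t)"
    and ui: "set_integrable lborel {x0..y} (\<lambda>x. (norm (u x))\<^sup>2)"
    and ri: "set_integrable lborel {x0..y} (\<lambda>x. (norm (residual B u g x))\<^sup>2)"
  shows "c * (LINT x:{x0..y}|lborel. (norm (u x))\<^sup>2) \<le>
    b (u y) (u y) - b (u x0) (u x0) + K\<^sup>2 / c * (LINT x:{x0..y}|lborel. (norm (residual B u g x))\<^sup>2)"
proof -
  interpret b: bounded_bilinear b by fact
  let ?r = "residual B u g"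
  note pr = product_rule_primitives[OF b le gi gi u u]
  have "c * (norm (u x))\<^sup>2 - K\<^sup>2 / c * (norm (?r x))\<^sup>2 \<le> b (u x) (g x) + b (g x) (u x)" if "x \<in> {x0..y}" for x
  proof -
    have "b (u x) (g x) = b (u x) (B x *v u x) + b (u x) (?r x)" by (simp add: residual_def b.diff_right)
    moreover have "b (u x) (B x *v u x) \<ge> c * (norm (u x))\<^sup>2" using coer that by simp
    moreover have "\<bar>b (u x) (?r x)\<bar> \<le> K * norm (u x) * norm (?r x)" by (rule K)
    moreover have "2 * (K * norm (u x) * norm (?r x)) \<le> c * (norm (u x))\<^sup>2 + K\<^sup>2 / c * (norm (?r x))\<^sup>2"
      by (rule weighted_product_le[OF c])
    moreover have "b (g x) (u x) = b (u x) (g x)" by (rule sym)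
    ultimately show ?thesis by linarith
  qed
  then have "(LINT x:{x0..y}|lborel. c * (norm (u x))\<^sup>2 - K\<^sup>2 / c * (norm (?r x))\<^sup>2)
      \<le> (LINT x:{x0..y}|lborel. b (u x) (g x) + b (g x) (u x))"
    by (intro set_integral_mono pr(1) set_integral_diff set_integrable_mult_right ui ri)
  then show ?thesis using pr(2) by (simp add: set_integral_diff ui ri)
qed

text \<open>Everything is read off the form \<open>b\<close> beyond a point \<open>x0\<close>.
  Vectors of \<open>E x\<close> satisfy \<open>b v v \<le> 0\<close> there, so solutions inside
  \<open>E\<close> have bounded energy. Conversely, \<open>u \<in> L2\<close> makes
  \<open>b (u y) (u y)\<close> small at suitable far points, which bounds by the residual both the
  energy and the part of \<open>u x0\<close> in the unstable space. Gronwall carries the estimates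
  from \<open>x0\<close> back to 0.\<close>

lemma half_line_dichotomy:
  fixes B :: "real \<Rightarrow> complex ^ 'n ^ 'n"
  assumes B: "bounded_coeff \<beta> B" and lim: "(B \<longlongrightarrow> Binf) at_top" and hyp: "hyperbolic Binf"
    and E: "transported_half B E (stable_space Binf)"
  obtains C where "C \<ge> 0"
    "\<And>e. e \<in> E 0 \<Longrightarrow> \<exists>u g. half u g \<and> (\<forall>x. residual B u g x = 0) \<and> u 0 = e"
    "\<And>u g. half u g \<Longrightarrow> \<exists>e\<in>E 0. norm (u 0 - e) \<le> C * l2norm (residual B u g)"
    "\<And>u g. half u g \<Longrightarrow> l2norm u \<le> C * (norm (u 0) + l2norm (residual B u g))"
proof -
  let ?S = "stable_space Binf" and ?U = "unstable_space Binf"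
  have subS: "vec.subspace ?S" and subU: "vec.subspace ?U" by (simp_all add: stable_space_def unstable_space_def)
  have subE: "vec.subspace (E x)" for x using E by (simp add: transported_half_def)
  obtain b :: "complex ^ 'n \<Rightarrow> complex ^ 'n \<Rightarrow> real" and c where b: "bounded_bilinear b" "\<And>v w. b v w = b w v" and c: "c > 0"
    and bB: "\<And>v. b v (Binf *v v) \<ge> c * (norm v)\<^sup>2"
    and bU: "\<And>v. v \<in> ?U \<Longrightarrow> b v v \<ge> c * (norm v)\<^sup>2" and bS: "\<And>v. v \<in> ?S \<Longrightarrow> b v v \<le> - (c * (norm v)\<^sup>2)"
    using hyperbolic_Lyapunov[OF hyp] by metis
  interpret b: bounded_bilinear b by fact
  obtain K where K: "K > 0" "\<And>v w. \<bar>b v w\<bar> \<le> K * norm v * norm w" using b.pos_bounded by (auto simp: mult_ac)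
  obtain \<kappa> where \<kappa>: "\<kappa> > 0" "\<And>(M :: complex ^ 'n ^ 'n) v. norm (M *v v) \<le> norm M * norm v * \<kappa>"
    using bounded_bilinear.pos_bounded[OF bounded_bilinear_matrix_vector] by metis
  obtain P Q where PQ: "bounded_linear P" "\<And>v. P v \<in> ?S" "\<And>v. Q v \<in> ?U" "\<And>v. v = P v + Q v"
  proof -
    have i: "v = 0" if "v \<in> ?S" "v \<in> ?U" for v by (rule stable_unstable_Int[OF that])
    have sm: "\<exists>s\<in>?S. \<exists>u\<in>?U. v = s + u" for v using stable_unstable_sum[OF hyp, of v] by metis
    show ?thesis by (rule exists_projections[OF subS subU i sm]) (assumption+, rule that)
  qed
  obtain p where p: "p > 0" "\<And>v. norm (P v) \<le> norm v * p" using bounded_linear.pos_bounded[OF PQ(1)] by auto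
  \<comment> \<open>The three bounds serve in turn to keep the nearest stable vector comparable to
    \<open>v\<close>, to make \<open>E x0\<close> and the unstable space span everything, and to get
    \<open>b v v \<le> 0\<close> on \<open>E x\<close>.\<close>
  define \<gamma> where "\<gamma> = min (1/2) (min (1 / (2 * p)) (c / (8 * K)))"
  have \<gamma>: "\<gamma> > 0" "\<gamma> \<le> 1/2" "\<gamma> * p < 1" "K * \<gamma> * 8 \<le> c"
  proof -
    show "\<gamma> > 0" "\<gamma> \<le> 1/2" using p c K by (auto simp: \<gamma>_def)
    have "\<gamma> \<le> 1 / (2 * p)" "\<gamma> \<le> c / (8 * K)" by (auto simp: \<gamma>_def)
    then show "\<gamma> * p < 1" "K * \<gamma> * 8 \<le> c" using p K by (auto simp: field_simps)
  qed
  have "\<forall>\<^sub>F x in at_top. dist (B x) Binf < c / (2 * K * \<kappa>)" using lim K c \<kappa> by (intro tendstoD) auto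
  moreover have "\<forall>\<^sub>F x in at_top. dist (gap (E x) ?S) 0 < \<gamma>" using E \<gamma> by (intro tendstoD) (auto simp: transported_half_def)
  ultimately have "\<forall>\<^sub>F x in at_top. dist (B x) Binf < c / (2 * K * \<kappa>) \<and> dist (gap (E x) ?S) 0 < \<gamma>" by eventually_elim simp
  then obtain x1 where x1: "\<And>x. x \<ge> x1 \<Longrightarrow> dist (B x) Binf < c / (2 * K * \<kappa>) \<and> dist (gap (E x) ?S) 0 < \<gamma>"
    unfolding eventually_at_top_linorder by blast
  define x0 where "x0 = max x1 0"
  have x0: "x0 \<ge> 0" by (simp add: x0_def)
  have Bx: "norm (B x - Binf) < c / (2 * K * \<kappa>)" and gapx: "gap (E x) ?S \<le> \<gamma>" if "x \<ge> x0" for x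
    using x1[of x] that by (auto simp: x0_def dist_norm)
  define c' where "c' = c / 2"
  have c': "c' > 0" using c by (simp add: c'_def)
  \<comment> \<open>Beyond \<open>x0\<close> the deviation \<open>B x - Binf\<close> costs at most
    half of the coercivity.\<close>
  have coer: "b v (B x *v v) \<ge> c' * (norm v)\<^sup>2" if "x \<ge> x0" for x v
  proof -
    have "\<bar>b v ((B x - Binf) *v v)\<bar> \<le> K * norm v * norm ((B x - Binf) *v v)" by (rule K)
    also have "\<dots> \<le> K * norm v * (norm (B x - Binf) * norm v * \<kappa>)" using K \<kappa> by (intro mult_left_mono) auto
    also have "\<dots> \<le> K * norm v * (c / (2 * K * \<kappa>) * norm v * \<kappa>)"
      using K \<kappa> Bx[OF that] by (intro mult_left_mono mult_right_mono) auto
    also have "\<dots> = c' * (norm v)\<^sup>2" using K \<kappa> by (simp add: c'_def power2_eq_square)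
    finally have "b v (B x *v v - Binf *v v) \<ge> - (c' * (norm v)\<^sup>2)" by (simp add: matrix_vector_mult_diff_rdistrib)
    then show ?thesis using bB[of v] by (simp add: b.diff_right c'_def)
  qed
  \<comment> \<open>For the nearest stable vector \<open>s\<close>, \<open>b s s\<close> is at most
    \<open>- c / 4\<close> times the square of \<open>norm v\<close>, and the cross terms contribute
    at most \<open>2 * K * \<gamma>\<close> times it; \<open>K * \<gamma> * 8 \<le> c\<close>
    balances the two.\<close>
  have negE: "b v v \<le> 0" if "x \<ge> x0" "v \<in> E x" for x v
  proof -
    define s where "s = closest_point ?S v"
    have sS: "s \<in> ?S" unfolding s_def by (rule closest_point_in_subspace[OF subS])
    have "norm (closest_point (E x) v - s) \<le> gap (E x) ?S * norm v"
      unfolding s_def by (rule norm_closest_point_diff_le_gap[OF subE subS])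
    also have "\<dots> \<le> \<gamma> * norm v" using gapx[OF that(1)] by (intro mult_right_mono) auto
    finally have d: "norm (v - s) \<le> \<gamma> * norm v" using that by (simp add: closest_point_self)
    then have "norm (v - s) \<le> 1/2 * norm v" using \<gamma>(2) mult_right_mono[OF \<gamma>(2) norm_ge_zero[of v]] by linarith
    then have s2: "norm s \<ge> 1/2 * norm v" "norm s \<le> 2 * norm v"
      using norm_triangle_ineq2[of v s] norm_triangle_ineq2[of s v] norm_minus_commute[of s v] by auto
    have "b v v = b s s + b (v - s) v + b s (v - s)" by (simp add: b.diff_left b.diff_right)
    also have "\<dots> \<le> - (c * (norm s)\<^sup>2) + K * norm (v - s) * norm v + K * norm s * norm (v - s)"
      using bS[OF sS] K(2)[of "v - s" v] K(2)[of s "v - s"] by linarith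
    also have "\<dots> \<le> - (c * (1/4 * (norm v)\<^sup>2)) + K * (\<gamma> * norm v) * norm v + K * (2 * norm v) * (\<gamma> * norm v) * (1/2)"
    proof -
      have "(1/2 * norm v)\<^sup>2 \<le> (norm s)\<^sup>2" using s2 by (intro power_mono) auto
      then have "c * (1/4 * (norm v)\<^sup>2) \<le> c * (norm s)\<^sup>2"
        using c by (intro mult_left_mono) (auto simp: power_mult_distrib power_divide)
      moreover have "K * norm (v - s) * norm v \<le> K * (\<gamma> * norm v) * norm v"
        using d K by (intro mult_left_mono mult_right_mono) auto
      moreover have "norm s \<le> norm v"
      proof -
        have "orthogonal (v - s) s"
        proof -
          have sub: "subspace ?S" by (rule vec_subspace_imp_subspace[OF subS])
          have "(v - s) \<bullet> (y - s) \<le> 0" if "y \<in> ?S" for y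
            unfolding s_def by (rule closest_point_dot[OF subspace_imp_convex[OF sub] closed_subspace[OF sub] that])
          from this[OF subspace_0[OF sub]] this[OF subspace_scale[OF sub sS, of 2]] show ?thesis
            by (simp add: orthogonal_def inner_diff_right)
        qed
        then have "(norm v)\<^sup>2 = (norm (v - s))\<^sup>2 + (norm s)\<^sup>2"
          using norm_add_Pythagorean[of "v - s" s] by (simp only: diff_add_cancel)
        then have "(norm s)\<^sup>2 \<le> (norm v)\<^sup>2" by simp
        then show ?thesis by (rule power2_le_imp_le) simp
      qed
      then have "K * norm s * norm (v - s) \<le> K * norm v * (\<gamma> * norm v)" using d K \<gamma> by (intro mult_mono) auto
      moreover have "K * (2 * norm v) * (\<gamma> * norm v) * (1/2) = K * norm v * (\<gamma> * norm v)" by simp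
      ultimately show ?thesis by linarith
    qed
    also have "\<dots> = (K * \<gamma> * 8 - c) * (1/4 * (norm v)\<^sup>2)" by (simp add: power2_eq_square algebra_simps)
    also have "\<dots> \<le> 0" using \<gamma>(4) by (intro mult_nonpos_nonneg) auto
    finally show ?thesis .
  qed
  \<comment> \<open>For \<open>z\<close> orthogonal to the sum, the square of \<open>norm z\<close>
    equals \<open>z \<bullet> (s - e)\<close>, where \<open>s = P z\<close> is stable and
    \<open>e\<close> is its nearest point in \<open>E x0\<close>. This is at most
    \<open>\<gamma> * p < 1\<close> times that square, so \<open>z = 0\<close>.\<close>
  have sumEU: "\<exists>e\<in>E x0. \<exists>u\<in>?U. v = e + u" for v
  proof (rule ccontr)
    let ?W = "{e + u | e u. e \<in> E x0 \<and> u \<in> ?U}"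
    have W: "subspace ?W" by (rule subspace_sums[OF vec_subspace_imp_subspace[OF subE] vec_subspace_imp_subspace[OF subU]])
    assume "\<not> ?thesis"
    then have v: "v \<notin> ?W" by blast
    obtain y z where yz: "y \<in> span ?W" "\<And>w. w \<in> span ?W \<Longrightarrow> orthogonal z w" "v = y + z"
      using orthogonal_subspace_decomp_exists[of ?W v] by blast
    have z: "z \<noteq> 0" using v yz W by (auto simp: span_eq_iff[THEN iffD2, OF W])
    define s where "s = P z"
    define e where "e = closest_point (E x0) s"
    have "e \<in> ?W" "Q z \<in> ?W" using closest_point_in_subspace[OF subE] PQ(3) vec.subspace_0[OF subU] vec.subspace_0[OF subE]
      by (force simp: e_def)+
    then have orth: "z \<bullet> e = 0" "z \<bullet> Q z = 0" using yz(2) by (auto simp: orthogonal_def intro: span_base)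
    have "(norm z)\<^sup>2 = z \<bullet> (s + Q z)" using PQ(4)[of z] by (simp add: s_def power2_norm_eq_inner)
    also have "\<dots> = z \<bullet> (s - e)" using orth by (simp add: inner_add_right inner_diff_right)
    also have "\<dots> \<le> norm z * norm (s - e)" by (rule norm_cauchy_schwarz)
    also have "norm (s - e) \<le> \<gamma> * norm s"
    proof -
      have "norm (e - closest_point ?S s) \<le> gap (E x0) ?S * norm s"
        unfolding e_def by (rule norm_closest_point_diff_le_gap[OF subE subS])
      also have "\<dots> \<le> \<gamma> * norm s" using gapx[of x0] by (intro mult_right_mono) auto
      finally show ?thesis using PQ(2) by (simp add: closest_point_self s_def norm_minus_commute)
    qed
    also have "norm s \<le> norm z * p" unfolding s_def by (rule p)
    finally have "(norm z)\<^sup>2 \<le> norm z * (\<gamma> * (norm z * p))" using \<gamma>(1) by (simp add: mult_left_mono)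
    also have "\<dots> = (\<gamma> * p) * (norm z)\<^sup>2" by (simp add: power2_eq_square)
    also have "\<dots> < 1 * (norm z)\<^sup>2" using \<gamma>(3) z by (intro mult_strict_right_mono) auto
    finally show False by simp
  qed
  define D where "D = K\<^sup>2 / c'"
  have D: "D \<ge> 0" using c' by (simp add: D_def)
  have sqi: "set_integrable lborel {a..y} (\<lambda>x. (norm (f x))\<^sup>2)" and sqle: "(LINT x:{a..y}|lborel. (norm (f x))\<^sup>2) \<le> (l2norm f)\<^sup>2"
    if "f \<in> L2" for f :: "real \<Rightarrow> complex ^ 'n" and a y
  proof -
    have i: "integrable lborel (\<lambda>x. (norm (f x))\<^sup>2)" using that by (simp add: L2_def)
    then show si: "set_integrable lborel {a..y} (\<lambda>x. (norm (f x))\<^sup>2)"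
      unfolding set_integrable_def by (rule integrable_mult_indicator[rotated]) auto
    show "(LINT x:{a..y}|lborel. (norm (f x))\<^sup>2) \<le> (l2norm f)\<^sup>2" unfolding l2norm_square set_lebesgue_integral_def
      by (rule integral_mono[OF si[unfolded set_integrable_def] i]) (auto simp: indicator_def)
  qed
  \<comment> \<open>The energy identity is used up to a far point \<open>Y\<close> at which
    \<open>u\<close> is small; its boundary term there is at most \<open>\<epsilon>\<close>. No
    limit of \<open>u\<close> at infinity is invoked.\<close>
  have tail: "b (u x0) (u x0) + c' * (LINT x:{x0..y}|lborel. (norm (u x))\<^sup>2) \<le> D * (l2norm (residual B u g))\<^sup>2"
    if h: "half u g" and y: "y \<ge> x0" for u g y
  proof (rule field_le_epsilon)
    fix \<epsilon> :: real assume "\<epsilon> > 0"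
    then have "sqrt (\<epsilon> / K) > 0" using K by simp
    from half_small_values[OF h this, of y] obtain Y where Y: "Y \<ge> y" "norm (u Y) < sqrt (\<epsilon> / K)" by blast
    have rL: "residual B u g \<in> L2" by (rule L2_residual[OF B h])
    have "c' * (LINT x:{x0..y}|lborel. (norm (u x))\<^sup>2) \<le> c' * (LINT x:{x0..Y}|lborel. (norm (u x))\<^sup>2)"
    proof (rule mult_left_mono)
      show "(LINT x:{x0..y}|lborel. (norm (u x))\<^sup>2) \<le> (LINT x:{x0..Y}|lborel. (norm (u x))\<^sup>2)"
        unfolding set_lebesgue_integral_def
        by (rule integral_mono[OF sqi[OF halfD(1)[OF h], unfolded set_integrable_def] sqi[OF halfD(1)[OF h], unfolded set_integrable_def]])
          (use Y in \<open>auto simp: indicator_def\<close>)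
    qed (use c' in simp)
    also have "\<dots> \<le> b (u Y) (u Y) - b (u x0) (u x0) + K\<^sup>2 / c' * (LINT x:{x0..Y}|lborel. (norm (residual B u g x))\<^sup>2)"
    proof (rule Lyapunov_increment[OF b c' K(2) coer])
      show "x0 \<le> Y" using y Y by simp
      show "u x - u x0 = (LINT t:{x0..x}|lborel. g t)" if "x \<in> {x0..Y}" for x using halfD(5)[OF h x0, of x] that by simp
    qed (auto intro: L2_norm_set_integrable sqi rL halfD[OF h])
    also have "b (u Y) (u Y) \<le> \<epsilon>"
    proof -
      have "b (u Y) (u Y) \<le> K * (norm (u Y))\<^sup>2" using K(2)[of "u Y" "u Y"] by (simp add: power2_eq_square mult_ac)
      also have "\<dots> \<le> K * (sqrt (\<epsilon> / K))\<^sup>2" using Y K by (intro mult_left_mono power_mono) auto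
      also have "\<dots> = \<epsilon>" using K \<open>\<epsilon> > 0\<close> by simp
      finally show ?thesis .
    qed
    also have "K\<^sup>2 / c' * (LINT x:{x0..Y}|lborel. (norm (residual B u g x))\<^sup>2) \<le> D * (l2norm (residual B u g))\<^sup>2"
      unfolding D_def[symmetric] using D by (intro mult_left_mono sqle rL)
    finally show "b (u x0) (u x0) + c' * (LINT x:{x0..y}|lborel. (norm (u x))\<^sup>2) \<le> D * (l2norm (residual B u g))\<^sup>2 + \<epsilon>" by simp
  qed
  \<comment> \<open>A solution staying in \<open>E\<close> has boundary term
    \<open>b (w y) (w y) \<le> 0\<close> at the far end, so its truncated energies are bounded by
    its value at \<open>x0\<close>. Cutting off the negative half-line then gives a half-line
    function with zero residual.\<close>
  have sol: "\<exists>u g. half u g \<and> (\<forall>x. residual B u g x = 0) \<and> u 0 \<in> E 0 \<and> u x = v" if x: "x \<ge> 0" and v: "v \<in> E x" for x v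
  proof -
    obtain w where w: "\<And>t. (w has_vector_derivative B t *v w t) (at t)" "w x = v" "\<And>y. w y \<in> E y"
      using E v unfolding transported_half_def by metis
    have cw: "continuous_on UNIV w" unfolding continuous_on_eq_continuous_at[OF open_UNIV]
      using has_vector_derivative_continuous[OF w(1)] by blast
    have cg: "continuous_on S (\<lambda>x. B x *v w x)" for S
      by (intro continuous_on_matrix_vector_mult continuous_on_subset[OF cw] continuous_on_subset[OF bounded_coeffD(2)[OF B]]) auto
    have ci: "set_integrable lborel {a..y} (\<lambda>x. (norm (w x))\<^sup>2)" for a y
      by (rule borel_integrable_atLeastAtMost') (intro continuous_intros continuous_on_subset[OF cw], auto)
    have FTC: "w d - w a = (LINT t:{a..d}|lborel. B t *v w t)" if "a \<le> d" for a d unfolding set_lebesgue_integral_def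
      by (rule integral_FTC_Icc[symmetric, OF that]) (auto intro: has_vector_derivative_at_within w(1) cg)
    have z: "set_integrable lborel A (\<lambda>x. 0::real)" for A :: "real set" by (simp add: set_integrable_def)
    have res0: "residual B w (\<lambda>x. B x *v w x) = (\<lambda>x. 0)" by (simp add: residual_def)
    have bound: "(LINT x:{x0..y}|lborel. (norm (w x))\<^sup>2) \<le> K * (norm (w x0))\<^sup>2 / c'" if "y \<ge> x0" for y
    proof -
      have "c' * (LINT x:{x0..y}|lborel. (norm (w x))\<^sup>2) \<le> b (w y) (w y) - b (w x0) (w x0) +
          K\<^sup>2 / c' * (LINT x:{x0..y}|lborel. (norm (residual B w (\<lambda>x. B x *v w x) x))\<^sup>2)"
        by (rule Lyapunov_increment[OF b c' K(2) coer that])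
          (use z in \<open>auto intro!: FTC ci borel_integrable_atLeastAtMost' cg simp: res0\<close>)
      also have "\<dots> = b (w y) (w y) - b (w x0) (w x0)" by (simp add: res0 set_lebesgue_integral_def)
      also have "\<dots> \<le> K * (norm (w x0))\<^sup>2"
        using negE[OF that w(3)] K(2)[of "w x0" "w x0"] by (simp add: power2_eq_square mult_ac)
      finally show ?thesis using c' by (simp add: field_simps)
    qed
    have tot: "(LINT x:{0..y}|lborel. (norm (w x))\<^sup>2) \<le> (LINT x:{0..x0}|lborel. (norm (w x))\<^sup>2) + K * (norm (w x0))\<^sup>2 / c'" (is "_ \<le> ?M")
      if "y \<ge> 0" for y
    proof -
      have "(LINT x:{0..y}|lborel. (norm (w x))\<^sup>2) \<le> (LINT x|lborel. indicator {0..x0} x *\<^sub>R (norm (w x))\<^sup>2 + indicator {x0..max x0 y} x *\<^sub>R (norm (w x))\<^sup>2)"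
        unfolding set_lebesgue_integral_def by (intro integral_mono Bochner_Integration.integrable_add)
          (use ci in \<open>auto simp: set_integrable_def indicator_def\<close>)
      also have "\<dots> = (LINT x:{0..x0}|lborel. (norm (w x))\<^sup>2) + (LINT x:{x0..max x0 y}|lborel. (norm (w x))\<^sup>2)"
        unfolding set_lebesgue_integral_def using ci by (simp add: set_integrable_def)
      finally show ?thesis using bound[of "max x0 y"] by simp
    qed
    have M0: "?M \<ge> 0" using K c' by (auto intro!: add_nonneg_nonneg simp: set_lebesgue_integral_def)
    define u where "u = (\<lambda>x. indicator {0..} x *\<^sub>R w x)"
    define g where "g = (\<lambda>x. B x *v u x)"
    have uL: "u \<in> L2" unfolding u_def by (rule L2_if_truncations_bounded(1)[OF cw, of "sqrt ?M"]) (use M0 tot in auto)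
    have "half u g" unfolding half_def
    proof (intro conjI allI impI uL)
      show "g \<in> L2" unfolding g_def by (rule L2_coeff_mult[OF B uL])
      fix a d :: real assume ad: "0 \<le> a" "a \<le> d"
      then show "u d - u a = (LINT x:{a..d}|lborel. g x)" using FTC[of a d] by (simp add: u_def g_def set_lebesgue_integral_def)
          (intro Bochner_Integration.integral_cong, auto simp: indicator_def)
    qed (auto simp: u_def g_def)
    then show ?thesis using w(2,3) x by (intro exI[of _ u] exI[of _ g]) (auto simp: residual_def g_def u_def)
  qed
  obtain G where G: "G \<ge> 0" "\<And>(u :: real \<Rightarrow> complex ^ 'n) g x y. half u g \<Longrightarrow> x \<in> {0..x0} \<Longrightarrow> y \<in> {0..x0} \<Longrightarrow>
      norm (u x) \<le> G * (norm (u y) + l2norm (residual B u g))" using Gronwall[OF B, of x0] by metis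
  \<comment> \<open>Subtracting the solution through the \<open>E x0\<close> component leaves the
    value \<open>v\<close> of the unstable space at \<open>x0\<close>. There \<open>b v v\<close> is
    coercive, while \<open>tail\<close> bounds it by the residual; Gronwall transfers the bound from
    \<open>x0\<close> to 0.\<close>
  have HL3: "\<exists>e\<in>E 0. norm (u 0 - e) \<le> G * (sqrt (D / c) + 1) * l2norm (residual B u g)" if h: "half u g" for u g
  proof -
    obtain e v where ev: "e \<in> E x0" "v \<in> ?U" "u x0 = e + v" using sumEU by blast
    obtain u' g' where h': "half u' g'" "\<And>x. residual B u' g' x = 0" "u' 0 \<in> E 0" "u' x0 = e" using sol[OF x0 ev(1)] by blast
    define w k where "w = (\<lambda>x. u x - u' x)" and "k = (\<lambda>x. g x - g' x)"
    have hw: "half w k" unfolding w_def k_def by (rule half_diff[OF h h'(1)])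
    have rw: "residual B w k = residual B u g"
    proof
      fix x
      have "residual B w k x = residual B u g x - residual B u' g' x"
        by (simp add: residual_def w_def k_def matrix_vector_mult_diff_distrib)
      then show "residual B w k x = residual B u g x" using h'(2) by simp
    qed
    have wv: "w x0 = v" using ev(3) h'(4) by (simp add: w_def)
    have "c * (norm v)\<^sup>2 \<le> b v v" by (rule bU[OF ev(2)])
    also have "\<dots> \<le> D * (l2norm (residual B u g))\<^sup>2" using tail[OF hw order_refl] c' unfolding wv rw
      by (smt (verit, best) mult_nonneg_nonneg set_lebesgue_integral_def integral_nonneg_AE AE_I2 scaleR_nonneg_nonneg indicator_pos_le zero_le_power2)
    finally have "(norm v)\<^sup>2 \<le> D / c * (l2norm (residual B u g))\<^sup>2" using c by (simp add: field_simps)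
    also have "\<dots> = (sqrt (D / c) * l2norm (residual B u g))\<^sup>2" using D c by (simp add: power_mult_distrib)
    finally have v: "norm v \<le> sqrt (D / c) * l2norm (residual B u g)" by (rule power2_le_imp_le) (use D c in simp)
    have "norm (u 0 - u' 0) \<le> G * (norm (w x0) + l2norm (residual B w k))" using G(2)[OF hw, of 0 x0] x0 by (simp add: w_def)
    also have "\<dots> \<le> G * (sqrt (D / c) * l2norm (residual B u g) + l2norm (residual B u g))"
      unfolding wv rw using v G by (intro mult_left_mono add_mono) auto
    finally show ?thesis using h'(3) by (auto simp: algebra_simps)
  qed
  \<comment> \<open>The first summand accounts for \<open>{0..x0}\<close> through Gronwall, the
    second for the rest through \<open>tail\<close>, with \<open>b (u x0) (u x0)\<close> estimated
    by Gronwall again.\<close>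
  define H where "H = sqrt x0 * G + sqrt ((K * G\<^sup>2 + D) / c')"
  have H0: "H \<ge> 0" using x0 G K D c' by (auto simp: H_def intro!: add_nonneg_nonneg mult_nonneg_nonneg divide_nonneg_nonneg)
  have HL4: "l2norm u \<le> H * (norm (u 0) + l2norm (residual B u g))" if h: "half u g" for u g
  proof -
    let ?r = "l2norm (residual B u g)"
    let ?m = "norm (u 0) + ?r"
    obtain e1 :: "complex ^ 'n" where e1: "norm e1 = 1" using vector_choose_size[of 1] by auto
    have uL: "u \<in> L2" by (rule halfD(1)[OF h])
    have [measurable]: "u \<in> borel_measurable borel" using uL by measurable
    define u1 where "u1 = (\<lambda>x. indicator {0..x0} x *\<^sub>R u x)"
    define u2 where "u2 = (\<lambda>x. indicator {x0<..} x *\<^sub>R u x)"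
    have u12: "u1 \<in> L2" "u2 \<in> L2" by (rule L2_scaled_bound[OF _ uL, of _ 1]; auto simp: u1_def u2_def indicator_def)+
    have u1: "l2norm u1 \<le> sqrt x0 * (G * ?m)"
    proof -
      define m where "m = G * ?m"
      have m: "m \<ge> 0" using G(1) by (simp add: m_def)
      have "l2norm u1 \<le> l2norm (\<lambda>x. indicator {0..x0} x *\<^sub>R (of_real m *s e1))"
      proof (rule l2norm_mono[OF u12(1) L2_indicator_const], rule AE_I2)
        fix x
        show "norm (u1 x) \<le> norm (indicator {0..x0} x *\<^sub>R (of_real m *s e1))"
          using G(2)[OF h, of x 0] x0 m by (auto simp: u1_def indicator_def norm_vec_scale e1 m_def[symmetric])
      qed
      also have "\<dots> = sqrt x0 * (G * ?m)" using m x0 by (simp add: l2norm_indicator_const norm_vec_scale e1) (simp add: m_def)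
      finally show ?thesis .
    qed
    have ux0: "norm (u x0) \<le> G * ?m" using G(2)[OF h, of x0 0] x0 by simp
    have int2: "(LINT x:{x0..y}|lborel. (norm (u x))\<^sup>2) \<le> (K * G\<^sup>2 + D) / c' * ?m\<^sup>2" if "y \<ge> x0" for y
    proof -
      have "c' * (LINT x:{x0..y}|lborel. (norm (u x))\<^sup>2) \<le> D * ?r\<^sup>2 - b (u x0) (u x0)" using tail[OF h that] by simp
      also have "\<dots> \<le> D * ?r\<^sup>2 + K * (norm (u x0))\<^sup>2"
        using K(2)[of "u x0" "u x0"] by (simp add: power2_eq_square mult_ac abs_le_iff)
      also have "\<dots> \<le> D * ?m\<^sup>2 + K * (G * ?m)\<^sup>2" using D K ux0 by (intro add_mono mult_left_mono power_mono) auto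
      also have "\<dots> = (K * G\<^sup>2 + D) * ?m\<^sup>2" unfolding power_mult_distrib by (simp only: ring_distribs mult.assoc add.commute)
      finally have "(LINT x:{x0..y}|lborel. (norm (u x))\<^sup>2) \<le> ((K * G\<^sup>2 + D) * ?m\<^sup>2) / c'"
        by (subst pos_le_divide_eq[OF c']) (simp only: mult.commute)
      then show ?thesis by simp
    qed
    have u2: "l2norm u2 \<le> sqrt ((K * G\<^sup>2 + D) / c') * ?m"
    proof (rule power2_le_imp_le)
      define f where "f = (\<lambda>n :: nat. \<lambda>x. indicator {x0<..x0 + n} x *\<^sub>R u x)"
      have fL: "f n \<in> L2" for n by (rule L2_scaled_bound[OF _ uL, of _ 1]; auto simp: f_def indicator_def)
      have le: "l2norm (f n) \<le> sqrt ((K * G\<^sup>2 + D) / c' * ?m\<^sup>2)" for n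
      proof (rule real_le_rsqrt)
        have "(l2norm (f n))\<^sup>2 \<le> (LINT x:{x0..x0 + n}|lborel. (norm (u x))\<^sup>2)" unfolding l2norm_square set_lebesgue_integral_def
          by (rule integral_mono[OF L2_integrable_square[OF fL] sqi[OF uL, unfolded set_integrable_def]])
            (auto simp: f_def indicator_def)
        with int2[of "x0 + n"] show "(l2norm (f n))\<^sup>2 \<le> (K * G\<^sup>2 + D) / c' * ?m\<^sup>2" by simp
      qed
      have conv: "AE x in lborel. (\<lambda>n. f n x) \<longlonglongrightarrow> u2 x"
      proof (rule AE_I2)
        fix x
        have "\<forall>\<^sub>F n in sequentially. f n x = u2 x" using eventually_ge_at_top[of "nat \<lceil>x - x0\<rceil>"]
        proof eventually_elim
          case (elim n)
          then have "x \<le> x0 + n" by linarith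
          then show ?case by (simp add: f_def u2_def indicator_def)
        qed
        then show "(\<lambda>n. f n x) \<longlonglongrightarrow> u2 x" by (rule tendsto_eventually)
      qed
      have "l2norm u2 \<le> sqrt ((K * G\<^sup>2 + D) / c' * ?m\<^sup>2)" by (rule L2_Fatou(2)[OF fL le conv L2_measurable[OF u12(2)]])
      also have "\<dots> = sqrt ((K * G\<^sup>2 + D) / c') * ?m"
      proof -
        have m0: "?m \<ge> 0" by simp
        show ?thesis by (simp only: real_sqrt_mult real_sqrt_abs abs_of_nonneg[OF m0])
      qed
      finally show "(l2norm u2)\<^sup>2 \<le> (sqrt ((K * G\<^sup>2 + D) / c') * ?m)\<^sup>2" by (rule power_mono) simp
    qed (use K D c' in auto)
    have "u x = u1 x + u2 x" for x using halfD(3)[OF h, of x] x0 by (simp add: u1_def u2_def indicator_def)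
    then have "l2norm u = l2norm (\<lambda>x. u1 x + u2 x)" by presburger
    also have "\<dots> \<le> l2norm u1 + l2norm u2" by (rule l2norm_triangle[OF u12])
    also have "\<dots> \<le> sqrt x0 * (G * ?m) + sqrt ((K * G\<^sup>2 + D) / c') * ?m" using u1 u2 by (rule add_mono)
    also have "\<dots> = H * ?m" by (simp only: H_def ring_distribs mult.assoc)
    finally show ?thesis .
  qed
  define C where "C = max H (G * (sqrt (D / c) + 1))"
  show ?thesis
  proof (rule that[of C])
    show "C \<ge> 0" using H0 by (simp add: C_def)
    show "\<exists>u g. half u g \<and> (\<forall>x. residual B u g x = 0) \<and> u 0 = e" if "e \<in> E 0" for e using sol[OF order_refl that] by blast
    show "\<exists>e\<in>E 0. norm (u 0 - e) \<le> C * l2norm (residual B u g)" if "half u g" for u g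
    proof -
      have "G * (sqrt (D / c) + 1) * l2norm (residual B u g) \<le> C * l2norm (residual B u g)"
        by (intro mult_right_mono) (auto simp: C_def)
      then show ?thesis using HL3[OF that] by (meson order_trans)
    qed
    show "l2norm u \<le> C * (norm (u 0) + l2norm (residual B u g))" if "half u g" for u g
    proof -
      have "H * (norm (u 0) + l2norm (residual B u g)) \<le> C * (norm (u 0) + l2norm (residual B u g))"
        by (intro mult_right_mono) (auto simp: C_def)
      then show ?thesis using HL4[OF that] by linarith
    qed
  qed
qed

section \<open>Fredholm operators have hyperbolic limits\<close>

text \<open>Gaussian elimination modulo \<open>V\<close>: a pivot \<open>f i0\<close> that involves
  \<open>b\<close> removes \<open>b\<close> from the other vectors, at the cost of one index and one
  spanning vector.\<close>

lemma (in vector_space) dependent_modulo_subspace: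
  assumes V: "subspace V" and "finite B" "finite I" "card B < card I" "\<And>i. i \<in> I \<Longrightarrow> f i \<in> span (V \<union> B)"
  shows "\<exists>c. (\<exists>i\<in>I. c i \<noteq> 0) \<and> (\<Sum>i\<in>I. scale (c i) (f i)) \<in> V"
  using assms(2-)
proof (induction B arbitrary: I f rule: finite_induct)
  case empty
  then obtain i0 where i0: "i0 \<in> I" by fastforce
  have "(\<Sum>i\<in>I. scale (if i = i0 then 1 else 0) (f i)) = f i0"
    using i0 empty by (simp add: if_distrib[where f = "\<lambda>c. scale c _"] cong: if_cong)
  moreover have "f i0 \<in> V" using empty i0 V by (simp add: span_eq_iff[THEN iffD2])
  ultimately show ?case using i0 by (intro exI[of _ "\<lambda>i. if i = i0 then 1 else 0"]) auto
next
  case (insert b B)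
  show ?case
  proof (cases "\<forall>i\<in>I. f i \<in> span (V \<union> B)")
    case True
    then show ?thesis using insert by auto
  next
    case False
    then obtain i0 where i0: "i0 \<in> I" "f i0 \<notin> span (V \<union> B)" by blast
    have "\<exists>k. f i - scale k b \<in> span (V \<union> B)" if "i \<in> I" for i using insert.prems(3)[OF that] by (simp add: span_breakdown_eq)
    then obtain k where k: "\<And>i. i \<in> I \<Longrightarrow> f i - scale (k i) b \<in> span (V \<union> B)" by metis
    have k0: "k i0 \<noteq> 0" using k[OF i0(1)] i0(2) by auto
    define f' where "f' = (\<lambda>i. f i - scale (k i / k i0) (f i0))"
    have f': "f' i \<in> span (V \<union> B)" if "i \<in> I - {i0}" for i
    proof -
      have "f' i = (f i - scale (k i) b) - scale (k i / k i0) (f i0 - scale (k i0) b)"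
        using k0 by (simp add: f'_def scale_right_diff_distrib)
      also have "\<dots> \<in> span (V \<union> B)" by (rule span_diff[OF k span_scale[OF k]]) (use that i0(1) in auto)
      finally show ?thesis .
    qed
    have "card B < card (I - {i0})" using insert i0 by auto
    have "\<exists>c. (\<exists>i\<in>I - {i0}. c i \<noteq> 0) \<and> (\<Sum>i\<in>I - {i0}. scale (c i) (f' i)) \<in> V"
      by (rule insert.IH[OF _ \<open>card B < card (I - {i0})\<close> f']) (use insert.prems(1) in auto)
    then obtain c where c: "\<exists>i\<in>I - {i0}. c i \<noteq> 0" "(\<Sum>i\<in>I - {i0}. scale (c i) (f' i)) \<in> V" by auto
    \<comment> \<open>The pivot receives the coefficient that undoes the elimination.\<close>
    define d where "d = (\<lambda>i. if i = i0 then - (\<Sum>i\<in>I - {i0}. c i * (k i / k i0)) else c i)"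
    have "(\<Sum>i\<in>I. scale (d i) (f i)) = scale (d i0) (f i0) + (\<Sum>i\<in>I - {i0}. scale (d i) (f i))"
      using insert.prems(1) i0(1) by (rule sum.remove)
    also have "(\<Sum>i\<in>I - {i0}. scale (d i) (f i)) = (\<Sum>i\<in>I - {i0}. scale (c i) (f i))" by (intro sum.cong) (auto simp: d_def)
    also have "scale (d i0) (f i0) = - (\<Sum>i\<in>I - {i0}. scale (c i * (k i / k i0)) (f i0))" by (simp add: d_def scale_sum_left)
    finally have "(\<Sum>i\<in>I. scale (d i) (f i)) = (\<Sum>i\<in>I - {i0}. scale (c i) (f' i))"
      by (simp add: f'_def scale_right_diff_distrib sum_subtractf)
    with c show ?thesis by (intro exI[of _ d]) (auto simp: d_def)
  qed
qed

text \<open>The infimum in \<open>ecodim\<close> is attained: it is finite, hence not that of the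
  empty set, and \<open>enat\<close> is well-ordered.\<close>

lemma dependent_if_card_gt_ecodim:
  assumes "vector_space s" "module.subspace s V" "ecodim s V W = enat k"
    and "finite I" "k < card I" "\<And>i. i \<in> I \<Longrightarrow> f i \<in> W"
  shows "\<exists>c. (\<exists>i\<in>I. c i \<noteq> 0) \<and> (\<Sum>i\<in>I. s (c i) (f i)) \<in> V"
proof -
  interpret vector_space s by fact
  let ?A = "{enat (card B) | B. finite B \<and> B \<subseteq> W \<and> W \<subseteq> module.span s (V \<union> B)}"
  have "?A \<noteq> {}" using assms(3) unfolding ecodim_def by (metis Inf_enat_def enat.distinct(2))
  then have "Inf ?A \<in> ?A" unfolding Inf_enat_def by (metis (mono_tags, lifting) LeastI ex_in_conv)
  then obtain B where B: "finite B" "B \<subseteq> W" "W \<subseteq> span (V \<union> B)" "card B = k" using assms(3) unfolding ecodim_def by auto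
  show ?thesis by (rule dependent_modulo_subspace[OF assms(2) B(1) assms(4)]) (use B assms in auto)
qed

lemma left_eigenvector:
  fixes A :: "complex ^ 'n ^ 'n"
  assumes "A *v v = \<mu> *s v" "v \<noteq> 0"
  obtains l where "l \<noteq> 0" "transpose A *v l = \<mu> *s l"
proof -
  have "(A - mat \<mu>) *v v = 0" using assms by (simp add: matrix_vector_mult_diff_rdistrib matrix_vector_mult_scale_left)
  then have "\<not> invertible (A - mat \<mu>)" using assms(2) matrix_left_invertible_ker invertible_left_inverse by metis
  then have "\<not> invertible (transpose (A - mat \<mu>))" by (simp add: invertible_det_nz det_transpose)
  then obtain l where l: "transpose (A - mat \<mu>) *v l = 0" "l \<noteq> 0"
    using matrix_left_invertible_ker[of "transpose (A - mat \<mu>)"] invertible_left_inverse[of "transpose (A - mat \<mu>)"] by metis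
  have "transpose (A - mat \<mu>) = transpose A - mat \<mu>" by (simp add: transpose_def mat_def vec_eq_iff)
  then show ?thesis using l that by (simp add: matrix_vector_mult_diff_rdistrib matrix_vector_mult_scale_left)
qed

text \<open>
  Testing against a parabolic cutoff of the solution \<open>e\<^sup>-\<^sup>\<mu>\<^sup>x l\<close> of the adjoint equation of the limit
  system: the boundary terms vanish, and the error is small on a long interval far out.
\<close>

lemma residual_test_estimate:
  fixes B :: "real \<Rightarrow> complex ^ 'n ^ 'n" and l :: "complex ^ 'n \<Rightarrow> complex"
  assumes B: "bounded_coeff \<beta> B" and h: "half u g" and l: "bounded_linear l" "\<And>w. norm (l w) \<le> p * norm w" "p \<ge> 0"
    and mu: "Re \<mu> = 0" "\<And>w. l (Binf *v w) = \<mu> * l w" and L: "L > 0" "a \<ge> 0"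
    and \<epsilon>: "\<And>x w. x \<in> {a..a + 2 * L} \<Longrightarrow> norm ((B x - Binf) *v w) \<le> \<epsilon> * norm w"
    and rep: "AE x in lborel. x \<in> {a..a + 2 * L} \<longrightarrow> l (residual B u g x) = \<gamma> * exp (\<mu> * complex_of_real x)"
  shows "norm \<gamma> * L \<le> (2 / L + \<epsilon>) * p * (sqrt (2 * L) * l2norm u)"
proof -
  interpret l: bounded_linear l by fact
  let ?I = "{a..a + 2 * L}"
  \<comment> \<open>Parabola with zeros at both ends of \<open>{a..a + 2 * L}\<close> and maximum 1
    in the middle. Its slope is at most \<open>2 / L\<close> and its integral is
    \<open>4/3 * L\<close>.\<close>
  define q where "q = (\<lambda>x :: real. 1 - ((x - a - L) / L)\<^sup>2)"
  define q' where "q' = (\<lambda>x :: real. - (2 / L * ((x - a - L) / L)))"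
  define E where "E = (\<lambda>x. exp (- \<mu> * complex_of_real x))"
  define \<phi> where "\<phi> = (\<lambda>x. of_real (q x) * E x)"
  define \<phi>' where "\<phi>' = (\<lambda>x. of_real (q' x) * E x - \<mu> * \<phi> x)"
  have Enorm: "norm (E x) = 1" for x using mu(1) by (simp add: E_def)
  have q01: "\<bar>q x\<bar> \<le> 1" "\<bar>q' x\<bar> \<le> 2 / L" if "x \<in> ?I" for x
  proof -
    have "\<bar>(x - a - L) / L\<bar> \<le> 1" using that L by (auto simp: abs_le_iff field_simps)
    then have "((x - a - L) / L)\<^sup>2 \<le> 1" by (simp add: abs_square_le_1)
    then show "\<bar>q x\<bar> \<le> 1" by (simp add: q_def abs_le_iff)
    have "\<bar>q' x\<bar> = 2 / L * \<bar>(x - a - L) / L\<bar>" unfolding q'_def abs_minus_cancel abs_mult using L by simp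
    also have "\<dots> \<le> 2 / L * 1" using \<open>\<bar>(x - a - L) / L\<bar> \<le> 1\<close> L by (intro mult_left_mono) auto
    finally show "\<bar>q' x\<bar> \<le> 2 / L" by simp
  qed
  have E': "(E has_vector_derivative (- \<mu> * E x)) (at x within S)" for x S unfolding E_def
    by (rule has_vector_derivative_real_field[THEN has_vector_derivative_at_within] derivative_eq_intros refl | simp)+
  have q_deriv: "(q has_real_derivative q' x) (at x within S)" for x S unfolding q_def q'_def using L
    by (auto intro!: derivative_eq_intros simp: power2_eq_square field_simps)
  have "((\<lambda>x. complex_of_real (q x)) has_vector_derivative of_real (q' x)) (at x within S)" for x S
    by (rule has_vector_derivative_of_real) (use q_deriv in \<open>simp add: has_real_derivative_iff_has_vector_derivative\<close>)
  from has_vector_derivative_mult[OF this E']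
  have \<phi>_deriv: "(\<phi> has_vector_derivative \<phi>' x) (at x within S)" for x S unfolding \<phi>_def \<phi>'_def by (simp add: algebra_simps)
  have cE: "continuous_on S E" for S unfolding E_def by (intro continuous_intros)
  have cq: "continuous_on S q" "continuous_on S q'" for S unfolding q_def q'_def using L by (intro continuous_intros; simp)+
  have c\<phi>: "continuous_on S \<phi>" "continuous_on S \<phi>'" for S unfolding \<phi>'_def \<phi>_def by (intro continuous_intros cE cq)+
  have bb: "bounded_bilinear (\<lambda>(z::complex) w. z * l w)"
    by (rule bounded_bilinear.comp[OF bounded_bilinear_mult bounded_linear_ident l(1)])
  have le: "a \<le> a + 2 * L" using L by simp
  have \<phi>_int: "\<phi> x - \<phi> a = (LINT t:{a..x}|lborel. \<phi>' t)" if "x \<in> ?I" for x unfolding set_lebesgue_integral_def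
    by (rule integral_FTC_Icc[symmetric]) (use that in \<open>auto intro: \<phi>_deriv c\<phi>\<close>)
  have u_int: "u x - u a = (LINT t:{a..x}|lborel. g t)" if "x \<in> ?I" for x using halfD(5)[OF h L(2), of x] that by simp
  have g_int: "set_integrable lborel ?I g" by (rule L2_norm_set_integrable[OF halfD(2)[OF h]])
  note pr = product_rule_primitives[OF bb le borel_integrable_atLeastAtMost'[OF c\<phi>(2)] g_int \<phi>_int u_int]
  have "q a = 0" "q (a + 2 * L) = 0" using L by (simp_all add: q_def)
  then have zero: "(LINT x:?I|lborel. \<phi> x * l (g x) + \<phi>' x * l (u x)) = 0" using pr(2) by (simp add: \<phi>_def)
  \<comment> \<open>The derivative of the exponential inside \<open>\<phi>'\<close> cancels
    \<open>\<mu> * l (u x)\<close>, so only the deviation of \<open>B\<close> from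
    \<open>Binf\<close> and the slope of the cutoff remain in \<open>R\<close>.\<close>
  define R where "R = (\<lambda>x. \<phi> x * l ((B x - Binf) *v u x) + of_real (q' x) * E x * l (u x))"
  have eq: "\<phi> x * l (g x) + \<phi>' x * l (u x) = \<phi> x * l (residual B u g x) + R x" for x
  proof -
    have "l (g x) = l (residual B u g x) + l ((B x - Binf) *v u x) + \<mu> * l (u x)"
      unfolding mu(2)[symmetric] by (simp add: residual_def matrix_vector_mult_diff_rdistrib l.diff)
    then show ?thesis by (simp add: R_def \<phi>'_def algebra_simps)
  qed
  have uL: "u \<in> L2" by (rule halfD(1)[OF h])
  have [measurable]: "u \<in> borel_measurable borel" using uL by (rule L2_measurable)
  have [measurable]: "B \<in> borel_measurable borel" by (rule bounded_coeffD[OF B])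
  have [measurable]: "l \<in> borel_measurable borel"
    by (rule borel_measurable_continuous_onI[OF l.continuous_on[OF continuous_on_id]])
  have [measurable]: "\<phi> \<in> borel_measurable borel" "E \<in> borel_measurable borel" "q' \<in> borel_measurable borel"
    using c\<phi> cE cq by (auto intro: borel_measurable_continuous_onI)
  have [measurable]: "R \<in> borel_measurable borel" unfolding R_def by measurable
  have \<epsilon>0: "\<epsilon> \<ge> 0"
  proof -
    obtain e1 :: "complex ^ 'n" where e1: "norm e1 = 1" using vector_choose_size[of 1] by auto
    have "0 \<le> norm ((B a - Binf) *v e1)" by simp
    also have "\<dots> \<le> \<epsilon> * norm e1" using \<epsilon>[of a e1] L by simp
    finally show ?thesis using e1 by simp
  qed
  have Rle: "norm (R x) \<le> (2 / L + \<epsilon>) * p * norm (u x)" if "x \<in> ?I" for x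
  proof -
    have "norm (R x) \<le> norm (\<phi> x) * norm (l ((B x - Binf) *v u x)) + norm (q' x) * norm (E x) * norm (l (u x))"
      unfolding R_def by (rule order_trans[OF norm_triangle_ineq]) (simp add: norm_mult)
    also have "\<dots> \<le> 1 * (p * (\<epsilon> * norm (u x))) + 2 / L * 1 * (p * norm (u x))"
    proof (intro add_mono mult_mono)
      show "norm (\<phi> x) \<le> 1" using q01(1)[OF that] Enorm by (simp add: \<phi>_def norm_mult)
      show "norm (l ((B x - Binf) *v u x)) \<le> p * (\<epsilon> * norm (u x))"
        by (rule order_trans[OF l(2) mult_left_mono[OF \<epsilon>[OF that] l(3)]])
    qed (use q01(2)[OF that] Enorm l L in auto)
    finally show ?thesis by (simp add: algebra_simps)
  qed
  have uI: "set_integrable lborel ?I (\<lambda>x. norm (u x))" using set_integrable_norm[OF L2_norm_set_integrable[OF uL]] by simp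
  have RI: "set_integrable lborel ?I R" unfolding set_integrable_def
  proof (rule Bochner_Integration.integrable_bound)
    show "integrable lborel (\<lambda>x. (2 / L + \<epsilon>) * p * (indicat_real ?I x *\<^sub>R norm (u x)))"
      by (intro integrable_mult_right) (use uI in \<open>simp add: set_integrable_def\<close>)
    show "AE x in lborel. norm (indicator ?I x *\<^sub>R R x) \<le> norm ((2 / L + \<epsilon>) * p * (indicat_real ?I x *\<^sub>R norm (u x)))"
      using Rle by (intro AE_I2) (auto simp: indicator_def intro: order_trans[OF _ abs_ge_self])
  qed measurable
  have "set_integrable lborel ?I (\<lambda>x. (\<phi> x * l (g x) + \<phi>' x * l (u x)) - R x)" by (rule set_integral_diff(1)[OF pr(1) RI])
  then have rI: "set_integrable lborel ?I (\<lambda>x. \<phi> x * l (residual B u g x))" unfolding eq by simp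
  have "0 = (LINT x:?I|lborel. \<phi> x * l (residual B u g x)) + (LINT x:?I|lborel. R x)"
    using zero unfolding eq set_integral_add(2)[OF rI RI] by simp
  then have main: "norm (LINT x:?I|lborel. \<phi> x * l (residual B u g x)) = norm (LINT x:?I|lborel. R x)"
    by (metis add.inverse_unique norm_minus_cancel)
  have "norm (LINT x:?I|lborel. R x) \<le> (LINT x:?I|lborel. (2 / L + \<epsilon>) * p * norm (u x))"
  proof -
    have "norm (LINT x:?I|lborel. R x) \<le> (LINT x:?I|lborel. norm (R x))"
      unfolding set_lebesgue_integral_def by (rule order_trans[OF integral_norm_bound]) simp
    also have "\<dots> \<le> (LINT x:?I|lborel. (2 / L + \<epsilon>) * p * norm (u x))"
      by (rule set_integral_mono) (use RI set_integrable_norm[OF RI] uI Rle in \<open>auto intro: set_integrable_mult_right\<close>)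
    finally show ?thesis .
  qed
  also have "\<dots> = (2 / L + \<epsilon>) * p * (LINT x:?I|lborel. norm (u x))" by simp
  also have "\<dots> \<le> (2 / L + \<epsilon>) * p * (sqrt (2 * L) * l2norm u)"
    using norm_L1_le_l2norm[OF uL le] \<epsilon>0 L l(3) by (intro mult_left_mono) (auto intro!: mult_nonneg_nonneg)
  finally have upper: "norm (LINT x:?I|lborel. \<phi> x * l (residual B u g x)) \<le> (2 / L + \<epsilon>) * p * (sqrt (2 * L) * l2norm u)"
    using main by simp
  have "(LINT x:?I|lborel. \<phi> x * l (residual B u g x)) = (LINT x:?I|lborel. \<gamma> * of_real (q x))"
  proof (rule set_lebesgue_integral_cong_AE)
    show "AE x\<in>?I in lborel. \<phi> x * l (residual B u g x) = \<gamma> * complex_of_real (q x)" using rep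
    proof eventually_elim
      case (elim x)
      have "exp (- (\<mu> * complex_of_real x)) * exp (\<mu> * complex_of_real x) = 1" by (simp flip: exp_add)
      with elim show ?case by (auto simp: \<phi>_def E_def)
    qed
    have [measurable]: "residual B u g \<in> borel_measurable borel" using L2_residual[OF B h] by (rule L2_measurable)
    show "(\<lambda>x. \<phi> x * l (residual B u g x)) \<in> borel_measurable lborel" by measurable
    show "(\<lambda>x. \<gamma> * complex_of_real (q x)) \<in> borel_measurable lborel" unfolding q_def by measurable
  qed simp
  also have "\<dots> = \<gamma> * of_real (LINT x:?I|lborel. q x)"
  proof -
    have "(LINT x:?I|lborel. complex_of_real (q x)) = of_real (LINT x:?I|lborel. q x)" by (rule set_integral_complex_of_real)
    then show ?thesis by simp
  qed
  also have "(LINT x:?I|lborel. q x) = 4/3 * L"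
  proof -
    define Q where "Q = (\<lambda>x. (x - a) - L / 3 * ((x - a - L) / L) ^ 3)"
    have Qd: "(Q has_real_derivative q x) (at x within S)" for x S unfolding Q_def q_def using L
      by (auto intro!: derivative_eq_intros simp: power2_eq_square power3_eq_cube field_simps)
    have "(LINT x:?I|lborel. q x) = Q (a + 2 * L) - Q a" unfolding set_lebesgue_integral_def
      by (rule integral_FTC_Icc[OF le]) (use Qd cq in \<open>auto simp: has_real_derivative_iff_has_vector_derivative\<close>)
    also have "\<dots> = 4/3 * L" using L by (simp add: Q_def)
    finally show ?thesis .
  qed
  finally have eq2: "(LINT x:?I|lborel. \<phi> x * l (residual B u g x)) = \<gamma> * of_real (4/3 * L)" .
  have "norm (LINT x:?I|lborel. \<phi> x * l (residual B u g x)) = norm \<gamma> * (4/3 * L)"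
    unfolding eq2 norm_mult norm_of_real using L by simp
  then have "norm \<gamma> * (4/3 * L) \<le> (2 / L + \<epsilon>) * p * (sqrt (2 * L) * l2norm u)" using upper by simp
  moreover have "norm \<gamma> * L \<le> norm \<gamma> * (4/3 * L)" using L by (intro mult_left_mono) auto
  ultimately show ?thesis by linarith
qed

text \<open>The lengths \<open>2 * 16 ^ n\<close> belong to the scaling of the functions constructed
  next; partial sums push every starting point past \<open>X n\<close> and past the previous
  interval.\<close>

lemma disjoint_intervals_exist:
  fixes X :: "nat \<Rightarrow> real"
  obtains s :: "nat \<Rightarrow> real" where "\<And>n. s n \<ge> 0" "\<And>n. s n \<ge> X n"
    "\<And>m n x. x \<in> {s m..s m + 2 * 16 ^ m} \<Longrightarrow> x \<in> {s n..s n + 2 * 16 ^ n} \<Longrightarrow> m = n"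
proof -
  define s where "s = (\<lambda>n. \<Sum>i\<le>n. \<bar>X i\<bar> + 2 * 16 ^ i :: real)"
  have X: "s n \<ge> X n" for n
  proof -
    have "\<bar>X n\<bar> + 2 * 16 ^ n \<le> s n" unfolding s_def by (rule member_le_sum) auto
    moreover have "(0::real) \<le> 2 * 16 ^ n" by simp
    ultimately show ?thesis by linarith
  qed
  have s0: "s n \<ge> 0" for n unfolding s_def by (intro sum_nonneg) auto
  have step: "s n + 2 * 16 ^ n < s (Suc n)" for n
  proof -
    have "s (Suc n) = s n + (\<bar>X (Suc n)\<bar> + 2 * 16 ^ Suc n)" by (simp add: s_def)
    moreover have "(16::real) ^ n > 0" by simp
    ultimately show ?thesis using abs_ge_zero[of "X (Suc n)"] unfolding power_Suc by linarith
  qed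
  have mono: "s i \<le> s j" if "i \<le> j" for i j by (rule lift_Suc_mono_le[OF _ that]) (use step in \<open>smt (verit) zero_less_power\<close>)
  have less: "s m + 2 * 16 ^ m < s n" if "m < n" for m n using step[of m] mono[of "Suc m" n] that by simp
  show ?thesis
  proof (rule that[OF s0 X])
    fix m n x
    assume x: "x \<in> {s m..s m + 2 * 16 ^ m}" "x \<in> {s n..s n + 2 * 16 ^ n}"
    show "m = n"
    proof (rule linorder_cases[of m n])
      assume "m < n" then show ?thesis using less[of m n] x by simp
    next
      assume "n < m" then show ?thesis using less[of n m] x by simp
    qed
  qed
qed

text \<open>Resonant right-hand sides. On intervals of length \<open>2 * 16 ^ n\<close>, moved out
  until \<open>B\<close> is within \<open>1 / 16 ^ n\<close> of its limit, \<open>f k\<close>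
  oscillates like \<open>exp (\<mu> * x)\<close> with amplitude \<open>1 / 8 ^ n\<close>. The
  squared norms sum like \<open>1 / 4 ^ n\<close>, so \<open>f k\<close> is in \<open>L2\<close>,
  whereas testing on interval \<open>n\<close> forces \<open>norm (c i) * 8 ^ n \<le> D\<close>.
  Each \<open>f k\<close> owns infinitely many intervals, on which all other members of the family
  vanish, so \<open>c i\<close> would have to be 0.\<close>

lemma infinite_codimension_if_not_hyperbolic:
  fixes B :: "real \<Rightarrow> complex ^ 'n ^ 'n"
  assumes B: "bounded_coeff \<beta> B" and lim: "(B \<longlongrightarrow> Binf) at_top" and nh: "\<not> hyperbolic Binf"
  obtains f :: "nat \<Rightarrow> real \<Rightarrow> complex ^ 'n" where "\<And>k. f k \<in> L2" "\<And>k x. x < 0 \<Longrightarrow> f k x = 0"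
    "\<And>I c i u g. finite I \<Longrightarrow> i \<in> I \<Longrightarrow> c i \<noteq> 0 \<Longrightarrow> half u g \<Longrightarrow> \<not> (AE x in lborel. residual B u g x = (\<Sum>k\<in>I. c k *s f k x))"
proof -
  obtain v \<mu> where v: "v \<noteq> 0" "Binf *v v = \<mu> *s v" "Re \<mu> = 0" using nh unfolding hyperbolic_def by blast
  obtain l0 where l0: "l0 \<noteq> 0" "transpose Binf *v l0 = \<mu> *s l0" using left_eigenvector[OF v(2,1)] .
  define l where "l = (\<lambda>w :: complex ^ 'n. \<Sum>i\<in>UNIV. w $ i * l0 $ i)"
  have l: "bounded_linear l" unfolding l_def
    by (intro bounded_linear_sum bounded_linear_mult_left[THEN bounded_linear_compose] bounded_linear_vec_nth)
  interpret l: bounded_linear l by fact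
  have lsc: "l (c *s w) = c * l w" for c w by (simp add: l_def sum_distrib_left mult.assoc)
  have lB: "l (Binf *v w) = \<mu> * l w" for w
  proof -
    have "l (Binf *v w) = (\<Sum>i\<in>UNIV. \<Sum>j\<in>UNIV. Binf $ i $ j * w $ j * l0 $ i)"
      by (simp add: l_def matrix_vector_mult_def sum_distrib_right)
    also have "\<dots> = (\<Sum>j\<in>UNIV. w $ j * (transpose Binf *v l0) $ j)"
      by (subst sum.swap) (simp add: matrix_vector_mult_def transpose_def sum_distrib_left mult_ac)
    also have "\<dots> = \<mu> * l w" unfolding l0(2) by (simp add: l_def sum_distrib_left mult_ac)
    finally show ?thesis .
  qed
  obtain p where p: "p > 0" "\<And>w. norm (l w) \<le> p * norm w" using l.pos_bounded by (auto simp: mult.commute)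
  obtain \<eta> where \<eta>: "l \<eta> = 1"
  proof -
    \<comment> \<open>The conjugate of \<open>l0\<close> pairs with \<open>l0\<close> to a squared
      norm, so a multiple of it has \<open>l \<eta> = 1\<close>.\<close>
    define \<eta>0 :: "complex ^ 'n" where "\<eta>0 = (\<chi> i. cnj (l0 $ i))"
    have "l \<eta>0 = of_real ((norm l0)\<^sup>2)" unfolding l_def \<eta>0_def power2_norm_eq_inner inner_vec_def of_real_sum
      by (intro sum.cong) (simp_all add: complex_norm_square[symmetric] mult.commute flip: power2_norm_eq_inner)
    then have "l ((1 / l \<eta>0) *s \<eta>0) = 1" using l0(1) by (simp add: lsc)
    then show ?thesis by (rule that)
  qed
  obtain \<kappa> where \<kappa>: "\<kappa> > 0" "\<And>(M :: complex ^ 'n ^ 'n) v. norm (M *v v) \<le> norm M * norm v * \<kappa>"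
    using bounded_bilinear.pos_bounded[OF bounded_bilinear_matrix_vector] by metis
  have "\<exists>X. \<forall>x\<ge>X. dist (B x) Binf < 1 / 16 ^ n" for n
    using tendstoD[OF lim, of "1 / 16 ^ n"] by (simp add: eventually_at_top_linorder)
  then obtain X where X: "\<And>n x. x \<ge> X n \<Longrightarrow> dist (B x) Binf < 1 / 16 ^ n" by metis
  obtain s where s: "\<And>n. s n \<ge> 0" "\<And>n. s n \<ge> X n"
    "\<And>m n x. x \<in> {s m..s m + 2 * 16 ^ m} \<Longrightarrow> x \<in> {s n..s n + 2 * 16 ^ n} \<Longrightarrow> m = n"
    by (rule disjoint_intervals_exist[of X]) (rule that, assumption+)
  define I where "I = (\<lambda>n. {s n..s n + 2 * 16 ^ n})"
  \<comment> \<open>The pairing function splits the interval indices into infinitely many infinite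
    classes, one for each \<open>k\<close>.\<close>
  define N where "N = (\<lambda>k. {n. fst (prod_decode n) = k})"
  have disj: "m = n" if "x \<in> I m" "x \<in> I n" for m n x using s(3) that by (simp add: I_def)
  \<comment> \<open>At most one term is nonzero at each \<open>x\<close>; the form as a series gives
    measurability directly.\<close>
  define \<rho> where "\<rho> = (\<lambda>k x. \<Sum>n. indicator (N k) n * indicator (I n) x * (1 / 8 ^ n) :: real)"
  have \<rho>_in: "\<rho> k x = indicator (N k) n * (1 / 8 ^ n)" if "x \<in> I n" for k n x
  proof -
    have "(\<lambda>m. indicator (N k) m * indicator (I m) x * (1 / 8 ^ m) :: real) sums
        (\<Sum>m\<in>{n}. indicator (N k) m * indicator (I m) x * (1 / 8 ^ m))"
      by (rule sums_finite) (use disj that in \<open>auto simp: indicator_def\<close>)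
    then show ?thesis using that by (simp add: \<rho>_def sums_iff)
  qed
  have \<rho>_out: "\<rho> k x = 0" if "\<And>n. x \<notin> I n" for k x using that by (simp add: \<rho>_def)
  have [measurable]: "\<rho> k \<in> borel_measurable borel" for k unfolding \<rho>_def I_def by measurable
  define f where "f = (\<lambda>k x. of_real (\<rho> k x) * exp (\<mu> * of_real x) *s \<eta>)"
  have fL: "f k \<in> L2" for k
  proof (rule L2I_bound)
    let ?h = "\<lambda>n x. (norm \<eta>)\<^sup>2 * (1 / 64 ^ n) * indicator (I n) x :: real"
    show "integrable lborel (\<lambda>x. \<Sum>n. ?h n x)"
    proof (rule integrable_suminf)
      have fin: "emeasure lborel (I n) < \<infinity>" for n by (simp add: I_def emeasure_lborel_Icc_eq)
      show "integrable lborel (?h n)" for n by (intro integrable_mult_right integrable_real_indicator fin) (simp add: I_def)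
      show "AE x in lborel. summable (\<lambda>n. norm (?h n x))"
      proof (rule AE_I2)
        fix x :: real
        have "summable (\<lambda>n. (norm \<eta>)\<^sup>2 * (1 / 64) ^ n)" by (intro summable_mult summable_geometric) simp
        then show "summable (\<lambda>n. norm (?h n x))"
          by (rule summable_comparison_test'[where N = 0]) (auto simp: indicator_def power_one_over)
      qed
      have "(LINT x|lborel. norm (?h n x)) = (norm \<eta>)\<^sup>2 * 2 * (1 / 4) ^ n" for n
      proof -
        have "(LINT x|lborel. norm (?h n x)) = (LINT x|lborel. ?h n x)"
          by (intro Bochner_Integration.integral_cong) (auto simp: indicator_def)
        also have "\<dots> = (norm \<eta>)\<^sup>2 * (1 / 64 ^ n) * (2 * 16 ^ n)" by (simp add: I_def)
        also have "\<dots> = (norm \<eta>)\<^sup>2 * 2 * (16 ^ n / 64 ^ n)" by simp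
        also have "(16 ^ n / 64 ^ n :: real) = (1 / 4) ^ n" by (simp flip: power_divide)
        finally show ?thesis .
      qed
      then show "summable (\<lambda>n. LINT x|lborel. norm (?h n x))" by (auto intro!: summable_mult summable_geometric)
    qed
    fix x
    show "(norm (f k x))\<^sup>2 \<le> (\<Sum>n. ?h n x)"
    proof (cases "\<exists>n. x \<in> I n")
      case True
      then obtain n where n: "x \<in> I n" by blast
      have "(\<lambda>m. ?h m x) sums (\<Sum>m\<in>{n}. ?h m x)" by (rule sums_finite) (use disj n in \<open>auto simp: indicator_def\<close>)
      then have "(\<Sum>n. ?h n x) = (norm \<eta>)\<^sup>2 * (1 / 64 ^ n)" using n by (simp add: sums_iff)
      moreover have "(norm (f k x))\<^sup>2 = (\<rho> k x)\<^sup>2 * (norm \<eta>)\<^sup>2"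
        using v(3) by (simp add: f_def norm_vec_scale norm_mult power_mult_distrib)
      moreover have "(\<rho> k x)\<^sup>2 \<le> 1 / 64 ^ n"
      proof -
        have "(8 ^ n)\<^sup>2 = (64::real) ^ n" by (simp add: power2_eq_square flip: power_mult_distrib)
        then show ?thesis by (auto simp: \<rho>_in[OF n] indicator_def power_divide)
      qed
      ultimately show ?thesis by (simp add: mult.commute mult_left_mono del: times_divide_eq_right times_divide_eq_left)
    next
      case False
      then show ?thesis by (simp add: f_def \<rho>_out)
    qed
  qed (unfold f_def, measurable)
  show ?thesis
  proof (rule that[OF fL])
    show "f k x = 0" if "x < 0" for k x
    proof -
      have "x \<notin> I n" for n using s(1)[of n] that by (auto simp: I_def)
      then show ?thesis by (simp add: f_def \<rho>_out)
    qed
    fix J :: "nat set" and c :: "nat \<Rightarrow> complex" and i and u g :: "real \<Rightarrow> complex ^ 'n"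
    assume J: "finite J" "i \<in> J" "c i \<noteq> 0" and h: "half u g"
    show "\<not> (AE x in lborel. residual B u g x = (\<Sum>k\<in>J. c k *s f k x))"
    proof
      assume AE: "AE x in lborel. residual B u g x = (\<Sum>k\<in>J. c k *s f k x)"
      define D where "D = (2 + \<kappa>) * p * sqrt 2 * l2norm u"
      \<comment> \<open>Testing yields \<open>norm (c i) * 2 ^ n * 4 ^ n \<le> D\<close>; the weaker
        bound is already unbounded in \<open>n\<close>.\<close>
      have key: "norm (c i) * 4 ^ n \<le> D" if n: "n \<in> N i" for n
      proof -
        let ?L = "16 ^ n :: real"
        have "norm (c i / 8 ^ n) * ?L \<le> (2 / ?L + \<kappa> / ?L) * p * (sqrt (2 * ?L) * l2norm u)"
        proof (rule residual_test_estimate[OF B h l p(2) _ v(3) lB, where a = "s n"])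
          show "norm ((B x - Binf) *v w) \<le> \<kappa> / ?L * norm w" if "x \<in> {s n..s n + 2 * ?L}" for x w
          proof -
            have "norm ((B x - Binf) *v w) \<le> norm (B x - Binf) * norm w * \<kappa>" by (rule \<kappa>)
            also have "\<dots> \<le> 1 / ?L * norm w * \<kappa>"
              using X[of n x] s(2)[of n] that \<kappa>(1) by (intro mult_right_mono) (auto simp: dist_norm)
            finally show ?thesis by (simp add: mult_ac)
          qed
          show "AE x in lborel. x \<in> {s n..s n + 2 * ?L} \<longrightarrow> l (residual B u g x) = c i / 8 ^ n * exp (\<mu> * complex_of_real x)"
            using AE
          proof eventually_elim
            case (elim x)
            show ?case
            proof
              assume "x \<in> {s n..s n + 2 * ?L}"
              then have x: "x \<in> I n" by (simp add: I_def)
              have "(\<Sum>k\<in>J. c k *s f k x) = (\<Sum>k\<in>J. if k = i then c i *s f i x else 0)"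
                using n by (intro sum.cong) (auto simp: f_def \<rho>_in[OF x] N_def indicator_def)
              also have "\<dots> = c i *s f i x" using J by simp
              finally show "l (residual B u g x) = c i / 8 ^ n * exp (\<mu> * complex_of_real x)"
                using n by (simp add: elim lsc f_def \<rho>_in[OF x] \<eta> N_def of_real_divide)
            qed
          qed
        qed (use s(1) p(1) in auto)
        also have "\<dots> = D * (4 ^ n / 16 ^ n)"
        proof -
          have "sqrt (2 * ?L) = sqrt 2 * 4 ^ n" by (simp add: real_sqrt_mult real_sqrt_power)
          then show ?thesis by (simp add: D_def field_simps)
        qed
        finally have "norm (c i) * (16 ^ n / 8 ^ n) \<le> D * (4 ^ n / 16 ^ n)" by (simp add: norm_divide norm_power)
        also have "(16 ^ n / 8 ^ n :: real) = 2 ^ n" by (simp flip: power_divide)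
        also have "(4 ^ n / 16 ^ n :: real) = 1 / 4 ^ n" by (simp flip: power_divide) (simp add: power_one_over)
        finally have "norm (c i) * 2 ^ n * 4 ^ n \<le> D" by (simp add: field_simps)
        moreover have "norm (c i) * 4 ^ n \<le> norm (c i) * 2 ^ n * 4 ^ n"
          by (intro mult_right_mono) (auto simp: mult_le_cancel_left1)
        ultimately show ?thesis by linarith
      qed
      have "norm (c i) * real j \<le> D" for j :: nat
      proof -
        have "prod_encode (i, j) \<in> N i" by (simp add: N_def)
        from key[OF this] have "norm (c i) * 4 ^ prod_encode (i, j) \<le> D" .
        moreover have "real j \<le> 4 ^ prod_encode (i, j)"
        proof -
          have "j \<le> prod_encode (i, j)" by (rule le_prod_encode_2)
          then have "real j \<le> real (prod_encode (i, j))" by simp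
          also have "\<dots> \<le> (4::real) ^ prod_encode (i, j)" using of_nat_less_two_power[of "prod_encode (i, j)", where 'a = real]
              power_mono[of "2::real" 4 "prod_encode (i, j)"] by linarith
          finally show ?thesis .
        qed
        ultimately show ?thesis by (meson mult_left_mono norm_ge_zero order_trans)
      qed
      moreover obtain j :: nat where "D / norm (c i) < j" using reals_Archimedean2 by blast
      ultimately show False using J(3) by (metis not_le pos_divide_less_eq zero_less_norm_iff mult.commute)
    qed
  qed
qed

section \<open>Gluing the half-lines\<close>

definition right_part :: "(real \<Rightarrow> complex ^ 'n) \<Rightarrow> real \<Rightarrow> complex ^ 'n" where
  "right_part u = (\<lambda>x. if x < 0 then 0 else u x)"

text \<open>Reflected, so that the left half-line becomes another problem of the form
  \<open>half\<close>.\<close>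

definition left_part :: "(real \<Rightarrow> complex ^ 'n) \<Rightarrow> real \<Rightarrow> complex ^ 'n" where
  "left_part u = (\<lambda>x. if x < 0 then 0 else u (- x))"

definition glue :: "(real \<Rightarrow> complex ^ 'n) \<Rightarrow> (real \<Rightarrow> complex ^ 'n) \<Rightarrow> real \<Rightarrow> complex ^ 'n" where
  "glue u v = (\<lambda>x. if x < 0 then v (- x) else u x)"

lemma L2_reflect:
  fixes f :: "real \<Rightarrow> complex ^ 'n"
  assumes "f \<in> L2" shows "(\<lambda>x. f (- x)) \<in> L2"
proof -
  have "(\<lambda>x. f (- x)) \<in> borel_measurable borel" by (rule measurable_compose[OF _ L2_measurable[OF assms]]) measurable
  moreover have "integrable lborel (\<lambda>x. (norm (f (- x)))\<^sup>2)"
    using lborel_integrable_real_affine[OF L2_integrable_square[OF assms], of "-1" 0] by simp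
  ultimately show ?thesis by (simp add: L2_def)
qed

lemma l2norm_reflect: "l2norm (\<lambda>x. f (- x)) = l2norm f"
  using lborel_integral_real_affine[of "-1" "\<lambda>x. (norm (f x))\<^sup>2" 0] by (simp add: l2norm_def)

lemma set_integral_reflect_interval:
  fixes f :: "real \<Rightarrow> complex ^ 'n"
  shows "(LINT x:{a..b}|lborel. f (- x)) = (LINT x:{-b..-a}|lborel. f x)"
proof -
  have "(LINT x:{-b..-a}|lborel. f x) = (LINT x|lborel. indicator {-b..-a} (- x) *\<^sub>R f (- x))"
    using lborel_integral_real_affine[of "-1" "\<lambda>x. indicator {-b..-a} x *\<^sub>R f x" 0] by (simp add: set_lebesgue_integral_def)
  also have "\<dots> = (LINT x:{a..b}|lborel. f (- x))"
    unfolding set_lebesgue_integral_def by (intro Bochner_Integration.integral_cong) (auto simp: indicator_def)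
  finally show ?thesis ..
qed

lemma L2_right_part:
  assumes "f \<in> L2" shows "right_part f \<in> L2" "l2norm (right_part f) \<le> l2norm f"
proof -
  have [measurable]: "f \<in> borel_measurable borel" using assms by (rule L2_measurable)
  show L: "right_part f \<in> L2" by (rule L2_scaled_bound[OF _ assms, of _ 1]) (auto simp: right_part_def)
  show "l2norm (right_part f) \<le> l2norm f" by (rule l2norm_mono[OF L assms]) (auto simp: right_part_def)
qed

lemma left_part_eq: "left_part f = right_part (\<lambda>x. f (- x))"
  by (simp add: left_part_def right_part_def)

lemma L2_left_part:
  assumes "f \<in> L2" shows "left_part f \<in> L2" "l2norm (left_part f) \<le> l2norm f"
  unfolding left_part_eq using L2_right_part[OF L2_reflect[OF assms]] by (simp_all add: l2norm_reflect)

lemma L2_glue: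
  assumes "f \<in> L2" "g \<in> L2" shows "glue f g \<in> L2" "l2norm (glue f g) \<le> l2norm f + l2norm g"
proof -
  define g' where "g' = (\<lambda>x. if x < 0 then g (- x) else 0)"
  note r = L2_right_part[OF assms(1)]
  have m: "(\<lambda>x. g (- x)) \<in> borel_measurable borel" using L2_reflect[OF assms(2)] by (rule L2_measurable)
  then have g': "g' \<in> L2" by (intro L2_scaled_bound[OF _ L2_reflect[OF assms(2)], of _ 1]) (auto simp: g'_def)
  have "l2norm g' \<le> l2norm (\<lambda>x. g (- x))" by (rule l2norm_mono[OF g' L2_reflect[OF assms(2)]]) (auto simp: g'_def)
  then have n: "l2norm g' \<le> l2norm g" by (simp add: l2norm_reflect)
  have eq: "glue f g = (\<lambda>x. right_part f x + g' x)" by (auto simp: glue_def right_part_def g'_def)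
  show "glue f g \<in> L2" "l2norm (glue f g) \<le> l2norm f + l2norm g"
    unfolding eq using L2_add[OF r(1) g'] l2norm_triangle[OF r(1) g'] r(2) n by auto
qed

lemma half_right_part:
  assumes "u \<in> L2" "has_weak_deriv u v" shows "half (right_part u) (right_part v)"
  unfolding half_def
proof (intro conjI allI impI)
  fix a b :: real assume ab: "0 \<le> a" "a \<le> b"
  have "(LINT x:{a..b}|lborel. right_part v x) = (LINT x:{a..b}|lborel. v x)" unfolding set_lebesgue_integral_def using ab
    by (intro Bochner_Integration.integral_cong) (auto simp: right_part_def indicator_def)
  then show "right_part u b - right_part u a = (LINT x:{a..b}|lborel. right_part v x)"
    using assms(2) ab by (simp add: right_part_def has_weak_deriv_def)
next
  show "right_part u \<in> L2" "right_part v \<in> L2" using assms by (auto simp: has_weak_deriv_def intro: L2_right_part)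
qed (auto simp: right_part_def)

lemma has_weak_deriv_reflect:
  assumes "has_weak_deriv u v" shows "has_weak_deriv (\<lambda>x. u (- x)) (\<lambda>x. - v (- x))"
  unfolding has_weak_deriv_def
proof (intro conjI allI impI)
  show "(\<lambda>x. - v (- x)) \<in> L2" using assms by (auto simp: has_weak_deriv_def intro: L2_minus L2_reflect)
  fix a b :: real assume "a \<le> b"
  then have "u (- a) - u (- b) = (LINT x:{-b..-a}|lborel. v x)" using assms by (simp add: has_weak_deriv_def)
  also have "\<dots> = (LINT x:{a..b}|lborel. v (- x))" by (simp add: set_integral_reflect_interval)
  finally have "u (- b) - u (- a) = - (LINT x:{a..b}|lborel. v (- x))" by (simp add: algebra_simps)
  also have "\<dots> = (LINT x:{a..b}|lborel. - v (- x))" by (simp add: set_lebesgue_integral_def)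
  finally show "u (- b) - u (- a) = (LINT x:{a..b}|lborel. - v (- x))" .
qed

lemma half_left_part:
  assumes "u \<in> L2" "has_weak_deriv u v" shows "half (left_part u) (\<lambda>x. - left_part v x)"
proof -
  have eq: "(\<lambda>x. - left_part v x) = right_part (\<lambda>x. - v (- x))" by (auto simp: left_part_def right_part_def)
  show ?thesis unfolding eq unfolding left_part_eq
    by (rule half_right_part[OF L2_reflect[OF assms(1)] has_weak_deriv_reflect[OF assms(2)]])
qed

text \<open>Equality of the traces removes the jump at 0, the only obstruction to absolute
  continuity of the glued function. The sign before \<open>g2\<close> comes from the
  reflection.\<close>

lemma has_weak_deriv_glue:
  assumes h1: "half u1 g1" and h2: "half u2 g2" and eq: "u1 0 = u2 0"
  shows "has_weak_deriv (glue u1 u2) (glue g1 (\<lambda>x. - g2 x))"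
  unfolding has_weak_deriv_def
proof (intro conjI allI impI)
  let ?g = "glue g1 (\<lambda>x. - g2 x)"
  show gL: "?g \<in> L2" by (intro L2_glue L2_minus halfD[OF h1] halfD[OF h2])
  have pos: "glue u1 u2 b - glue u1 u2 a = (LINT x:{a..b}|lborel. ?g x)" if "0 \<le> a" "a \<le> b" for a b
  proof -
    have "(LINT x:{a..b}|lborel. ?g x) = (LINT x:{a..b}|lborel. g1 x)" unfolding set_lebesgue_integral_def using that
      by (intro Bochner_Integration.integral_cong) (auto simp: glue_def indicator_def)
    then show ?thesis using halfD(5)[OF h1 that] that by (simp add: glue_def)
  qed
  have neg: "glue u1 u2 b - glue u1 u2 a = (LINT x:{a..b}|lborel. ?g x)" if "a \<le> b" "b \<le> 0" for a b
  proof -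
    have [measurable]: "g1 \<in> borel_measurable borel" "g2 \<in> borel_measurable borel" "?g \<in> borel_measurable borel"
      using halfD(2)[OF h1] halfD(2)[OF h2] gL by (auto intro: L2_measurable)
    have "(LINT x:{a..b}|lborel. ?g x) = (LINT x:{a..b}|lborel. - g2 (- x))"
    proof (rule set_lebesgue_integral_cong_AE)
      have "AE x in lborel. x \<noteq> (0::real)" by (rule AE_lborel_singleton)
      then show "AE x\<in>{a..b} in lborel. ?g x = - g2 (- x)" by eventually_elim (use that in \<open>auto simp: glue_def\<close>)
    qed auto
    also have "\<dots> = - (LINT x:{a..b}|lborel. g2 (- x))" by (simp add: set_lebesgue_integral_def)
    also have "\<dots> = - (LINT x:{-b..-a}|lborel. g2 x)" by (simp add: set_integral_reflect_interval)
    also have "\<dots> = u2 (- b) - u2 (- a)" using halfD(5)[OF h2, of "-b" "-a"] that by (simp add: algebra_simps)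
    also have "\<dots> = glue u1 u2 b - glue u1 u2 a" using that eq by (cases "b = 0"; cases "a = 0") (auto simp: glue_def)
    finally show ?thesis ..
  qed
  fix a b :: real assume ab: "a \<le> b"
  consider "0 \<le> a" | "b \<le> 0" | "a < 0" "0 < b" by linarith
  then show "glue u1 u2 b - glue u1 u2 a = (LINT x:{a..b}|lborel. ?g x)"
  proof cases
    case 3
    have "(LINT x:{a..b}|lborel. ?g x) = (LINT x:{a..0}|lborel. ?g x) + (LINT x:{0..b}|lborel. ?g x)"
    proof -
      have i: "set_integrable lborel {c..d} ?g" for c d by (rule L2_norm_set_integrable[OF gL])
      have "{a..b} = {a..0} \<union> {0..b}" using 3 by auto
      moreover have "(LINT x:{a..0} \<union> {0..b}|lborel. ?g x) = (LINT x:{a..0}|lborel. ?g x) + (LINT x:{0..b}|lborel. ?g x)"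
      proof (rule set_integral_Un_AE[OF _ _ _ i i])
        have "AE x in lborel. x \<noteq> (0::real)" by (rule AE_lborel_singleton)
        then show "AE x in lborel. \<not> (x \<in> {a..0} \<and> x \<in> {0..b})" by eventually_elim auto
      qed auto
      ultimately show ?thesis by simp
    qed
    also have "\<dots> = (glue u1 u2 0 - glue u1 u2 a) + (glue u1 u2 b - glue u1 u2 0)" using pos[of 0 b] neg[of a 0] 3 by simp
    finally show ?thesis by simp
  qed (use pos neg ab in auto)
qed

lemma H1_glue:
  assumes "half u1 g1" "half u2 g2" "u1 0 = u2 0" shows "glue u1 u2 \<in> H1"
  using has_weak_deriv_glue[OF assms] L2_glue(1)[OF halfD(1)[OF assms(1)] halfD(1)[OF assms(2)]] by (auto simp: H1_def)

lemma has_weak_deriv_weak_deriv: "u \<in> H1 \<Longrightarrow> has_weak_deriv u (weak_deriv u)"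
  using someI_ex[of "has_weak_deriv u"] by (auto simp: H1_def weak_deriv_def)

lemma weak_deriv_AE:
  assumes "has_weak_deriv u v" "u \<in> L2" shows "AE x in lborel. weak_deriv u x = v x"
proof -
  have "has_weak_deriv u (weak_deriv u)" using assms by (intro has_weak_deriv_weak_deriv) (auto simp: H1_def)
  then show ?thesis using assms(1) by (intro AE_eq_if_interval_integrals_eq) (auto simp: has_weak_deriv_def)
qed

lemma H1_half:
  assumes "u \<in> H1"
  shows "half (right_part u) (right_part (weak_deriv u))"
    "half (left_part u) (\<lambda>x. - left_part (weak_deriv u) x)"
  using assms has_weak_deriv_weak_deriv[OF assms] by (auto simp: H1_def intro: half_right_part half_left_part)

lemma parts_at_0 [simp]: "right_part u 0 = u 0" "left_part u 0 = u 0"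
  by (simp_all add: right_part_def left_part_def)

text \<open>A half-line function with prescribed trace \<open>v\<close>. It serves to extend
  half-line functions across 0 and to turn vectors into right-hand sides.\<close>

definition decaying_exp :: "complex ^ 'n \<Rightarrow> real \<Rightarrow> complex ^ 'n" where
  "decaying_exp v = (\<lambda>x. indicator {0..} x *\<^sub>R (exp (- x) *\<^sub>R v))"

lemma half_decaying_exp:
  shows "half (decaying_exp v) (\<lambda>x. - decaying_exp v x)" "l2norm (decaying_exp v) \<le> norm v"
    "decaying_exp v 0 = v"
proof -
  have c: "continuous_on S (\<lambda>x. exp (- x) *\<^sub>R v)" for S :: "real set" by (intro continuous_intros)
  have "(LINT x:{0..y}|lborel. (norm (exp (- x) *\<^sub>R v))\<^sup>2) \<le> (norm v)\<^sup>2" if "y \<ge> 0" for y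
  proof -
    have "(LINT x:{0..y}|lborel. (norm (exp (- x) *\<^sub>R v))\<^sup>2) \<le> (LINT x:{0..y}|lborel. exp (- x) * (norm v)\<^sup>2)"
    proof (rule set_integral_mono)
      show "set_integrable lborel {0..y} (\<lambda>x. (norm (exp (- x) *\<^sub>R v))\<^sup>2)"
        "set_integrable lborel {0..y} (\<lambda>x. exp (- x) * (norm v)\<^sup>2)"
        by (auto intro!: borel_integrable_atLeastAtMost' continuous_intros)
      fix x :: real assume "x \<in> {0..y}"
      then have "exp (- x) * exp (- x) \<le> exp (- x) * 1" by (intro mult_left_mono) auto
      then show "(norm (exp (- x) *\<^sub>R v))\<^sup>2 \<le> exp (- x) * (norm v)\<^sup>2"
        by (simp add: power_mult_distrib power2_eq_square[of "exp _"] mult_right_mono)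
    qed
    also have "\<dots> = (- exp (- y) * (norm v)\<^sup>2) - (- exp (- 0) * (norm v)\<^sup>2)" unfolding set_lebesgue_integral_def
      by (rule integral_FTC_Icc[OF that])
        (auto intro!: derivative_eq_intros continuous_intros simp flip: has_real_derivative_iff_has_vector_derivative)
    also have "\<dots> \<le> (norm v)\<^sup>2" by simp
    finally show ?thesis .
  qed
  from L2_if_truncations_bounded[OF c norm_ge_zero this]
  have L: "decaying_exp v \<in> L2" and n: "l2norm (decaying_exp v) \<le> norm v" unfolding decaying_exp_def by auto
  show "l2norm (decaying_exp v) \<le> norm v" by (rule n)
  show "decaying_exp v 0 = v" by (simp add: decaying_exp_def)
  show "half (decaying_exp v) (\<lambda>x. - decaying_exp v x)" unfolding half_def
  proof (intro conjI allI impI L L2_minus)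
    fix a b :: real assume ab: "0 \<le> a" "a \<le> b"
    have "(LINT x:{a..b}|lborel. - decaying_exp v x) = (LINT x:{a..b}|lborel. - exp (- x) *\<^sub>R v)"
      unfolding set_lebesgue_integral_def using ab
      by (intro Bochner_Integration.integral_cong) (auto simp: decaying_exp_def indicator_def)
    also have "\<dots> = exp (- b) *\<^sub>R v - exp (- a) *\<^sub>R v" unfolding set_lebesgue_integral_def by (rule integral_FTC_Icc[OF ab(2)])
        (auto intro!: derivative_eq_intros continuous_intros)
    finally show "decaying_exp v b - decaying_exp v a = (LINT x:{a..b}|lborel. - decaying_exp v x)"
      using ab by (simp add: decaying_exp_def)
  qed (auto simp: decaying_exp_def)
qed

text \<open>Coefficient of the reflected equation: if \<open>u' = A u\<close>, then
  \<open>u (- x)\<close> has derivative \<open>- A (- x)\<close> applied to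
  \<open>u (- x)\<close>.\<close>

definition left_coeff :: "(real \<Rightarrow> complex \<Rightarrow> complex ^ 'n ^ 'n) \<Rightarrow> complex \<Rightarrow> real \<Rightarrow> complex ^ 'n ^ 'n" where
  "left_coeff A z x = - A (- x) z"

lemma matrix_uminus_vector: "(- M) *v v = - (M *v (v :: complex ^ 'n))"
  by (simp add: matrix_vector_mult_def vec_eq_iff sum_negf)

lemma right_part_ode_op:
  "right_part (ode_op A z u) = residual (\<lambda>x. A x z) (right_part u) (right_part (weak_deriv u))"
  by (auto simp: right_part_def ode_op_def residual_def)

lemma left_part_ode_op:
  "left_part (ode_op A z u) = (\<lambda>x. - residual (left_coeff A z) (left_part u) (\<lambda>x. - left_part (weak_deriv u) x) x)"
  by (auto simp: left_part_def ode_op_def residual_def left_coeff_def matrix_uminus_vector)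

lemma AE_reflect:
  assumes "AE x in lborel. P x" shows "AE x in lborel. P (- x :: real)"
proof -
  have "AE x in distr lborel borel uminus. P x" unfolding lborel_distr_uminus by (rule assms)
  then have "AE x in lborel. P (- x)" by (rule AE_distrD[rotated]) simp
  then show ?thesis .
qed

lemma AE_parts:
  assumes "AE x in lborel. f x = g x"
  shows "AE x in lborel. right_part f x = right_part g x" "AE x in lborel. left_part f x = left_part g x"
  using assms AE_reflect[OF assms] by (auto simp: right_part_def left_part_def)

lemma bounded_coeff_if_limits:
  fixes B :: "real \<Rightarrow> complex ^ 'n ^ 'n"
  assumes "continuous_on UNIV B" "(B \<longlongrightarrow> Bp) at_top" "(B \<longlongrightarrow> Bm) at_bot"
  obtains \<beta> where "bounded_coeff \<beta> B"
proof -
  have "\<forall>\<^sub>F x in at_top. dist (B x) Bp < 1" "\<forall>\<^sub>F x in at_bot. dist (B x) Bm < 1" using assms(2,3) by (auto intro: tendstoD)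
  then obtain a b where ab: "\<And>x. x \<ge> a \<Longrightarrow> dist (B x) Bp < 1" "\<And>x. x \<le> b \<Longrightarrow> dist (B x) Bm < 1"
    by (auto simp: eventually_at_top_linorder eventually_at_bot_linorder)
  have "compact (B ` {b..a})" by (intro compact_continuous_image continuous_on_subset[OF assms(1)]) auto
  then obtain M where M: "\<And>x. x \<in> {b..a} \<Longrightarrow> norm (B x) \<le> M" using compact_imp_bounded bounded_iff by (metis imageI)
  define K where "K = max M (max (norm Bp + 1) (norm Bm + 1))"
  have K: "norm (B x) \<le> K" for x
  proof -
    consider "x \<in> {b..a}" | "x \<ge> a" | "x \<le> b" by fastforce
    then show ?thesis
    proof cases
      case 1 then show ?thesis using M[of x] by (simp add: K_def)
    next
      case 2 then show ?thesis using ab(1)[of x] norm_triangle_ineq2[of "B x" Bp] by (simp add: K_def dist_norm)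
    next
      case 3 then show ?thesis using ab(2)[of x] norm_triangle_ineq2[of "B x" Bm] by (simp add: K_def dist_norm)
    qed
  qed
  obtain \<kappa> where \<kappa>: "\<kappa> > 0" "\<And>(M :: complex ^ 'n ^ 'n) v. norm (M *v v) \<le> norm M * norm v * \<kappa>"
    using bounded_bilinear.pos_bounded[OF bounded_bilinear_matrix_vector] by metis
  have "norm (B x *v v) \<le> K * \<kappa> * norm v" for x v
  proof -
    have "norm (B x) * norm v * \<kappa> \<le> K * norm v * \<kappa>" using K \<kappa> by (intro mult_right_mono) auto
    then show ?thesis using \<kappa>(2)[of "B x" v] by (simp add: mult_ac)
  qed
  moreover have "K * \<kappa> \<ge> 0" using \<kappa> norm_ge_zero[of Bp] by (auto simp: K_def le_max_iff_disj intro!: mult_nonneg_nonneg)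
  ultimately show ?thesis using that assms(1) by (auto simp: bounded_coeff_def)
qed

lemma edim_linear_image:
  assumes lin: "Vector_Spaces.linear s1 s2 f" and V: "module.subspace s1 V" and inj: "inj_on f V"
  shows "edim s2 (f ` V) = edim s1 V"
proof -
  interpret Vector_Spaces.linear s1 s2 f by fact
  obtain B where B: "B \<subseteq> V" "vs1.independent B" "V \<subseteq> vs1.span B" "card B = vs1.dim V" using vs1.basis_exists[of V] .
  have spB: "vs1.span B = V" using B(1,3) V vs1.span_minimal by blast
  have injB: "inj_on f (vs1.span B)" using inj spB by simp
  have ind: "vs2.independent (f ` B)" by (rule independent_injective_image[OF B(2) injB])
  have spf: "vs2.span (f ` B) = f ` V" by (simp add: span_image spB)
  have injB': "inj_on f B" using inj B(1) inj_on_subset by blast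
  have "(\<exists>C. finite C \<and> f ` V \<subseteq> vs2.span C) \<longleftrightarrow> (\<exists>C. finite C \<and> V \<subseteq> vs1.span C)"
  proof
    assume "\<exists>C. finite C \<and> f ` V \<subseteq> vs2.span C"
    then obtain C where C: "finite C" "f ` V \<subseteq> vs2.span C" by blast
    have "f ` B \<subseteq> vs2.span C" using C(2) B(1) by blast
    then have "finite (f ` B)" using vs2.independent_span_bound[OF C(1) ind] by blast
    then have "finite B" using injB' finite_imageD by blast
    then show "\<exists>C. finite C \<and> V \<subseteq> vs1.span C" using B(3) by blast
  next
    assume "\<exists>C. finite C \<and> V \<subseteq> vs1.span C"
    then obtain C where C: "finite C" "V \<subseteq> vs1.span C" by blast
    have "f ` V \<subseteq> f ` vs1.span C" using C(2) by (rule image_mono)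
    also have "\<dots> = vs2.span (f ` C)" by (rule span_image[symmetric])
    finally show "\<exists>C. finite C \<and> f ` V \<subseteq> vs2.span C" using C(1) by blast
  qed
  moreover have "vs2.dim (f ` V) = vs1.dim V" using vs2.dim_eq_card[OF _ ind, of "f ` V"] B(4) card_image[OF injB']
    by (metis spf vs2.span_span)
  ultimately show ?thesis by (simp add: edim_def)
qed

lemma edim_vec: "edim (*s) (V :: (complex ^ 'n) set) = enat (vec.dim V)"
proof -
  obtain B where B: "B \<subseteq> V" "vec.independent B" "V \<subseteq> vec.span B" "card B = vec.dim V" using vec.basis_exists[of V] .
  then have "finite B" using vec.independent_bound_general by blast
  then show ?thesis using B(3) by (auto simp: edim_def)
qed

text \<open>The conclusions of \<open>half_line_dichotomy\<close> at a single parameter value, with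
  only the fibre at \<open>x = 0\<close> kept. Here \<open>C\<close> may depend on the parameter;
  \<open>uniform_dichotomy\<close> repairs this.\<close>

definition dichotomy :: "(real \<Rightarrow> complex ^ 'n ^ 'n) \<Rightarrow> (complex ^ 'n) set \<Rightarrow> bool" where
  "dichotomy B E0 \<longleftrightarrow> vec.subspace E0 \<and> (\<exists>\<beta>. bounded_coeff \<beta> B) \<and> (\<exists>C\<ge>0.
    (\<forall>e\<in>E0. \<exists>u g. half u g \<and> (\<forall>x. residual B u g x = 0) \<and> u 0 = e) \<and>
    (\<forall>u g. half u g \<longrightarrow> (\<exists>e\<in>E0. norm (u 0 - e) \<le> C * l2norm (residual B u g))) \<and>
    (\<forall>u g. half u g \<longrightarrow> l2norm u \<le> C * (norm (u 0) + l2norm (residual B u g))))"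

text \<open>The last claim holds at every point, not just almost everywhere: the norms of both
  \<open>u\<close> and its derivative vanish, and the Sobolev bound is pointwise.\<close>

lemma dichotomyD:
  assumes "dichotomy B E0"
  shows "vec.subspace E0" "e \<in> E0 \<Longrightarrow> \<exists>u g. half u g \<and> (\<forall>x. residual B u g x = 0) \<and> u 0 = e"
    "half u g \<Longrightarrow> l2norm (residual B u g) = 0 \<Longrightarrow> u 0 \<in> E0"
    "half u g \<Longrightarrow> l2norm (residual B u g) = 0 \<Longrightarrow> u 0 = 0 \<Longrightarrow> u x = 0"
proof -
  obtain C where C: "C \<ge> 0"
    "\<forall>e\<in>E0. \<exists>u g. half u g \<and> (\<forall>x. residual B u g x = 0) \<and> u 0 = e"
    "\<forall>u g. half u g \<longrightarrow> (\<exists>e\<in>E0. norm (u 0 - e) \<le> C * l2norm (residual B u g))"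
    "\<forall>u g. half u g \<longrightarrow> l2norm u \<le> C * (norm (u 0) + l2norm (residual B u g))" using assms unfolding dichotomy_def by blast
  show "vec.subspace E0" using assms by (simp add: dichotomy_def)
  show "e \<in> E0 \<Longrightarrow> \<exists>u g. half u g \<and> (\<forall>x. residual B u g x = 0) \<and> u 0 = e" using C(2) by blast
  assume h: "half u g" and r: "l2norm (residual B u g) = 0"
  obtain e where "e \<in> E0" "norm (u 0 - e) \<le> C * l2norm (residual B u g)" using C(3) h by blast
  then show "u 0 \<in> E0" using r by simp
  assume u0: "u 0 = 0"
  have "l2norm u \<le> 0" using C(4)[rule_format, OF h] r u0 by simp
  then have "l2norm u = 0" using l2norm_nonneg[of u] by linarith
  then have ae: "AE x in lborel. u x = 0" using l2norm_eq_0_iff[OF halfD(1)[OF h]] by simp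
  obtain \<beta> where B: "bounded_coeff \<beta> B" using assms by (auto simp: dichotomy_def)
  have "l2norm g \<le> 0" using l2norm_derivative_le[OF B h] r \<open>l2norm u = 0\<close> by simp
  then have "l2norm g = 0" using l2norm_nonneg[of g] by linarith
  then show "u x = 0" using half_Sobolev[OF h, of x] \<open>l2norm u = 0\<close> halfD(3)[OF h, of x] by (cases "x \<ge> 0") auto
qed

lemma residual_add: "residual B (\<lambda>x. u x + v x) (\<lambda>x. g x + k x) = (\<lambda>x. residual B u g x + residual B v k x)"
  by (simp add: residual_def fun_eq_iff matrix_vector_right_distrib)

lemma residual_scale: "residual B (\<lambda>x. c *s u x) (\<lambda>x. c *s g x) = (\<lambda>x. c *s residual B u g x)"
  by (simp add: residual_def fun_eq_iff matrix_vector_mult_vec_scale vec.scale_right_diff_distrib)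

lemma residual_diff: "residual B (\<lambda>x. u x - v x) (\<lambda>x. g x - k x) = (\<lambda>x. residual B u g x - residual B v k x)"
  by (simp add: residual_def fun_eq_iff matrix_vector_mult_diff_distrib)

lemma residual_sum: "residual B (\<lambda>x. \<Sum>i\<in>I. u i x) (\<lambda>x. \<Sum>i\<in>I. g i x) = (\<lambda>x. \<Sum>i\<in>I. residual B (u i) (g i) x)"
  by (induction I rule: infinite_finite_induct) (simp_all add: residual_add, simp_all add: residual_def)

lemma residual_neg_half:
  assumes "half u g" "x < 0" shows "residual B u g x = 0"
  using halfD(3,4)[OF assms(1), of x] assms(2) by (simp add: residual_def)

section \<open>Reflection of spectral subspaces and of transported families\<close>

lemma gen_eigenspace_uminus: "gen_eigenspace (- B) (- \<mu>) = gen_eigenspace B \<mu>"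
proof -
  have "((\<lambda>w. (- B) *v w - (- \<mu>) *s w) ^^ k) v = (- 1) ^ k *s ((\<lambda>w. B *v w - \<mu> *s w) ^^ k) v" for k v
  proof (induction k)
    case (Suc k)
    then show ?case
      by (simp add: matrix_uminus_vector matrix_vector_mult_vec_scale vec.scale_right_diff_distrib vec.scale_left_commute)
  qed simp
  then show ?thesis by (simp add: gen_eigenspace_def vec.scale_eq_0_iff)
qed

lemma stable_space_uminus: "stable_space (- B) = unstable_space B"
proof -
  have "(\<Union>\<mu>\<in>{\<mu>. Re \<mu> < 0}. gen_eigenspace (- B) \<mu>) = (\<Union>\<mu>\<in>{\<mu>. Re \<mu> > 0}. gen_eigenspace B \<mu>)"
  proof (intro equalityI subsetI)
    fix v assume "v \<in> (\<Union>\<mu>\<in>{\<mu>. Re \<mu> < 0}. gen_eigenspace (- B) \<mu>)"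
    then obtain \<mu> where "Re \<mu> < 0" "v \<in> gen_eigenspace (- B) (- (- \<mu>))" by auto
    then show "v \<in> (\<Union>\<mu>\<in>{\<mu>. Re \<mu> > 0}. gen_eigenspace B \<mu>)" unfolding gen_eigenspace_uminus by force
  next
    fix v assume "v \<in> (\<Union>\<mu>\<in>{\<mu>. Re \<mu> > 0}. gen_eigenspace B \<mu>)"
    then obtain \<mu> where "Re \<mu> > 0" "v \<in> gen_eigenspace (- B) (- \<mu>)" unfolding gen_eigenspace_uminus by blast
    then show "v \<in> (\<Union>\<mu>\<in>{\<mu>. Re \<mu> < 0}. gen_eigenspace (- B) \<mu>)" by force
  qed
  then show ?thesis by (simp add: stable_space_def unstable_space_def)
qed

lemma transported_half_right:
  assumes "transported_family B at_top V E" shows "transported_half B E V"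
  unfolding transported_half_def
proof (intro conjI allI ballI)
  fix x v assume v: "v \<in> E x"
  have E: "E y = {u y | u. (\<forall>t. (u has_vector_derivative B t *v u t) (at t)) \<and> u x \<in> E x}" for x y
    using assms by (auto simp: transported_family_def)
  obtain w where w: "\<forall>t. (w has_vector_derivative B t *v w t) (at t)" "w x = v" using v by (subst (asm) E[of x x]) auto
  then have "w y \<in> E y" for y using v by (subst E[of y x]) auto
  then show "\<exists>w. (\<forall>t. (w has_vector_derivative B t *v w t) (at t)) \<and> w x = v \<and> (\<forall>y. w y \<in> E y)" using w by blast
qed (use assms in \<open>auto simp: transported_family_def\<close>)

lemma transported_half_left:
  assumes "transported_family (\<lambda>x. A x z) at_bot V E"
  shows "transported_half (left_coeff A z) (\<lambda>x. E (- x)) V"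
  unfolding transported_half_def
proof (intro conjI allI ballI)
  fix x v assume v: "v \<in> E (- x)"
  have E: "E y = {u y | u. (\<forall>t. (u has_vector_derivative A t z *v u t) (at t)) \<and> u x \<in> E x}" for x y
    using assms by (auto simp: transported_family_def)
  obtain w where w: "\<forall>t. (w has_vector_derivative A t z *v w t) (at t)" "w (- x) = v"
    using v by (subst (asm) E[of "- x" "- x"]) auto
  have Ew: "w y \<in> E y" for y using v w by (subst E[of y "- x"]) auto
  have "((\<lambda>t. w (- t)) has_vector_derivative left_coeff A z t *v w (- t)) (at t)" for t
  proof -
    have "(w \<circ> uminus has_vector_derivative (- 1) *\<^sub>R (A (- t) z *v w (- t))) (at t)"
      by (rule vector_diff_chain_at) (use w(1) in \<open>auto intro!: derivative_eq_intros\<close>)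
    then show ?thesis by (simp add: o_def left_coeff_def matrix_uminus_vector)
  qed
  then show "\<exists>w. (\<forall>t. (w has_vector_derivative left_coeff A z t *v w t) (at t)) \<and> w x = v \<and> (\<forall>y. w y \<in> E (- y))"
    using w(2) Ew by (intro exI[of _ "\<lambda>t. w (- t)"]) auto
next
  show "((\<lambda>x. gap (E (- x)) V) \<longlongrightarrow> 0) at_top" using assms by (simp add: transported_family_def filterlim_at_bot_mirror)
qed (use assms in \<open>auto simp: transported_family_def\<close>)

section \<open>Operators that are linear up to null sets: range, kernel and what the Fredholm
  property yields\<close>

lemma H1_lincomb:
  assumes "u \<in> H1" "v \<in> H1" shows "cscale c u + v \<in> H1"
proof -
  have u: "u \<in> L2" and v: "v \<in> L2" using assms by (auto simp: H1_def)
  note du = has_weak_deriv_weak_deriv[OF assms(1)] and dv = has_weak_deriv_weak_deriv[OF assms(2)]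
  have "has_weak_deriv (cscale c u + v) (\<lambda>x. c *s weak_deriv u x + weak_deriv v x)" unfolding has_weak_deriv_def
  proof (intro conjI allI impI)
    have L: "weak_deriv u \<in> L2" "weak_deriv v \<in> L2" using du dv by (auto simp: has_weak_deriv_def)
    show "(\<lambda>x. c *s weak_deriv u x + weak_deriv v x) \<in> L2" by (intro L2_add L2_scale L)
    fix a b :: real assume ab: "a \<le> b"
    have "(LINT x:{a..b}|lborel. c *s weak_deriv u x + weak_deriv v x) =
        c *s (LINT x:{a..b}|lborel. weak_deriv u x) + (LINT x:{a..b}|lborel. weak_deriv v x)"
      by (simp add: set_integral_add L2_norm_set_integrable L2_scale L set_integral_vec_scale)
    also have "\<dots> = c *s (u b - u a) + (v b - v a)" using du dv ab by (simp add: has_weak_deriv_def)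
    finally show "(cscale c u + v) b - (cscale c u + v) a = (LINT x:{a..b}|lborel. c *s weak_deriv u x + weak_deriv v x)"
      by (simp add: cscale_def vec.scale_right_diff_distrib)
  qed
  moreover have "cscale c u + v \<in> L2" using L2_add[OF L2_scale[OF u] v, of c] by (simp add: cscale_def plus_fun_def)
  ultimately show ?thesis by (auto simp: H1_def)
qed

lemma bounded_H1_L2_lincomb_AE:
  assumes S: "bounded_H1_L2 S" and that: "u \<in> H1" "v \<in> H1"
  shows "AE x in lborel. S (cscale c u + v) x = c *s S u x + S v x"
proof -
  have SL: "S u \<in> L2" if "u \<in> H1" for u using S that by (auto simp: bounded_H1_L2_def)
  have L: "(\<lambda>x. c *s S u x + S v x) \<in> L2" by (intro L2_add L2_scale SL that)
  have eq: "S (cscale c u + v) - (cscale c (S u) + S v) = (\<lambda>x. S (cscale c u + v) x - (c *s S u x + S v x))"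
    by (simp add: fun_eq_iff cscale_def)
  have "l2norm (\<lambda>x. S (cscale c u + v) x - (c *s S u x + S v x)) = 0"
    using S that unfolding eq[symmetric] by (simp add: bounded_H1_L2_def)
  then show ?thesis using l2norm_eq_0_iff[OF L2_diff[OF SL[OF H1_lincomb[OF that]] L]] by simp
qed

lemma subspace_range:
  assumes "bounded_H1_L2 S" shows "module.subspace cscale (range_H1_L2 S)"
proof -
  interpret vector_space "cscale :: _ \<Rightarrow> (real \<Rightarrow> complex ^ 'a) \<Rightarrow> _" by (rule vector_space_cscale)
  have SL: "S u \<in> L2" if "u \<in> H1" for u using assms that by (auto simp: bounded_H1_L2_def)
  note H1 = H1_lincomb and lin = bounded_H1_L2_lincomb_AE[OF assms]
  have zero: "(\<lambda>x. 0) \<in> H1" by (auto simp: H1_def has_weak_deriv_def set_lebesgue_integral_def intro!: exI[of _ "\<lambda>x. 0"])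
  have range_iff: "f \<in> range_H1_L2 S \<longleftrightarrow> f \<in> L2 \<and> (\<exists>u\<in>H1. AE x in lborel. f x = S u x)" for f
  proof -
    have "l2norm (f - S u) = 0 \<longleftrightarrow> (AE x in lborel. f x = S u x)" if "f \<in> L2" "u \<in> H1" for u
      using l2norm_eq_0_iff[OF L2_diff[OF that(1) SL[OF that(2)]]] by (simp add: fun_diff_def)
    then show ?thesis by (auto simp: range_H1_L2_def)
  qed
  show ?thesis
  proof (rule subspaceI)
    have "AE x in lborel. S (\<lambda>x. 0) x = 0"
    proof -
      have e: "cscale 1 (\<lambda>x. 0) + (\<lambda>x. 0) = (\<lambda>x. 0 :: complex ^ 'a)" by (simp add: cscale_def fun_eq_iff)
      show ?thesis using lin[OF zero zero, of 1] unfolding e by simp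
    qed
    then show "0 \<in> range_H1_L2 S" using zero by (auto simp: range_iff)
    fix f g c assume f: "f \<in> range_H1_L2 S"
    then obtain u where u: "f \<in> L2" "u \<in> H1" "AE x in lborel. f x = S u x" by (auto simp: range_iff)
    have *: "cscale c f + g \<in> range_H1_L2 S" if g: "g \<in> range_H1_L2 S" for c g
    proof -
      obtain v where v: "g \<in> L2" "v \<in> H1" "AE x in lborel. g x = S v x" using g by (auto simp: range_iff)
      have "AE x in lborel. (cscale c f + g) x = S (cscale c u + v) x"
        using u(3) v(3) lin[OF u(2) v(2), of c] by eventually_elim (simp add: cscale_def)
      moreover have "cscale c f + g \<in> L2" using L2_add[OF L2_scale[OF u(1)] v(1), of c] by (simp add: cscale_def plus_fun_def)
      ultimately show ?thesis using H1[OF u(2) v(2)] by (auto simp: range_iff)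
    qed
    show "f + g \<in> range_H1_L2 S" if "g \<in> range_H1_L2 S" using *[OF that, of 1] by (simp add: cscale_def)
    show "cscale c f \<in> range_H1_L2 S" using *[OF \<open>0 \<in> range_H1_L2 S\<close>, of c] by simp
  qed
qed

lemma range_H1_L2D:
  assumes "bounded_H1_L2 S" "f \<in> range_H1_L2 S"
  obtains u where "u \<in> H1" "AE x in lborel. S u x = f x"
proof -
  obtain u where u: "f \<in> L2" "u \<in> H1" "l2norm (f - S u) = 0" using assms(2) by (auto simp: range_H1_L2_def)
  have "S u \<in> L2" using assms(1) u(2) by (auto simp: bounded_H1_L2_def)
  then have "AE x in lborel. f x - S u x = 0" using l2norm_eq_0_iff[OF L2_diff[OF u(1)]] u(3) by (simp add: fun_diff_def)
  then have "AE x in lborel. S u x = f x" by (auto elim: eventually_mono)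
  with u that show ?thesis by blast
qed

lemma sum_cscale: "(\<Sum>k\<in>I. cscale (c k) (f k)) x = (\<Sum>k\<in>I. c k *s f k x)"
  by (induction I rule: infinite_finite_induct) (simp_all add: cscale_def)

text \<open>If the range has codimension \<open>k\<close>, some nontrivial combination of
  \<open>k + 1\<close> resonant functions lies in it. These vanish for \<open>x < 0\<close>, so the
  right part of a preimage is a half-line function with exactly that residual, which is impossible.
  For the other end the functions are reflected.\<close>

lemma hyperbolic_limits:
  assumes fr: "fredholm_H1_L2 (ode_op A z)"
    and Br: "bounded_coeff \<beta> (\<lambda>x. A x z)" and Bl: "bounded_coeff \<beta>' (left_coeff A z)"
    and lim: "((\<lambda>x. A x z) \<longlongrightarrow> Ap) at_top" "(left_coeff A z \<longlongrightarrow> Am') at_top"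
  shows "hyperbolic Ap" "hyperbolic Am'"
proof -
  have bd: "bounded_H1_L2 (ode_op A z)" using fr by (simp add: fredholm_H1_L2_def)
  obtain k where k: "ecodim cscale (range_H1_L2 (ode_op A z)) L2 = enat k"
    using fr unfolding fredholm_H1_L2_def by (cases "ecodim cscale (range_H1_L2 (ode_op A z)) L2") auto
  have dep: "\<exists>c u i. i \<in> {..k} \<and> c i \<noteq> 0 \<and> u \<in> H1 \<and> (AE x in lborel. ode_op A z u x = (\<Sum>i\<in>{..k}. c i *s f i x))"
    if "\<And>i. f i \<in> L2" for f
  proof -
    obtain c where c: "\<exists>i\<in>{..k}. c i \<noteq> 0" "(\<Sum>i\<in>{..k}. cscale (c i) (f i)) \<in> range_H1_L2 (ode_op A z)"
      using dependent_if_card_gt_ecodim[OF vector_space_cscale subspace_range[OF bd] k, of "{..k}" f] \<open>\<And>i. f i \<in> L2\<close> by auto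
    obtain u where "u \<in> H1" "AE x in lborel. ode_op A z u x = (\<Sum>i\<in>{..k}. cscale (c i) (f i)) x" using range_H1_L2D[OF bd c(2)] .
    then show ?thesis using c(1) unfolding sum_cscale by blast
  qed
  show "hyperbolic Ap"
  proof (rule ccontr)
    assume nh: "\<not> hyperbolic Ap"
    obtain f :: "nat \<Rightarrow> real \<Rightarrow> complex ^ 'a" where f: "\<And>k. f k \<in> L2" "\<And>k x. x < 0 \<Longrightarrow> f k x = 0"
      "\<And>I c i u g. finite I \<Longrightarrow> i \<in> I \<Longrightarrow> c i \<noteq> 0 \<Longrightarrow> half u g \<Longrightarrow>
      \<not> (AE x in lborel. residual (\<lambda>x. A x z) u g x = (\<Sum>k\<in>I. c k *s f k x))"
      by (rule infinite_codimension_if_not_hyperbolic[OF Br lim(1) nh]) (rule that, assumption+)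
    obtain c u i where c: "i \<in> {..k}" "c i \<noteq> 0" "u \<in> H1" "AE x in lborel. ode_op A z u x = (\<Sum>i\<in>{..k}. c i *s f i x)"
      using dep[of f] f(1) by blast
    have "AE x in lborel. residual (\<lambda>x. A x z) (right_part u) (right_part (weak_deriv u)) x = (\<Sum>i\<in>{..k}. c i *s f i x)"
      using AE_parts(1)[OF c(4)] unfolding right_part_ode_op
    proof eventually_elim
      case (elim x)
      then show ?case using f(2)[of x] by (cases "x < 0") (auto simp: right_part_def)
    qed
    with f(3)[of "{..k}" i c, OF finite_atMost c(1,2) H1_half(1)[OF c(3)]] show False by simp
  qed
  show "hyperbolic Am'"
  proof (rule ccontr)
    assume nh: "\<not> hyperbolic Am'"
    obtain f :: "nat \<Rightarrow> real \<Rightarrow> complex ^ 'a" where f: "\<And>k. f k \<in> L2" "\<And>k x. x < 0 \<Longrightarrow> f k x = 0"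
      "\<And>I c i u g. finite I \<Longrightarrow> i \<in> I \<Longrightarrow> c i \<noteq> 0 \<Longrightarrow> half u g \<Longrightarrow>
      \<not> (AE x in lborel. residual (left_coeff A z) u g x = (\<Sum>k\<in>I. c k *s f k x))"
      by (rule infinite_codimension_if_not_hyperbolic[OF Bl lim(2) nh]) (rule that, assumption+)
    obtain c u i where c: "i \<in> {..k}" "c i \<noteq> 0" "u \<in> H1"
      "AE x in lborel. ode_op A z u x = (\<Sum>i\<in>{..k}. c i *s f i (- x))"
      using dep[of "\<lambda>i x. f i (- x)"] L2_reflect[OF f(1)] by blast
    have "AE x in lborel. residual (left_coeff A z) (left_part u) (\<lambda>x. - left_part (weak_deriv u) x) x =
        (\<Sum>i\<in>{..k}. (- c i) *s f i x)" using AE_parts(2)[OF c(4)] unfolding left_part_ode_op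
    proof eventually_elim
      case (elim x)
      then have "residual (left_coeff A z) (left_part u) (\<lambda>x. - left_part (weak_deriv u) x) x =
          - left_part (\<lambda>x. \<Sum>i\<in>{..k}. c i *s f i (- x)) x" by (metis minus_minus)
      then show ?case using f(2)[of x] by (cases "x < 0") (auto simp: left_part_def sum_negf)
    qed
    with f(3)[of "{..k}" i "\<lambda>i. - c i", OF finite_atMost c(1) _ H1_half(2)[OF c(3)]] c(2) show False by simp
  qed
qed

lemma L2_ode_op:
  assumes "bounded_H1_L2 (ode_op A z)" "u \<in> H1"
  shows "ode_op A z u \<in> L2"
  using assms by (auto simp: bounded_H1_L2_def)

lemma half_residual_le_ode_op:
  assumes "bounded_H1_L2 (ode_op A z)" "u \<in> H1"
  shows "l2norm (residual (\<lambda>x. A x z) (right_part u) (right_part (weak_deriv u))) \<le> l2norm (ode_op A z u)"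
    "l2norm (residual (left_coeff A z) (left_part u) (\<lambda>x. - left_part (weak_deriv u) x)) \<le> l2norm (ode_op A z u)"
  using L2_right_part(2)[OF L2_ode_op[OF assms]] L2_left_part(2)[OF L2_ode_op[OF assms]]
  unfolding right_part_ode_op left_part_ode_op l2norm_minus by auto

lemma ode_op_glue:
  assumes h: "half u1 g1" "half u2 g2" "u1 0 = u2 0"
  shows "AE x in lborel. ode_op A z (glue u1 u2) x =
    glue (residual (\<lambda>x. A x z) u1 g1) (\<lambda>x. - residual (left_coeff A z) u2 g2 x) x"
proof -
  have "AE x in lborel. weak_deriv (glue u1 u2) x = glue g1 (\<lambda>x. - g2 x) x"
    by (rule weak_deriv_AE[OF has_weak_deriv_glue[OF h] L2_glue(1)[OF halfD(1)[OF h(1)] halfD(1)[OF h(2)]]])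
  then show ?thesis by eventually_elim (auto simp: ode_op_def glue_def residual_def left_coeff_def matrix_uminus_vector)
qed

lemma linear_eval_at_0: "Vector_Spaces.linear cscale (*s) (\<lambda>u :: real \<Rightarrow> complex ^ 'n. u 0)"
  unfolding Vector_Spaces.linear_iff using vector_space_cscale vec.vector_space_axioms by (simp add: cscale_def)

lemma subspace_kernel:
  assumes "bounded_H1_L2 S" shows "module.subspace cscale (ker_H1_L2 S)"
proof -
  interpret vector_space "cscale :: _ \<Rightarrow> (real \<Rightarrow> complex ^ 'a) \<Rightarrow> _" by (rule vector_space_cscale)
  have SL: "S u \<in> L2" if "u \<in> H1" for u using assms that by (auto simp: bounded_H1_L2_def)
  have iff: "u \<in> ker_H1_L2 S \<longleftrightarrow> u \<in> H1 \<and> (AE x in lborel. S u x = 0)" for u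
    using l2norm_eq_0_iff[OF SL] by (auto simp: ker_H1_L2_def)
  have comb: "cscale c u + v \<in> ker_H1_L2 S" if "u \<in> ker_H1_L2 S" "v \<in> ker_H1_L2 S" for c u v
  proof -
    have "AE x in lborel. S u x = 0" "AE x in lborel. S v x = 0" using that by (auto simp: iff)
    moreover have "AE x in lborel. S (cscale c u + v) x = c *s S u x + S v x"
      using that by (intro bounded_H1_L2_lincomb_AE assms) (auto simp: iff)
    ultimately have "AE x in lborel. S (cscale c u + v) x = 0" by eventually_elim simp
    then show ?thesis using that by (auto simp: iff intro: H1_lincomb)
  qed
  have zH: "(\<lambda>x. 0) \<in> H1" by (auto simp: H1_def has_weak_deriv_def set_lebesgue_integral_def intro!: exI[of _ "\<lambda>x. 0"])
  have e: "cscale 1 (\<lambda>x. 0) + (\<lambda>x. 0) = (\<lambda>x. 0 :: complex ^ 'a)" by (simp add: cscale_def fun_eq_iff)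
  have "AE x in lborel. S (\<lambda>x. 0) x = 0" using bounded_H1_L2_lincomb_AE[OF assms zH zH, of 1] unfolding e by simp
  then have z: "0 \<in> ker_H1_L2 S" using zH by (simp add: iff zero_fun_def)
  show ?thesis
  proof (rule subspaceI)
    show "u + v \<in> ker_H1_L2 S" if "u \<in> ker_H1_L2 S" "v \<in> ker_H1_L2 S" for u v
      using comb[OF that, of 1] by (simp add: cscale_def)
    show "cscale c u \<in> ker_H1_L2 S" if "u \<in> ker_H1_L2 S" for c u using comb[OF that z, of c] by simp
  qed (rule z)
qed

text \<open>Evaluation at 0 is the isomorphism. Both parts of a kernel element solve homogeneous
  half-line problems, two solutions with a common trace can be glued, and the trace determines each
  part.\<close>

lemma kernel_ode_op:
  assumes bd: "bounded_H1_L2 (ode_op A z)"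
    and Es: "dichotomy (\<lambda>x. A x z) Es" and Eu: "dichotomy (left_coeff A z) Eu"
  shows "(\<lambda>u. u 0) ` ker_H1_L2 (ode_op A z) = Es \<inter> Eu" "inj_on (\<lambda>u. u 0) (ker_H1_L2 (ode_op A z))"
    "edim cscale (ker_H1_L2 (ode_op A z)) = enat (vec.dim (Es \<inter> Eu))"
proof -
  let ?K = "ker_H1_L2 (ode_op A z)"
  have uK: "l2norm (residual (\<lambda>x. A x z) (right_part u) (right_part (weak_deriv u))) = 0"
    "l2norm (residual (left_coeff A z) (left_part u) (\<lambda>x. - left_part (weak_deriv u) x)) = 0"
    "u \<in> H1" if "u \<in> ?K" for u
  proof -
    show u: "u \<in> H1" using that by (simp add: ker_H1_L2_def)
    show "l2norm (residual (\<lambda>x. A x z) (right_part u) (right_part (weak_deriv u))) = 0"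
      "l2norm (residual (left_coeff A z) (left_part u) (\<lambda>x. - left_part (weak_deriv u) x)) = 0"
      using half_residual_le_ode_op[OF bd u] that by (auto simp: ker_H1_L2_def intro: antisym)
  qed
  show im: "(\<lambda>u. u 0) ` ?K = Es \<inter> Eu"
  proof (intro equalityI subsetI)
    fix e assume "e \<in> (\<lambda>u. u 0) ` ?K"
    then obtain u where u: "u \<in> ?K" "e = u 0" by blast
    show "e \<in> Es \<inter> Eu" using dichotomyD(3)[OF Es H1_half(1)[OF uK(3)[OF u(1)]] uK(1)[OF u(1)]]
        dichotomyD(3)[OF Eu H1_half(2)[OF uK(3)[OF u(1)]] uK(2)[OF u(1)]] u(2) by simp
  next
    fix e assume e: "e \<in> Es \<inter> Eu"
    obtain u1 g1 where 1: "half u1 g1" "\<And>x. residual (\<lambda>x. A x z) u1 g1 x = 0" "u1 0 = e"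
      using dichotomyD(2)[OF Es, of e] e by blast
    obtain u2 g2 where 2: "half u2 g2" "\<And>x. residual (left_coeff A z) u2 g2 x = 0" "u2 0 = e"
      using dichotomyD(2)[OF Eu, of e] e by blast
    have eq: "u1 0 = u2 0" using 1 2 by simp
    have H: "glue u1 u2 \<in> H1" by (rule H1_glue[OF 1(1) 2(1) eq])
    have "AE x in lborel. ode_op A z (glue u1 u2) x = 0"
      using ode_op_glue[OF 1(1) 2(1) eq, of A z] by eventually_elim (simp add: glue_def 1(2) 2(2))
    then have "l2norm (ode_op A z (glue u1 u2)) = 0" using l2norm_eq_0_iff[OF L2_ode_op[OF bd H]] by simp
    then have "glue u1 u2 \<in> ?K" using H by (simp add: ker_H1_L2_def)
    moreover have "glue u1 u2 0 = e" using 1(3) by (simp add: glue_def)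
    ultimately show "e \<in> (\<lambda>u. u 0) ` ?K" by blast
  qed
  have sub: "module.subspace cscale ?K" by (rule subspace_kernel[OF bd])
  interpret vector_space "cscale :: _ \<Rightarrow> (real \<Rightarrow> complex ^ 'a) \<Rightarrow> _" by (rule vector_space_cscale)
  show inj: "inj_on (\<lambda>u. u 0) ?K"
  proof (rule inj_onI)
    fix u v assume uv: "u \<in> ?K" "v \<in> ?K" "u 0 = v 0"
    define w where "w = u - v"
    have w: "w \<in> ?K" unfolding w_def by (rule subspace_diff[OF sub uv(1,2)])
    have w0: "w 0 = 0" using uv(3) by (simp add: w_def)
    have "right_part w x = 0" "left_part w x = 0" for x using dichotomyD(4)[OF Es H1_half(1)[OF uK(3)[OF w]] uK(1)[OF w]]
        dichotomyD(4)[OF Eu H1_half(2)[OF uK(3)[OF w]] uK(2)[OF w]] w0 by auto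
    then have "right_part w x = 0" "left_part w (- x) = 0" for x by auto
    then have "w x = 0" for x by (cases "x < 0") (metis left_part_def minus_minus neg_0_less_iff_less not_less_iff_gr_or_eq, metis right_part_def)
    then have "u x = v x" for x by (simp add: w_def)
    then show "u = v" by blast
  qed
  have "edim (*s) ((\<lambda>u. u 0) ` ?K) = edim cscale ?K" by (rule edim_linear_image[OF linear_eval_at_0 sub inj])
  then show "edim cscale ?K = enat (vec.dim (Es \<inter> Eu))" unfolding im edim_vec by simp
qed

text \<open>\<open>D\<close> completes a basis of \<open>S + T\<close> to a basis of the whole
  space. As the dimensions add up to \<open>CARD('n)\<close>, what \<open>S + T\<close> misses is as
  large as the overlap \<open>S \<inter> T\<close>.\<close>

lemma exists_complement_indices:
  fixes S T :: "(complex ^ 'n) set"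
  assumes S: "vec.subspace S" and T: "vec.subspace T" and dim: "vec.dim S + vec.dim T = CARD('n)"
  obtains D where "finite D" "card D \<ge> vec.dim (S \<inter> T)"
    "\<And>c s t d. s \<in> S \<Longrightarrow> t \<in> T \<Longrightarrow> (\<Sum>d\<in>D. c d *s d) = s + t \<Longrightarrow> d \<in> D \<Longrightarrow> c d = 0"
proof -
  obtain C where C: "C \<subseteq> S \<inter> T" "vec.independent C" "S \<inter> T \<subseteq> vec.span C" "card C = vec.dim (S \<inter> T)"
    using vec.basis_exists[of "S \<inter> T"] .
  obtain CS where CS: "C \<subseteq> CS" "CS \<subseteq> S" "vec.independent CS" "S \<subseteq> vec.span CS"
    using vec.maximal_independent_subset_extend[of C S] C by auto
  obtain CT where CT: "C \<subseteq> CT" "CT \<subseteq> T" "vec.independent CT" "T \<subseteq> vec.span CT"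
    using vec.maximal_independent_subset_extend[of C T] C by auto
  have fin: "finite CS" "finite CT" using CS(3) CT(3) vec.independent_bound_general by blast+
  have card: "card CS = vec.dim S" "card CT = vec.dim T"
    by (rule vec.basis_card_eq_dim[OF CS(2,4,3)], rule vec.basis_card_eq_dim[OF CT(2,4,3)])
  obtain B where B: "B \<subseteq> CS \<union> CT" "vec.independent B" "CS \<union> CT \<subseteq> vec.span B" using vec.basis_exists[of "CS \<union> CT"] by metis
  obtain B' where B': "B \<subseteq> B'" "vec.independent B'" "UNIV \<subseteq> vec.span B'"
    using vec.maximal_independent_subset_extend[of B UNIV] B by auto
  have finB': "finite B'" using B'(2) vec.independent_bound_general by blast
  have "card B' = CARD('n)" using vec.basis_card_eq_dim[of B' UNIV] B' by (simp add: vec.dim_UNIV card_cart_basis)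
  moreover have "card B + vec.dim (S \<inter> T) \<le> CARD('n)"
  proof -
    have "card B \<le> card (CS \<union> CT)" using B(1) fin by (intro card_mono) auto
    moreover have "card CS + card CT = card (CS \<union> CT) + card (CS \<inter> CT)" by (rule card_Un_Int[OF fin])
    moreover have "card C \<le> card (CS \<inter> CT)" using CS(1) CT(1) fin by (intro card_mono) auto
    ultimately show ?thesis using card dim C(4) by simp
  qed
  ultimately have cardD: "card (B' - B) \<ge> vec.dim (S \<inter> T)"
    using card_Diff_subset[of B B'] B'(1) finB' finite_subset by fastforce
  show ?thesis
  proof (rule that[of "B' - B"])
    fix c :: "complex ^ 'n \<Rightarrow> complex" and s t d
    assume st: "s \<in> S" "t \<in> T" "(\<Sum>d\<in>B' - B. c d *s d) = s + t" and d: "d \<in> B' - B"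
    have "vec.span (CS \<union> CT) \<subseteq> vec.span B" using B(3) by (intro vec.span_minimal vec.subspace_span)
    moreover have "s \<in> vec.span (CS \<union> CT)" "t \<in> vec.span (CS \<union> CT)"
      using st CS(4) CT(4) vec.span_mono[of CS "CS \<union> CT"] vec.span_mono[of CT "CS \<union> CT"] by auto
    ultimately have "s + t \<in> vec.span B" by (blast intro: vec.span_add)
    moreover have finB: "finite B" using B'(1) finB' finite_subset by blast
    ultimately obtain a where a: "s + t = (\<Sum>b\<in>B. a b *s b)" unfolding vec.span_finite[OF finB] by auto
    define u where "u = (\<lambda>b. if b \<in> B then - a b else c b)"
    have "(\<Sum>b\<in>B'. u b *s b) = (\<Sum>b\<in>B. u b *s b) + (\<Sum>b\<in>B' - B. u b *s b)"
      using B'(1) finB' by (subst sum.subset_diff[of B]) (auto simp: add.commute)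
    also have "(\<Sum>b\<in>B. u b *s b) = - (s + t)" unfolding a by (simp add: u_def sum_negf)
    also have "(\<Sum>b\<in>B' - B. u b *s b) = s + t" unfolding st(3)[symmetric] by (intro sum.cong) (auto simp: u_def)
    finally have "(\<Sum>b\<in>B'. u b *s b) = 0" by simp
    then have "u d = 0" using vec.independentD[OF B'(2) finB' subset_refl] d by auto
    then show "c d = 0" using d by (simp add: u_def)
  qed (use cardD finB' in auto)
qed

text \<open>With index 0 the range has codimension \<open>vec.dim (Es \<inter> Eu)\<close>, and this
  is already used up by the residuals \<open>fd d\<close> of decaying exponentials with traces
  \<open>d \<in> D\<close>: a combination of them in the range would put a combination of
  \<open>D\<close> into \<open>Es + Eu\<close>. Adding \<open>f\<close> forces a relation modulo the
  range in which \<open>f\<close> occurs. Dividing by its coefficient solves both half-line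
  problems, with unrelated traces at 0.\<close>

lemma half_problems_solvable:
  fixes A :: "real \<Rightarrow> complex \<Rightarrow> complex ^ 'n ^ 'n"
  assumes fr: "fredholm_H1_L2 (ode_op A z)" and ind: "fredholm_index (ode_op A z) = 0"
    and Es: "dichotomy (\<lambda>x. A x z) Es" and Eu: "dichotomy (left_coeff A z) Eu"
    and dim: "vec.dim Es + vec.dim Eu = CARD('n)" and f: "f \<in> L2"
  obtains u1 g1 u2 g2 where "half u1 g1" "AE x in lborel. residual (\<lambda>x. A x z) u1 g1 x = right_part f x"
    "half u2 g2" "AE x in lborel. residual (left_coeff A z) u2 g2 x = left_part f x"
proof -
  let ?T = "ode_op A z" and ?k = "vec.dim (Es \<inter> Eu)"
  have bd: "bounded_H1_L2 ?T" using fr by (simp add: fredholm_H1_L2_def)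
  have k: "ecodim cscale (range_H1_L2 ?T) L2 = enat ?k"
  proof -
    obtain j where j: "ecodim cscale (range_H1_L2 ?T) L2 = enat j"
      using fr unfolding fredholm_H1_L2_def by (cases "ecodim cscale (range_H1_L2 ?T) L2") auto
    then show ?thesis using ind kernel_ode_op(3)[OF bd Es Eu] by (simp add: fredholm_index_def)
  qed
  obtain D where D: "finite D" "card D \<ge> ?k"
    "\<And>c s t d. s \<in> Es \<Longrightarrow> t \<in> Eu \<Longrightarrow> (\<Sum>d\<in>D. c d *s d) = s + t \<Longrightarrow> d \<in> D \<Longrightarrow> c d = 0"
    by (rule exists_complement_indices[OF dichotomyD(1)[OF Es] dichotomyD(1)[OF Eu] dim]) (rule that, assumption+)
  \<comment> \<open>Used as a right-hand side on the whole line. For \<open>d \<noteq> 0\<close> the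
    exponential itself jumps at 0, so it is no preimage in \<open>H1\<close>.\<close>
  define fd where "fd = (\<lambda>d. residual (\<lambda>x. A x z) (decaying_exp d) (\<lambda>x. - decaying_exp d x))"
  define F where "F = (\<lambda>i. case i of None \<Rightarrow> f | Some d \<Rightarrow> fd d)"
  define I where "I = insert None (Some ` D)"
  have I: "finite I" "?k < card I" using D by (auto simp: I_def card_image)
  obtain \<beta> where \<beta>: "bounded_coeff \<beta> (\<lambda>x. A x z)" using Es by (auto simp: dichotomy_def)
  have fdL: "fd d \<in> L2" for d unfolding fd_def by (rule L2_residual[OF \<beta> half_decaying_exp(1)])
  have FL: "F i \<in> L2" for i using f fdL by (simp add: F_def split: option.split)
  obtain c where c: "\<exists>i\<in>I. c i \<noteq> 0" "(\<Sum>i\<in>I. cscale (c i) (F i)) \<in> range_H1_L2 ?T"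
    using dependent_if_card_gt_ecodim[OF vector_space_cscale subspace_range[OF bd] k I, of F] FL by auto
  obtain u where u: "u \<in> H1" "AE x in lborel. ?T u x = (\<Sum>i\<in>I. cscale (c i) (F i)) x" using range_H1_L2D[OF bd c(2)] .
  define h where "h = (\<lambda>x. \<Sum>d\<in>D. c (Some d) *s decaying_exp d x)"
  define h' where "h' = (\<lambda>x. \<Sum>d\<in>D. c (Some d) *s (- decaying_exp d x))"
  have hh: "half h h'" unfolding h_def h'_def by (intro half_sum half_scale half_decaying_exp)
  have resh: "residual (\<lambda>x. A x z) h h' = (\<lambda>x. \<Sum>d\<in>D. c (Some d) *s fd d x)"
    unfolding h_def h'_def residual_sum residual_scale fd_def ..
  have Tu: "AE x in lborel. ?T u x = c None *s f x + (\<Sum>d\<in>D. c (Some d) *s fd d x)"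
  proof -
    have "(\<Sum>i\<in>I. c i *s F i x) = c None *s f x + (\<Sum>d\<in>D. c (Some d) *s fd d x)" for x
      unfolding I_def using D(1) by (simp add: sum.reindex F_def)
    then show ?thesis using u(2) unfolding sum_cscale by simp
  qed
  define w where "w = (\<lambda>x. right_part u x - h x)"
  define w' where "w' = (\<lambda>x. right_part (weak_deriv u) x - h' x)"
  have hw: "half w w'" unfolding w_def w'_def by (rule half_diff[OF H1_half(1)[OF u(1)] hh])
  have resw: "AE x in lborel. residual (\<lambda>x. A x z) w w' x = c None *s right_part f x"
    using AE_parts(1)[OF Tu] unfolding right_part_ode_op w_def w'_def residual_diff resh
  proof eventually_elim
    case (elim x)
    show ?case
    proof (cases "x < 0")
      case True
      then show ?thesis using residual_neg_half[OF H1_half(1)[OF u(1)] True]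
        by (simp add: right_part_def fd_def residual_neg_half[OF half_decaying_exp(1) True])
    next
      case False
      then show ?thesis using elim by (simp add: right_part_def)
    qed
  qed
  let ?lu = "left_part u" and ?lg = "\<lambda>x. - left_part (weak_deriv u) x"
  have hl: "half ?lu ?lg" by (rule H1_half(2)[OF u(1)])
  \<comment> \<open>The reflection reverses the sign of the residual, hence \<open>- c None\<close>.
    The exponentials do not contribute: on the left they vanish except at the single point
    0.\<close>
  have resl: "AE x in lborel. residual (left_coeff A z) ?lu ?lg x = - c None *s left_part f x"
    using AE_parts(2)[OF Tu] AE_lborel_singleton[of 0] unfolding left_part_ode_op
  proof eventually_elim
    case (elim x)
    show ?case
    proof (cases "x < 0")
      case True
      then show ?thesis using residual_neg_half[OF hl] by (simp add: left_part_def)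
    next
      case False
      have "residual (left_coeff A z) ?lu ?lg x = - (c None *s f (- x) + (\<Sum>d\<in>D. c (Some d) *s fd d (- x)))"
        using elim False by (simp add: left_part_def minus_equation_iff)
      also have "(\<Sum>d\<in>D. c (Some d) *s fd d (- x)) = 0"
        using False elim(2) by (simp add: fd_def residual_neg_half[OF half_decaying_exp(1)])
      finally show ?thesis using False by (simp add: left_part_def)
    qed
  qed
  obtain \<beta>' where \<beta>': "bounded_coeff \<beta>' (left_coeff A z)" using Eu by (auto simp: dichotomy_def)
  \<comment> \<open>Without \<open>f\<close>, the function \<open>u - h\<close> on the right and
    \<open>u\<close> on the left would solve homogeneous problems, so \<open>h 0\<close> would lie
    in \<open>Es + Eu\<close>, contrary to the choice of \<open>D\<close>.\<close>
  have cN: "c None \<noteq> 0"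
  proof
    assume c0: "c None = 0"
    have "l2norm (residual (\<lambda>x. A x z) w w') = 0" using l2norm_eq_0_iff[OF L2_residual[OF \<beta> hw]] resw c0 by simp
    from dichotomyD(3)[OF Es hw this] have 1: "u 0 - h 0 \<in> Es" by (simp add: w_def)
    have "l2norm (residual (left_coeff A z) ?lu ?lg) = 0" using l2norm_eq_0_iff[OF L2_residual[OF \<beta>' hl]] resl c0 by simp
    from dichotomyD(3)[OF Eu hl this] have 2: "u 0 \<in> Eu" by simp
    have "h 0 = (\<Sum>d\<in>D. c (Some d) *s d)" by (simp add: h_def half_decaying_exp)
    then have "(\<Sum>d\<in>D. c (Some d) *s d) = - (u 0 - h 0) + u 0" by simp
    from D(3)[OF vec.subspace_neg[OF dichotomyD(1)[OF Es] 1] 2 this] c(1) c0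
    show False by (auto simp: I_def)
  qed
  show ?thesis
  proof (rule that)
    show "half (\<lambda>x. (1 / c None) *s w x) (\<lambda>x. (1 / c None) *s w' x)" by (rule half_scale[OF hw])
    show "AE x in lborel. residual (\<lambda>x. A x z) (\<lambda>x. (1 / c None) *s w x) (\<lambda>x. (1 / c None) *s w' x) x = right_part f x"
      using resw unfolding residual_scale by eventually_elim (use cN in simp)
    show "half (\<lambda>x. (- 1 / c None) *s ?lu x) (\<lambda>x. (- 1 / c None) *s ?lg x)" by (rule half_scale[OF hl])
    show "AE x in lborel. residual (left_coeff A z) (\<lambda>x. (- 1 / c None) *s ?lu x) (\<lambda>x. (- 1 / c None) *s ?lg x) x = left_part f x"
      using resl unfolding residual_scale by eventually_elim (use cN in simp)
  qed
qed

section \<open>Uniform dependence on the parameter\<close>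

lemma h1norm_le: "h1norm u \<le> l2norm u + l2norm (weak_deriv u)"
  unfolding h1norm_def by (rule sqrt_sum_squares_le_sum) auto

lemma h1norm_nonneg: "h1norm u \<ge> 0"
  by (simp add: h1norm_def)

text \<open>Differentiability in operator norm with \<open>\<epsilon> = 1\<close>: near
  \<open>z\<close> the difference quotients differ from the bounded derivative by an operator of
  norm at most 1.\<close>

lemma pencil_Lipschitz:
  fixes T :: "complex \<Rightarrow> (real \<Rightarrow> complex ^ 'n) \<Rightarrow> real \<Rightarrow> complex ^ 'n"
  assumes T: "analytic_pencil_H1_L2 T \<Omega>" and "open \<Omega>" "z \<in> \<Omega>"
  obtains K \<delta> where "K \<ge> 0" "\<delta> > 0" "ball z \<delta> \<subseteq> \<Omega>"
    "\<And>\<mu> u. \<mu> \<in> ball z \<delta> \<Longrightarrow> u \<in> H1 \<Longrightarrow> l2norm (\<lambda>x. T \<mu> u x - T z u x) \<le> K * norm (\<mu> - z) * h1norm u"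
proof -
  have bd: "bounded_H1_L2 (T \<mu>)" if "\<mu> \<in> \<Omega>" for \<mu> using T that by (auto simp: analytic_pencil_H1_L2_def)
  obtain D where D: "bounded_H1_L2 D"
    and lim: "\<And>\<epsilon>. \<epsilon> > 0 \<Longrightarrow> \<forall>\<^sub>F \<mu> in at z. \<forall>u\<in>H1. l2norm (cscale (1 / (\<mu> - z)) (T \<mu> u - T z u) - D u) \<le> \<epsilon> * h1norm u"
    using T assms(3) unfolding analytic_pencil_H1_L2_def by blast
  obtain C where C: "\<And>u. u \<in> H1 \<Longrightarrow> l2norm (D u) \<le> C * h1norm u" using D unfolding bounded_H1_L2_def by blast
  obtain \<delta>1 where \<delta>1: "\<delta>1 > 0" "\<And>\<mu> u. \<mu> \<noteq> z \<Longrightarrow> dist \<mu> z < \<delta>1 \<Longrightarrow> u \<in> H1 \<Longrightarrow>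
      l2norm (cscale (1 / (\<mu> - z)) (T \<mu> u - T z u) - D u) \<le> 1 * h1norm u" using lim[of 1] unfolding eventually_at by auto
  obtain \<delta>2 where \<delta>2: "\<delta>2 > 0" "ball z \<delta>2 \<subseteq> \<Omega>" using assms(2,3) open_contains_ball by blast
  show ?thesis
  proof (rule that[of "\<bar>C\<bar> + 1" "min \<delta>1 \<delta>2"])
    fix \<mu> and u :: "real \<Rightarrow> complex ^ 'n" assume \<mu>: "\<mu> \<in> ball z (min \<delta>1 \<delta>2)" and u: "u \<in> H1"
    show "l2norm (\<lambda>x. T \<mu> u x - T z u x) \<le> (\<bar>C\<bar> + 1) * norm (\<mu> - z) * h1norm u"
    proof (cases "\<mu> = z")
      case False
      have L: "T \<mu> u \<in> L2" "T z u \<in> L2" "D u \<in> L2" using bd[of \<mu>] bd[of z] \<mu> \<delta>2 assms(3) u D by (auto simp: bounded_H1_L2_def)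
      define q where "q = (\<lambda>x. (1 / (\<mu> - z)) *s (T \<mu> u x - T z u x))"
      have qL: "q \<in> L2" unfolding q_def by (intro L2_scale L2_diff L)
      have eq: "cscale (1 / (\<mu> - z)) (T \<mu> u - T z u) - D u = (\<lambda>x. q x - D u x)" by (simp add: fun_eq_iff cscale_def q_def)
      have "l2norm (\<lambda>x. q x - D u x) \<le> h1norm u" using \<delta>1(2)[OF False _ u] \<mu> unfolding eq by (simp add: dist_commute)
      moreover have "l2norm q = l2norm (\<lambda>x. (q x - D u x) + D u x)" by simp
      moreover have "l2norm (\<lambda>x. (q x - D u x) + D u x) \<le> l2norm (\<lambda>x. q x - D u x) + l2norm (D u)"
        by (intro l2norm_triangle L2_diff qL L)
      moreover have "l2norm (D u) \<le> \<bar>C\<bar> * h1norm u"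
        using C[OF u] mult_right_mono[OF abs_ge_self h1norm_nonneg, of C u] by linarith
      ultimately have "l2norm q \<le> (\<bar>C\<bar> + 1) * h1norm u" by (simp add: algebra_simps)
      then have "norm (\<mu> - z) * l2norm q \<le> norm (\<mu> - z) * ((\<bar>C\<bar> + 1) * h1norm u)" by (intro mult_left_mono) auto
      moreover have "norm (\<mu> - z) * l2norm q = l2norm (\<lambda>x. T \<mu> u x - T z u x)"
        using False unfolding l2norm_scale[symmetric] q_def by simp
      ultimately show ?thesis by (simp add: mult_ac)
    qed simp
  qed (use \<delta>1 \<delta>2 in auto)
qed

text \<open>The bound for the pencil transferred to half-line functions. Such a function, extended
  by 0, need not be in \<open>H1\<close>, so \<open>l2norm u + l2norm g\<close> takes the place of
  \<open>h1norm\<close>.\<close>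

definition half_Lipschitz :: "(complex \<Rightarrow> real \<Rightarrow> complex ^ 'n ^ 'n) \<Rightarrow> complex \<Rightarrow> real \<Rightarrow> real \<Rightarrow> bool" where
  "half_Lipschitz B z K \<delta> \<longleftrightarrow> K \<ge> 0 \<and> \<delta> > 0 \<and> (\<forall>\<mu>\<in>ball z \<delta>. \<forall>u g. half u g \<longrightarrow>
    l2norm (\<lambda>x. B \<mu> x *v u x - B z x *v u x) \<le> K * norm (\<mu> - z) * (l2norm u + l2norm g))"

text \<open>Before the estimate of the pencil can be applied, a half-line function is glued to a
  decaying exponential with the same trace on the other side. By \<open>half_Sobolev\<close> the
  trace, and with it the extension, is controlled by \<open>l2norm u + l2norm g\<close>.\<close>

lemma half_Lipschitz_if_pencil:
  assumes T: "analytic_pencil_H1_L2 (ode_op A) \<Omega>" and "open \<Omega>" "z \<in> \<Omega>"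
  obtains K \<delta> where "ball z \<delta> \<subseteq> \<Omega>" "half_Lipschitz (\<lambda>\<mu> x. A x \<mu>) z K \<delta>" "half_Lipschitz (left_coeff A) z K \<delta>"
proof -
  obtain K \<delta> where K: "K \<ge> 0" "\<delta> > 0" "ball z \<delta> \<subseteq> \<Omega>"
    "\<And>\<mu> u. \<mu> \<in> ball z \<delta> \<Longrightarrow> u \<in> H1 \<Longrightarrow> l2norm (\<lambda>x. ode_op A \<mu> u x - ode_op A z u x) \<le> K * norm (\<mu> - z) * h1norm u"
    by (rule pencil_Lipschitz[OF assms]) (rule that, assumption+)
  have LT: "ode_op A \<mu> u \<in> L2" if "\<mu> \<in> \<Omega>" "u \<in> H1" for \<mu> u
    using T that by (auto simp: analytic_pencil_H1_L2_def bounded_H1_L2_def)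
  define h where "h = (\<lambda>u :: real \<Rightarrow> complex ^ 'a. decaying_exp (u 0))"
  note he = half_decaying_exp
  \<comment> \<open>The exponential and its derivative each cost at most
    \<open>l2norm u + l2norm g\<close>, which the factor 4 covers with room to spare.\<close>
  have bound: "h1norm w \<le> 4 * (l2norm u + l2norm g)" "w \<in> H1"
    if hu: "half u g" and w: "w = glue u (h u) \<or> w = glue (h u) u" for u g and w :: "real \<Rightarrow> complex ^ 'a"
  proof -
    have u0: "norm (u 0) \<le> l2norm u + l2norm g" by (rule half_Sobolev[OF hu]) simp
    have nh: "l2norm (h u) \<le> norm (u 0)" unfolding h_def by (rule he)
    have *: "h1norm w \<le> 4 * (l2norm u + l2norm g)" "w \<in> H1"
      if h1: "half u1 g1" and h2: "half u2 g2" and e: "u1 0 = u2 0" and w: "w = glue u1 u2"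
        and n: "l2norm u1 + l2norm u2 + (l2norm g1 + l2norm g2) \<le> 4 * (l2norm u + l2norm g)"
      for u1 g1 u2 g2
    proof -
      show "w \<in> H1" unfolding w by (rule H1_glue[OF h1 h2 e])
      have L: "glue u1 u2 \<in> L2" "l2norm (glue u1 u2) \<le> l2norm u1 + l2norm u2"
        using L2_glue[OF halfD(1)[OF h1] halfD(1)[OF h2]] by auto
      have L': "glue g1 (\<lambda>x. - g2 x) \<in> L2" "l2norm (glue g1 (\<lambda>x. - g2 x)) \<le> l2norm g1 + l2norm g2"
        using L2_glue[OF halfD(2)[OF h1] L2_minus[OF halfD(2)[OF h2]]] by (auto simp: l2norm_minus)
      have wd: "has_weak_deriv w (weak_deriv w)" by (rule has_weak_deriv_weak_deriv[OF \<open>w \<in> H1\<close>])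
      have "l2norm (weak_deriv w) = l2norm (glue g1 (\<lambda>x. - g2 x))" unfolding w
        by (rule l2norm_cong_AE[OF _ L'(1) weak_deriv_AE[OF has_weak_deriv_glue[OF h1 h2 e] L(1)]])
          (use wd w in \<open>simp add: has_weak_deriv_def\<close>)
      then show "h1norm w \<le> 4 * (l2norm u + l2norm g)" using h1norm_le[of w] L(2) L'(2) n w by simp
    qed
    have hh: "half (h u) (\<lambda>x. - h u x)" "h u 0 = u 0" unfolding h_def by (rule he)+
    have n: "l2norm (h u) \<le> l2norm u + l2norm g" "l2norm (\<lambda>x. - h u x) \<le> l2norm u + l2norm g"
      using nh u0 by (auto simp: l2norm_minus)
    have n0: "l2norm u \<ge> 0" "l2norm g \<ge> 0" by simp_all
    have sm: "l2norm u + l2norm (h u) + (l2norm g + l2norm (\<lambda>x. - h u x)) \<le> 4 * (l2norm u + l2norm g)"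
      "l2norm (h u) + l2norm u + (l2norm (\<lambda>x. - h u x) + l2norm g) \<le> 4 * (l2norm u + l2norm g)"
    proof -
      have e: "l2norm (\<lambda>x. - h u x) = l2norm (h u)" by (rule l2norm_minus)
      have "H \<le> U + G \<Longrightarrow> 0 \<le> U + G \<Longrightarrow> U + H + (G + H) \<le> 4 * (U + G) \<and> H + U + (H + G) \<le> 4 * (U + G)" for H U G :: real
        by (intro conjI; argo)
      from this[OF n(1)]
      show "l2norm u + l2norm (h u) + (l2norm g + l2norm (\<lambda>x. - h u x)) \<le> 4 * (l2norm u + l2norm g)"
        "l2norm (h u) + l2norm u + (l2norm (\<lambda>x. - h u x) + l2norm g) \<le> 4 * (l2norm u + l2norm g)" unfolding e by simp_all
    qed
    from w show "h1norm w \<le> 4 * (l2norm u + l2norm g)"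
    proof
      assume "w = glue u (h u)"
      then show ?thesis by (rule *(1)[OF hu hh(1) hh(2)[symmetric]]) (rule sm)
    next
      assume "w = glue (h u) u"
      then show ?thesis by (rule *(1)[OF hh(1) hu hh(2)]) (rule sm)
    qed
    from w show "w \<in> H1"
    proof
      assume "w = glue u (h u)"
      then show ?thesis by (rule *(2)[OF hu hh(1) hh(2)[symmetric]]) (rule sm)
    next
      assume "w = glue (h u) u"
      then show ?thesis by (rule *(2)[OF hh(1) hu hh(2)]) (rule sm)
    qed
  qed
  have zO: "z \<in> \<Omega>" by fact
  have r: "half_Lipschitz (\<lambda>\<mu> x. A x \<mu>) z (4 * K) \<delta>" unfolding half_Lipschitz_def
  proof (intro conjI ballI allI impI)
    fix \<mu> and u g :: "real \<Rightarrow> complex ^ 'a" assume \<mu>: "\<mu> \<in> ball z \<delta>" and hu: "half u g"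
    define w where "w = glue u (h u)"
    have w: "h1norm w \<le> 4 * (l2norm u + l2norm g)" "w \<in> H1" using bound[OF hu] w_def by auto
    have D: "(\<lambda>x. ode_op A \<mu> w x - ode_op A z w x) \<in> L2" using LT w(2) \<mu> K(3) zO by (intro L2_diff) auto
    have "l2norm (\<lambda>x. A x \<mu> *v u x - A x z *v u x) = l2norm (right_part (\<lambda>x. ode_op A \<mu> w x - ode_op A z w x))"
      by (rule l2norm_cong_norm)
        (auto simp: right_part_def ode_op_def w_def glue_def halfD(3)[OF hu] norm_minus_commute)
    also have "\<dots> \<le> l2norm (\<lambda>x. ode_op A \<mu> w x - ode_op A z w x)" by (rule L2_right_part(2)[OF D])
    also have "\<dots> \<le> K * norm (\<mu> - z) * h1norm w" by (rule K(4)[OF \<mu> w(2)])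
    also have "\<dots> \<le> K * norm (\<mu> - z) * (4 * (l2norm u + l2norm g))" using K(1) w(1) by (intro mult_left_mono) auto
    also have "\<dots> = 4 * K * norm (\<mu> - z) * (l2norm u + l2norm g)" by (simp only: mult.assoc mult.left_commute)
    finally show "l2norm (\<lambda>x. A x \<mu> *v u x - A x z *v u x) \<le> 4 * K * norm (\<mu> - z) * (l2norm u + l2norm g)" .
  qed (use K in auto)
  have l: "half_Lipschitz (left_coeff A) z (4 * K) \<delta>" unfolding half_Lipschitz_def
  proof (intro conjI ballI allI impI)
    fix \<mu> and u g :: "real \<Rightarrow> complex ^ 'a" assume \<mu>: "\<mu> \<in> ball z \<delta>" and hu: "half u g"
    define w where "w = glue (h u) u"
    have w: "h1norm w \<le> 4 * (l2norm u + l2norm g)" "w \<in> H1" using bound[OF hu] w_def by auto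
    have D: "(\<lambda>x. ode_op A \<mu> w x - ode_op A z w x) \<in> L2" using LT w(2) \<mu> K(3) zO by (intro L2_diff) auto
    have "l2norm (\<lambda>x. left_coeff A \<mu> x *v u x - left_coeff A z x *v u x) = l2norm (left_part (\<lambda>x. ode_op A \<mu> w x - ode_op A z w x))"
    proof (rule l2norm_cong_norm)
      fix x :: real
      have "w (- x) = u x" if "x \<ge> 0" using that by (cases "x = 0") (auto simp: w_def glue_def h_def he)
      then show "norm (left_coeff A \<mu> x *v u x - left_coeff A z x *v u x) = norm (left_part (\<lambda>x. ode_op A \<mu> w x - ode_op A z w x) x)"
        by (auto simp: left_part_def ode_op_def left_coeff_def matrix_uminus_vector halfD(3)[OF hu])
    qed
    also have "\<dots> \<le> l2norm (\<lambda>x. ode_op A \<mu> w x - ode_op A z w x)" by (rule L2_left_part(2)[OF D])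
    also have "\<dots> \<le> K * norm (\<mu> - z) * h1norm w" by (rule K(4)[OF \<mu> w(2)])
    also have "\<dots> \<le> K * norm (\<mu> - z) * (4 * (l2norm u + l2norm g))" using K(1) w(1) by (intro mult_left_mono) auto
    also have "\<dots> = 4 * K * norm (\<mu> - z) * (l2norm u + l2norm g)" by (simp only: mult.assoc mult.left_commute)
    finally show "l2norm (\<lambda>x. left_coeff A \<mu> x *v u x - left_coeff A z x *v u x) \<le> 4 * K * norm (\<mu> - z) * (l2norm u + l2norm g)" .
  qed (use K in auto)
  show ?thesis by (rule that[OF K(3) r l])
qed

lemma exists_complementary_subspace:
  fixes S :: "(complex ^ 'n) set"
  assumes S: "vec.subspace S"
  obtains F P where "vec.subspace F" "bounded_linear P" "\<And>c v. P (c *s v) = c *s P v" "\<And>v. P v \<in> S"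
    "\<And>v. v - P v \<in> F" "\<And>s f. s \<in> S \<Longrightarrow> f \<in> F \<Longrightarrow> P (s + f) = s"
proof -
  obtain B where B: "B \<subseteq> S" "vec.independent B" "S \<subseteq> vec.span B" "card B = vec.dim S" using vec.basis_exists[of S] .
  obtain B' where B': "B \<subseteq> B'" "vec.independent B'" "UNIV \<subseteq> vec.span B'"
    using vec.maximal_independent_subset_extend[of B UNIV] B by auto
  have spB: "vec.span B = S" using B S vec.span_minimal by blast
  define F where "F = vec.span (B' - B)"
  have F: "vec.subspace F" by (simp add: F_def)
  have B'eq: "B' = B \<union> (B' - B)" using B'(1) by blast
  have int: "v = 0" if vS: "v \<in> S" and vF: "v \<in> F" for v
  proof -
    have fin: "finite B'" using B'(2) vec.independent_bound_general by blast
    have finB: "finite B" "finite (B' - B)" using fin B'(1) finite_subset by auto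
    obtain a where a: "v = (\<Sum>b\<in>B. a b *s b)" using vS vec.span_finite[OF finB(1)] spB by auto
    obtain c where c: "v = (\<Sum>b\<in>B' - B. c b *s b)" using vF vec.span_finite[OF finB(2)] F_def by auto
    define d where "d = (\<lambda>b. if b \<in> B then a b else - c b)"
    have "(\<Sum>b\<in>B'. d b *s b) = (\<Sum>b\<in>B' - B. d b *s b) + (\<Sum>b\<in>B. d b *s b)" by (rule sum.subset_diff[OF B'(1) fin])
    also have "(\<Sum>b\<in>B. d b *s b) = v" unfolding a by (intro sum.cong) (auto simp: d_def)
    also have "(\<Sum>b\<in>B' - B. d b *s b) = - v" unfolding c sum_negf[symmetric] by (intro sum.cong) (auto simp: d_def)
    finally have "(\<Sum>b\<in>B'. d b *s b) = 0" by simp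
    then have d0: "d b = 0" if "b \<in> B'" for b using vec.independentD[OF B'(2) fin subset_refl, of d b] that by blast
    have "a b = 0" if "b \<in> B" for b using d0[of b] B'(1) that by (auto simp: d_def)
    then show "v = 0" unfolding a by simp
  qed
  have sum: "\<exists>s\<in>S. \<exists>f\<in>F. v = s + f" for v
  proof -
    have "v \<in> vec.span (B \<union> (B' - B))" using B'(3) B'eq by auto
    then show ?thesis unfolding vec.span_Un spB F_def by blast
  qed
  obtain P Q where PQ: "bounded_linear P" "bounded_linear Q" "\<And>v. P v \<in> S" "\<And>v. Q v \<in> F" "\<And>v. v = P v + Q v"
    "\<And>s u. s \<in> S \<Longrightarrow> u \<in> F \<Longrightarrow> P (s + u) = s" "\<And>s u. s \<in> S \<Longrightarrow> u \<in> F \<Longrightarrow> Q (s + u) = u"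
    by (rule exists_projections[OF S F int sum]) (assumption+, rule that)
  show ?thesis
  proof (rule that[OF F PQ(1) _ PQ(3) _ PQ(6)])
    fix c v
    have "c *s v = c *s P v + c *s Q v" using PQ(5)[of v] by (metis vec.scale_right_distrib)
    then show "P (c *s v) = c *s P v"
      using PQ(6)[OF vec.subspace_scale[OF S PQ(3)] vec.subspace_scale[OF F PQ(4)], of c v c v] by simp
    have "v - P v = Q v" using PQ(5)[of v] by (metis add_diff_cancel_left')
    then show "v - P v \<in> F" using PQ(4) by simp
  qed
qed

text \<open>Dichotomies at single parameters do not provide a common constant, so the one at
  \<open>z\<close> is perturbed. For half-line functions with trace in a fixed complement
  \<open>F\<close> of \<open>E z\<close> the residual controls everything, and this persists for
  nearby \<open>\<mu>\<close>. It makes the projection \<open>P\<close> injective on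
  \<open>E \<mu>\<close>, hence onto \<open>E z\<close> by equality of dimensions; subtracting a
  solution with the same projection moves any trace into \<open>F\<close>.\<close>

lemma uniform_dichotomy:
  fixes B :: "complex \<Rightarrow> real \<Rightarrow> complex ^ 'n ^ 'n"
  assumes di: "\<And>\<mu>. \<mu> \<in> ball z \<delta> \<Longrightarrow> dichotomy (B \<mu>) (E \<mu>)" and Lip: "half_Lipschitz B z K \<delta>"
    and dim: "\<And>\<mu>. \<mu> \<in> ball z \<delta> \<Longrightarrow> vec.dim (E \<mu>) = d"
  obtains C \<delta>' where "C \<ge> 0" "\<delta>' > 0" "\<delta>' \<le> \<delta>"
    "\<And>\<mu> u g. \<mu> \<in> ball z \<delta>' \<Longrightarrow> half u g \<Longrightarrow> \<exists>e\<in>E \<mu>. norm (u 0 - e) \<le> C * l2norm (residual (B \<mu>) u g)"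
    "\<And>\<mu> u g. \<mu> \<in> ball z \<delta>' \<Longrightarrow> half u g \<Longrightarrow> l2norm u \<le> C * (norm (u 0) + l2norm (residual (B \<mu>) u g))"
proof -
  have \<delta>: "\<delta> > 0" and K0: "K \<ge> 0" using Lip by (auto simp: half_Lipschitz_def)
  have zb: "z \<in> ball z \<delta>" using \<delta> by simp
  note dz = di[OF zb]
  obtain C0 where C0: "C0 \<ge> 0"
    "\<And>u g. half u g \<Longrightarrow> \<exists>e\<in>E z. norm (u 0 - e) \<le> C0 * l2norm (residual (B z) u g)"
    "\<And>u g. half u g \<Longrightarrow> l2norm u \<le> C0 * (norm (u 0) + l2norm (residual (B z) u g))" using dz unfolding dichotomy_def by blast
  obtain \<beta> where \<beta>: "bounded_coeff \<beta> (B z)" using dz by (auto simp: dichotomy_def)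
  have \<beta>0: "\<beta> \<ge> 0" by (rule bounded_coeffD(1)[OF \<beta>])
  have bc: "\<exists>\<beta>. bounded_coeff \<beta> (B \<mu>)" if "\<mu> \<in> ball z \<delta>" for \<mu> using di[OF that] by (auto simp: dichotomy_def)
  obtain F P where F: "vec.subspace F" and P: "bounded_linear P" "\<And>c v. P (c *s v) = c *s P v" "\<And>v. P v \<in> E z"
    "\<And>v. v - P v \<in> F" "\<And>s f. s \<in> E z \<Longrightarrow> f \<in> F \<Longrightarrow> P (s + f) = s"
    by (rule exists_complementary_subspace[OF dichotomyD(1)[OF dz]]) (rule that, assumption+)
  interpret P: bounded_linear P by fact
  obtain p where p: "p > 0" "\<And>v. norm (P v) \<le> norm v * p" using P.pos_bounded by blast
  have PF: "P f = 0" if "f \<in> F" for f using P(5)[OF vec.subspace_0[OF dichotomyD(1)[OF dz]] that] by simp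
  define X where "X = (\<lambda>(u :: real \<Rightarrow> complex ^ 'n) (g :: real \<Rightarrow> complex ^ 'n). l2norm u + l2norm g)"
  define C2 where "C2 = (1 + \<beta>) * C0 + 1"
  have C2: "C2 > 0" using C0(1) \<beta>0 by (simp add: C2_def add_nonneg_pos)
  have X2: "X u g \<le> C2 * (norm (u 0) + l2norm (residual (B z) u g))" if "half u g" for u g
  proof -
    have "X u g \<le> (1 + \<beta>) * l2norm u + l2norm (residual (B z) u g)"
      using l2norm_derivative_le[OF \<beta> that] by (simp add: X_def algebra_simps)
    also have "\<dots> \<le> (1 + \<beta>) * (C0 * (norm (u 0) + l2norm (residual (B z) u g))) + (norm (u 0) + l2norm (residual (B z) u g))"
      using C0(3)[OF that] \<beta>0 by (intro add_mono mult_left_mono) auto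
    finally show ?thesis by (simp add: C2_def algebra_simps)
  qed
  define C3 where "C3 = C2 * ((1 + p) * C0 + 1)"
  have C3: "C3 > 0" using C2 C0(1) p(1) by (simp add: C3_def add_nonneg_pos)
  \<comment> \<open>\<open>P\<close> kills \<open>u 0\<close> and fixes \<open>e\<close>, so
    \<open>norm e\<close> is at most \<open>p * norm (u 0 - e)\<close>: for traces in
    \<open>F\<close> the distance to \<open>E z\<close> controls the whole trace.\<close>
  have X3: "X u g \<le> C3 * l2norm (residual (B z) u g)" if h: "half u g" and u0: "u 0 \<in> F" for u g
  proof -
    obtain e where e: "e \<in> E z" "norm (u 0 - e) \<le> C0 * l2norm (residual (B z) u g)" using C0(2)[OF h] by blast
    have Pe: "P e = e" using P(5)[OF e(1) vec.subspace_0[OF F]] by simp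
    have "P (u 0 - e) = - e" using PF[OF u0] by (simp add: P.diff Pe)
    then have "norm e \<le> norm (u 0 - e) * p" using p(2)[of "u 0 - e"] by simp
    then have "norm (u 0) \<le> (1 + p) * norm (u 0 - e)" using norm_triangle_ineq[of "u 0 - e" e] by (simp add: algebra_simps)
    also have "\<dots> \<le> (1 + p) * (C0 * l2norm (residual (B z) u g))" using e(2) p(1) by (intro mult_left_mono) auto
    finally have "norm (u 0) + l2norm (residual (B z) u g) \<le> ((1 + p) * C0 + 1) * l2norm (residual (B z) u g)"
      by (simp add: algebra_simps)
    then have "C2 * (norm (u 0) + l2norm (residual (B z) u g)) \<le> C3 * l2norm (residual (B z) u g)"
      using C2 unfolding C3_def mult.assoc by (intro mult_left_mono) auto
    then show ?thesis using X2[OF h] by linarith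
  qed
  define C4 where "C4 = max C2 C3"
  \<comment> \<open>Within this radius a change of parameter alters the residual by at most
    \<open>X u g / (2 * C4)\<close>, which \<open>absorb\<close> moves to the left-hand
    side.\<close>
  define \<delta>' where "\<delta>' = min \<delta> (1 / (2 * C4 * (K + 1)))"
  have C4: "C4 > 0" using C2 by (simp add: C4_def)
  have \<delta>': "\<delta>' > 0" "\<delta>' \<le> \<delta>" using \<delta> C4 K0 by (auto simp: \<delta>'_def)
  have rz: "l2norm (residual (B z) u g) \<le> l2norm (residual (B \<mu>) u g) + X u g / (2 * C4)"
    if \<mu>: "\<mu> \<in> ball z \<delta>'" and h: "half u g" for \<mu> u g
  proof -
    have \<mu>': "\<mu> \<in> ball z \<delta>" using \<mu> \<delta>' by auto
    obtain \<beta>' where \<beta>': "bounded_coeff \<beta>' (B \<mu>)" using bc[OF \<mu>'] by blast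
    have uL: "u \<in> L2" by (rule halfD(1)[OF h])
    have "l2norm (residual (B z) u g) = l2norm (\<lambda>x. residual (B \<mu>) u g x + (B \<mu> x *v u x - B z x *v u x))"
      by (simp add: residual_def)
    also have "\<dots> \<le> l2norm (residual (B \<mu>) u g) + l2norm (\<lambda>x. B \<mu> x *v u x - B z x *v u x)"
      by (intro l2norm_triangle L2_residual[OF \<beta>' h] L2_diff L2_coeff_mult[OF \<beta>' uL] L2_coeff_mult[OF \<beta> uL])
    also have "l2norm (\<lambda>x. B \<mu> x *v u x - B z x *v u x) \<le> K * norm (\<mu> - z) * X u g"
      using Lip \<mu>' h by (auto simp: half_Lipschitz_def X_def)
    also have "\<dots> \<le> 1 / (2 * C4) * X u g"
    proof (rule mult_right_mono)
      have "norm (\<mu> - z) \<le> 1 / (2 * C4 * (K + 1))" using \<mu> by (auto simp: \<delta>'_def dist_norm norm_minus_commute)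
      then have "K * norm (\<mu> - z) \<le> (K + 1) * (1 / (2 * C4 * (K + 1)))" using K0 by (intro mult_mono) auto
      also have "\<dots> = 1 / (2 * C4)" using K0 by simp
      finally show "K * norm (\<mu> - z) \<le> 1 / (2 * C4)" .
    qed (simp add: X_def)
    finally show ?thesis by simp
  qed
  have absorb: "X u g \<le> 2 * C4 * (a + l2norm (residual (B \<mu>) u g))"
    if \<mu>: "\<mu> \<in> ball z \<delta>'" and h: "half u g" and *: "X u g \<le> C4 * (a + l2norm (residual (B z) u g))" for \<mu> u g a
  proof -
    have "X u g \<le> C4 * (a + (l2norm (residual (B \<mu>) u g) + X u g / (2 * C4)))"
      using * mult_left_mono[OF rz[OF \<mu> h], of C4] C4 by (simp add: distrib_left)
    also have "\<dots> = C4 * (a + l2norm (residual (B \<mu>) u g)) + X u g / 2" using C4 by (simp add: distrib_left)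
    finally show ?thesis by simp
  qed
  have F': "norm (u 0) \<le> 2 * C4 * l2norm (residual (B \<mu>) u g)" if \<mu>: "\<mu> \<in> ball z \<delta>'" and h: "half u g" and u0: "u 0 \<in> F" for \<mu> u g
  proof -
    have "C3 * l2norm (residual (B z) u g) \<le> C4 * (0 + l2norm (residual (B z) u g))" by (simp add: C4_def mult_right_mono)
    with X3[OF h u0] have "X u g \<le> C4 * (0 + l2norm (residual (B z) u g))" by linarith
    from absorb[OF \<mu> h this] show ?thesis using half_Sobolev[OF h, of 0] by (simp add: X_def)
  qed
  show ?thesis
  proof (rule that[of "2 * C4" \<delta>'])
    fix \<mu> u g assume \<mu>: "\<mu> \<in> ball z \<delta>'" and h: "half (u :: real \<Rightarrow> complex ^ 'n) g"
    have \<mu>': "\<mu> \<in> ball z \<delta>" using \<mu> \<delta>' by auto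
    note d\<mu> = di[OF \<mu>']
    obtain \<beta>' where \<beta>': "bounded_coeff \<beta>' (B \<mu>)" using bc[OF \<mu>'] by blast
    have subE: "vec.subspace (E \<mu>)" by (rule dichotomyD(1)[OF d\<mu>])
    have PE: "P ` E \<mu> = E z"
    proof (rule vec.subspace_dim_equal)
      have lin: "Vector_Spaces.linear (*s) (*s) P"
        unfolding Vector_Spaces.linear_iff using vec.vector_space_axioms by (auto simp: P.add P(2))
      show "vec.subspace (P ` E \<mu>)"
      proof (rule vec.subspaceI)
        show "0 \<in> P ` E \<mu>" using vec.subspace_0[OF subE] P.zero by (metis image_eqI)
      next
        fix x y assume "x \<in> P ` E \<mu>" "y \<in> P ` E \<mu>"
        then show "x + y \<in> P ` E \<mu>" using vec.subspace_add[OF subE] by (auto simp flip: P.add)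
      next
        fix c x assume "x \<in> P ` E \<mu>"
        then show "c *s x \<in> P ` E \<mu>" using vec.subspace_scale[OF subE] by (auto simp flip: P(2))
      qed
      show "vec.subspace (E z)" by (rule dichotomyD(1)[OF dz])
      show "P ` E \<mu> \<subseteq> E z" using P(3) by auto
      \<comment> \<open>Two vectors of \<open>E \<mu>\<close> with the same projection differ by the
        trace of a homogeneous solution that lies in \<open>F\<close>, and \<open>F'\<close> forces
        this trace to be 0.\<close>
      have inj: "inj_on P (vec.span (E \<mu>))"
      proof (rule inj_onI)
        fix x y assume "x \<in> vec.span (E \<mu>)" "y \<in> vec.span (E \<mu>)" "P x = P y"
        then have xy: "x \<in> E \<mu>" "y \<in> E \<mu>" "P (x - y) = 0" using subE by (auto simp: vec.span_eq_iff[THEN iffD2] P.diff)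
        have "x - y \<in> E \<mu>" using xy vec.subspace_diff[OF subE] by blast
        then obtain v k where v: "half v k" "\<And>t. residual (B \<mu>) v k t = 0" "v 0 = x - y" using dichotomyD(2)[OF d\<mu>] by blast
        have "v 0 \<in> F" using P(4)[of "x - y"] xy(3) v(3) by simp
        from F'[OF \<mu> v(1) this] have "norm (v 0) \<le> 2 * C4 * l2norm (\<lambda>t. 0 :: complex ^ 'n)"
          using v(2) by (simp add: fun_eq_iff[of "residual (B \<mu>) v k" "\<lambda>t. 0", THEN iffD2])
        then show "x = y" using v(3) by simp
      qed
      have "vec.dim (P ` E \<mu>) = vec.dim (E \<mu>)" by (rule vec.dim_image_eq[OF lin inj])
      then show "vec.dim (P ` E \<mu>) \<ge> vec.dim (E z)" using dim[OF \<mu>'] dim[OF zb] by simp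
    qed
    have "P (u 0) \<in> P ` E \<mu>" using PE P(3) by simp
    then obtain e where e: "e \<in> E \<mu>" "P e = P (u 0)" by auto
    obtain v k where v: "half v k" "\<And>t. residual (B \<mu>) v k t = 0" "v 0 = e" using dichotomyD(2)[OF d\<mu> e(1)] by blast
    have hw: "half (\<lambda>x. u x - v x) (\<lambda>x. g x - k x)" by (rule half_diff[OF h v(1)])
    have "u 0 - e - P (u 0 - e) \<in> F" by (rule P(4))
    then have wF: "u 0 - v 0 \<in> F" using e(2) v(3) by (simp add: P.diff)
    have res: "residual (B \<mu>) (\<lambda>x. u x - v x) (\<lambda>x. g x - k x) = residual (B \<mu>) u g" unfolding residual_diff v(2) by simp
    show "\<exists>e\<in>E \<mu>. norm (u 0 - e) \<le> 2 * C4 * l2norm (residual (B \<mu>) u g)" using F'[OF \<mu> hw wF] e(1) v(3) unfolding res by auto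
    have "C2 * (norm (u 0) + l2norm (residual (B z) u g)) \<le> C4 * (norm (u 0) + l2norm (residual (B z) u g))"
      by (intro mult_right_mono) (auto simp: C4_def)
    with X2[OF h] have "X u g \<le> C4 * (norm (u 0) + l2norm (residual (B z) u g))" by linarith
    from absorb[OF \<mu> h this] show "l2norm u \<le> 2 * C4 * (norm (u 0) + l2norm (residual (B \<mu>) u g))"
      using l2norm_nonneg[of g] unfolding X_def by linarith
  qed (use C4 \<delta>' in auto)
qed

section \<open>Taylor coefficients in the mean\<close>

definition unity_root :: "nat \<Rightarrow> nat \<Rightarrow> complex" where
  "unity_root N j = exp (2 * of_real pi * \<i> * of_nat j / of_nat N)"

lemma norm_unity_root [simp]: "norm (unity_root N j) = 1"
proof -
  have "2 * complex_of_real pi * \<i> * of_nat j / of_nat N = \<i> * of_real (2 * pi * real j / real N)" by simp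
  then show ?thesis unfolding unity_root_def by (simp only: norm_exp_i_times)
qed

lemma sum_unity_root_powers:
  assumes "N > 0"
  shows "(\<Sum>j<N. unity_root N j ^ m) = (if N dvd m then of_nat N else 0)"
proof -
  have eq: "unity_root N j ^ m = unity_root N m ^ j" for j
    unfolding unity_root_def exp_of_nat_mult[symmetric] by (simp add: mult_ac)
  have one: "unity_root N m = 1 \<longleftrightarrow> N dvd m" unfolding unity_root_def using assms by (intro complex_root_unity_eq_1) auto
  have "unity_root N m ^ N = exp (of_nat N * (2 * of_real pi * \<i> * of_nat m / of_nat N))"
    unfolding unity_root_def exp_of_nat_mult ..
  also have "of_nat N * (2 * of_real pi * \<i> * of_nat m / of_nat N) = of_nat m * (2 * of_real pi * \<i>)" using assms by simp
  also have "exp (of_nat m * (2 * of_real pi * \<i>)) = 1" unfolding exp_of_nat_mult by simp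
  finally have pw: "unity_root N m ^ N = 1" .
  show ?thesis
  proof (cases "N dvd m")
    case True
    then show ?thesis unfolding eq using one by simp
  next
    case False
    then show ?thesis unfolding eq using one pw geometric_sum[of "unity_root N m" N] by simp
  qed
qed

definition taylor_coeff :: "(complex \<Rightarrow> complex) \<Rightarrow> complex \<Rightarrow> nat \<Rightarrow> complex" where
  "taylor_coeff f z k = (deriv ^^ k) f z / fact k"

lemma taylor_coeff_sums:
  assumes "f holomorphic_on ball z r" "w \<in> ball z r"
  shows "(\<lambda>n. taylor_coeff f z n * (w - z) ^ n) sums f w"
  using holomorphic_power_series[OF assms] by (simp add: taylor_coeff_def)

text \<open>Averaging over equidistant points of a circle recovers Taylor coefficients up to aliasing.\<close>

lemma discrete_averages_tendsto_taylor_coeff: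
  assumes hol: "F holomorphic_on ball z r" and s: "0 < s" "s < r"
  shows "(\<lambda>n. \<Sum>j<n+k+1. 1 / of_nat (n+k+1) * unity_root (n+k+1) j ^ (n+1) * F (z + of_real s * unity_root (n+k+1) j))
    \<longlonglongrightarrow> taylor_coeff F z k * of_real s ^ k"
proof -
  define b where "b = (\<lambda>l. taylor_coeff F z l * of_real s ^ l)"
  \<comment> \<open>Modulo \<open>n + k + 1\<close> the exponent \<open>n + 1\<close> stands for
    \<open>- k\<close>, so the average keeps exactly the indices \<open>l\<close> congruent to
    \<open>k\<close>. Tannery's theorem removes the aliases \<open>l \<noteq> k\<close> in the
    limit.\<close>
  define g where "g = (\<lambda>n l. 1 / of_nat (n+k+1) * (\<Sum>j<n+k+1. unity_root (n+k+1) j ^ (l+n+1)))"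
  have gN: "g n l = (if n+k+1 dvd l+n+1 then 1 else 0)" for n l
  proof -
    have ne: "of_nat (n+k+1) \<noteq> (0::complex)" by (simp only: of_nat_eq_0_iff)
    have pos: "n+k+1 > 0" by simp
    show ?thesis unfolding g_def sum_unity_root_powers[OF pos] using ne
      by (cases "n+k+1 dvd l+n+1") (simp_all only: times_divide_eq_left mult_1 if_True if_False divide_self not_False_eq_True mult_zero_right)
  qed
  have bsum: "summable (\<lambda>l. norm (b l))"
  proof -
    define s' where "s' = (s + r) / 2"
    have s': "s < s'" "s' < r" using s by (auto simp: s'_def)
    have "(\<lambda>n. taylor_coeff F z n * (z + of_real s' - z) ^ n) sums F (z + of_real s')"
      by (rule taylor_coeff_sums[OF hol]) (use s s' in \<open>auto simp: dist_norm\<close>)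
    then have "summable (\<lambda>n. taylor_coeff F z n * of_real s' ^ n)" by (simp add: sums_iff)
    from powser_insidea[OF this, of "of_real s"] show ?thesis using s s' by (simp add: b_def)
  qed
  have "(\<lambda>n. suminf (\<lambda>l. b l * g n l)) \<longlonglongrightarrow> suminf (\<lambda>l. if l = k then b l else 0)"
  proof (rule tannerys_theorem[THEN conjunct2, THEN conjunct2])
    show "(\<lambda>n. b l * g n l) \<longlonglongrightarrow> (if l = k then b l else 0)" for l
    proof (rule tendsto_eventually)
      show "\<forall>\<^sub>F n in sequentially. b l * g n l = (if l = k then b l else 0)" using eventually_ge_at_top[of l]
      proof eventually_elim
        case (elim n)
        have "n+k+1 dvd l+n+1 \<longleftrightarrow> l = k"
        proof
          assume "n+k+1 dvd l+n+1"
          then obtain q where q: "l+n+1 = (n+k+1) * q" by (rule dvdE)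
          have "q < 2"
          proof (rule ccontr)
            assume "\<not> q < 2"
            then have "(n+k+1) * 2 \<le> (n+k+1) * q" by (intro mult_le_mono2) simp
            then show False using q elim by simp
          qed
          moreover have "q \<noteq> 0" using q by (intro notI) simp
          ultimately have "q = 1" by simp
          then show "l = k" using q by simp
        qed (simp add: add.commute)
        then show ?case by (simp add: gN)
      qed
    qed
    show "\<forall>\<^sub>F (l, n) in at_top \<times>\<^sub>F sequentially. norm (b l * g n l) \<le> norm (b l)"
      by (intro always_eventually) (auto simp: gN norm_mult)
    show "summable (\<lambda>l. norm (b l))" by (rule bsum)
  qed simp
  also have "suminf (\<lambda>l. if l = k then b l else 0) = b k" using sums_single[of k b] by (simp add: sums_iff)
  also have "(\<lambda>n. suminf (\<lambda>l. b l * g n l)) =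
      (\<lambda>n. \<Sum>j<n+k+1. 1 / of_nat (n+k+1) * unity_root (n+k+1) j ^ (n+1) * F (z + of_real s * unity_root (n+k+1) j))"
  proof
    fix n
    let ?N = "n+k+1"
    have "(\<lambda>l. \<Sum>j<?N. 1 / of_nat ?N * unity_root ?N j ^ (n+1) * (taylor_coeff F z l * (z + of_real s * unity_root ?N j - z) ^ l)) sums
        (\<Sum>j<?N. 1 / of_nat ?N * unity_root ?N j ^ (n+1) * F (z + of_real s * unity_root ?N j))"
      by (intro sums_sum sums_mult taylor_coeff_sums[OF hol]) (use s in \<open>auto simp: dist_norm norm_mult\<close>)
    moreover have "(\<Sum>j<?N. 1 / of_nat ?N * unity_root ?N j ^ (n+1) * (taylor_coeff F z l * (z + of_real s * unity_root ?N j - z) ^ l)) = b l * g n l" for l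
      unfolding g_def b_def sum_distrib_left by (intro sum.cong) (auto simp: power_mult_distrib power_add mult_ac)
    ultimately show "suminf (\<lambda>l. b l * g n l) =
        (\<Sum>j<?N. 1 / of_nat ?N * unity_root ?N j ^ (n+1) * F (z + of_real s * unity_root ?N j))" by (simp only: sums_iff)
  qed
  finally show ?thesis by (simp add: b_def)
qed

definition vec_taylor_coeff :: "(complex \<Rightarrow> complex ^ 'n) \<Rightarrow> complex \<Rightarrow> nat \<Rightarrow> complex ^ 'n" where
  "vec_taylor_coeff f z k = (\<chi> i. taylor_coeff (\<lambda>w. f w $ i) z k)"

text \<open>Cauchy's estimate in \<open>L2\<close> for functions that are holomorphic only pointwise
  in \<open>x\<close>. Finite averages replace the contour integral: they lie in \<open>L2\<close>
  with the expected bound, Fatou passes to the limit, and measurability in \<open>x\<close> is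
  inherited.\<close>

lemma L2_taylor_coeff:
  fixes \<rho> :: "complex \<Rightarrow> real \<Rightarrow> complex ^ 'n"
  assumes hol: "\<And>x i. (\<lambda>w. \<rho> w x $ i) holomorphic_on ball z r" and s: "0 < s" "s < r"
    and L: "\<And>w. w \<in> ball z r \<Longrightarrow> \<rho> w \<in> L2" and M: "\<And>w. norm (w - z) = s \<Longrightarrow> l2norm (\<rho> w) \<le> M"
  shows "(\<lambda>x. vec_taylor_coeff (\<lambda>w. \<rho> w x) z k) \<in> L2"
    "l2norm (\<lambda>x. vec_taylor_coeff (\<lambda>w. \<rho> w x) z k) \<le> M / s ^ k"
proof -
  define c where "c = (\<lambda>n j. 1 / of_real s ^ k * (1 / of_nat (n+k+1) * unity_root (n+k+1) j ^ (n+1)))"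
  define f where "f = (\<lambda>n x. \<Sum>j<n+k+1. c n j *s \<rho> (z + of_real s * unity_root (n+k+1) j) x)"
  have inb: "z + of_real s * unity_root N j \<in> ball z r" "norm (z + of_real s * unity_root N j - z) = s" for N j
    using s by (auto simp: dist_norm norm_mult)
  have fL: "f n \<in> L2" for n unfolding f_def by (intro L2_sum L2_scale L inb)
  have le: "l2norm (f n) \<le> M / s ^ k" for n
  proof -
    have "l2norm (f n) \<le> (\<Sum>j<n+k+1. l2norm (\<lambda>x. c n j *s \<rho> (z + of_real s * unity_root (n+k+1) j) x))"
      unfolding f_def by (rule l2norm_sum) (intro L2_scale L inb)
    also have "\<dots> \<le> (\<Sum>j<n+k+1. 1 / s ^ k * (1 / real (n+k+1)) * M)"
    proof (rule sum_mono)
      fix j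
      have "norm (c n j) = 1 / s ^ k * (1 / real (n+k+1))"
        using s unfolding c_def norm_mult norm_divide norm_power norm_of_nat norm_of_real norm_unity_root by simp
      then show "l2norm (\<lambda>x. c n j *s \<rho> (z + of_real s * unity_root (n+k+1) j) x) \<le> 1 / s ^ k * (1 / real (n+k+1)) * M"
        using M[OF inb(2)[of "n+k+1" j]] s by (simp only: l2norm_scale) (rule mult_left_mono, simp_all)
    qed
    also have "\<dots> = real (n+k+1) * (1 / s ^ k * (1 / real (n+k+1)) * M)" by (simp only: sum_constant card_lessThan)
    also have "\<dots> = M / s ^ k"
    proof -
      have "N * (1 / a * (1 / N) * M) = M / a" if "N \<noteq> 0" for N a :: real using that by simp
      then show ?thesis by simp
    qed
    finally show ?thesis .
  qed
  have conv: "(\<lambda>n. f n x) \<longlonglongrightarrow> vec_taylor_coeff (\<lambda>w. \<rho> w x) z k" for x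
  proof (rule vec_tendstoI)
    fix i
    have "(\<lambda>n. 1 / of_real s ^ k * (\<Sum>j<n+k+1. 1 / of_nat (n+k+1) * unity_root (n+k+1) j ^ (n+1) * \<rho> (z + of_real s * unity_root (n+k+1) j) x $ i))
        \<longlonglongrightarrow> 1 / of_real s ^ k * (taylor_coeff (\<lambda>w. \<rho> w x $ i) z k * of_real s ^ k)"
      by (intro tendsto_mult tendsto_const discrete_averages_tendsto_taylor_coeff[OF hol s])
    moreover have "1 / of_real s ^ k * (taylor_coeff (\<lambda>w. \<rho> w x $ i) z k * of_real s ^ k) = vec_taylor_coeff (\<lambda>w. \<rho> w x) z k $ i"
      using s by (simp add: vec_taylor_coeff_def)
    moreover have "1 / of_real s ^ k * (\<Sum>j<n+k+1. 1 / of_nat (n+k+1) * unity_root (n+k+1) j ^ (n+1) * \<rho> (z + of_real s * unity_root (n+k+1) j) x $ i) = f n x $ i" for n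
      unfolding f_def c_def sum_component sum_distrib_left by (intro sum.cong) (auto simp: mult_ac)
    ultimately show "(\<lambda>n. f n x $ i) \<longlonglongrightarrow> vec_taylor_coeff (\<lambda>w. \<rho> w x) z k $ i" by simp
  qed
  have meas: "(\<lambda>x. vec_taylor_coeff (\<lambda>w. \<rho> w x) z k) \<in> borel_measurable borel"
    by (rule borel_measurable_LIMSEQ_metric[OF L2_measurable[OF fL] conv])
  from L2_Fatou[OF fL le AE_I2[OF conv] meas]
  show "(\<lambda>x. vec_taylor_coeff (\<lambda>w. \<rho> w x) z k) \<in> L2"
    "l2norm (\<lambda>x. vec_taylor_coeff (\<lambda>w. \<rho> w x) z k) \<le> M / s ^ k" by - assumption+
qed

text \<open>Below order \<open>p\<close> the Cauchy estimate on circles of radius \<open>s\<close>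
  tends to 0 with \<open>s\<close>, so those coefficients vanish almost everywhere; beyond order
  \<open>p\<close> the series is dominated by a geometric one. The pointwise clause on
  \<open>f\<close> keeps its support in the half-line.\<close>

lemma L2_leading_coefficient:
  fixes \<rho> :: "complex \<Rightarrow> real \<Rightarrow> complex ^ 'n"
  assumes hol: "\<And>x i. (\<lambda>w. \<rho> w x $ i) holomorphic_on ball z r" and r: "0 < r" and C: "C \<ge> 0"
    and L: "\<And>w. w \<in> ball z r \<Longrightarrow> \<rho> w \<in> L2" and M: "\<And>w. w \<in> ball z r \<Longrightarrow> l2norm (\<rho> w) \<le> C * norm (w - z) ^ p"
  obtains f C' r' where "f \<in> L2" "C' \<ge> 0" "0 < r'" "r' \<le> r" "\<forall>x. (\<forall>w. \<rho> w x = 0) \<longrightarrow> f x = 0"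
    "\<And>w. w \<in> ball z r' \<Longrightarrow> l2norm (\<lambda>x. \<rho> w x - (w - z) ^ p *s f x) \<le> C' * norm (w - z) ^ Suc p"
proof -
  define a where "a = (\<lambda>k x. vec_taylor_coeff (\<lambda>w. \<rho> w x) z k)"
  have a: "a k \<in> L2" "l2norm (a k) \<le> C * s ^ p / s ^ k" if s: "0 < s" "s < r" for k s
  proof -
    have M': "l2norm (\<rho> w) \<le> C * s ^ p" if "norm (w - z) = s" for w
      using M[of w] that s by (simp add: dist_norm norm_minus_commute)
    show "a k \<in> L2" "l2norm (a k) \<le> C * s ^ p / s ^ k" unfolding a_def by (rule L2_taylor_coeff[OF hol s L M'], assumption+)+
  qed
  have aL: "a k \<in> L2" for k using a(1)[of "r/2"] r by simp
  have a0: "AE x in lborel. a k x = 0" if "k < p" for k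
  proof -
    have "l2norm (a k) \<le> C * s" if s: "0 < s" "s < min r 1" for s
    proof -
      have "l2norm (a k) \<le> C * s ^ p / s ^ k" using a(2)[of s k] s by simp
      also have "\<dots> = C * s ^ (p - k)" using \<open>k < p\<close> s by (simp add: power_diff)
      also have "\<dots> \<le> C * s ^ 1" using s C \<open>k < p\<close> by (intro mult_left_mono power_decreasing) auto
      finally show ?thesis by simp
    qed
    then have "\<forall>\<^sub>F s in at_right 0. l2norm (a k) \<le> C * s" using eventually_at_right_less[of "0::real"] r
      by (auto simp: eventually_at_right[of 0 "min r 1"] intro!: exI[of _ "min r 1"])
    moreover have "((\<lambda>s. C * s) \<longlongrightarrow> C * 0) (at_right 0)" by (intro tendsto_intros)
    ultimately have "l2norm (a k) \<le> C * 0" by (intro tendsto_lowerbound) auto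
    then have "l2norm (a k) = 0" using l2norm_nonneg[of "a k"] by simp
    then show ?thesis using l2norm_eq_0_iff[OF aL] by simp
  qed
  define s where "s = r / 2"
  have s: "0 < s" "s < r" using r by (auto simp: s_def)
  \<comment> \<open>For \<open>norm t \<le> s / 2\<close> the tail is geometric with ratio at most
    1/2, whence the factor 2; the extra division by \<open>s\<close> comes from order
    \<open>Suc p\<close>.\<close>
  define C' where "C' = 2 * C / s"
  have C': "C' \<ge> 0" using C s by (simp add: C'_def)
  show ?thesis
  proof (rule that[OF aL[of p] C', of "s / 2"])
    show "\<forall>x. (\<forall>w. \<rho> w x = 0) \<longrightarrow> a p x = 0" by (simp add: a_def vec_taylor_coeff_def taylor_coeff_def vec_eq_iff)
    fix w assume w: "w \<in> ball z (s / 2)"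
    define t where "t = w - z"
    have t: "norm t \<le> s / 2" "w \<in> ball z r" using w s by (auto simp: t_def dist_norm norm_minus_commute)
    define f where "f = (\<lambda>n x. \<Sum>k\<in>{Suc p..p + n}. t ^ k *s a k x)"
    have fL: "f n \<in> L2" for n unfolding f_def by (intro L2_sum L2_scale aL)
    have q: "0 \<le> norm t / s" "norm t / s \<le> 1 / 2" using t s by (auto simp: field_simps)
    have le: "l2norm (f n) \<le> C' * norm t ^ Suc p" for n
    proof -
      have "l2norm (f n) \<le> (\<Sum>k\<in>{Suc p..p + n}. l2norm (\<lambda>x. t ^ k *s a k x))"
        unfolding f_def by (rule l2norm_sum) (intro L2_scale aL)
      also have "\<dots> \<le> (\<Sum>k\<in>{Suc p..p + n}. C * s ^ p * (norm t / s) ^ k)"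
      proof (rule sum_mono)
        fix k
        have "norm t ^ k * l2norm (a k) \<le> norm t ^ k * (C * s ^ p / s ^ k)" by (intro mult_left_mono a s) auto
        then show "l2norm (\<lambda>x. t ^ k *s a k x) \<le> C * s ^ p * (norm t / s) ^ k"
          by (simp add: l2norm_scale norm_power power_divide mult_ac)
      qed
      also have "\<dots> = (\<Sum>j<n. C * s ^ p * (norm t / s) ^ (j + Suc p))"
        by (rule sum.reindex_bij_witness[of _ "\<lambda>j. j + Suc p" "\<lambda>k. k - Suc p"]) auto
      also have "\<dots> = C * s ^ p * (norm t / s) ^ Suc p * (\<Sum>j<n. (norm t / s) ^ j)"
        unfolding sum_distrib_left by (intro sum.cong) (auto simp: power_add mult_ac)
      also have "\<dots> \<le> C * s ^ p * (norm t / s) ^ Suc p * 2"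
      proof (rule mult_left_mono)
        have "(\<Sum>j<n. (norm t / s) ^ j) \<le> (\<Sum>j<n. (1 / 2) ^ j)" by (intro sum_mono power_mono q)
        also have "\<dots> \<le> (2::real)" by (subst geometric_sum) (auto simp: field_simps)
        finally show "(\<Sum>j<n. (norm t / s) ^ j) \<le> 2" .
      qed (use C s in \<open>auto intro!: mult_nonneg_nonneg\<close>)
      also have "\<dots> = C' * norm t ^ Suc p" using s by (simp add: C'_def power_divide field_simps)
      finally show ?thesis .
    qed
    have "AE x in lborel. \<forall>k<p. a k x = 0" using a0 by (simp add: AE_all_countable)
    then have conv: "AE x in lborel. (\<lambda>n. f n x) \<longlonglongrightarrow> \<rho> w x - t ^ p *s a p x"
    proof eventually_elim
      case (elim x)
      show ?case
      proof (rule vec_tendstoI)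
        fix i
        have "(\<lambda>k. a k x $ i * t ^ k) sums (\<rho> w x $ i)"
          using taylor_coeff_sums[OF hol t(2), of x i] by (simp add: a_def vec_taylor_coeff_def t_def)
        from sums_split_initial_segment[OF this, of "Suc p"]
        have "(\<lambda>k. a (k + Suc p) x $ i * t ^ (k + Suc p)) sums (\<rho> w x $ i - (\<Sum>k<Suc p. a k x $ i * t ^ k))" .
        moreover have "(\<Sum>k<Suc p. a k x $ i * t ^ k) = t ^ p * a p x $ i" using elim by (simp add: mult.commute)
        ultimately have "(\<lambda>n. \<Sum>k<n. a (k + Suc p) x $ i * t ^ (k + Suc p)) \<longlonglongrightarrow> \<rho> w x $ i - t ^ p * a p x $ i"
          unfolding sums_def by (simp only:)
        moreover have "(\<Sum>k<n. a (k + Suc p) x $ i * t ^ (k + Suc p)) = f n x $ i" for n unfolding f_def sum_component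
          by (rule sum.reindex_bij_witness[of _ "\<lambda>k. k - Suc p" "\<lambda>j. j + Suc p"]) auto
        ultimately show "(\<lambda>n. f n x $ i) \<longlonglongrightarrow> (\<rho> w x - t ^ p *s a p x) $ i" by simp
      qed
    qed
    have dL: "(\<lambda>x. \<rho> w x - t ^ p *s a p x) \<in> L2" by (intro L2_diff L2_scale L t aL)
    show "l2norm (\<lambda>x. \<rho> w x - (w - z) ^ p *s a p x) \<le> C' * norm (w - z) ^ Suc p"
      using L2_Fatou(2)[OF fL le conv L2_measurable[OF dL]] unfolding t_def .
  qed (use s in auto)
qed

section \<open>Jets of traces\<close>

definition jet_sum :: "complex \<Rightarrow> nat \<Rightarrow> (nat \<Rightarrow> complex ^ 'n) \<Rightarrow> complex \<Rightarrow> complex ^ 'n" where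
  "jet_sum z p w \<mu> = (\<Sum>j<p. (\<mu> - z) ^ j *s w j)"

text \<open>Order of contact of a polynomial with the bundle \<open>E\<close>, measured by distances
  so that no analytic description of \<open>E\<close> enters. Only powers \<open>j < p\<close>
  occur, so a root function of order \<open>p\<close> corresponds to contact of order
  \<open>Suc p\<close>.\<close>

definition jet_in :: "(complex \<Rightarrow> (complex ^ 'n) set) \<Rightarrow> complex \<Rightarrow> nat \<Rightarrow> (nat \<Rightarrow> complex ^ 'n) \<Rightarrow> bool" where
  "jet_in E z p w \<longleftrightarrow> (\<exists>C\<ge>0. \<exists>r>0. \<forall>\<mu>\<in>ball z r. \<exists>e\<in>E \<mu>. norm (jet_sum z p w \<mu> - e) \<le> C * norm (\<mu> - z) ^ p)"

text \<open>One half-line near the centre \<open>z\<close>, with constants uniform in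
  \<open>\<mu>\<close>. Holomorphy is pointwise in \<open>x\<close>, the operator-norm information
  sits in \<open>Lip\<close>, and solvability is stated at \<open>z\<close>, where the corrections
  of each order are computed.\<close>

locale half_pencil =
  fixes B :: "complex \<Rightarrow> real \<Rightarrow> complex ^ 'n ^ 'n" and E :: "complex \<Rightarrow> (complex ^ 'n) set"
    and z :: complex and \<delta> K C0 :: real
  assumes di: "\<mu> \<in> ball z \<delta> \<Longrightarrow> dichotomy (B \<mu>) (E \<mu>)"
    and Lip: "half_Lipschitz B z K \<delta>"
    and C0: "C0 \<ge> 0"
    and trace: "\<mu> \<in> ball z \<delta> \<Longrightarrow> half u g \<Longrightarrow> \<exists>e\<in>E \<mu>. norm (u 0 - e) \<le> C0 * l2norm (residual (B \<mu>) u g)"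
    and apriori: "\<mu> \<in> ball z \<delta> \<Longrightarrow> half u g \<Longrightarrow> l2norm u \<le> C0 * (norm (u 0) + l2norm (residual (B \<mu>) u g))"
    and hol: "(\<lambda>\<mu>. B \<mu> x $ i $ j) holomorphic_on ball z \<delta>"
    and solvable: "f \<in> L2 \<Longrightarrow> (\<And>x. x < 0 \<Longrightarrow> f x = 0) \<Longrightarrow> \<exists>u g. half u g \<and> (AE x in lborel. residual (B z) u g x = f x)"
begin

lemma delta_pos: "\<delta> > 0" and K_nonneg: "K \<ge> 0"
  using Lip by (auto simp: half_Lipschitz_def)

lemma center_in_ball: "z \<in> ball z \<delta>"
  using delta_pos by simp

lemma L2_residual_at: "\<mu> \<in> ball z \<delta> \<Longrightarrow> half u g \<Longrightarrow> residual (B \<mu>) u g \<in> L2"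
  using di[of \<mu>] L2_residual by (auto simp: dichotomy_def)

lemma residual_difference_le:
  assumes "\<mu> \<in> ball z \<delta>" "half u g"
  shows "l2norm (\<lambda>x. residual (B \<mu>) u g x - residual (B z) u g x) \<le> K * norm (\<mu> - z) * (l2norm u + l2norm g)"
proof -
  have "l2norm (\<lambda>x. residual (B \<mu>) u g x - residual (B z) u g x) = l2norm (\<lambda>x. B \<mu> x *v u x - B z x *v u x)"
    by (rule l2norm_cong_norm) (simp add: residual_def norm_minus_commute)
  also have "\<dots> \<le> K * norm (\<mu> - z) * (l2norm u + l2norm g)" using Lip assms by (auto simp: half_Lipschitz_def)
  finally show ?thesis .
qed

lemma residual_le:
  assumes "\<mu> \<in> ball z \<delta>" "half u g"
  shows "l2norm (residual (B \<mu>) u g) \<le> l2norm (residual (B z) u g) + K * norm (\<mu> - z) * (l2norm u + l2norm g)"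
proof -
  have "l2norm (residual (B \<mu>) u g) = l2norm (\<lambda>x. residual (B z) u g x + (residual (B \<mu>) u g x - residual (B z) u g x))" by simp
  also have "\<dots> \<le> l2norm (residual (B z) u g) + l2norm (\<lambda>x. residual (B \<mu>) u g x - residual (B z) u g x)"
    by (intro l2norm_triangle L2_diff L2_residual_at assms center_in_ball)
  finally show ?thesis using residual_difference_le[OF assms] by linarith
qed

lemma residual_holomorphic: "(\<lambda>\<mu>. residual (B \<mu>) u g x $ i) holomorphic_on ball z \<delta>"
  unfolding residual_def matrix_vector_mult_def by (simp, intro holomorphic_intros hol)

text \<open>Solutions depend boundedly on their initial values, so limits of elements of \<open>E \<mu>\<close> lie in \<open>E z\<close>.\<close>

lemma limit_in_subspace:
  assumes "r > 0" "\<And>\<mu>. \<mu> \<in> ball z r \<Longrightarrow> \<mu> \<noteq> z \<Longrightarrow> \<exists>e\<in>E \<mu>. norm (v - e) \<le> C * norm (\<mu> - z)"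
  shows "v \<in> E z"
proof -
  have sub: "vec.subspace (E z)" by (rule dichotomyD(1)[OF di[OF center_in_ball]])
  obtain \<beta> where \<beta>: "bounded_coeff \<beta> (B z)" using di[OF center_in_ball] by (auto simp: dichotomy_def)
  have b0: "\<beta> \<ge> 0" by (rule bounded_coeffD(1)[OF \<beta>])
  define X where "X = norm v + \<bar>C\<bar>"
  have X0: "X \<ge> 0" by (simp add: X_def)
  \<comment> \<open>Ensures \<open>K * s \<le> 1 / 2\<close>, so that the norm of \<open>g\<close>,
    which appears on both sides of its own bound, can be absorbed.\<close>
  define s where "s = min (min r \<delta>) (min 1 (1 / (2 * K * (1 + C0) + 1)))"
  have s: "s > 0" "s \<le> 1" "K * s \<le> 1 / 2"
  proof -
    have den: "2 * K * (1 + C0) + 1 > 0" using K_nonneg C0 by (intro add_nonneg_pos mult_nonneg_nonneg) auto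
    show "s > 0" "s \<le> 1" using assms(1) delta_pos den by (auto simp: s_def)
    have "K * s \<le> K * (1 / (2 * K * (1 + C0) + 1))" using K_nonneg by (intro mult_left_mono) (auto simp: s_def)
    also have "\<dots> \<le> 1 / 2"
    proof -
      have "2 * K * 1 \<le> 2 * K * (1 + C0)" using K_nonneg C0 by (intro mult_left_mono) auto
      then show ?thesis using den by (simp add: field_simps)
    qed
    finally show "K * s \<le> 1 / 2" .
  qed
  have dist: "\<exists>e\<in>E z. norm (v - e) \<le> (\<bar>C\<bar> + C0 * (K * ((C0 + 2 * (1 + \<beta>) * C0 + 1) * X))) * t" if t: "0 < t" "t < s" for t
  proof -
    define \<mu> where "\<mu> = z + of_real t"
    have \<mu>: "\<mu> \<in> ball z r" "\<mu> \<in> ball z \<delta>" "\<mu> \<noteq> z" "norm (\<mu> - z) = t" using t by (auto simp: \<mu>_def dist_norm s_def)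
    obtain e where e: "e \<in> E \<mu>" "norm (v - e) \<le> C * norm (\<mu> - z)" using assms(2)[OF \<mu>(1,3)] by blast
    have vC: "norm (v - e) \<le> \<bar>C\<bar> * t"
    proof -
      have "C * t \<le> \<bar>C\<bar> * t" using t by (intro mult_right_mono) auto
      then show ?thesis using e(2) unfolding \<mu>(4) by linarith
    qed
    also have "\<dots> \<le> \<bar>C\<bar> * 1" using t s by (intro mult_left_mono) auto
    finally have eX: "norm e \<le> X" using norm_triangle_ineq2[of e v] by (simp add: X_def norm_minus_commute)
    obtain u g where u: "half u g" "\<And>x. residual (B \<mu>) u g x = 0" "u 0 = e" using dichotomyD(2)[OF di[OF \<mu>(2)] e(1)] by blast
    have r0: "l2norm (residual (B \<mu>) u g) = 0" using u(2) by (simp add: l2norm_def)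
    have uX: "l2norm u \<le> C0 * X" using apriori[OF \<mu>(2) u(1)] r0 u(3) mult_left_mono[OF eX C0] by simp
    have diff: "l2norm (residual (B z) u g) \<le> K * t * (l2norm u + l2norm g)"
    proof -
      have "l2norm (residual (B z) u g) = l2norm (\<lambda>x. residual (B \<mu>) u g x - residual (B z) u g x)"
        by (rule l2norm_cong_norm) (simp add: u(2))
      then show ?thesis using residual_difference_le[OF \<mu>(2) u(1)] \<mu>(4) by simp
    qed
    have "l2norm g \<le> K * t * (l2norm u + l2norm g) + \<beta> * l2norm u" using l2norm_derivative_le[OF \<beta> u(1)] diff by linarith
    also have "K * t * (l2norm u + l2norm g) \<le> 1 / 2 * (l2norm u + l2norm g)"
    proof (rule mult_right_mono)
      have "K * t \<le> K * s" using t K_nonneg by (intro mult_left_mono) auto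
      then show "K * t \<le> 1 / 2" using s(3) by linarith
    qed simp
    finally have "l2norm g \<le> 1 / 2 * (l2norm u + l2norm g) + \<beta> * l2norm u" by simp
    moreover have "G \<le> 1 / 2 * (U + G) + bU \<Longrightarrow> 0 \<le> U \<Longrightarrow> G \<le> 2 * (U + bU)" for G U bU :: real by argo
    ultimately have "l2norm g \<le> 2 * (l2norm u + \<beta> * l2norm u)" using l2norm_nonneg[of u] by blast
    then have "l2norm g \<le> 2 * (1 + \<beta>) * l2norm u" by (simp add: algebra_simps)
    also have "\<dots> \<le> 2 * (1 + \<beta>) * (C0 * X)" using uX b0 by (intro mult_left_mono) auto
    finally have gX: "l2norm g \<le> 2 * (1 + \<beta>) * C0 * X" by (simp add: mult.assoc)
    have "l2norm u + l2norm g \<le> (C0 + 2 * (1 + \<beta>) * C0 + 1) * X" using uX gX X0 by (simp add: distrib_right)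
    then have "K * t * (l2norm u + l2norm g) \<le> K * t * ((C0 + 2 * (1 + \<beta>) * C0 + 1) * X)"
      using K_nonneg t by (intro mult_left_mono) auto
    with diff have rz: "l2norm (residual (B z) u g) \<le> K * t * ((C0 + 2 * (1 + \<beta>) * C0 + 1) * X)" by linarith
    obtain e' where e': "e' \<in> E z" "norm (u 0 - e') \<le> C0 * l2norm (residual (B z) u g)"
      using trace[OF center_in_ball u(1)] by blast
    have "norm (v - e') \<le> norm (v - e) + norm (e - e')" using norm_triangle_ineq[of "v - e" "e - e'"] by simp
    also have "\<dots> \<le> \<bar>C\<bar> * t + C0 * (K * t * ((C0 + 2 * (1 + \<beta>) * C0 + 1) * X))"
      using vC e'(2) u(3) mult_left_mono[OF rz C0] by (intro add_mono) auto
    finally show ?thesis using e'(1) by (auto simp: algebra_simps)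
  qed
  define D where "D = \<bar>C\<bar> + C0 * (K * ((C0 + 2 * (1 + \<beta>) * C0 + 1) * X))"
  have cl: "closed (E z)" by (rule closed_subspace[OF vec_subspace_imp_subspace[OF sub]])
  have "v \<in> closure (E z)" unfolding closure_approachable
  proof (intro allI impI)
    fix \<epsilon> :: real assume \<epsilon>: "\<epsilon> > 0"
    define t where "t = min (s / 2) (\<epsilon> / (2 * (\<bar>D\<bar> + 1)))"
    have t: "0 < t" "t < s" using s \<epsilon> by (auto simp: t_def)
    obtain e where e: "e \<in> E z" "norm (v - e) \<le> D * t" using dist[OF t] unfolding D_def by blast
    have "D * t \<le> (\<bar>D\<bar> + 1) * (\<epsilon> / (2 * (\<bar>D\<bar> + 1)))" using t by (intro mult_mono) (auto simp: t_def)
    also have "\<dots> = \<epsilon> / 2"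
    proof -
      have "q * (\<epsilon> / (2 * q)) = \<epsilon> / 2" if "q > 0" for q :: real using that by simp
      from this[of "\<bar>D\<bar> + 1"] show ?thesis by simp
    qed
    also have "\<dots> < \<epsilon>" using \<epsilon> by simp
    finally have "dist e v < \<epsilon>" using e(2) by (simp add: dist_norm norm_minus_commute)
    then show "\<exists>y\<in>E z. dist y v < \<epsilon>" using e(1) by blast
  qed
  then show ?thesis using cl by (simp add: closure_closed)
qed

text \<open>For fixed \<open>\<mu>\<close> the polynomial with coefficients \<open>u j\<close> is
  itself a half-line function, so \<open>trace\<close> applies to it as a whole.\<close>

lemma jet_in_if_half_jets:
  assumes h: "\<And>j. j < p \<Longrightarrow> half (u j) (g j)" and r: "r > 0" and C: "C \<ge> 0"
    and res: "\<And>\<mu>. \<mu> \<in> ball z r \<Longrightarrow> l2norm (\<lambda>x. \<Sum>j<p. (\<mu> - z) ^ j *s residual (B \<mu>) (u j) (g j) x) \<le> C * norm (\<mu> - z) ^ p"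
  shows "jet_in E z p (\<lambda>j. u j 0)"
  unfolding jet_in_def
proof (intro exI conjI ballI)
  fix \<mu> assume \<mu>: "\<mu> \<in> ball z (min r \<delta>)"
  have hs: "half (\<lambda>x. \<Sum>j<p. (\<mu> - z) ^ j *s u j x) (\<lambda>x. \<Sum>j<p. (\<mu> - z) ^ j *s g j x)" by (intro half_sum half_scale h) auto
  obtain e where e: "e \<in> E \<mu>" "norm ((\<Sum>j<p. (\<mu> - z) ^ j *s u j 0) - e) \<le>
      C0 * l2norm (residual (B \<mu>) (\<lambda>x. \<Sum>j<p. (\<mu> - z) ^ j *s u j x) (\<lambda>x. \<Sum>j<p. (\<mu> - z) ^ j *s g j x))"
    using trace[OF _ hs] \<mu> by force
  note e(2)
  also have "C0 * l2norm (residual (B \<mu>) (\<lambda>x. \<Sum>j<p. (\<mu> - z) ^ j *s u j x) (\<lambda>x. \<Sum>j<p. (\<mu> - z) ^ j *s g j x))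
      \<le> C0 * (C * norm (\<mu> - z) ^ p)" unfolding residual_sum residual_scale using res[of \<mu>] \<mu> C0 by (intro mult_left_mono) auto
  finally show "\<exists>e\<in>E \<mu>. norm (jet_sum z p (\<lambda>j. u j 0) \<mu> - e) \<le> C0 * C * norm (\<mu> - z) ^ p"
    using e(1) by (auto simp: jet_sum_def mult.assoc)
qed (use r delta_pos C C0 in auto)

lemma jet_in_Suc:
  assumes "jet_in E z (Suc p) w" shows "jet_in E z p w"
proof -
  obtain C r where C: "C \<ge> 0" "r > 0"
    "\<And>\<mu>. \<mu> \<in> ball z r \<Longrightarrow> \<exists>e\<in>E \<mu>. norm (jet_sum z (Suc p) w \<mu> - e) \<le> C * norm (\<mu> - z) ^ Suc p"
    using assms unfolding jet_in_def by blast
  show ?thesis unfolding jet_in_def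
  proof (intro exI conjI ballI)
    fix \<mu> assume \<mu>: "\<mu> \<in> ball z (min r 1)"
    then obtain e where e: "e \<in> E \<mu>" "norm (jet_sum z (Suc p) w \<mu> - e) \<le> C * norm (\<mu> - z) ^ Suc p" using C(3)[of \<mu>] by auto
    have t1: "norm (\<mu> - z) \<le> 1" using \<mu> by (simp add: dist_norm norm_minus_commute)
    have "norm (jet_sum z p w \<mu> - e) = norm ((jet_sum z (Suc p) w \<mu> - e) - (\<mu> - z) ^ p *s w p)" by (simp add: jet_sum_def)
    also have "\<dots> \<le> norm (jet_sum z (Suc p) w \<mu> - e) + norm ((\<mu> - z) ^ p *s w p)" by (rule norm_triangle_ineq4)
    also have "\<dots> \<le> C * norm (\<mu> - z) ^ p + norm (w p) * norm (\<mu> - z) ^ p"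
    proof (rule add_mono)
      have "C * norm (\<mu> - z) ^ Suc p \<le> C * norm (\<mu> - z) ^ p" using C(1) t1 by (intro mult_left_mono power_decreasing) auto
      then show "norm (jet_sum z (Suc p) w \<mu> - e) \<le> C * norm (\<mu> - z) ^ p" using e(2) by linarith
    qed (simp add: norm_vec_scale norm_power)
    finally show "\<exists>e\<in>E \<mu>. norm (jet_sum z p w \<mu> - e) \<le> (C + norm (w p)) * norm (\<mu> - z) ^ p"
      using e(1) by (auto simp: distrib_right)
  qed (use C in auto)
qed

text \<open>The leading term \<open>f\<close> of the residual, of order \<open>p\<close>, is in
  \<open>L2\<close> and vanishes for \<open>x < 0\<close>, so solving at \<open>z\<close> removes
  it. The new coefficient \<open>v\<close> comes with an arbitrary trace; but \<open>v 0\<close> and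
  \<open>w p\<close> both continue the same jet to contact of order \<open>Suc p\<close>, so their
  difference lies in \<open>E z\<close> and is the trace of a homogeneous solution at
  \<open>z\<close>, which is subtracted.\<close>

theorem half_jets_if_jet_in:
  assumes "jet_in E z p w"
  shows "\<exists>u g. (\<forall>j. half (u j) (g j)) \<and> (\<forall>j<p. u j 0 = w j) \<and> (\<exists>C\<ge>0. \<exists>r>0. r \<le> \<delta> \<and> (\<forall>\<mu>\<in>ball z r.
    l2norm (\<lambda>x. \<Sum>j<p. (\<mu> - z) ^ j *s residual (B \<mu>) (u j) (g j) x) \<le> C * norm (\<mu> - z) ^ p))" using assms
proof (induction p)
  case 0
  show ?case by (rule exI[of _ "\<lambda>j x. 0"], rule exI[of _ "\<lambda>j x. 0"])
      (use delta_pos in \<open>auto intro!: exI[of _ 0] exI[of _ \<delta>] half_zero\<close>)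
next
  case (Suc p)
  obtain u g C r where h: "\<And>j. half (u j) (g j)" and u0: "\<And>j. j < p \<Longrightarrow> u j 0 = w j" and C: "C \<ge> 0" and r: "r > 0" "r \<le> \<delta>"
    and res: "\<And>\<mu>. \<mu> \<in> ball z r \<Longrightarrow> l2norm (\<lambda>x. \<Sum>j<p. (\<mu> - z) ^ j *s residual (B \<mu>) (u j) (g j) x) \<le> C * norm (\<mu> - z) ^ p"
    using Suc.IH[OF jet_in_Suc[OF Suc.prems]] by blast
  define \<rho> where "\<rho> = (\<lambda>\<mu> x. \<Sum>j<p. (\<mu> - z) ^ j *s residual (B \<mu>) (u j) (g j) x)"
  have sub: "ball z r \<subseteq> ball z \<delta>" using r by auto
  have \<rho>hol: "(\<lambda>\<mu>. \<rho> \<mu> x $ i) holomorphic_on ball z r" for x i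
    unfolding \<rho>_def by (simp, intro holomorphic_intros holomorphic_on_subset[OF residual_holomorphic sub])
  have \<rho>L: "\<rho> \<mu> \<in> L2" if "\<mu> \<in> ball z r" for \<mu> unfolding \<rho>_def using that sub by (intro L2_sum L2_scale L2_residual_at h) auto
  obtain f C' r' where f: "f \<in> L2" "\<forall>x. (\<forall>\<mu>. \<rho> \<mu> x = 0) \<longrightarrow> f x = 0" and C': "C' \<ge> 0" and r': "0 < r'" "r' \<le> r"
    and f_rem: "\<And>\<mu>. \<mu> \<in> ball z r' \<Longrightarrow> l2norm (\<lambda>x. \<rho> \<mu> x - (\<mu> - z) ^ p *s f x) \<le> C' * norm (\<mu> - z) ^ Suc p"
  proof -
    have res': "l2norm (\<rho> \<mu>) \<le> C * norm (\<mu> - z) ^ p" if "\<mu> \<in> ball z r" for \<mu> unfolding \<rho>_def by (rule res[OF that])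
    show ?thesis by (rule L2_leading_coefficient[OF \<rho>hol r(1) C \<rho>L res']) (assumption+, rule that)
  qed
  have "\<exists>v k. half v k \<and> (AE x in lborel. residual (B z) v k x = - f x)"
  proof (rule solvable)
    show "(\<lambda>x. - f x) \<in> L2" by (rule L2_minus[OF f(1)])
    show "- f x = 0" if "x < 0" for x using f(2) residual_neg_half[OF h that] by (simp add: \<rho>_def)
  qed
  then obtain v k where v: "half v k" "AE x in lborel. residual (B z) v k x = - f x" by blast
  define X where "X = l2norm v + l2norm k"
  have r'\<delta>: "\<mu> \<in> ball z \<delta>" if "\<mu> \<in> ball z r'" for \<mu> using that r r' by auto
  \<comment> \<open>The equation for \<open>v\<close> holds at \<open>z\<close> only; passing to
    \<open>\<mu>\<close> costs a term with a factor \<open>norm (\<mu> - z)\<close>, which supplies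
    exactly the missing order.\<close>
  have step: "l2norm (\<lambda>x. \<rho> \<mu> x + (\<mu> - z) ^ p *s residual (B \<mu>) v k x) \<le> (C' + K * X) * norm (\<mu> - z) ^ Suc p"
    if \<mu>: "\<mu> \<in> ball z r'" for \<mu>
  proof -
    let ?d = "\<lambda>x. residual (B \<mu>) v k x - residual (B z) v k x"
    have L: "\<rho> \<mu> \<in> L2" "residual (B \<mu>) v k \<in> L2" "?d \<in> L2"
      using \<rho>L L2_residual_at[OF r'\<delta>[OF \<mu>] v(1)] L2_residual_at[OF center_in_ball v(1)] \<mu> r' by (auto intro: L2_diff)
    have "l2norm (\<lambda>x. \<rho> \<mu> x + (\<mu> - z) ^ p *s residual (B \<mu>) v k x) =
        l2norm (\<lambda>x. (\<rho> \<mu> x - (\<mu> - z) ^ p *s f x) + (\<mu> - z) ^ p *s ?d x)"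
    proof (rule l2norm_cong_AE)
      show "AE x in lborel. \<rho> \<mu> x + (\<mu> - z) ^ p *s residual (B \<mu>) v k x = (\<rho> \<mu> x - (\<mu> - z) ^ p *s f x) + (\<mu> - z) ^ p *s ?d x"
        using v(2) by eventually_elim (simp add: vec.scale_right_distrib)
    qed (intro L2_add L2_diff L2_scale L f)+
    also have "\<dots> \<le> l2norm (\<lambda>x. \<rho> \<mu> x - (\<mu> - z) ^ p *s f x) + l2norm (\<lambda>x. (\<mu> - z) ^ p *s ?d x)"
      by (intro l2norm_triangle L2_diff L2_scale L f)
    also have "\<dots> \<le> C' * norm (\<mu> - z) ^ Suc p + norm (\<mu> - z) ^ p * (K * norm (\<mu> - z) * X)"
      unfolding l2norm_scale norm_power X_def
      by (intro add_mono f_rem[OF \<mu>] mult_left_mono residual_difference_le[OF r'\<delta>[OF \<mu>] v(1)]) auto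
    finally show ?thesis by (simp add: algebra_simps)
  qed
  define U G where "U = u(p := v)" and "G = g(p := k)"
  have UG: "half (U j) (G j)" for j using h v(1) by (simp add: U_def G_def)
  have sumUG: "(\<Sum>j<Suc p. (\<mu> - z) ^ j *s residual (B \<mu>) (U j) (G j) x) = \<rho> \<mu> x + (\<mu> - z) ^ p *s residual (B \<mu>) v k x" for \<mu> x
    by (simp add: \<rho>_def U_def G_def)
  have X0: "X \<ge> 0" by (simp add: X_def)
  have CX: "C' + K * X \<ge> 0" using C' K_nonneg X0 by simp
  \<comment> \<open>Contact already holds with the uncorrected top entry \<open>v 0\<close>;
    comparison with the given jet isolates \<open>v 0 - w p\<close>.\<close>
  have "jet_in E z (Suc p) (\<lambda>j. U j 0)" by (rule jet_in_if_half_jets[OF UG r'(1) CX]) (simp only: sumUG, rule step)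
  then obtain C1 r1 where C1: "C1 \<ge> 0" "r1 > 0"
    "\<And>\<mu>. \<mu> \<in> ball z r1 \<Longrightarrow> \<exists>e\<in>E \<mu>. norm (jet_sum z (Suc p) (\<lambda>j. U j 0) \<mu> - e) \<le> C1 * norm (\<mu> - z) ^ Suc p"
    unfolding jet_in_def by blast
  obtain C2 r2 where C2: "C2 \<ge> 0" "r2 > 0"
    "\<And>\<mu>. \<mu> \<in> ball z r2 \<Longrightarrow> \<exists>e\<in>E \<mu>. norm (jet_sum z (Suc p) w \<mu> - e) \<le> C2 * norm (\<mu> - z) ^ Suc p"
    using Suc.prems unfolding jet_in_def by blast
  have "v 0 - w p \<in> E z"
  proof (rule limit_in_subspace)
    show "min \<delta> (min r1 r2) > 0" using C1 C2 delta_pos by simp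
    fix \<mu> assume \<mu>: "\<mu> \<in> ball z (min \<delta> (min r1 r2))" "\<mu> \<noteq> z"
    have subE: "vec.subspace (E \<mu>)" using dichotomyD(1)[OF di] \<mu> by simp
    obtain e1 where e1: "e1 \<in> E \<mu>" "norm (jet_sum z (Suc p) (\<lambda>j. U j 0) \<mu> - e1) \<le> C1 * norm (\<mu> - z) ^ Suc p"
      using C1(3)[of \<mu>] \<mu> by auto
    obtain e2 where e2: "e2 \<in> E \<mu>" "norm (jet_sum z (Suc p) w \<mu> - e2) \<le> C2 * norm (\<mu> - z) ^ Suc p" using C2(3)[of \<mu>] \<mu> by auto
    let ?t = "(\<mu> - z) ^ p"
    have t: "?t \<noteq> 0" using \<mu>(2) by simp
    have eq: "?t *s (v 0 - w p) - (e1 - e2) = (jet_sum z (Suc p) (\<lambda>j. U j 0) \<mu> - e1) - (jet_sum z (Suc p) w \<mu> - e2)"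
      by (simp add: jet_sum_def U_def u0 vec.scale_right_diff_distrib)
    have "norm ?t * norm ((v 0 - w p) - (1 / ?t) *s (e1 - e2)) = norm (?t *s (v 0 - w p) - (e1 - e2))"
    proof -
      have "?t *s ((v 0 - w p) - (1 / ?t) *s (e1 - e2)) = ?t *s (v 0 - w p) - (e1 - e2)"
      proof -
        have tt: "?t * (1 / ?t) = 1" by (simp only: times_divide_eq_right mult_1_right divide_self[OF t])
        show ?thesis by (simp only: vec.scale_right_diff_distrib vec.scale_scale tt vec.scale_one)
      qed
      then show ?thesis by (metis norm_vec_scale)
    qed
    also have "\<dots> \<le> C1 * norm (\<mu> - z) ^ Suc p + C2 * norm (\<mu> - z) ^ Suc p"
      unfolding eq by (rule order_trans[OF norm_triangle_ineq4 add_mono[OF e1(2) e2(2)]])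
    also have "\<dots> = norm ?t * ((C1 + C2) * norm (\<mu> - z))" by (simp add: norm_power algebra_simps)
    finally have "norm ((v 0 - w p) - (1 / ?t) *s (e1 - e2)) \<le> (C1 + C2) * norm (\<mu> - z)"
      by (rule mult_left_le_imp_le) (use t in simp)
    moreover have "(1 / ?t) *s (e1 - e2) \<in> E \<mu>" by (intro vec.subspace_scale[OF subE] vec.subspace_diff[OF subE] e1 e2)
    ultimately show "\<exists>e\<in>E \<mu>. norm (v 0 - w p - e) \<le> (C1 + C2) * norm (\<mu> - z)" by blast
  qed
  then obtain a b where ab: "half a b" "\<And>x. residual (B z) a b x = 0" "a 0 = v 0 - w p"
    using dichotomyD(2)[OF di[OF center_in_ball]] by blast
  define v' k' where "v' = (\<lambda>x. v x - a x)" and "k' = (\<lambda>x. k x - b x)"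
  define Y where "Y = l2norm a + l2norm b"
  have hv': "half v' k'" unfolding v'_def k'_def by (rule half_diff[OF v(1) ab(1)])
  \<comment> \<open>The residual of \<open>a\<close> vanishes at \<open>z\<close>, so at
    \<open>\<mu>\<close> it is of first order and the bound of order \<open>Suc p\<close> survives
    the correction.\<close>
  have step': "l2norm (\<lambda>x. \<rho> \<mu> x + (\<mu> - z) ^ p *s residual (B \<mu>) v' k' x) \<le> (C' + K * X + K * Y) * norm (\<mu> - z) ^ Suc p"
    if \<mu>: "\<mu> \<in> ball z r'" for \<mu>
  proof -
    have L: "\<rho> \<mu> \<in> L2" "residual (B \<mu>) v k \<in> L2" "residual (B \<mu>) a b \<in> L2"
      using \<rho>L L2_residual_at[OF r'\<delta>[OF \<mu>] v(1)] L2_residual_at[OF r'\<delta>[OF \<mu>] ab(1)] \<mu> r' by auto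
    have ra: "l2norm (residual (B \<mu>) a b) \<le> K * norm (\<mu> - z) * Y"
    proof -
      have "l2norm (residual (B \<mu>) a b) = l2norm (\<lambda>x. residual (B \<mu>) a b x - residual (B z) a b x)"
        by (rule l2norm_cong_norm) (simp add: ab(2))
      then show ?thesis using residual_difference_le[OF r'\<delta>[OF \<mu>] ab(1)] by (simp add: Y_def)
    qed
    have "(\<lambda>x. \<rho> \<mu> x + (\<mu> - z) ^ p *s residual (B \<mu>) v' k' x) =
        (\<lambda>x. (\<rho> \<mu> x + (\<mu> - z) ^ p *s residual (B \<mu>) v k x) - (\<mu> - z) ^ p *s residual (B \<mu>) a b x)"
      unfolding v'_def k'_def residual_diff by (simp only: vec.scale_right_diff_distrib add_diff_eq)
    then have "l2norm (\<lambda>x. \<rho> \<mu> x + (\<mu> - z) ^ p *s residual (B \<mu>) v' k' x) \<le>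
        l2norm (\<lambda>x. \<rho> \<mu> x + (\<mu> - z) ^ p *s residual (B \<mu>) v k x) + l2norm (\<lambda>x. (\<mu> - z) ^ p *s residual (B \<mu>) a b x)"
      using l2norm_triangle_diff[OF L2_add[OF L(1) L2_scale[OF L(2), of "(\<mu> - z) ^ p"]] L2_scale[OF L(3), of "(\<mu> - z) ^ p"]] by simp
    also have "\<dots> \<le> (C' + K * X) * norm (\<mu> - z) ^ Suc p + norm (\<mu> - z) ^ p * (K * norm (\<mu> - z) * Y)"
      unfolding l2norm_scale norm_power by (intro add_mono step[OF \<mu>] mult_left_mono ra) auto
    finally show ?thesis by (simp add: algebra_simps)
  qed
  have sum': "(\<Sum>j<Suc p. (\<mu> - z) ^ j *s residual (B \<mu>) ((u(p := v')) j) ((g(p := k')) j) x) =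
      \<rho> \<mu> x + (\<mu> - z) ^ p *s residual (B \<mu>) v' k' x" for \<mu> x by (simp add: \<rho>_def)
  have Y0: "Y \<ge> 0" by (simp add: Y_def)
  show ?case
  proof (rule exI[of _ "u(p := v')"], rule exI[of _ "g(p := k')"], intro conjI allI impI)
    show "half ((u(p := v')) j) ((g(p := k')) j)" for j using h hv' by simp
    show "(u(p := v')) j 0 = w j" if "j < Suc p" for j using that u0 ab(3) by (auto simp: v'_def less_Suc_eq)
    show "\<exists>C\<ge>0. \<exists>r>0. r \<le> \<delta> \<and> (\<forall>\<mu>\<in>ball z r.
        l2norm (\<lambda>x. \<Sum>j<Suc p. (\<mu> - z) ^ j *s residual (B \<mu>) ((u(p := v')) j) ((g(p := k')) j) x) \<le> C * norm (\<mu> - z) ^ Suc p)"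
      unfolding sum' using step' r r' CX K_nonneg Y0 by (intro exI[of _ "C' + K * X + K * Y"] exI[of _ r'] conjI) auto
  qed
qed

text \<open>All terms except the constant one carry a factor \<open>\<mu> - z\<close>; letting
  \<open>\<mu>\<close> tend to \<open>z\<close> along a ray leaves the constant term with norm
  0.\<close>

lemma residual_bound_at_center:
  assumes h: "\<And>j. half (u j) (g j)" and r: "r > 0" and p: "p > 0"
    and res: "\<And>\<mu>. \<mu> \<in> ball z r \<Longrightarrow> \<mu> \<noteq> z \<Longrightarrow> l2norm (\<lambda>x. \<Sum>j<p. (\<mu> - z) ^ j *s residual (B \<mu>) (u j) (g j) x) \<le> C * norm (\<mu> - z) ^ p"
  shows "l2norm (residual (B z) (u 0) (g 0)) = 0"
proof -
  obtain q where q: "p = Suc q" using p by (cases p) auto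
  \<comment> \<open>Bounds the residual of the coefficient \<open>u j\<close> uniformly for
    \<open>norm (\<mu> - z) \<le> 1\<close>.\<close>
  define D where "D = (\<lambda>j. l2norm (residual (B z) (u j) (g j)) + K * (l2norm (u j) + l2norm (g j)))"
  define M where "M = \<bar>C\<bar> + (\<Sum>j<q. D (Suc j)) + D 0"
  have D0: "D j \<ge> 0" for j using K_nonneg by (simp add: D_def)
  have key: "l2norm (residual (B z) (u 0) (g 0)) \<le> M * t" if t: "0 < t" "t < min r (min \<delta> 1)" for t
  proof -
    define \<mu> where "\<mu> = z + of_real t"
    have \<mu>: "\<mu> \<in> ball z r" "\<mu> \<in> ball z \<delta>" "\<mu> \<noteq> z" "norm (\<mu> - z) = t" using t by (auto simp: \<mu>_def dist_norm)
    have L: "residual (B \<mu>) (u j) (g j) \<in> L2" for j by (rule L2_residual_at[OF \<mu>(2) h])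
    have Lz: "residual (B z) (u j) (g j) \<in> L2" for j by (rule L2_residual_at[OF center_in_ball h])
    have Dj: "l2norm (residual (B \<mu>) (u j) (g j)) \<le> D j" for j
    proof -
      have "K * norm (\<mu> - z) * (l2norm (u j) + l2norm (g j)) \<le> K * 1 * (l2norm (u j) + l2norm (g j))"
        using K_nonneg t \<mu>(4) by (intro mult_right_mono mult_left_mono) auto
      then show ?thesis using residual_le[OF \<mu>(2) h, of j] by (simp add: D_def)
    qed
    let ?S = "\<lambda>x. \<Sum>j<p. (\<mu> - z) ^ j *s residual (B \<mu>) (u j) (g j) x"
    let ?R = "\<lambda>x. \<Sum>j<q. (\<mu> - z) ^ Suc j *s residual (B \<mu>) (u (Suc j)) (g (Suc j)) x"
    let ?d = "\<lambda>x. residual (B \<mu>) (u 0) (g 0) x - residual (B z) (u 0) (g 0) x"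
    have LS: "?S \<in> L2" "?R \<in> L2" "?d \<in> L2" by (intro L2_sum L2_scale L2_diff L Lz)+
    have eq: "residual (B z) (u 0) (g 0) = (\<lambda>x. (?S x - ?R x) - ?d x)"
      by (simp add: q fun_eq_iff sum.lessThan_Suc_shift del: sum.lessThan_Suc power_Suc)
    have "l2norm (residual (B z) (u 0) (g 0)) \<le> l2norm ?S + l2norm ?R + l2norm ?d"
      by (subst eq) (rule order_trans[OF l2norm_triangle_diff[OF L2_diff[OF LS(1,2)] LS(3)] add_right_mono[OF l2norm_triangle_diff[OF LS(1,2)]]])
    also have "l2norm ?S \<le> \<bar>C\<bar> * t"
    proof -
      have "l2norm ?S \<le> C * t ^ p" using res[OF \<mu>(1,3)] \<mu>(4) by simp
      also have "\<dots> \<le> \<bar>C\<bar> * t ^ p" using t by (intro mult_right_mono) auto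
      also have "\<dots> \<le> \<bar>C\<bar> * t ^ 1" using t p by (intro mult_left_mono power_decreasing) auto
      finally show ?thesis by simp
    qed
    also have "l2norm ?R \<le> (\<Sum>j<q. D (Suc j)) * t"
    proof -
      have "l2norm ?R \<le> (\<Sum>j<q. l2norm (\<lambda>x. (\<mu> - z) ^ Suc j *s residual (B \<mu>) (u (Suc j)) (g (Suc j)) x))"
        by (rule l2norm_sum) (intro L2_scale L)
      also have "\<dots> \<le> (\<Sum>j<q. D (Suc j) * t)"
      proof (rule sum_mono)
        fix j
        have "t ^ Suc j * l2norm (residual (B \<mu>) (u (Suc j)) (g (Suc j))) \<le> t ^ 1 * D (Suc j)"
          using t Dj D0 by (intro mult_mono power_decreasing) auto
        then show "l2norm (\<lambda>x. (\<mu> - z) ^ Suc j *s residual (B \<mu>) (u (Suc j)) (g (Suc j)) x) \<le> D (Suc j) * t"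
          unfolding l2norm_scale norm_power \<mu>(4) by (simp add: mult.commute)
      qed
      finally show ?thesis by (simp add: sum_distrib_right)
    qed
    also have "l2norm ?d \<le> D 0 * t"
    proof -
      have "l2norm ?d \<le> K * t * (l2norm (u 0) + l2norm (g 0))" using residual_difference_le[OF \<mu>(2) h, of 0] \<mu>(4) by simp
      also have "\<dots> = K * (l2norm (u 0) + l2norm (g 0)) * t" by simp
      also have "\<dots> \<le> D 0 * t" using t by (intro mult_right_mono) (auto simp: D_def)
      finally show ?thesis .
    qed
    finally show ?thesis by (simp add: M_def distrib_right)
  qed
  have M0: "M \<ge> 0" using D0 by (auto simp: M_def intro!: add_nonneg_nonneg sum_nonneg)
  have "l2norm (residual (B z) (u 0) (g 0)) \<le> \<epsilon>" if "\<epsilon> > 0" for \<epsilon>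
  proof -
    define t where "t = min (min r (min \<delta> 1) / 2) (\<epsilon> / (M + 1))"
    have t: "0 < t" "t < min r (min \<delta> 1)" using r delta_pos M0 that by (auto simp: t_def)
    have "M * t \<le> (M + 1) * (\<epsilon> / (M + 1))" using M0 t by (intro mult_mono) (auto simp: t_def)
    also have "\<dots> = \<epsilon>" using M0 by simp
    finally show ?thesis using key[OF t] by linarith
  qed
  then have "l2norm (residual (B z) (u 0) (g 0)) \<le> 0" by (rule field_le_epsilon[of _ 0, simplified])
  then show ?thesis using l2norm_nonneg[of "residual (B z) (u 0) (g 0)"] by linarith
qed

text \<open>A punctured neighbourhood suffices, since the bound forces the constant term to vanish.\<close>

lemma residual_bound_punctured:
  assumes h: "\<And>j. half (u j) (g j)" and r: "r > 0" and p: "p > 0"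
    and res: "\<And>\<mu>. \<mu> \<in> ball z r \<Longrightarrow> \<mu> \<noteq> z \<Longrightarrow> l2norm (\<lambda>x. \<Sum>j<p. (\<mu> - z) ^ j *s residual (B \<mu>) (u j) (g j) x) \<le> C * norm (\<mu> - z) ^ p"
    and \<mu>: "\<mu> \<in> ball z r"
  shows "l2norm (\<lambda>x. \<Sum>j<p. (\<mu> - z) ^ j *s residual (B \<mu>) (u j) (g j) x) \<le> C * norm (\<mu> - z) ^ p"
proof (cases "\<mu> = z")
  case True
  obtain q where q: "p = Suc q" using p by (cases p) auto
  have "(\<lambda>x. \<Sum>j<p. (\<mu> - z) ^ j *s residual (B \<mu>) (u j) (g j) x) = residual (B z) (u 0) (g 0)"
    by (simp add: True q sum.lessThan_Suc_shift del: sum.lessThan_Suc)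
  then show ?thesis using residual_bound_at_center[OF h r p res] by (simp add: True q)
qed (use res \<mu> in auto)

end

section \<open>Root functions of the differential operator and their traces at 0\<close>

lemma H1_zero: "0 \<in> H1" "(\<lambda>x. 0) \<in> H1"
  by (auto simp: zero_fun_def H1_def has_weak_deriv_def set_lebesgue_integral_def intro!: exI[of _ "\<lambda>x. 0"])

lemma H1_sum_scaled:
  assumes "\<And>j. j \<in> I \<Longrightarrow> u j \<in> H1" shows "(\<Sum>j\<in>I. cscale (c j) (u j)) \<in> H1"
  using assms by (induction I rule: infinite_finite_induct) (auto intro: H1_zero H1_lincomb)

lemma H1_scale: "u \<in> H1 \<Longrightarrow> cscale c u \<in> H1"
  using H1_lincomb[OF _ H1_zero(1)] by simp

lemma ode_op_sum_AE:
  assumes bd: "bounded_H1_L2 (ode_op A z)" and "\<And>j. j \<in> I \<Longrightarrow> u j \<in> H1"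
  shows "AE x in lborel. ode_op A z (\<Sum>j\<in>I. cscale (c j) (u j)) x = (\<Sum>j\<in>I. c j *s ode_op A z (u j) x)"
  using assms(2)
proof (induction I rule: infinite_finite_induct)
  case (insert i I)
  have "AE x in lborel. ode_op A z (cscale (c i) (u i) + (\<Sum>j\<in>I. cscale (c j) (u j))) x =
      c i *s ode_op A z (u i) x + ode_op A z (\<Sum>j\<in>I. cscale (c j) (u j)) x"
    using insert.prems by (intro bounded_H1_L2_lincomb_AE bd H1_sum_scaled) auto
  moreover have "AE x in lborel. ode_op A z (\<Sum>j\<in>I. cscale (c j) (u j)) x = (\<Sum>j\<in>I. c j *s ode_op A z (u j) x)"
    using insert by auto
  ultimately show ?case by eventually_elim (simp only: sum.insert[OF insert.hyps])
next
  case empty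
  have e: "cscale 1 0 + 0 = (0 :: real \<Rightarrow> complex ^ 'a)" by (simp add: cscale_def fun_eq_iff)
  have "AE x in lborel. ode_op A z 0 x = 0"
    using bounded_H1_L2_lincomb_AE[OF bd H1_zero(1) H1_zero(1), of 1] unfolding e by simp
  then show ?case by (simp only: sum.empty)
next
  case (infinite I)
  have e: "cscale 1 0 + 0 = (0 :: real \<Rightarrow> complex ^ 'a)" by (simp add: cscale_def fun_eq_iff)
  have "AE x in lborel. ode_op A z 0 x = 0"
    using bounded_H1_L2_lincomb_AE[OF bd H1_zero(1) H1_zero(1), of 1] unfolding e by simp
  then show ?case by (simp only: sum.infinite[OF infinite(1)])
qed

lemma bigo_at_iff:
  fixes f :: "complex \<Rightarrow> real"
  assumes nn: "\<And>z. f z \<ge> 0"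
  shows "f \<in> O[at z0](\<lambda>z. norm (z - z0) ^ p) \<longleftrightarrow> (\<exists>C\<ge>0. \<exists>r>0. \<forall>\<mu>\<in>ball z0 r. \<mu> \<noteq> z0 \<longrightarrow> f \<mu> \<le> C * norm (\<mu> - z0) ^ p)"
proof
  assume "f \<in> O[at z0](\<lambda>z. norm (z - z0) ^ p)"
  then obtain c where c: "c > 0" "\<forall>\<^sub>F x in at z0. norm (f x) \<le> c * norm (norm (x - z0) ^ p)" by (rule landau_o.bigE)
  then obtain r where r: "r > 0" "\<And>x. x \<noteq> z0 \<Longrightarrow> dist x z0 < r \<Longrightarrow> norm (f x) \<le> c * norm (norm (x - z0) ^ p)"
    unfolding eventually_at by blast
  show "\<exists>C\<ge>0. \<exists>r>0. \<forall>\<mu>\<in>ball z0 r. \<mu> \<noteq> z0 \<longrightarrow> f \<mu> \<le> C * norm (\<mu> - z0) ^ p"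
  proof (intro exI conjI ballI impI)
    fix \<mu> assume "\<mu> \<in> ball z0 r" "\<mu> \<noteq> z0"
    then show "f \<mu> \<le> c * norm (\<mu> - z0) ^ p" using r(2)[of \<mu>] nn[of \<mu>] by (simp add: dist_commute)
  qed (use c r in auto)
next
  assume "\<exists>C\<ge>0. \<exists>r>0. \<forall>\<mu>\<in>ball z0 r. \<mu> \<noteq> z0 \<longrightarrow> f \<mu> \<le> C * norm (\<mu> - z0) ^ p"
  then obtain C r where C: "r > 0" "\<And>\<mu>. \<mu> \<in> ball z0 r \<Longrightarrow> \<mu> \<noteq> z0 \<Longrightarrow> f \<mu> \<le> C * norm (\<mu> - z0) ^ p" by blast
  show "f \<in> O[at z0](\<lambda>z. norm (z - z0) ^ p)"
  proof (rule bigoI[where c = C])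
    show "\<forall>\<^sub>F x in at z0. norm (f x) \<le> C * norm (norm (x - z0) ^ p)"
      unfolding eventually_at using C nn by (intro exI[of _ r]) (auto simp: dist_commute)
  qed
qed

lemma continuous_zero_if_AE_zero:
  assumes h: "half u g" and u0: "l2norm u = 0" shows "u x = 0"
proof (cases "x < 0")
  case False
  show ?thesis
  proof (rule ccontr)
    assume ux: "u x \<noteq> 0"
    have "continuous (at x within {0..}) u" using half_continuous[OF h] False by (simp add: continuous_on_eq_continuous_within)
    then have "((u) \<longlongrightarrow> u x) (at x within {0..})" by (simp add: continuous_within)
    then have "\<forall>\<^sub>F y in at x within {0..}. dist (u y) (u x) < norm (u x) / 2" by (rule tendstoD) (use ux in simp)
    then obtain d where d: "d > 0" "\<And>y. y \<ge> 0 \<Longrightarrow> y \<noteq> x \<Longrightarrow> dist y x < d \<Longrightarrow> dist (u y) (u x) < norm (u x) / 2"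
      unfolding eventually_at by auto
    have big: "norm (u y) \<ge> norm (u x) / 2" if "y \<in> {x..x + d/2}" for y
    proof (cases "y = x")
      case False
      then have "dist (u y) (u x) < norm (u x) / 2" using d that \<open>\<not> x < 0\<close> by (intro d(2)) (auto simp: dist_real_def)
      moreover have "norm (u x) - norm (u y) \<le> dist (u y) (u x)"
        using norm_triangle_ineq2[of "u x" "u y"] by (simp add: dist_norm norm_minus_commute)
      ultimately show ?thesis by linarith
    qed (simp add: ux)
    have "l2norm (\<lambda>y. indicator {x..x + d/2} y *\<^sub>R ((1/2) *\<^sub>R u x)) \<le> l2norm u"
      by (rule l2norm_mono[OF L2_indicator_const halfD(1)[OF h]]) (use big in \<open>auto intro!: AE_I2 simp: indicator_def\<close>)
    then have "sqrt (d / 2) * (norm (u x) / 2) \<le> 0" using d(1) u0 by (subst (asm) l2norm_indicator_const) auto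
    then show False using d(1) ux by (simp add: mult_le_0_iff)
  qed
qed (use halfD(3)[OF h] in auto)

text \<open>The constant term vanishes in the limit; then a factor \<open>\<mu> - z\<close> is
  divided out, which lowers both the degree and the order by one.\<close>

lemma polynomial_coefficients_zero:
  fixes u :: "nat \<Rightarrow> real \<Rightarrow> complex ^ 'n"
  assumes "\<And>j. u j \<in> L2" "r > 0"
    "\<And>\<mu>. \<mu> \<in> ball z r \<Longrightarrow> \<mu> \<noteq> z \<Longrightarrow> l2norm (\<lambda>x. \<Sum>j<p. (\<mu> - z) ^ j *s u j x) \<le> C * norm (\<mu> - z) ^ p"
    and "j < p"
  shows "l2norm (u j) = 0"
  using assms
proof (induction p arbitrary: u j)
  case (Suc p)
  have u0: "l2norm (u 0) = 0"
  proof -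
    define M where "M = \<bar>C\<bar> + (\<Sum>j<p. l2norm (u (Suc j)))"
    have M0: "M \<ge> 0" by (auto simp: M_def intro!: add_nonneg_nonneg sum_nonneg)
    have key: "l2norm (u 0) \<le> M * t" if t: "0 < t" "t < min r 1" for t
    proof -
      define \<mu> where "\<mu> = z + of_real t"
      have \<mu>: "\<mu> \<in> ball z r" "\<mu> \<noteq> z" "norm (\<mu> - z) = t" using t by (auto simp: \<mu>_def dist_norm)
      let ?S = "\<lambda>x. \<Sum>j<Suc p. (\<mu> - z) ^ j *s u j x" and ?R = "\<lambda>x. \<Sum>j<p. (\<mu> - z) ^ Suc j *s u (Suc j) x"
      have L: "?S \<in> L2" "?R \<in> L2" by (intro L2_sum L2_scale Suc.prems(1))+
      have eq: "u 0 = (\<lambda>x. ?S x - ?R x)" by (simp add: fun_eq_iff sum.lessThan_Suc_shift del: sum.lessThan_Suc power_Suc)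
      have "l2norm (u 0) \<le> l2norm ?S + l2norm ?R" by (subst eq) (rule l2norm_triangle_diff[OF L])
      also have "l2norm ?S \<le> \<bar>C\<bar> * t"
      proof -
        have "l2norm ?S \<le> C * t ^ Suc p" using Suc.prems(3)[OF \<mu>(1,2)] \<mu>(3) by simp
        also have "\<dots> \<le> \<bar>C\<bar> * t ^ Suc p" using t by (intro mult_right_mono) auto
        also have "\<dots> \<le> \<bar>C\<bar> * t ^ 1" using t by (intro mult_left_mono power_decreasing) auto
        finally show ?thesis by simp
      qed
      also have "l2norm ?R \<le> (\<Sum>j<p. l2norm (u (Suc j))) * t"
      proof -
        have "l2norm ?R \<le> (\<Sum>j<p. l2norm (\<lambda>x. (\<mu> - z) ^ Suc j *s u (Suc j) x))"
          by (rule l2norm_sum) (intro L2_scale Suc.prems(1))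
        also have "\<dots> \<le> (\<Sum>j<p. l2norm (u (Suc j)) * t)"
        proof (rule sum_mono)
          fix j
          have "t ^ Suc j * l2norm (u (Suc j)) \<le> t ^ 1 * l2norm (u (Suc j))"
            using t by (intro mult_right_mono power_decreasing) auto
          then show "l2norm (\<lambda>x. (\<mu> - z) ^ Suc j *s u (Suc j) x) \<le> l2norm (u (Suc j)) * t"
            unfolding l2norm_scale norm_power \<mu>(3) by (simp add: mult.commute)
        qed
        finally show ?thesis by (simp add: sum_distrib_right)
      qed
      finally show ?thesis by (simp add: M_def distrib_right)
    qed
    have "l2norm (u 0) \<le> \<epsilon>" if "\<epsilon> > 0" for \<epsilon>
    proof -
      define t where "t = min (min r 1 / 2) (\<epsilon> / (M + 1))"
      have t: "0 < t" "t < min r 1" using Suc.prems(2) M0 that by (auto simp: t_def)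
      have "M * t \<le> (M + 1) * (\<epsilon> / (M + 1))" using M0 t by (intro mult_mono) (auto simp: t_def)
      also have "\<dots> = \<epsilon>" using M0 by simp
      finally show ?thesis using key[OF t] by linarith
    qed
    then have "l2norm (u 0) \<le> 0" by (rule field_le_epsilon[of _ 0, simplified])
    then show ?thesis using l2norm_nonneg[of "u 0"] by linarith
  qed
  show ?case
  proof (cases j)
    case 0
    then show ?thesis using u0 by simp
  next
    case (Suc i)
    have ae: "AE x in lborel. u 0 x = 0" using u0 l2norm_eq_0_iff[OF Suc.prems(1)] by simp
    have "l2norm (u (Suc i)) = 0"
    proof (rule Suc.IH[of "\<lambda>j. u (Suc j)"])
      fix \<mu> assume \<mu>: "\<mu> \<in> ball z r" "\<mu> \<noteq> z"
      have "norm (\<mu> - z) * l2norm (\<lambda>x. \<Sum>j<p. (\<mu> - z) ^ j *s u (Suc j) x) = l2norm (\<lambda>x. \<Sum>j<Suc p. (\<mu> - z) ^ j *s u j x)"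
        unfolding l2norm_scale[symmetric]
      proof (rule l2norm_cong_AE)
        show "AE x in lborel. (\<mu> - z) *s (\<Sum>j<p. (\<mu> - z) ^ j *s u (Suc j) x) = (\<Sum>j<Suc p. (\<mu> - z) ^ j *s u j x)"
          using ae by eventually_elim
            (simp add: sum.lessThan_Suc_shift vec.scale_sum_right del: sum.lessThan_Suc)
      qed (intro L2_scale L2_sum Suc.prems(1))+
      also have "\<dots> \<le> C * norm (\<mu> - z) ^ Suc p" by (rule Suc.prems(3)[OF \<mu>])
      also have "\<dots> = norm (\<mu> - z) * (C * norm (\<mu> - z) ^ p)" by simp
      finally show "l2norm (\<lambda>x. \<Sum>j<p. (\<mu> - z) ^ j *s u (Suc j) x) \<le> C * norm (\<mu> - z) ^ p"
        by (rule mult_left_le_imp_le) (use \<mu> in simp)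
    qed (use Suc Suc.prems in auto)
    then show ?thesis using Suc by simp
  qed
qed simp

locale ode_pencil =
  R: half_pencil "\<lambda>\<mu> x. A x \<mu>" Es z \<delta> K C0 + L: half_pencil "left_coeff A" Eu z \<delta> K C0
  for A :: "real \<Rightarrow> complex \<Rightarrow> complex ^ 'n ^ 'n" and Es Eu z \<delta> K C0 +
  assumes bd: "\<mu> \<in> ball z \<delta> \<Longrightarrow> bounded_H1_L2 (ode_op A \<mu>)"
begin

abbreviation "Tsum p u \<mu> x \<equiv> (\<Sum>j<p. (\<mu> - z) ^ j *s ode_op A \<mu> (u j) x)"

lemma L2_Tsum: "\<mu> \<in> ball z \<delta> \<Longrightarrow> (\<And>j. u j \<in> H1) \<Longrightarrow> Tsum p u \<mu> \<in> L2"
  by (intro L2_sum L2_scale L2_ode_op bd)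

text \<open>\<open>ode_op\<close> is linear only up to null sets, so the powers are pulled out of it
  under the norm. The radius is capped by \<open>\<delta>\<close>, where the pencil is known to be
  bounded.\<close>

lemma root_functions_iff:
  "u \<in> root_functions cscale H1 l2norm (ode_op A) z p \<longleftrightarrow> (\<forall>j. u j \<in> H1) \<and> (\<forall>j>p. u j = 0) \<and>
    (\<exists>C\<ge>0. \<exists>r>0. r \<le> \<delta> \<and> (\<forall>\<mu>\<in>ball z r. \<mu> \<noteq> z \<longrightarrow> l2norm (Tsum (Suc p) u \<mu>) \<le> C * norm (\<mu> - z) ^ Suc p))"
proof (cases "\<forall>j. u j \<in> H1")
  case True
  have eq: "l2norm (ode_op A \<mu> (\<Sum>j\<le>p. cscale ((\<mu> - z) ^ j) (u j))) = l2norm (Tsum (Suc p) u \<mu>)" if "\<mu> \<in> ball z \<delta>" for \<mu>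
  proof (rule l2norm_cong_AE)
    show "ode_op A \<mu> (\<Sum>j\<le>p. cscale ((\<mu> - z) ^ j) (u j)) \<in> L2" using True by (intro L2_ode_op[OF bd[OF that]] H1_sum_scaled) auto
    show "Tsum (Suc p) u \<mu> \<in> L2" using True by (intro L2_Tsum[OF that]) auto
    show "AE x in lborel. ode_op A \<mu> (\<Sum>j\<le>p. cscale ((\<mu> - z) ^ j) (u j)) x = Tsum (Suc p) u \<mu> x"
      using ode_op_sum_AE[OF bd[OF that], of "{..p}" u "\<lambda>j. (\<mu> - z) ^ j"] True by (simp add: lessThan_Suc_atMost)
  qed
  have "(\<exists>C\<ge>0. \<exists>r>0. \<forall>\<mu>\<in>ball z r. \<mu> \<noteq> z \<longrightarrow> l2norm (ode_op A \<mu> (\<Sum>j\<le>p. cscale ((\<mu> - z) ^ j) (u j))) \<le> C * norm (\<mu> - z) ^ Suc p)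
      \<longleftrightarrow> (\<exists>C\<ge>0. \<exists>r>0. r \<le> \<delta> \<and> (\<forall>\<mu>\<in>ball z r. \<mu> \<noteq> z \<longrightarrow> l2norm (Tsum (Suc p) u \<mu>) \<le> C * norm (\<mu> - z) ^ Suc p))"
    (is "?l \<longleftrightarrow> ?r")
  proof
    assume ?l
    then obtain C r where C: "C \<ge> 0" "r > 0"
      "\<And>\<mu>. \<mu> \<in> ball z r \<Longrightarrow> \<mu> \<noteq> z \<Longrightarrow> l2norm (ode_op A \<mu> (\<Sum>j\<le>p. cscale ((\<mu> - z) ^ j) (u j))) \<le> C * norm (\<mu> - z) ^ Suc p" by blast
    show ?r
    proof (intro exI conjI ballI impI)
      fix \<mu> assume "\<mu> \<in> ball z (min r \<delta>)" "\<mu> \<noteq> z"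
      then show "l2norm (Tsum (Suc p) u \<mu>) \<le> C * norm (\<mu> - z) ^ Suc p" using C(3)[of \<mu>] eq[of \<mu>] by simp
    qed (use C R.delta_pos in auto)
  next
    assume ?r
    then obtain C r where C: "C \<ge> 0" "r > 0" "r \<le> \<delta>"
      "\<And>\<mu>. \<mu> \<in> ball z r \<Longrightarrow> \<mu> \<noteq> z \<Longrightarrow> l2norm (Tsum (Suc p) u \<mu>) \<le> C * norm (\<mu> - z) ^ Suc p" by blast
    show ?l
    proof (intro exI conjI ballI impI)
      fix \<mu> assume "\<mu> \<in> ball z r" "\<mu> \<noteq> z"
      then show "l2norm (ode_op A \<mu> (\<Sum>j\<le>p. cscale ((\<mu> - z) ^ j) (u j))) \<le> C * norm (\<mu> - z) ^ Suc p"
        using C(3) C(4)[of \<mu>] eq[of \<mu>] by simp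
    qed (use C in auto)
  qed
  then show ?thesis unfolding root_functions_def mem_Collect_eq Suc_eq_plus1[symmetric] by (subst bigo_at_iff) auto
qed (auto simp: root_functions_def)

lemma subspace_root_functions:
  "module.subspace (\<lambda>c u j. cscale c (u j)) (root_functions cscale H1 l2norm (ode_op A) z p)"
proof -
  interpret vector_space "\<lambda>c (u :: nat \<Rightarrow> real \<Rightarrow> complex ^ 'n) j. cscale c (u j)"
    by (rule vector_space_coefficients[OF vector_space_cscale])
  let ?V = "root_functions cscale H1 l2norm (ode_op A) z p"
  have T0: "AE x in lborel. ode_op A \<mu> 0 x = 0" if "\<mu> \<in> ball z \<delta>" for \<mu> using ode_op_sum_AE[OF bd[OF that], of "{}"] by simp
  show ?thesis
  proof (rule subspaceI)
    show "0 \<in> ?V" unfolding root_functions_iff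
    proof (intro conjI exI ballI allI impI)
      show "\<delta> > 0" by (rule R.delta_pos)
      fix \<mu> assume \<mu>: "\<mu> \<in> ball z \<delta>" "\<mu> \<noteq> z"
      have "l2norm (Tsum (Suc p) 0 \<mu>) = l2norm (\<lambda>x. 0 :: complex ^ 'n)"
      proof (rule l2norm_cong_AE)
        show "AE x in lborel. Tsum (Suc p) 0 \<mu> x = 0" using T0[OF \<mu>(1)] by eventually_elim simp
        have z0: "(0 :: nat \<Rightarrow> real \<Rightarrow> complex ^ 'n) j \<in> H1" for j by (simp add: H1_zero)
        show "Tsum (Suc p) 0 \<mu> \<in> L2" by (rule L2_Tsum[OF \<mu>(1) z0])
      qed (rule L2_zero)
      then show "l2norm (Tsum (Suc p) 0 \<mu>) \<le> 0 * norm (\<mu> - z) ^ Suc p" by simp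
    qed (auto simp: H1_zero)
  next
    fix u v assume u: "u \<in> ?V" and v: "v \<in> ?V"
    obtain C r where C: "C \<ge> 0" "r > 0" "r \<le> \<delta>" "\<And>\<mu>. \<mu> \<in> ball z r \<Longrightarrow> \<mu> \<noteq> z \<Longrightarrow> l2norm (Tsum (Suc p) u \<mu>) \<le> C * norm (\<mu> - z) ^ Suc p"
      using u unfolding root_functions_iff by blast
    obtain C' r' where C': "C' \<ge> 0" "r' > 0" "r' \<le> \<delta>" "\<And>\<mu>. \<mu> \<in> ball z r' \<Longrightarrow> \<mu> \<noteq> z \<Longrightarrow> l2norm (Tsum (Suc p) v \<mu>) \<le> C' * norm (\<mu> - z) ^ Suc p"
      using v unfolding root_functions_iff by blast
    have uH: "u j \<in> H1" and vH: "v j \<in> H1" for j using u v by (auto simp: root_functions_iff)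
    have uvH: "(u + v) j \<in> H1" for j using H1_lincomb[OF uH vH, of 1 j j] by (simp add: cscale_def plus_fun_def)
    show "u + v \<in> ?V" unfolding root_functions_iff
    proof (intro conjI exI ballI allI impI uvH)
      fix \<mu> assume \<mu>: "\<mu> \<in> ball z (min r r')" "\<mu> \<noteq> z"
      have \<mu>\<delta>: "\<mu> \<in> ball z \<delta>" using \<mu> C by auto
      have "AE x in lborel. \<forall>j. ode_op A \<mu> ((u + v) j) x = ode_op A \<mu> (u j) x + ode_op A \<mu> (v j) x"
      proof -
        have "AE x in lborel. ode_op A \<mu> ((u + v) j) x = ode_op A \<mu> (u j) x + ode_op A \<mu> (v j) x" for j
          using bounded_H1_L2_lincomb_AE[OF bd[OF \<mu>\<delta>] uH vH, of 1 j j] by (simp add: cscale_def plus_fun_def)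
        then show ?thesis by (simp add: AE_all_countable)
      qed
      then have "AE x in lborel. Tsum (Suc p) (u + v) \<mu> x = Tsum (Suc p) u \<mu> x + Tsum (Suc p) v \<mu> x"
        by eventually_elim (simp only: vec.scale_right_distrib sum.distrib)
      then have "l2norm (Tsum (Suc p) (u + v) \<mu>) = l2norm (\<lambda>x. Tsum (Suc p) u \<mu> x + Tsum (Suc p) v \<mu> x)"
        by (intro l2norm_cong_AE L2_add L2_Tsum[OF \<mu>\<delta>] uH vH uvH)
      also have "\<dots> \<le> l2norm (Tsum (Suc p) u \<mu>) + l2norm (Tsum (Suc p) v \<mu>)" by (intro l2norm_triangle L2_Tsum[OF \<mu>\<delta>] uH vH)
      also have "\<dots> \<le> C * norm (\<mu> - z) ^ Suc p + C' * norm (\<mu> - z) ^ Suc p"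
        using C(4)[of \<mu>] C'(4)[of \<mu>] \<mu> by (intro add_mono) auto
      finally show "l2norm (Tsum (Suc p) (u + v) \<mu>) \<le> (C + C') * norm (\<mu> - z) ^ Suc p" by (simp add: distrib_right)
    next
      fix j assume "p < j"
      then show "(u + v) j = 0" using u v by (simp add: root_functions_iff)
    qed (use C C' in auto)
  next
    fix c u assume u: "u \<in> ?V"
    obtain C r where C: "C \<ge> 0" "r > 0" "r \<le> \<delta>" "\<And>\<mu>. \<mu> \<in> ball z r \<Longrightarrow> \<mu> \<noteq> z \<Longrightarrow> l2norm (Tsum (Suc p) u \<mu>) \<le> C * norm (\<mu> - z) ^ Suc p"
      using u unfolding root_functions_iff by blast
    have uH: "u j \<in> H1" for j using u by (auto simp: root_functions_iff)
    have cuH: "cscale c (u j) \<in> H1" for j by (rule H1_scale[OF uH])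
    show "(\<lambda>j. cscale c (u j)) \<in> ?V" unfolding root_functions_iff
    proof (intro conjI exI ballI allI impI cuH)
      fix \<mu> assume \<mu>: "\<mu> \<in> ball z r" "\<mu> \<noteq> z"
      have \<mu>\<delta>: "\<mu> \<in> ball z \<delta>" using \<mu> C by auto
      have "AE x in lborel. \<forall>j. ode_op A \<mu> (cscale c (u j)) x = c *s ode_op A \<mu> (u j) x"
      proof -
        have "AE x in lborel. ode_op A \<mu> (cscale c (u j)) x = c *s ode_op A \<mu> (u j) x" for j
          using bounded_H1_L2_lincomb_AE[OF bd[OF \<mu>\<delta>] uH H1_zero(1), of c j] T0[OF \<mu>\<delta>] by eventually_elim simp
        then show ?thesis by (simp add: AE_all_countable)
      qed
      then have "AE x in lborel. Tsum (Suc p) (\<lambda>j. cscale c (u j)) \<mu> x = c *s Tsum (Suc p) u \<mu> x"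
        by eventually_elim (simp only: vec.scale_sum_right vec.scale_left_commute)
      then have "l2norm (Tsum (Suc p) (\<lambda>j. cscale c (u j)) \<mu>) = l2norm (\<lambda>x. c *s Tsum (Suc p) u \<mu> x)"
        by (intro l2norm_cong_AE L2_scale L2_Tsum[OF \<mu>\<delta>] uH cuH)
      also have "\<dots> \<le> norm c * (C * norm (\<mu> - z) ^ Suc p)" unfolding l2norm_scale by (intro mult_left_mono C(4)[OF \<mu>]) auto
      finally show "l2norm (Tsum (Suc p) (\<lambda>j. cscale c (u j)) \<mu>) \<le> (norm c * C) * norm (\<mu> - z) ^ Suc p" by (simp add: mult.assoc)
    next
      fix j assume "p < j"
      then show "cscale c (u j) = 0" using u by (simp add: root_functions_iff cscale_def fun_eq_iff)
    qed (use C in auto)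
  qed
qed

lemma root_function_half_bounds:
  assumes "u \<in> root_functions cscale H1 l2norm (ode_op A) z p"
  obtains C r where "C \<ge> 0" "r > 0" "r \<le> \<delta>"
    "\<And>\<mu>. \<mu> \<in> ball z r \<Longrightarrow> \<mu> \<noteq> z \<Longrightarrow> l2norm (\<lambda>x. \<Sum>j<Suc p. (\<mu> - z) ^ j *s
      residual (\<lambda>x. A x \<mu>) (right_part (u j)) (right_part (weak_deriv (u j))) x) \<le> C * norm (\<mu> - z) ^ Suc p"
    "\<And>\<mu>. \<mu> \<in> ball z r \<Longrightarrow> \<mu> \<noteq> z \<Longrightarrow> l2norm (\<lambda>x. \<Sum>j<Suc p. (\<mu> - z) ^ j *s
      residual (left_coeff A \<mu>) (left_part (u j)) (\<lambda>x. - left_part (weak_deriv (u j)) x) x) \<le> C * norm (\<mu> - z) ^ Suc p"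
proof -
  obtain C r where C: "C \<ge> 0" "r > 0" "r \<le> \<delta>" "\<And>\<mu>. \<mu> \<in> ball z r \<Longrightarrow> \<mu> \<noteq> z \<Longrightarrow> l2norm (Tsum (Suc p) u \<mu>) \<le> C * norm (\<mu> - z) ^ Suc p"
    using assms unfolding root_functions_iff by blast
  have uH: "u j \<in> H1" for j using assms by (auto simp: root_functions_iff)
  show ?thesis
  proof (rule that[OF C(1-3)])
    fix \<mu> assume \<mu>: "\<mu> \<in> ball z r" "\<mu> \<noteq> z"
    have L: "Tsum (Suc p) u \<mu> \<in> L2" using \<mu> C by (intro L2_Tsum uH) auto
    have "(\<lambda>x. \<Sum>j<Suc p. (\<mu> - z) ^ j *s residual (\<lambda>x. A x \<mu>) (right_part (u j)) (right_part (weak_deriv (u j))) x) =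
        right_part (Tsum (Suc p) u \<mu>)" unfolding right_part_ode_op[symmetric] by (auto simp: right_part_def fun_eq_iff)
    then show "l2norm (\<lambda>x. \<Sum>j<Suc p. (\<mu> - z) ^ j *s residual (\<lambda>x. A x \<mu>) (right_part (u j)) (right_part (weak_deriv (u j))) x)
        \<le> C * norm (\<mu> - z) ^ Suc p" using L2_right_part(2)[OF L] C(4)[OF \<mu>] by simp
    have res: "residual (left_coeff A \<mu>) (left_part (u j)) (\<lambda>x. - left_part (weak_deriv (u j)) x) x = - left_part (ode_op A \<mu> (u j)) x" for j x
      by (simp add: left_part_ode_op)
    have "l2norm (\<lambda>x. \<Sum>j<Suc p. (\<mu> - z) ^ j *s residual (left_coeff A \<mu>) (left_part (u j)) (\<lambda>x. - left_part (weak_deriv (u j)) x) x) =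
        l2norm (left_part (Tsum (Suc p) u \<mu>))"
    proof (rule l2norm_cong_norm)
      fix x
      have "(\<Sum>j<Suc p. (\<mu> - z) ^ j *s - left_part (ode_op A \<mu> (u j)) x) = - left_part (Tsum (Suc p) u \<mu>) x"
        by (auto simp: left_part_def sum_negf simp del: sum.lessThan_Suc)
      then show "norm (\<Sum>j<Suc p. (\<mu> - z) ^ j *s residual (left_coeff A \<mu>) (left_part (u j)) (\<lambda>x. - left_part (weak_deriv (u j)) x) x) =
          norm (left_part (Tsum (Suc p) u \<mu>) x)" unfolding res by (simp only: norm_minus_cancel)
    qed
    then show "l2norm (\<lambda>x. \<Sum>j<Suc p. (\<mu> - z) ^ j *s residual (left_coeff A \<mu>) (left_part (u j)) (\<lambda>x. - left_part (weak_deriv (u j)) x) x)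
        \<le> C * norm (\<mu> - z) ^ Suc p" using L2_left_part(2)[OF L] C(4)[OF \<mu>] by simp
  qed
qed

text \<open>The meeting point of the two eigenvalue problems: root functions of the operator and of
  the matrix pencil are both identified with these jets.\<close>

definition matching_jets :: "nat \<Rightarrow> (nat \<Rightarrow> complex ^ 'n) set" where
  "matching_jets p = {w. (\<forall>j>p. w j = 0) \<and> jet_in Es z (Suc p) w \<and> jet_in Eu z (Suc p) w}"

text \<open>Restriction to the half-lines gives one inclusion. For the other, the jet is lifted on
  each side; the lifts have equal traces, so they glue coefficientwise to elements of
  \<open>H1\<close>, and the residual of the glued polynomial is the glued residual.\<close>

lemma initial_jets_root_functions:
  "(\<lambda>u j. u j 0) ` root_functions cscale H1 l2norm (ode_op A) z p = matching_jets p"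
proof (intro equalityI subsetI)
  let ?V = "root_functions cscale H1 l2norm (ode_op A) z p"
  fix w assume "w \<in> (\<lambda>u j. u j 0) ` ?V"
  then obtain u where u: "u \<in> ?V" "w = (\<lambda>j. u j 0)" by blast
  have uH: "u j \<in> H1" for j using u by (auto simp: root_functions_iff)
  obtain C r where C: "C \<ge> 0" "r > 0" "r \<le> \<delta>"
    and Rb: "\<And>\<mu>. \<mu> \<in> ball z r \<Longrightarrow> \<mu> \<noteq> z \<Longrightarrow> l2norm (\<lambda>x. \<Sum>j<Suc p. (\<mu> - z) ^ j *s
      residual (\<lambda>x. A x \<mu>) (right_part (u j)) (right_part (weak_deriv (u j))) x) \<le> C * norm (\<mu> - z) ^ Suc p"
    and Lb: "\<And>\<mu>. \<mu> \<in> ball z r \<Longrightarrow> \<mu> \<noteq> z \<Longrightarrow> l2norm (\<lambda>x. \<Sum>j<Suc p. (\<mu> - z) ^ j *s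
      residual (left_coeff A \<mu>) (left_part (u j)) (\<lambda>x. - left_part (weak_deriv (u j)) x) x) \<le> C * norm (\<mu> - z) ^ Suc p"
    by (rule root_function_half_bounds[OF u(1)]) (rule that, assumption+)
  have 1: "jet_in Es z (Suc p) (\<lambda>j. right_part (u j) 0)"
    by (rule R.jet_in_if_half_jets[OF H1_half(1)[OF uH] C(2,1) R.residual_bound_punctured[OF H1_half(1)[OF uH] C(2) _ Rb]]) auto
  have 2: "jet_in Eu z (Suc p) (\<lambda>j. left_part (u j) 0)"
    by (rule L.jet_in_if_half_jets[OF H1_half(2)[OF uH] C(2,1) L.residual_bound_punctured[OF H1_half(2)[OF uH] C(2) _ Lb]]) auto
  show "w \<in> matching_jets p" using 1 2 u by (auto simp: matching_jets_def root_functions_iff)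
next
  let ?V = "root_functions cscale H1 l2norm (ode_op A) z p"
  fix w assume w: "w \<in> matching_jets p"
  obtain u1 g1 C1 r1 where 1: "\<And>j. half (u1 j) (g1 j)" "\<And>j. j < Suc p \<Longrightarrow> u1 j 0 = w j" "C1 \<ge> 0" "r1 > 0" "r1 \<le> \<delta>"
    "\<And>\<mu>. \<mu> \<in> ball z r1 \<Longrightarrow> l2norm (\<lambda>x. \<Sum>j<Suc p. (\<mu> - z) ^ j *s residual (\<lambda>x. A x \<mu>) (u1 j) (g1 j) x) \<le> C1 * norm (\<mu> - z) ^ Suc p"
    using R.half_jets_if_jet_in[of "Suc p" w] w unfolding matching_jets_def by blast
  obtain u2 g2 C2 r2 where 2: "\<And>j. half (u2 j) (g2 j)" "\<And>j. j < Suc p \<Longrightarrow> u2 j 0 = w j" "C2 \<ge> 0" "r2 > 0" "r2 \<le> \<delta>"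
    "\<And>\<mu>. \<mu> \<in> ball z r2 \<Longrightarrow> l2norm (\<lambda>x. \<Sum>j<Suc p. (\<mu> - z) ^ j *s residual (left_coeff A \<mu>) (u2 j) (g2 j) x) \<le> C2 * norm (\<mu> - z) ^ Suc p"
    using L.half_jets_if_jet_in[of "Suc p" w] w unfolding matching_jets_def by blast
  have eq0: "u1 j 0 = u2 j 0" if "j \<le> p" for j using 1(2) 2(2) that by simp
  define u where "u = (\<lambda>j. if j \<le> p then glue (u1 j) (u2 j) else 0)"
  have uH: "u j \<in> H1" for j unfolding u_def using H1_glue[OF 1(1) 2(1) eq0] H1_zero(1) by auto
  have "u \<in> ?V" unfolding root_functions_iff
  proof (intro conjI exI ballI allI impI uH)
    fix \<mu> assume \<mu>: "\<mu> \<in> ball z (min r1 r2)" "\<mu> \<noteq> z"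
    have \<mu>\<delta>: "\<mu> \<in> ball z \<delta>" using \<mu> 1 by auto
    let ?S1 = "\<lambda>x. \<Sum>j<Suc p. (\<mu> - z) ^ j *s residual (\<lambda>x. A x \<mu>) (u1 j) (g1 j) x"
    let ?S2 = "\<lambda>x. \<Sum>j<Suc p. (\<mu> - z) ^ j *s residual (left_coeff A \<mu>) (u2 j) (g2 j) x"
    have LS: "?S1 \<in> L2" "?S2 \<in> L2" by (intro L2_sum L2_scale R.L2_residual_at L.L2_residual_at \<mu>\<delta> 1(1) 2(1))+
    have "AE x in lborel. \<forall>j. j \<le> p \<longrightarrow> ode_op A \<mu> (glue (u1 j) (u2 j)) x =
        glue (residual (\<lambda>x. A x \<mu>) (u1 j) (g1 j)) (\<lambda>x. - residual (left_coeff A \<mu>) (u2 j) (g2 j) x) x"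
      unfolding AE_all_countable using ode_op_glue[OF 1(1) 2(1) eq0] by auto
    then have "AE x in lborel. Tsum (Suc p) u \<mu> x = glue ?S1 (\<lambda>x. - ?S2 x) x"
    proof eventually_elim
      case (elim x)
      have "Tsum (Suc p) u \<mu> x = (\<Sum>j<Suc p. (\<mu> - z) ^ j *s
          glue (residual (\<lambda>x. A x \<mu>) (u1 j) (g1 j)) (\<lambda>x. - residual (left_coeff A \<mu>) (u2 j) (g2 j) x) x)"
        using elim by (intro sum.cong) (auto simp: u_def)
      then show ?case by (auto simp: glue_def sum_negf simp del: sum.lessThan_Suc)
    qed
    then have "l2norm (Tsum (Suc p) u \<mu>) = l2norm (glue ?S1 (\<lambda>x. - ?S2 x))"
      by (intro l2norm_cong_AE L2_Tsum[OF \<mu>\<delta>] uH L2_glue(1) L2_minus LS)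
    also have "\<dots> \<le> l2norm ?S1 + l2norm (\<lambda>x. - ?S2 x)" by (intro L2_glue(2) L2_minus LS)
    also have "\<dots> \<le> C1 * norm (\<mu> - z) ^ Suc p + C2 * norm (\<mu> - z) ^ Suc p"
      unfolding l2norm_minus using 1(6)[of \<mu>] 2(6)[of \<mu>] \<mu> by (intro add_mono) auto
    finally show "l2norm (Tsum (Suc p) u \<mu>) \<le> (C1 + C2) * norm (\<mu> - z) ^ Suc p" by (simp add: distrib_right)
  qed (use 1(3-5) 2(3-5) in \<open>auto simp: u_def\<close>)
  moreover have "w = (\<lambda>j. u j 0)" using 1(2) w by (auto simp: fun_eq_iff u_def glue_def matching_jets_def)
  ultimately show "w \<in> (\<lambda>u j. u j 0) ` ?V" by blast
qed

text \<open>With zero traces the a priori bound makes both half-line polynomials themselves of order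
  \<open>Suc p\<close> in \<open>L2\<close>, so all their coefficients vanish.\<close>

lemma inj_on_initial_jets: "inj_on (\<lambda>u j. u j 0) (root_functions cscale H1 l2norm (ode_op A) z p)"
proof (rule inj_onI)
  let ?V = "root_functions cscale H1 l2norm (ode_op A) z p"
  interpret vector_space "\<lambda>c (u :: nat \<Rightarrow> real \<Rightarrow> complex ^ 'n) j. cscale c (u j)"
    by (rule vector_space_coefficients[OF vector_space_cscale])
  fix v w assume vw: "v \<in> ?V" "w \<in> ?V" "(\<lambda>j. v j 0) = (\<lambda>j. w j 0)"
  define u where "u = v - w"
  have u: "u \<in> ?V" unfolding u_def by (rule subspace_diff[OF subspace_root_functions vw(1,2)])
  have u0: "u j 0 = 0" for j using fun_cong[OF vw(3), of j] by (simp add: u_def)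
  have uH: "u j \<in> H1" for j using u by (auto simp: root_functions_iff)
  obtain C r where C: "C \<ge> 0" "r > 0" "r \<le> \<delta>"
    and Rb: "\<And>\<mu>. \<mu> \<in> ball z r \<Longrightarrow> \<mu> \<noteq> z \<Longrightarrow> l2norm (\<lambda>x. \<Sum>j<Suc p. (\<mu> - z) ^ j *s
      residual (\<lambda>x. A x \<mu>) (right_part (u j)) (right_part (weak_deriv (u j))) x) \<le> C * norm (\<mu> - z) ^ Suc p"
    and Lb: "\<And>\<mu>. \<mu> \<in> ball z r \<Longrightarrow> \<mu> \<noteq> z \<Longrightarrow> l2norm (\<lambda>x. \<Sum>j<Suc p. (\<mu> - z) ^ j *s
      residual (left_coeff A \<mu>) (left_part (u j)) (\<lambda>x. - left_part (weak_deriv (u j)) x) x) \<le> C * norm (\<mu> - z) ^ Suc p"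
    by (rule root_function_half_bounds[OF u]) (rule that, assumption+)
  have C00: "C0 \<ge> 0" by (rule R.C0)
  have r0: "right_part (u j) x = 0" if "j < Suc p" for j x
  proof (rule continuous_zero_if_AE_zero[OF H1_half(1)[OF uH]])
    show "l2norm (right_part (u j)) = 0"
    proof (rule polynomial_coefficients_zero[OF halfD(1)[OF H1_half(1)[OF uH]] C(2) _ that])
      fix \<mu> assume \<mu>: "\<mu> \<in> ball z r" "\<mu> \<noteq> z"
      have \<mu>\<delta>: "\<mu> \<in> ball z \<delta>" using \<mu> C by auto
      have hs: "half (\<lambda>x. \<Sum>j<Suc p. (\<mu> - z) ^ j *s right_part (u j) x) (\<lambda>x. \<Sum>j<Suc p. (\<mu> - z) ^ j *s right_part (weak_deriv (u j)) x)"
        by (intro half_sum half_scale H1_half uH)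
      have "l2norm (\<lambda>x. \<Sum>j<Suc p. (\<mu> - z) ^ j *s right_part (u j) x) \<le> C0 * (0 + C * norm (\<mu> - z) ^ Suc p)"
        by (rule order_trans[OF R.apriori[OF \<mu>\<delta> hs]], rule mult_left_mono[OF _ C00])
          (use Rb[OF \<mu>] in \<open>simp add: residual_sum residual_scale u0 del: sum.lessThan_Suc power_Suc\<close>)
      then show "l2norm (\<lambda>x. \<Sum>j<Suc p. (\<mu> - z) ^ j *s right_part (u j) x) \<le> (C0 * C) * norm (\<mu> - z) ^ Suc p"
        by (simp only: add_0 mult.assoc)
    qed
  qed
  have l0: "left_part (u j) x = 0" if "j < Suc p" for j x
  proof (rule continuous_zero_if_AE_zero[OF H1_half(2)[OF uH]])
    show "l2norm (left_part (u j)) = 0"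
    proof (rule polynomial_coefficients_zero[OF halfD(1)[OF H1_half(2)[OF uH]] C(2) _ that])
      fix \<mu> assume \<mu>: "\<mu> \<in> ball z r" "\<mu> \<noteq> z"
      have \<mu>\<delta>: "\<mu> \<in> ball z \<delta>" using \<mu> C by auto
      have hs: "half (\<lambda>x. \<Sum>j<Suc p. (\<mu> - z) ^ j *s left_part (u j) x) (\<lambda>x. \<Sum>j<Suc p. (\<mu> - z) ^ j *s (- left_part (weak_deriv (u j)) x))"
        by (intro half_sum half_scale H1_half uH)
      have "l2norm (\<lambda>x. \<Sum>j<Suc p. (\<mu> - z) ^ j *s left_part (u j) x) \<le> C0 * (0 + C * norm (\<mu> - z) ^ Suc p)"
        by (rule order_trans[OF L.apriori[OF \<mu>\<delta> hs]], rule mult_left_mono[OF _ C00], unfold residual_sum residual_scale)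
          (use Lb[OF \<mu>] in \<open>simp add: u0 del: sum.lessThan_Suc power_Suc\<close>)
      then show "l2norm (\<lambda>x. \<Sum>j<Suc p. (\<mu> - z) ^ j *s left_part (u j) x) \<le> (C0 * C) * norm (\<mu> - z) ^ Suc p"
        by (simp only: add_0 mult.assoc)
    qed
  qed
  have "u j x = 0" for j x
  proof (cases "j < Suc p")
    case True
    show ?thesis using r0[OF True, of x] l0[OF True, of "- x"] by (cases "x < 0") (auto simp: right_part_def left_part_def)
  next
    case False
    then show ?thesis using u by (simp add: root_functions_iff)
  qed
  then have "v j x = w j x" for j x by (simp add: u_def)
  then show "v = w" by (simp add: fun_eq_iff)
qed

lemma edim_root_functions:
  "edim (\<lambda>c u j. cscale c (u j)) (root_functions cscale H1 l2norm (ode_op A) z p) = edim (\<lambda>c w j. c *s w j) (matching_jets p)"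
proof -
  have "Vector_Spaces.linear (\<lambda>c u j. cscale c (u j)) (\<lambda>c w j. c *s w j) (\<lambda>(u :: nat \<Rightarrow> real \<Rightarrow> complex ^ 'n) j. u j 0)"
    unfolding Vector_Spaces.linear_iff
    using vector_space_coefficients[OF vector_space_cscale] vector_space_coefficients[OF vec.vector_space_axioms]
    by (auto simp: cscale_def fun_eq_iff)
  from edim_linear_image[OF this subspace_root_functions inj_on_initial_jets]
  show ?thesis unfolding initial_jets_root_functions by simp
qed

end

section \<open>Jets in an analytic basis\<close>

text \<open>Absolute convergence at a radius \<open>s\<close> inside the disc of convergence yields
  \<open>C\<close> as the sum of the shifted series.\<close>

lemma fps_remainder:
  fixes f :: "complex \<Rightarrow> complex"
  assumes "(\<lambda>x. f (z + x)) has_fps_expansion F"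
  obtains C r where "C \<ge> 0" "r > 0"
    "\<And>\<mu>. \<mu> \<in> ball z r \<Longrightarrow> norm (f \<mu> - (\<Sum>n<p. fps_nth F n * (\<mu> - z) ^ n)) \<le> C * norm (\<mu> - z) ^ p"
proof -
  have rad: "fps_conv_radius F > 0" and ev: "\<forall>\<^sub>F x in nhds 0. eval_fps F x = f (z + x)"
    using assms by (auto simp: has_fps_expansion_def)
  obtain d where d: "d > 0" "\<And>x. norm x < d \<Longrightarrow> eval_fps F x = f (z + x)"
    using ev unfolding eventually_nhds_metric by (auto simp: dist_norm)
  obtain s where s: "s > 0" "ereal s < fps_conv_radius F" using ereal_dense2[OF rad] by (auto simp: zero_ereal_def)
  have sums: "summable (\<lambda>n. norm (fps_nth F n * of_real s ^ n))"
    by (rule abs_summable_in_conv_radius) (use s in \<open>auto simp: fps_conv_radius_def\<close>)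
  define C where "C = (\<Sum>n. norm (fps_nth F (n + p)) * s ^ n)"
  have "summable (\<lambda>n. norm (fps_nth F (n + p) * of_real s ^ (n + p)))"
    using summable_iff_shift[of "\<lambda>n. norm (fps_nth F n * of_real s ^ n)" p] sums by simp
  then have "summable (\<lambda>n. norm (fps_nth F (n + p) * of_real s ^ (n + p)) / s ^ p)" by (rule summable_divide)
  then have sC: "summable (\<lambda>n. norm (fps_nth F (n + p)) * s ^ n)" using s(1) by (simp add: norm_mult norm_power power_add)
  have C0: "C \<ge> 0" unfolding C_def using s(1) by (intro suminf_nonneg sC) auto
  show ?thesis
  proof (rule that[OF C0, of "min d s"])
    fix \<mu> assume "\<mu> \<in> ball z (min d s)"
    then have \<mu>: "norm (\<mu> - z) < d" "norm (\<mu> - z) < s" by (auto simp: dist_norm norm_minus_commute)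
    let ?t = "\<mu> - z"
    have "ereal (norm ?t) < fps_conv_radius F" using \<mu>(2) s(2) by (meson ereal_less(2) less_trans less_ereal.simps(1))
    then have summ: "summable (\<lambda>n. fps_nth F n * ?t ^ n)" by (intro summable_fps) auto
    have "f \<mu> = (\<Sum>n. fps_nth F n * ?t ^ n)" using d(2)[OF \<mu>(1)] by (simp add: eval_fps_def)
    also have "\<dots> = (\<Sum>n. fps_nth F (n + p) * ?t ^ (n + p)) + (\<Sum>n<p. fps_nth F n * ?t ^ n)"
      by (rule suminf_split_initial_segment[OF summ])
    finally have eq: "f \<mu> - (\<Sum>n<p. fps_nth F n * ?t ^ n) = (\<Sum>n. fps_nth F (n + p) * ?t ^ (n + p))" by simp
    have le: "norm (fps_nth F (n + p) * ?t ^ (n + p)) \<le> norm (fps_nth F (n + p)) * s ^ n * norm ?t ^ p" for n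
    proof -
      have "norm ?t ^ n \<le> s ^ n" using \<mu>(2) by (intro power_mono) auto
      then have "norm (fps_nth F (n + p)) * norm ?t ^ n * norm ?t ^ p \<le> norm (fps_nth F (n + p)) * s ^ n * norm ?t ^ p"
        by (intro mult_right_mono mult_left_mono) auto
      then show ?thesis by (simp add: norm_mult norm_power power_add mult.assoc)
    qed
    have sm: "summable (\<lambda>n. norm (fps_nth F (n + p)) * s ^ n * norm ?t ^ p)" by (rule summable_mult2[OF sC])
    have sn: "summable (\<lambda>n. norm (fps_nth F (n + p) * ?t ^ (n + p)))"
      by (rule summable_comparison_test'[OF sm, of 0]) (use le in simp)
    have "norm (\<Sum>n. fps_nth F (n + p) * ?t ^ (n + p)) \<le> (\<Sum>n. norm (fps_nth F (n + p) * ?t ^ (n + p)))"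
      by (rule summable_norm[OF sn])
    also have "\<dots> \<le> (\<Sum>n. norm (fps_nth F (n + p)) * s ^ n * norm ?t ^ p)" by (rule suminf_le[OF le sn sm])
    also have "\<dots> = C * norm ?t ^ p" unfolding C_def by (rule suminf_mult2[OF sC, symmetric])
    finally show "norm (f \<mu> - (\<Sum>n<p. fps_nth F n * ?t ^ n)) \<le> C * norm ?t ^ p" unfolding eq .
  qed (use d s in auto)
qed

text \<open>Scalars are turned into constant functions on the unit interval, which reduces the claim
  to \<open>polynomial_coefficients_zero\<close>.\<close>

lemma scalar_polynomial_coefficients_zero:
  fixes a :: "nat \<Rightarrow> complex"
  assumes "r > 0" "\<And>\<mu>. \<mu> \<in> ball z r \<Longrightarrow> \<mu> \<noteq> z \<Longrightarrow> norm (\<Sum>j<p. a j * (\<mu> - z) ^ j) \<le> C * norm (\<mu> - z) ^ p" "j < p"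
  shows "a j = 0"
proof -
  obtain v :: "complex ^ 1" where v: "norm v = 1" using vector_choose_size[of 1] by auto
  define u :: "nat \<Rightarrow> real \<Rightarrow> complex ^ 1" where "u = (\<lambda>j x. indicator {0..1} x *\<^sub>R (a j *s v))"
  have uL: "u j \<in> L2" for j unfolding u_def by (rule L2_indicator_const)
  have eq: "(\<Sum>j<p. t ^ j *s u j x) = indicator {0..1} x *\<^sub>R ((\<Sum>j<p. a j * t ^ j) *s v)" for t x
    by (simp add: u_def vec_eq_iff sum_distrib_right sum_distrib_left scaleR_sum_right mult_ac)
  have "l2norm (u j) = 0"
  proof (rule polynomial_coefficients_zero[OF uL assms(1) _ assms(3)])
    fix \<mu> assume \<mu>: "\<mu> \<in> ball z r" "\<mu> \<noteq> z"
    have "l2norm (\<lambda>x. \<Sum>j<p. (\<mu> - z) ^ j *s u j x) = norm (\<Sum>j<p. a j * (\<mu> - z) ^ j)"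
      unfolding eq by (subst l2norm_indicator_const) (auto simp: norm_vec_scale v)
    then show "l2norm (\<lambda>x. \<Sum>j<p. (\<mu> - z) ^ j *s u j x) \<le> C * norm (\<mu> - z) ^ p" using assms(2)[OF \<mu>] by simp
  qed
  moreover have "l2norm (u j) = norm (a j)" unfolding u_def by (subst l2norm_indicator_const) (auto simp: norm_vec_scale v)
  ultimately show ?thesis by simp
qed

lemma fps_order_iff:
  fixes f :: "complex \<Rightarrow> complex"
  assumes "(\<lambda>x. f (z + x)) has_fps_expansion F"
  shows "(\<exists>C\<ge>0. \<exists>r>0. \<forall>\<mu>\<in>ball z r. \<mu> \<noteq> z \<longrightarrow> norm (f \<mu>) \<le> C * norm (\<mu> - z) ^ p) \<longleftrightarrow> (\<forall>n<p. fps_nth F n = 0)"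
proof -
  obtain C r where C: "C \<ge> 0" "r > 0"
    "\<And>\<mu>. \<mu> \<in> ball z r \<Longrightarrow> norm (f \<mu> - (\<Sum>n<p. fps_nth F n * (\<mu> - z) ^ n)) \<le> C * norm (\<mu> - z) ^ p"
    by (rule fps_remainder[OF assms, of p]) (rule that, assumption+)
  show ?thesis
  proof (intro iffI allI impI)
    fix n assume "\<exists>C\<ge>0. \<exists>r>0. \<forall>\<mu>\<in>ball z r. \<mu> \<noteq> z \<longrightarrow> norm (f \<mu>) \<le> C * norm (\<mu> - z) ^ p" and n: "n < p"
    then obtain C' r' where C': "r' > 0" "\<And>\<mu>. \<mu> \<in> ball z r' \<Longrightarrow> \<mu> \<noteq> z \<Longrightarrow> norm (f \<mu>) \<le> C' * norm (\<mu> - z) ^ p" by blast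
    show "fps_nth F n = 0"
    proof (rule scalar_polynomial_coefficients_zero[OF _ _ n])
      show "min r r' > 0" using C C' by simp
      fix \<mu> assume \<mu>: "\<mu> \<in> ball z (min r r')" "\<mu> \<noteq> z"
      have "norm (\<Sum>n<p. fps_nth F n * (\<mu> - z) ^ n) \<le> norm (f \<mu>) + norm (f \<mu> - (\<Sum>n<p. fps_nth F n * (\<mu> - z) ^ n))"
        using norm_triangle_sub[of "\<Sum>n<p. fps_nth F n * (\<mu> - z) ^ n" "f \<mu>"] by (simp add: norm_minus_commute)
      also have "\<dots> \<le> C' * norm (\<mu> - z) ^ p + C * norm (\<mu> - z) ^ p" using C(3)[of \<mu>] C'(2)[of \<mu>] \<mu> by (intro add_mono) auto
      finally show "norm (\<Sum>n<p. fps_nth F n * (\<mu> - z) ^ n) \<le> (C' + C) * norm (\<mu> - z) ^ p" by (simp add: distrib_right)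
    qed
  next
    assume 0: "\<forall>n<p. fps_nth F n = 0"
    have "norm (f \<mu>) \<le> C * norm (\<mu> - z) ^ p" if "\<mu> \<in> ball z r" for \<mu>
    proof -
      have "(\<Sum>n<p. fps_nth F n * (\<mu> - z) ^ n) = 0" using 0 by simp
      then show ?thesis using C(3)[OF that] by simp
    qed
    then show "\<exists>C\<ge>0. \<exists>r>0. \<forall>\<mu>\<in>ball z r. \<mu> \<noteq> z \<longrightarrow> norm (f \<mu>) \<le> C * norm (\<mu> - z) ^ p" using C(1,2) by blast
  qed
qed

lemma vec_norm_le_of_components:
  fixes v :: "complex ^ 'n"
  assumes "\<And>i. norm (v $ i) \<le> c" shows "norm v \<le> real CARD('n) * c"
proof -
  have "norm v \<le> (\<Sum>i\<in>UNIV. norm (v $ i))" unfolding norm_vec_def by (rule L2_set_le_sum) simp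
  also have "\<dots> \<le> (\<Sum>i\<in>(UNIV :: 'n set). c)" by (rule sum_mono) (rule assms)
  finally show ?thesis by simp
qed

definition basis_jet :: "(nat \<Rightarrow> complex \<Rightarrow> complex ^ 'n) \<Rightarrow> complex \<Rightarrow> nat \<Rightarrow> nat \<Rightarrow> complex ^ 'n" where
  "basis_jet w z j n = (\<chi> i. fps_nth (fps_expansion (\<lambda>\<mu>. w j \<mu> $ i) z) n)"

text \<open>Jets of \<open>\<Sum>\<^sub>j (\<Sum>\<^sub>k \<alpha> k j (\<mu> - z)\<^sup>k) w j \<mu>\<close>.\<close>

definition comb_jet :: "nat set \<Rightarrow> (nat \<Rightarrow> complex \<Rightarrow> complex ^ 'n) \<Rightarrow> complex \<Rightarrow> (nat \<Rightarrow> nat \<Rightarrow> complex) \<Rightarrow> nat \<Rightarrow> complex ^ 'n" where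
  "comb_jet J w z \<alpha> n = (\<Sum>j\<in>J. \<Sum>k\<le>n. \<alpha> k j *s basis_jet w z j (n - k))"

lemma basis_jet_0: "basis_jet w z j 0 = w j z"
  by (simp add: basis_jet_def fps_expansion_def vec_eq_iff)

lemma comb_jet_fps:
  fixes w :: "nat \<Rightarrow> complex \<Rightarrow> complex ^ 'n"
  assumes "\<And>j i. j \<in> J \<Longrightarrow> (\<lambda>\<mu>. w j \<mu> $ i) analytic_on {z}"
  obtains F where "(\<lambda>x. (\<Sum>j\<in>J. (\<Sum>k<q. x ^ k * \<alpha> k j) * (w j (z + x) $ i))) has_fps_expansion F"
    "\<And>n. n < q \<Longrightarrow> fps_nth F n = comb_jet J w z \<alpha> n $ i"
proof
  define F where "F = (\<Sum>j\<in>J. (\<Sum>k<q. fps_X ^ k * fps_const (\<alpha> k j)) * fps_expansion (\<lambda>\<mu>. w j \<mu> $ i) z)"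
  show "(\<lambda>x. (\<Sum>j\<in>J. (\<Sum>k<q. x ^ k * \<alpha> k j) * (w j (z + x) $ i))) has_fps_expansion F" unfolding F_def
    by (intro has_fps_expansion_sum has_fps_expansion_mult has_fps_expansion_fps_X_power has_fps_expansion_const
        analytic_at_imp_has_fps_expansion assms)
  fix n assume n: "n < q"
  have pc: "fps_nth (\<Sum>k<q. fps_X ^ k * fps_const (\<alpha> k j)) l = \<alpha> l j" if "l < q" for l j
  proof -
    have "fps_nth (fps_X ^ k * fps_const (\<alpha> k j)) l = (if k = l then \<alpha> k j else 0)" for k by (auto simp: fps_X_power_mult_nth)
    then have "fps_nth (\<Sum>k<q. fps_X ^ k * fps_const (\<alpha> k j)) l = (\<Sum>k<q. if k = l then \<alpha> k j else 0)" by (simp only: fps_sum_nth)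
    also have "\<dots> = \<alpha> l j" using that by (simp add: sum.delta)
    finally show ?thesis .
  qed
  show "fps_nth F n = comb_jet J w z \<alpha> n $ i" unfolding F_def fps_sum_nth comb_jet_def sum_component
  proof (intro sum.cong refl)
    fix j assume "j \<in> J"
    show "fps_nth ((\<Sum>k<q. fps_X ^ k * fps_const (\<alpha> k j)) * fps_expansion (\<lambda>\<mu>. w j \<mu> $ i) z) n =
        (\<Sum>k\<le>n. (\<alpha> k j *s basis_jet w z j (n - k)) $ i)"
      unfolding fps_mult_nth using n by (intro sum.cong) (auto simp: pc basis_jet_def)
  qed
qed

text \<open>The estimate is assembled from the finitely many components, with the least radius and
  the sum of the constants.\<close>

lemma comb_jet_approx:
  fixes w :: "nat \<Rightarrow> complex \<Rightarrow> complex ^ 'n"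
  assumes "\<And>j i. j \<in> J \<Longrightarrow> (\<lambda>\<mu>. w j \<mu> $ i) analytic_on {z}"
  obtains C r where "C \<ge> 0" "r > 0" "\<And>\<mu>. \<mu> \<in> ball z r \<Longrightarrow>
    norm ((\<Sum>j\<in>J. (\<Sum>k<q. (\<mu> - z) ^ k * \<alpha> k j) *s w j \<mu>) - jet_sum z q (comb_jet J w z \<alpha>) \<mu>) \<le> C * norm (\<mu> - z) ^ q"
proof -
  have "\<exists>C\<ge>0. \<exists>r>0. \<forall>\<mu>\<in>ball z r. norm (((\<Sum>j\<in>J. (\<Sum>k<q. (\<mu> - z) ^ k * \<alpha> k j) *s w j \<mu>) -
      jet_sum z q (comb_jet J w z \<alpha>) \<mu>) $ i) \<le> C * norm (\<mu> - z) ^ q" for i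
  proof -
    obtain F where F: "(\<lambda>x. (\<Sum>j\<in>J. (\<Sum>k<q. x ^ k * \<alpha> k j) * (w j (z + x) $ i))) has_fps_expansion F"
      "\<And>n. n < q \<Longrightarrow> fps_nth F n = comb_jet J w z \<alpha> n $ i"
      by (rule comb_jet_fps[where J = J and w = w and z = z and q = q and \<alpha> = \<alpha> and i = i, OF assms]) (assumption+, rule that)
    define f where "f = (\<lambda>\<mu>. \<Sum>j\<in>J. (\<Sum>k<q. (\<mu> - z) ^ k * \<alpha> k j) * (w j \<mu> $ i))"
    have F': "(\<lambda>x. f (z + x)) has_fps_expansion F" using F(1) by (simp add: f_def)
    obtain C r where C: "C \<ge> 0" "r > 0"
      "\<And>\<mu>. \<mu> \<in> ball z r \<Longrightarrow> norm (f \<mu> - (\<Sum>n<q. fps_nth F n * (\<mu> - z) ^ n)) \<le> C * norm (\<mu> - z) ^ q"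
      by (rule fps_remainder[OF F', of q]) (rule that, assumption+)
    have "((\<Sum>j\<in>J. (\<Sum>k<q. (\<mu> - z) ^ k * \<alpha> k j) *s w j \<mu>) - jet_sum z q (comb_jet J w z \<alpha>) \<mu>) $ i =
        f \<mu> - (\<Sum>n<q. fps_nth F n * (\<mu> - z) ^ n)" for \<mu>
    proof -
      have "(\<Sum>n<q. fps_nth F n * (\<mu> - z) ^ n) = (\<Sum>n<q. (\<mu> - z) ^ n * comb_jet J w z \<alpha> n $ i)"
        by (intro sum.cong) (auto simp: F(2))
      then show ?thesis by (simp add: f_def jet_sum_def)
    qed
    then show ?thesis using C by (intro exI conjI ballI) (simp_all only:)
  qed
  then have "\<forall>i. \<exists>C r. C \<ge> 0 \<and> r > 0 \<and> (\<forall>\<mu>\<in>ball z r. norm (((\<Sum>j\<in>J. (\<Sum>k<q. (\<mu> - z) ^ k * \<alpha> k j) *s w j \<mu>) -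
      jet_sum z q (comb_jet J w z \<alpha>) \<mu>) $ i) \<le> C * norm (\<mu> - z) ^ q)" by blast
  then obtain C r where "\<forall>i. C i \<ge> 0 \<and> r i > 0 \<and> (\<forall>\<mu>\<in>ball z (r i). norm (((\<Sum>j\<in>J. (\<Sum>k<q. (\<mu> - z) ^ k * \<alpha> k j) *s w j \<mu>) -
      jet_sum z q (comb_jet J w z \<alpha>) \<mu>) $ i) \<le> C i * norm (\<mu> - z) ^ q)"
    unfolding choice_iff by (elim exE) (rule that, assumption)
  then have C: "\<And>i. C i \<ge> 0" "\<And>i. r i > 0"
    "\<And>i \<mu>. \<mu> \<in> ball z (r i) \<Longrightarrow> norm (((\<Sum>j\<in>J. (\<Sum>k<q. (\<mu> - z) ^ k * \<alpha> k j) *s w j \<mu>) -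
      jet_sum z q (comb_jet J w z \<alpha>) \<mu>) $ i) \<le> C i * norm (\<mu> - z) ^ q" by blast+
  define r' where "r' = Min (range r)"
  have r': "r' > 0" "r' \<le> r i" for i using C(2) by (auto simp: r'_def)
  define C' where "C' = (\<Sum>i\<in>UNIV. C i)"
  have C': "C i \<le> C'" for i unfolding C'_def using C(1) by (intro member_le_sum) auto
  have C'0: "C' \<ge> 0" unfolding C'_def using C(1) by (intro sum_nonneg) auto
  show ?thesis
  proof (rule that[of "real CARD('n) * C'" r'])
    fix \<mu> assume \<mu>: "\<mu> \<in> ball z r'"
    have "norm ((\<Sum>j\<in>J. (\<Sum>k<q. (\<mu> - z) ^ k * \<alpha> k j) *s w j \<mu>) - jet_sum z q (comb_jet J w z \<alpha>) \<mu>)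
        \<le> real CARD('n) * (C' * norm (\<mu> - z) ^ q)"
    proof (rule vec_norm_le_of_components)
      fix i
      have "\<mu> \<in> ball z (r i)" using \<mu> r'(2)[of i] by auto
      moreover have "C i * norm (\<mu> - z) ^ q \<le> C' * norm (\<mu> - z) ^ q" by (intro mult_right_mono C') auto
      ultimately show "norm (((\<Sum>j\<in>J. (\<Sum>k<q. (\<mu> - z) ^ k * \<alpha> k j) *s w j \<mu>) - jet_sum z q (comb_jet J w z \<alpha>) \<mu>) $ i)
          \<le> C' * norm (\<mu> - z) ^ q" using C(3)[of \<mu> i] by linarith
    qed
    then show "norm ((\<Sum>j\<in>J. (\<Sum>k<q. (\<mu> - z) ^ k * \<alpha> k j) *s w j \<mu>) - jet_sum z q (comb_jet J w z \<alpha>) \<mu>)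
        \<le> real CARD('n) * C' * norm (\<mu> - z) ^ q" by (simp add: mult.assoc)
  qed (use C'0 r' in auto)
qed

locale half_pencil_basis = half_pencil B E z \<delta> K C0
  for B :: "complex \<Rightarrow> real \<Rightarrow> complex ^ 'n ^ 'n" and E z \<delta> K C0 +
  fixes J :: "nat set" and w :: "nat \<Rightarrow> complex \<Rightarrow> complex ^ 'n"
  assumes fin: "finite J" and ana: "j \<in> J \<Longrightarrow> (\<lambda>\<mu>. w j \<mu> $ i) analytic_on {z}"
    and spn: "\<mu> \<in> ball z \<delta> \<Longrightarrow> vec.span ((\<lambda>j. w j \<mu>) ` J) = E \<mu>"
    and ind: "vec.independent ((\<lambda>j. w j z) ` J)" and inj: "inj_on (\<lambda>j. w j z) J"
begin

lemma basis_comb_in: "\<mu> \<in> ball z \<delta> \<Longrightarrow> (\<Sum>j\<in>J. a j *s w j \<mu>) \<in> E \<mu>"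
  unfolding spn[symmetric] by (intro vec.span_sum vec.span_scale vec.span_base) auto

lemma in_E_center:
  assumes "v \<in> E z" obtains a where "v = (\<Sum>j\<in>J. a j *s w j z)"
proof -
  have "v \<in> vec.span ((\<lambda>j. w j z) ` J)" using spn[OF center_in_ball] assms by simp
  moreover have "finite ((\<lambda>j. w j z) ` J)" using fin by simp
  ultimately obtain u where "v = (\<Sum>x\<in>(\<lambda>j. w j z) ` J. u x *s x)" by (auto simp: vec.span_finite)
  then have "v = (\<Sum>j\<in>J. u (w j z) *s w j z)" by (simp add: sum.reindex[OF inj])
  then show ?thesis by (rule that)
qed

lemma basis_independent:
  assumes "(\<Sum>j\<in>J. a j *s w j z) = 0" "j \<in> J" shows "a j = 0"
proof -
  define u where "u = (\<lambda>x. a (inv_into J (\<lambda>j. w j z) x))"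
  have "(\<Sum>x\<in>(\<lambda>j. w j z) ` J. u x *s x) = (\<Sum>j\<in>J. a j *s w j z)"
    unfolding sum.reindex[OF inj] by (intro sum.cong) (auto simp: u_def inv_into_f_f[OF inj])
  then have "u (w j z) = 0" using vec.independentD[OF ind _ subset_refl, of u "w j z"] fin assms by simp
  then show ?thesis using assms(2) by (simp add: u_def inv_into_f_f[OF inj])
qed

text \<open>The system is triangular: once the lower coefficients vanish, the jet of order
  \<open>n\<close> is a combination of the independent vectors \<open>w j z\<close>.\<close>

lemma comb_jet_zero_imp:
  assumes "\<And>n. n < q \<Longrightarrow> comb_jet J w z \<alpha> n = 0" "n < q" "j \<in> J"
  shows "\<alpha> n j = 0"
  using assms(2,3)
proof (induction n arbitrary: j rule: less_induct)
  case (less n)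
  have "comb_jet J w z \<alpha> n = (\<Sum>j\<in>J. \<alpha> n j *s w j z)" unfolding comb_jet_def
  proof (intro sum.cong refl)
    fix j assume "j \<in> J"
    have "(\<Sum>k\<le>n. \<alpha> k j *s basis_jet w z j (n - k)) = (\<Sum>k\<in>{n}. \<alpha> k j *s basis_jet w z j (n - k))"
      by (rule sum.mono_neutral_right) (use less \<open>j \<in> J\<close> in auto)
    then show "(\<Sum>k\<le>n. \<alpha> k j *s basis_jet w z j (n - k)) = \<alpha> n j *s w j z" by (simp add: basis_jet_0)
  qed
  then show ?case using assms(1)[OF less.prems(1)] basis_independent[of "\<alpha> n"] less.prems(2) by simp
qed

lemma jet_in_comb_jet:
  assumes "\<And>n. n < q \<Longrightarrow> v n = comb_jet J w z \<alpha> n" shows "jet_in E z q v"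
proof -
  obtain C r where C: "C \<ge> 0" "r > 0" "\<And>\<mu>. \<mu> \<in> ball z r \<Longrightarrow>
    norm ((\<Sum>j\<in>J. (\<Sum>k<q. (\<mu> - z) ^ k * \<alpha> k j) *s w j \<mu>) - jet_sum z q (comb_jet J w z \<alpha>) \<mu>) \<le> C * norm (\<mu> - z) ^ q"
    by (rule comb_jet_approx[where J = J and w = w and z = z and q = q and \<alpha> = \<alpha>, OF ana]) (assumption+, rule that)
  have eq: "jet_sum z q v \<mu> = jet_sum z q (comb_jet J w z \<alpha>) \<mu>" for \<mu> unfolding jet_sum_def using assms by (intro sum.cong) auto
  show ?thesis unfolding jet_in_def
  proof (intro exI conjI ballI)
    fix \<mu> assume \<mu>: "\<mu> \<in> ball z (min r \<delta>)"
    show "\<exists>e\<in>E \<mu>. norm (jet_sum z q v \<mu> - e) \<le> C * norm (\<mu> - z) ^ q" using C(3)[of \<mu>] \<mu> unfolding eq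
      by (intro bexI[OF _ basis_comb_in[where a = "\<lambda>j. \<Sum>k<q. (\<mu> - z) ^ k * \<alpha> k j"]]) (auto simp: norm_minus_commute)
  qed (use C delta_pos in auto)
qed

text \<open>Order by order. Once the coefficients below \<open>q\<close> are fixed, the discrepancy
  \<open>d\<close> at order \<open>q\<close> is approximated by vectors of \<open>E \<mu>\<close> up
  to \<open>norm (\<mu> - z)\<close>, so it lies in \<open>E z\<close>; its coordinates in the basis
  at \<open>z\<close> become the coefficients of order \<open>q\<close>.\<close>

lemma comb_jet_if_jet_in:
  assumes "jet_in E z q v"
  shows "\<exists>\<alpha>. \<forall>n<q. v n = comb_jet J w z \<alpha> n"
  using assms
proof (induction q)
  case (Suc q)
  obtain \<alpha> where \<alpha>: "\<And>n. n < q \<Longrightarrow> v n = comb_jet J w z \<alpha> n" using Suc.IH[OF jet_in_Suc[OF Suc.prems]] by blast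
  \<comment> \<open>Cut off at \<open>q\<close>, since the values of \<open>\<alpha>\<close> from
    there on are arbitrary and must not enter \<open>d\<close>.\<close>
  define \<beta> where "\<beta> = (\<lambda>k j. if k < q then \<alpha> k j else 0)"
  have \<beta>: "v n = comb_jet J w z \<beta> n" if "n < q" for n
    unfolding \<alpha>[OF that] comb_jet_def using that by (intro sum.cong) (auto simp: \<beta>_def)
  define d where "d = v q - comb_jet J w z \<beta> q"
  obtain C r where C: "C \<ge> 0" "r > 0" "\<And>\<mu>. \<mu> \<in> ball z r \<Longrightarrow>
    norm ((\<Sum>j\<in>J. (\<Sum>k<Suc q. (\<mu> - z) ^ k * \<beta> k j) *s w j \<mu>) - jet_sum z (Suc q) (comb_jet J w z \<beta>) \<mu>) \<le> C * norm (\<mu> - z) ^ Suc q"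
    by (rule comb_jet_approx[where J = J and w = w and z = z and q = "Suc q" and \<alpha> = \<beta>, OF ana]) (assumption+, rule that)
  obtain C2 r2 where C2: "C2 \<ge> 0" "r2 > 0"
    "\<And>\<mu>. \<mu> \<in> ball z r2 \<Longrightarrow> \<exists>e\<in>E \<mu>. norm (jet_sum z (Suc q) v \<mu> - e) \<le> C2 * norm (\<mu> - z) ^ Suc q"
    using Suc.prems unfolding jet_in_def by blast
  have "d \<in> E z"
  proof (rule limit_in_subspace)
    show "min \<delta> (min r r2) > 0" using C C2 delta_pos by simp
    fix \<mu> assume \<mu>: "\<mu> \<in> ball z (min \<delta> (min r r2))" "\<mu> \<noteq> z"
    have \<mu>\<delta>: "\<mu> \<in> ball z \<delta>" using \<mu> by simp
    have subE: "vec.subspace (E \<mu>)" using dichotomyD(1)[OF di] \<mu> by simp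
    obtain e where e: "e \<in> E \<mu>" "norm (jet_sum z (Suc q) v \<mu> - e) \<le> C2 * norm (\<mu> - z) ^ Suc q" using C2(3)[of \<mu>] \<mu> by auto
    define f where "f = (\<Sum>j\<in>J. (\<Sum>k<Suc q. (\<mu> - z) ^ k * \<beta> k j) *s w j \<mu>)"
    have f: "f \<in> E \<mu>" unfolding f_def by (rule basis_comb_in[OF \<mu>\<delta>])
    let ?t = "(\<mu> - z) ^ q"
    have t: "?t \<noteq> 0" using \<mu>(2) by simp
    have "jet_sum z q v \<mu> = jet_sum z q (comb_jet J w z \<beta>) \<mu>" unfolding jet_sum_def using \<beta> by (intro sum.cong) auto
    then have eq: "?t *s d - (e - f) = (jet_sum z (Suc q) v \<mu> - e) + (f - jet_sum z (Suc q) (comb_jet J w z \<beta>) \<mu>)"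
      by (simp add: d_def jet_sum_def vec.scale_right_diff_distrib)
    have "norm ?t * norm (d - (1 / ?t) *s (e - f)) = norm (?t *s d - (e - f))"
    proof -
      have tt: "?t * (1 / ?t) = 1" by (simp only: times_divide_eq_right mult_1_right divide_self[OF t])
      have "?t *s (d - (1 / ?t) *s (e - f)) = ?t *s d - (e - f)"
        by (simp only: vec.scale_right_diff_distrib vec.scale_scale tt vec.scale_one)
      then show ?thesis by (metis norm_vec_scale)
    qed
    also have "\<dots> \<le> C2 * norm (\<mu> - z) ^ Suc q + C * norm (\<mu> - z) ^ Suc q"
    proof -
      have "norm (f - jet_sum z (Suc q) (comb_jet J w z \<beta>) \<mu>) \<le> C * norm (\<mu> - z) ^ Suc q"
        unfolding f_def using C(3)[of \<mu>] \<mu>(1) by (simp del: sum.lessThan_Suc power_Suc)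
      then show ?thesis unfolding eq by (intro order_trans[OF norm_triangle_ineq add_mono[OF e(2)]])
    qed
    also have "\<dots> = norm ?t * ((C2 + C) * norm (\<mu> - z))" by (simp add: norm_power algebra_simps)
    finally have "norm (d - (1 / ?t) *s (e - f)) \<le> (C2 + C) * norm (\<mu> - z)" by (rule mult_left_le_imp_le) (use t in simp)
    moreover have "(1 / ?t) *s (e - f) \<in> E \<mu>" by (intro vec.subspace_scale[OF subE] vec.subspace_diff[OF subE] e f)
    ultimately show "\<exists>e\<in>E \<mu>. norm (d - e) \<le> (C2 + C) * norm (\<mu> - z)" by blast
  qed
  then obtain a where a: "d = (\<Sum>j\<in>J. a j *s w j z)" by (rule in_E_center)
  define \<gamma> where "\<gamma> = (\<lambda>k j. if k < q then \<alpha> k j else a j)"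
  have "v n = comb_jet J w z \<gamma> n" if "n < Suc q" for n
  proof (cases "n < q")
    case True
    then show ?thesis unfolding \<alpha>[OF True] comb_jet_def by (intro sum.cong) (auto simp: \<gamma>_def)
  next
    case False
    then have n: "n = q" using that by simp
    have "comb_jet J w z \<gamma> q = (\<Sum>j\<in>J. (\<Sum>k\<le>q. \<beta> k j *s basis_jet w z j (q - k)) + a j *s w j z)" unfolding comb_jet_def
    proof (intro sum.cong refl)
      fix j
      have "(\<Sum>k\<le>q. \<gamma> k j *s basis_jet w z j (q - k)) = (\<Sum>k<q. \<gamma> k j *s basis_jet w z j (q - k)) + a j *s w j z"
        by (simp add: lessThan_Suc_atMost[symmetric] \<gamma>_def basis_jet_0)
      moreover have "(\<Sum>k\<le>q. \<beta> k j *s basis_jet w z j (q - k)) = (\<Sum>k<q. \<beta> k j *s basis_jet w z j (q - k))"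
        by (simp add: lessThan_Suc_atMost[symmetric] \<beta>_def)
      moreover have "(\<Sum>k<q. \<gamma> k j *s basis_jet w z j (q - k)) = (\<Sum>k<q. \<beta> k j *s basis_jet w z j (q - k))"
        by (intro sum.cong) (auto simp: \<beta>_def \<gamma>_def)
      ultimately show "(\<Sum>k\<le>q. \<gamma> k j *s basis_jet w z j (q - k)) = (\<Sum>k\<le>q. \<beta> k j *s basis_jet w z j (q - k)) + a j *s w j z" by simp
    qed
    also have "\<dots> = comb_jet J w z \<beta> q + d" by (simp add: comb_jet_def sum.distrib a)
    finally show ?thesis by (simp add: n d_def)
  qed
  then show ?case by blast
qed simp

end

section \<open>The order of the determinant\<close>

lemma edim_ge_independent_family:
  assumes vs: "vector_space s" and sub: "module.subspace s V" and u: "\<And>i. i < k \<Longrightarrow> u i \<in> V"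
    and ind: "\<And>a i. (\<Sum>i<k. s (a i) (u i)) = 0 \<Longrightarrow> i < k \<Longrightarrow> a i = 0"
  shows "enat k \<le> edim s V"
proof (cases "\<exists>C. finite C \<and> V \<subseteq> module.span s C")
  case True
  interpret vector_space s by fact
  obtain C where C: "finite C" "V \<subseteq> span C" using True by blast
  obtain B where B: "B \<subseteq> V" "independent B" "V \<subseteq> span B" "card B = dim V" using basis_exists[of V] .
  have finB: "finite B" using independent_span_bound[OF C(1) B(2)] B(1) C(2) by blast
  have inj: "inj_on u {..<k}"
  proof (rule inj_onI, rule ccontr)
    fix i j assume ij: "i \<in> {..<k}" "j \<in> {..<k}" "u i = u j" "i \<noteq> j"
    let ?a = "\<lambda>l. if l = i then 1 else if l = j then - 1 else (0 :: complex)"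
    have "(\<Sum>l<k. s (?a l) (u l)) = (\<Sum>l\<in>{i, j}. s (?a l) (u l))" by (rule sum.mono_neutral_right) (use ij in auto)
    also have "\<dots> = 0" using ij by simp
    finally have "?a i = 0" using ind[of ?a i] ij(1) by blast
    then show False by simp
  qed
  have "independent (u ` {..<k})"
  proof (rule independent_if_scalars_zero)
    fix f x assume f: "(\<Sum>x\<in>u ` {..<k}. s (f x) x) = 0" and x: "x \<in> u ` {..<k}"
    have "(\<Sum>i<k. s (f (u i)) (u i)) = 0" using f by (simp add: sum.reindex[OF inj])
    then show "f x = 0" using ind[of "\<lambda>i. f (u i)"] x by auto
  qed simp
  then have "card (u ` {..<k}) \<le> card B" using independent_span_bound[OF finB] u B(3) by blast
  then show ?thesis using True by (simp add: edim_def card_image[OF inj] B(4))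
next
  case False
  then have "edim s V = \<infinity>" unfolding edim_def by (rule if_not_P)
  then show ?thesis by simp
qed

lemma sum_fun_apply: "(\<Sum>i\<in>I. f i) x = (\<Sum>i\<in>I. f i x)"
  by (induction I rule: infinite_finite_induct) auto

text \<open>Together the functionals embed \<open>V\<close> into the sequences supported below
  \<open>d\<close>, which are spanned by \<open>d\<close> unit sequences.\<close>

lemma edim_le_separating_functionals:
  assumes vs: "vector_space s" and sub: "module.subspace s V"
    and lin: "\<And>i. i < d \<Longrightarrow> Vector_Spaces.linear s (*) (L i)"
    and sep: "\<And>x. x \<in> V \<Longrightarrow> (\<And>i. i < d \<Longrightarrow> L i x = 0) \<Longrightarrow> x = 0"
  shows "edim s V \<le> enat d"
proof -
  interpret V: vector_space s by fact
  have vc: "vector_space ((*) :: complex \<Rightarrow> _)" by unfold_locales (auto simp: algebra_simps)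
  interpret S: vector_space "\<lambda>c u (j::nat). c * (u j :: complex)" by (rule vector_space_coefficients[OF vc])
  define F where "F = (\<lambda>x i. if i < d then L i x else 0)"
  have linF: "Vector_Spaces.linear s (\<lambda>c u (j::nat). c * (u j :: complex)) F"
    using lin V.vector_space_axioms S.vector_space_axioms unfolding Vector_Spaces.linear_iff by (auto simp: F_def fun_eq_iff)
  interpret F: Vector_Spaces.linear s "\<lambda>c u (j::nat). c * (u j :: complex)" F by (rule linF)
  have inj: "inj_on F V"
  proof (rule inj_onI)
    fix x y assume xy: "x \<in> V" "y \<in> V" "F x = F y"
    have "F (x - y) = 0" using xy(3) by (simp add: F.diff)
    then have "L i (x - y) = 0" if "i < d" for i using that by (auto simp: F_def fun_eq_iff split: if_splits dest: spec[of _ i])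
    then have "x - y = 0" using sep[of "x - y"] V.subspace_diff[OF sub xy(1,2)] by blast
    then show "x = y" by simp
  qed
  define D where "D = (\<lambda>i j. if j = i then 1 else (0::complex)) ` {..<d}"
  have sp: "F ` V \<subseteq> S.span D"
  proof
    fix y assume "y \<in> F ` V"
    then have y: "y j = 0" if "j \<ge> d" for j using that by (auto simp: F_def)
    have "y = (\<Sum>i<d. (\<lambda>j. y i * (if j = i then 1 else 0)))"
      by (rule ext) (use y in \<open>auto simp: sum_fun_apply sum.delta if_distrib not_less cong: if_cong\<close>)
    also have "\<dots> \<in> S.span D" by (intro S.span_sum S.span_scale S.span_base) (auto simp: D_def)
    finally show "y \<in> S.span D" .
  qed
  have "S.dim (F ` V) \<le> card D" by (rule S.dim_le_card[OF sp]) (simp add: D_def)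
  also have "\<dots> \<le> d" unfolding D_def using card_image_le[of "{..<d}"] by simp
  finally have "edim (\<lambda>c u (j::nat). c * (u j :: complex)) (F ` V) \<le> enat d" using sp by (auto simp: edim_def D_def)
  then show ?thesis using edim_linear_image[OF linF sub inj] by simp
qed

lemma fps_X_power_dvd_iff:
  fixes f :: "complex fps"
  shows "fps_X ^ n dvd f \<longleftrightarrow> (\<forall>i<n. fps_nth f i = 0)"
proof
  assume "\<forall>i<n. fps_nth f i = 0"
  then have "f = fps_X ^ n * fps_shift n f" by (intro fps_ext) (auto simp: fps_X_power_mult_nth)
  then show "fps_X ^ n dvd f" by (rule dvdI)
qed (auto simp: fps_X_power_mult_nth elim!: dvdE)

definition column_fps :: "(nat \<Rightarrow> complex ^ 'n) \<Rightarrow> complex fps ^ 'n" where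
  "column_fps c = (\<chi> j. Abs_fps (\<lambda>n. vec_nth (c n) j))"

text \<open>\<open>c\<close> lists the coefficients of a polynomial of degree \<open>< q\<close>.\<close>

definition fps_kernel :: "complex fps ^ 'n ^ 'n \<Rightarrow> nat \<Rightarrow> (nat \<Rightarrow> complex ^ 'n) set" where
  "fps_kernel M q = {c. (\<forall>j\<ge>q. c j = 0) \<and> (\<forall>i. fps_X ^ q dvd vec_nth (M *v column_fps c) i)}"

lemma column_fps_nth [simp]: "fps_nth (vec_nth (column_fps c) j) n = vec_nth (c n) j"
  by (simp add: column_fps_def)

lemma subspace_fps_kernel:
  fixes M :: "complex fps ^ 'n ^ 'n"
  shows "module.subspace (\<lambda>a c j. a *s c j) (fps_kernel M q)"
proof -
  interpret vector_space "\<lambda>a c (j::nat). a *s (c j :: complex ^ 'n)"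
    by (rule vector_space_coefficients[OF vec.vector_space_axioms])
  have 0: "column_fps (\<lambda>j. 0) = 0" by (simp add: vec_eq_iff fps_eq_iff)
  have s: "column_fps (\<lambda>j. a *s c j) = fps_const a *s column_fps c" for a and c :: "nat \<Rightarrow> complex ^ 'n"
    by (simp add: vec_eq_iff fps_eq_iff)
  have p: "column_fps (\<lambda>j. c j + d j) = column_fps c + column_fps d" for c d :: "nat \<Rightarrow> complex ^ 'n"
    by (simp add: vec_eq_iff fps_eq_iff)
  have ms: "vec_nth (M *v (a *s x)) i = a * vec_nth (M *v x) i" for a x i
    by (simp add: matrix_vector_mult_def sum_distrib_left mult.left_commute)
  have "(\<lambda>j. a *s c j) \<in> fps_kernel M q" if "c \<in> fps_kernel M q" for a c
    using that unfolding fps_kernel_def s mem_Collect_eq ms by (auto intro: dvd_mult)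
  moreover have "c + d \<in> fps_kernel M q" if "c \<in> fps_kernel M q" "d \<in> fps_kernel M q" for c d
    using that unfolding fps_kernel_def plus_fun_def mem_Collect_eq p matrix_vector_right_distrib vector_add_component
    by (auto intro: dvd_add)
  moreover have "0 \<in> fps_kernel M q" unfolding fps_kernel_def zero_fun_def mem_Collect_eq 0 by simp
  ultimately show ?thesis by (intro subspaceI)
qed

text \<open>Cramer's rule before division, hence valid over any commutative ring, in particular over
  power series.\<close>

lemma det_replace_column:
  fixes M :: "'a::comm_ring_1 ^ 'n ^ 'n"
  shows "det (\<chi> i j. if j = k then (M *v v) $ i else M $ i $ j) = v $ k * det M"
proof -
  let ?T = "transpose M"
  have row: "det (\<chi> i. if i = k then ?T $ j else ?T $ i) = (if j = k then det ?T else 0)" for j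
  proof (cases "j = k")
    case True
    then have "(\<chi> i. if i = k then ?T $ j else ?T $ i) = ?T" by (simp add: vec_eq_iff)
    then show ?thesis using True by simp
  next
    case False
    then show ?thesis by (simp, intro det_identical_rows[of j k]) (auto simp: row_def vec_eq_iff)
  qed
  have "det (\<chi> i j. if j = k then (M *v v) $ i else M $ i $ j) =
      det (transpose (\<chi> i j. if j = k then (M *v v) $ i else M $ i $ j))" by simp
  also have "transpose (\<chi> i j. if j = k then (M *v v) $ i else M $ i $ j) =
      (\<chi> i. if i = k then \<Sum>j\<in>UNIV. v $ j *s ?T $ j else ?T $ i)"
    by (auto simp: vec_eq_iff transpose_def matrix_vector_mult_def mult.commute)
  also have "det \<dots> = (\<Sum>j\<in>UNIV. det (\<chi> i. if i = k then v $ j *s ?T $ j else ?T $ i))"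
    by (rule det_linear_row_sum[where a = "\<lambda>i j. v $ j *s ?T $ j"]) simp
  also have "\<dots> = (\<Sum>j\<in>UNIV. v $ j * det (\<chi> i. if i = k then ?T $ j else ?T $ i))" by (intro sum.cong refl, rule det_row_mul)
  also have "\<dots> = v $ k * det ?T" by (simp add: row sum.delta if_distrib cong: if_cong)
  finally show ?thesis by simp
qed

lemma fps_nth_prod_0: "fps_nth (prod f S) 0 = (\<Prod>i\<in>S. fps_nth (f i) 0)" for f :: "'b \<Rightarrow> complex fps"
  by (induction S rule: infinite_finite_induct) auto

lemma fps_nth_det_0: "fps_nth (det M) 0 = det (\<chi> i j. fps_nth (vec_nth (vec_nth M i) j) 0)" for M :: "complex fps ^ 'n ^ 'n"
proof -
  have *: "fps_nth (of_int m) 0 = (of_int m :: complex)" for m by (simp add: fps_of_int[symmetric])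
  show ?thesis by (simp add: det_def fps_sum_nth fps_nth_prod_0 *)
qed

lemma kernel_vector_if_det_0:
  fixes M :: "complex ^ 'n ^ 'n"
  assumes "det M = 0" obtains v where "v \<noteq> 0" "M *v v = 0"
  using assms invertible_det_nz[of M] invertible_left_inverse[of M] matrix_left_invertible_ker[of M] by blast

text \<open>
  Column \<open>k\<close> of \<open>M\<close> is replaced by \<open>t\<^sup>-\<^sup>1 M v\<close>, where \<open>M v\<close> vanishes at \<open>t = 0\<close>; this lowers the order of
  the determinant by one, and the dimension of \<open>fps_kernel\<close> by at most one.
\<close>

locale column_reduction =
  fixes M M1 :: "complex fps ^ 'n ^ 'n" and v :: "complex ^ 'n" and k :: 'n
  assumes vk: "vec_nth v k \<noteq> 0"
    and M1_other: "j \<noteq> k \<Longrightarrow> vec_nth (vec_nth M1 i) j = vec_nth (vec_nth M i) j"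
    and M1_k: "fps_X * vec_nth (vec_nth M1 i) k = (\<Sum>j\<in>UNIV. vec_nth (vec_nth M i) j * fps_const (vec_nth v j))"
begin

lemma det_reduced: "fps_X * det M1 = fps_const (vec_nth v k) * det M"
proof -
  have "fps_X * det M1 = det (\<chi> i j. if j = k then vec_nth (M1 *v (axis k fps_X)) i else vec_nth (vec_nth M1 i) j)"
    by (subst det_replace_column) (simp add: axis_def)
  also have "(\<chi> i j. if j = k then vec_nth (M1 *v (axis k fps_X)) i else vec_nth (vec_nth M1 i) j) =
     (\<chi> i j. if j = k then vec_nth (M *v (\<chi> j. fps_const (vec_nth v j))) i else vec_nth (vec_nth M i) j)"
    by (auto simp: vec_eq_iff M1_other matrix_vector_mult_def axis_def if_distrib sum.delta M1_k mult.commute[of _ fps_X] cong: if_cong)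
  also have "det \<dots> = fps_const (vec_nth v k) * det M" by (subst det_replace_column) simp
  finally show ?thesis .
qed

lemma M1_mult:
  "vec_nth (M1 *v y) i = vec_nth (vec_nth M1 i) k * vec_nth y k + (\<Sum>j\<in>UNIV-{k}. vec_nth (vec_nth M i) j * vec_nth y j)"
proof -
  have "vec_nth (M1 *v y) i = (\<Sum>j\<in>UNIV. vec_nth (vec_nth M1 i) j * vec_nth y j)" by (simp add: matrix_vector_mult_def)
  also have "\<dots> = vec_nth (vec_nth M1 i) k * vec_nth y k + (\<Sum>j\<in>UNIV-{k}. vec_nth (vec_nth M1 i) j * vec_nth y j)"
    by (rule sum.remove) auto
  also have "(\<Sum>j\<in>UNIV-{k}. vec_nth (vec_nth M1 i) j * vec_nth y j) = (\<Sum>j\<in>UNIV-{k}. vec_nth (vec_nth M i) j * vec_nth y j)"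
    by (intro sum.cong) (auto simp: M1_other)
  finally show ?thesis .
qed

text \<open>With \<open>t\<close> for \<open>fps_X\<close>, the substitution
  \<open>x_k = v_k y_k\<close>, \<open>x_j = t y_j + v_j y_k\<close> for \<open>j \<noteq> k\<close>
  turns \<open>M x\<close> into \<open>t M1 y\<close>.\<close>

lemma M_mult_expand:
  "vec_nth (M *v (\<chi> j. (if j = k then 0 else fps_X * vec_nth y j) + fps_const (vec_nth v j) * vec_nth y k)) i =
    fps_X * vec_nth (M1 *v y) i"
proof -
  have "vec_nth (M *v (\<chi> j. (if j = k then 0 else fps_X * vec_nth y j) + fps_const (vec_nth v j) * vec_nth y k)) i =
      (\<Sum>j\<in>UNIV. if j = k then 0 else fps_X * (vec_nth (vec_nth M i) j * vec_nth y j)) +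
      (\<Sum>j\<in>UNIV. vec_nth (vec_nth M i) j * fps_const (vec_nth v j)) * vec_nth y k"
    unfolding matrix_vector_mult_def sum_distrib_right sum.distrib[symmetric] vec_lambda_beta
    by (intro sum.cong) (auto simp: algebra_simps)
  also have "(\<Sum>j\<in>UNIV. if j = k then 0 else fps_X * (vec_nth (vec_nth M i) j * vec_nth y j)) =
      fps_X * (\<Sum>j\<in>UNIV-{k}. vec_nth (vec_nth M i) j * vec_nth y j)"
    unfolding sum_distrib_left by (intro sum.mono_neutral_cong_right) auto
  finally show ?thesis unfolding M1_k[symmetric] M1_mult by (simp add: algebra_simps)
qed

text \<open>The inverse substitution, stated for \<open>x\<close> multiplied by \<open>fps_X\<close>
  so that no negative power occurs; the factor cancels in the end.\<close>

lemma fps_X_mult_eq: "vec_nth (M1 *v y) i = vec_nth (M *v x) i"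
  if "\<And>j. vec_nth x j * fps_X = (if j = k then 0 else fps_X * vec_nth y j) + fps_const (vec_nth v j) * vec_nth y k"
proof -
  have "fps_X * vec_nth (M *v x) i = vec_nth (M *v (\<chi> j. vec_nth x j * fps_X)) i"
    by (simp add: matrix_vector_mult_def sum_distrib_left mult_ac)
  also have "\<dots> = fps_X * vec_nth (M1 *v y) i" unfolding that M_mult_expand ..
  finally show ?thesis by simp
qed

text \<open>Coefficients of the substitution in \<open>M_mult_expand\<close>; it raises the order of
  vanishing by one.\<close>

definition lift :: "(nat \<Rightarrow> complex ^ 'n) \<Rightarrow> nat \<Rightarrow> complex ^ 'n" where
  "lift y n = (\<chi> j. (if j = k \<or> n = 0 then 0 else vec_nth (y (n - 1)) j) + vec_nth v j * vec_nth (y n) k)"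

text \<open>Coefficients of the inverse substitution \<open>y_k = t x_k / v_k\<close>,
  \<open>y_j = x_j - v_j x_k / v_k\<close>, truncated at \<open>q\<close>. The shift in
  \<open>y_k\<close> pushes component \<open>k\<close> of \<open>c (q - 1)\<close> beyond the
  truncation; this single lost number is the one dimension by which the kernels may differ.\<close>

definition reduce :: "nat \<Rightarrow> (nat \<Rightarrow> complex ^ 'n) \<Rightarrow> nat \<Rightarrow> complex ^ 'n" where
  "reduce q c n = (if n < q then \<chi> j. if j = k then (if n = 0 then 0 else vec_nth (c (n - 1)) k / vec_nth v k)
    else vec_nth (c n) j - vec_nth (c n) k * vec_nth v j / vec_nth v k else 0)"

lemma lift_in_kernel:
  assumes "y \<in> fps_kernel M1 q" shows "lift y \<in> fps_kernel M (Suc q)"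
proof -
  have "column_fps (lift y) = (\<chi> j. (if j = k then 0 else fps_X * vec_nth (column_fps y) j) + fps_const (vec_nth v j) * vec_nth (column_fps y) k)"
    by (auto simp: vec_eq_iff fps_eq_iff lift_def)
  then have "vec_nth (M *v column_fps (lift y)) i = fps_X * vec_nth (M1 *v column_fps y) i" for i by (simp only: M_mult_expand)
  then show ?thesis using assms by (auto simp: fps_kernel_def lift_def vec_eq_iff intro: mult_dvd_mono)
qed

text \<open>The additional kernel element \<open>t ^ q v\<close>, with \<open>t\<close> for
  \<open>fps_X\<close>: the last power of \<open>t\<close> is contributed by
  \<open>M v\<close>.\<close>

lemma top_in_kernel: "(\<lambda>n. if n = q then v else 0) \<in> fps_kernel M (Suc q)"
proof -
  have "vec_nth (M *v column_fps (\<lambda>n. if n = q then v else 0)) i = fps_X ^ Suc q * vec_nth (vec_nth M1 i) k" for i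
  proof -
    have "vec_nth (column_fps (\<lambda>n. if n = q then v else 0)) j = fps_X ^ q * fps_const (vec_nth v j)" for j
      by (auto simp: fps_eq_iff fps_X_power_mult_nth)
    then have "vec_nth (M *v column_fps (\<lambda>n. if n = q then v else 0)) i =
        fps_X ^ q * (\<Sum>j\<in>UNIV. vec_nth (vec_nth M i) j * fps_const (vec_nth v j))"
      by (simp add: matrix_vector_mult_def sum_distrib_left mult_ac)
    then show ?thesis unfolding M1_k[symmetric] by (simp add: mult_ac)
  qed
  then show ?thesis by (auto simp: fps_kernel_def)
qed

lemma reduce_in_kernel:
  assumes c: "c \<in> fps_kernel M q" shows "reduce q c \<in> fps_kernel M1 q"
proof -
  define y where "y = (\<chi> j. if j = k then fps_X * fps_const (1 / vec_nth v k) * vec_nth (column_fps c) k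
    else vec_nth (column_fps c) j - fps_const (vec_nth v j / vec_nth v k) * vec_nth (column_fps c) k)"
  have y: "vec_nth (M1 *v y) i = vec_nth (M *v column_fps c) i" for i
  proof (rule fps_X_mult_eq)
    fix j
    have "fps_const (vec_nth v j) * (fps_X * fps_const (1 / vec_nth v k)) = fps_X * fps_const (vec_nth v j / vec_nth v k)"
      by (simp only: mult.left_commute[of "fps_const _"] fps_const_mult times_divide_eq_right mult_1_right)
    then have yk: "fps_const (vec_nth v j) * vec_nth y k = fps_X * fps_const (vec_nth v j / vec_nth v k) * vec_nth (column_fps c) k"
      by (simp add: y_def mult.assoc[symmetric])
    show "vec_nth (column_fps c) j * fps_X = (if j = k then 0 else fps_X * vec_nth y j) + fps_const (vec_nth v j) * vec_nth y k"
    proof (cases "j = k")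
      case True
      then show ?thesis unfolding yk using vk by (simp add: mult.commute)
    next
      case False
      then have "vec_nth y j = vec_nth (column_fps c) j - fps_const (vec_nth v j / vec_nth v k) * vec_nth (column_fps c) k"
        by (simp add: y_def)
      then show ?thesis unfolding yk using False by (simp only: if_False right_diff_distrib mult.assoc diff_add_cancel mult.commute[of fps_X])
    qed
  qed
  \<comment> \<open>\<open>y\<close> and its truncation differ by multiples of
    \<open>fps_X ^ q\<close> only, which divisibility by that power does not see.\<close>
  have diff: "fps_X ^ q dvd vec_nth y j - vec_nth (column_fps (reduce q c)) j" for j
    unfolding fps_X_power_dvd_iff by (auto simp: y_def reduce_def mult.assoc)
  have "fps_X ^ q dvd vec_nth (M1 *v column_fps (reduce q c)) i" for i
  proof -
    have "vec_nth (M1 *v column_fps (reduce q c)) i = vec_nth (M *v column_fps c) i -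
        (\<Sum>j\<in>UNIV. vec_nth (vec_nth M1 i) j * (vec_nth y j - vec_nth (column_fps (reduce q c)) j))"
      unfolding y[symmetric] by (simp add: matrix_vector_mult_def sum_subtractf[symmetric] algebra_simps)
    then show ?thesis using c diff by (auto simp: fps_kernel_def intro!: dvd_diff dvd_sum)
  qed
  then show ?thesis by (auto simp: fps_kernel_def reduce_def)
qed

lemma reduce_eq_0_imp:
  assumes c: "\<And>j. j \<ge> q \<Longrightarrow> c j = 0" and 0: "reduce q c = 0" "vec_nth (c (q - 1)) k = 0" shows "c = 0"
proof -
  have r: "reduce q c n = 0" for n using 0(1) by simp
  have ck: "vec_nth (c n) k = 0" for n
  proof -
    consider "n \<ge> q" | "n = q - 1" | "Suc n < q" by linarith
    then show ?thesis
    proof cases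
      case 3
      then have "vec_nth (reduce q c (Suc n)) k = vec_nth (c n) k / vec_nth v k" by (simp add: reduce_def)
      then show ?thesis using vk r[of "Suc n"] by simp
    qed (use c 0 in auto)
  qed
  have "vec_nth (c n) j = 0" for n j
  proof (cases "n < q \<and> j \<noteq> k")
    case True
    then have "vec_nth (reduce q c n) j = vec_nth (c n) j" by (simp add: reduce_def ck)
    then show ?thesis using r[of n] by simp
  qed (use c ck in \<open>auto simp: not_less\<close>)
  then show ?thesis by (simp add: fun_eq_iff vec_eq_iff)
qed

end

text \<open>A singular constant term has a kernel vector \<open>v\<close>, so \<open>M v\<close> is
  divisible by \<open>fps_X\<close>; any nonzero entry of \<open>v\<close> can serve as pivot
  \<open>k\<close>.\<close>

lemma column_reduction_exists:
  assumes "fps_nth (det M) 0 = 0"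
  obtains v k M1 where "column_reduction M M1 v k"
proof -
  obtain v where v: "v \<noteq> 0" "(\<chi> i j. fps_nth (vec_nth (vec_nth M i) j) 0) *v v = 0"
    by (rule kernel_vector_if_det_0[of "\<chi> i j. fps_nth (vec_nth (vec_nth M i) j) 0"]) (use assms fps_nth_det_0[of M] in auto)
  obtain k where k: "vec_nth v k \<noteq> 0" using v(1) by (auto simp: vec_eq_iff)
  define h where "h = (\<lambda>i. \<Sum>j\<in>UNIV. vec_nth (vec_nth M i) j * fps_const (vec_nth v j))"
  have h0: "fps_nth (h i) 0 = 0" for i using v(2) by (simp add: h_def vec_eq_iff fps_sum_nth matrix_vector_mult_def)
  have h: "fps_X * fps_shift 1 (h i) = h i" for i using h0[of i] by (auto simp: fps_eq_iff)
  show ?thesis by (rule that[of "\<chi> i j. if j = k then fps_shift 1 (h i) else vec_nth (vec_nth M i) j" v k], unfold_locales)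
      (use k h in \<open>auto simp: h_def\<close>)
qed

text \<open>Column reduction supplies \<open>k\<close> independent elements for \<open>M1\<close> at
  truncation \<open>q'\<close>; their lifts together with the top element are the
  \<open>k + 1\<close> elements for \<open>M\<close> at truncation \<open>q = Suc q'\<close>. The
  truncation thus drops along with \<open>k\<close>.\<close>

lemma fps_kernel_lower:
  assumes "fps_X ^ k dvd det M" "k \<le> q"
  shows "\<exists>u. (\<forall>i<k. u i \<in> fps_kernel M q) \<and> (\<forall>a. (\<Sum>i<k. (\<lambda>n. a i *s u i n)) = 0 \<longrightarrow> (\<forall>i<k. a i = 0))"
  using assms
proof (induction k arbitrary: M q)
  case (Suc k)
  obtain q' where q': "q = Suc q'" "k \<le> q'" using Suc.prems(2) by (cases q) auto
  have "fps_nth (det M) 0 = 0" using Suc.prems(1) unfolding fps_X_power_dvd_iff by simp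
  then obtain v l M1 where "column_reduction M M1 v l" by (rule column_reduction_exists)
  then interpret column_reduction M M1 v l .
  have "fps_X * fps_X ^ k dvd fps_X * det M1" unfolding det_reduced using Suc.prems(1) by (intro dvd_mult) simp
  then have d1: "fps_X ^ k dvd det M1" by simp
  have "\<exists>u. (\<forall>i<k. u i \<in> fps_kernel M1 q') \<and> (\<forall>a. (\<Sum>i<k. (\<lambda>n. a i *s u i n)) = 0 \<longrightarrow> (\<forall>i<k. a i = 0))"
    by (rule Suc.IH) (simp_all add: q' d1)
  then obtain u where u': "\<forall>i<k. u i \<in> fps_kernel M1 q'"
    and ui: "\<forall>a. (\<Sum>i<k. (\<lambda>n. a i *s u i n)) = 0 \<longrightarrow> (\<forall>i<k. a i = 0)"
    by (elim exE conjE) (rule that, assumption+)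
  have u: "u i \<in> fps_kernel M1 q'" if "i < k" for i using u' that by blast
  define w where "w = (\<lambda>i. if i < k then lift (u i) else (\<lambda>n. if n = q' then v else 0))"
  have "w i \<in> fps_kernel M q" if "i < Suc k" for i using that lift_in_kernel[OF u] top_in_kernel by (auto simp: w_def q')
  moreover have "a i = 0" if a: "(\<Sum>i<Suc k. (\<lambda>n. a i *s w i n)) = 0" and i: "i < Suc k" for a i
  proof -
    define Y where "Y = (\<lambda>n. \<Sum>i<k. a i *s u i n)"
    have lf: "(\<Sum>i<k. a i *s w i n) = lift Y n" for n
      by (auto simp: w_def lift_def Y_def vec_eq_iff sum.distrib sum_distrib_left algebra_simps intro!: sum.cong)
    have eq: "lift Y n + a k *s (if n = q' then v else 0) = 0" for n
    proof -
      have "(\<Sum>i<Suc k. (\<lambda>n. a i *s w i n)) n = lift Y n + a k *s w k n"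
        by (simp only: sum_fun_apply sum.lessThan_Suc lf plus_fun_apply)
      then show ?thesis unfolding a by (simp add: w_def)
    qed
    \<comment> \<open>At order \<open>q'\<close> component \<open>l\<close> of the lifts is 0, while
      that of the top element is \<open>vec_nth v l\<close>; this isolates the coefficient
      \<open>a k\<close>.\<close>
    have Yq: "Y q' = 0" using u by (simp add: Y_def fps_kernel_def)
    have "vec_nth (lift Y q') l = 0" by (simp add: lift_def Yq)
    then have ak: "a k = 0" using arg_cong[OF eq[of q'], of "\<lambda>x. vec_nth x l"] vk by simp
    have L: "lift Y n = 0" for n using eq[of n] ak by simp
    have Yl: "vec_nth (Y n) l = 0" for n using arg_cong[OF L[of n], of "\<lambda>x. vec_nth x l"] vk by (simp add: lift_def)
    have "vec_nth (Y n) j = 0" for n j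
      using arg_cong[OF L[of "Suc n"], of "\<lambda>x. vec_nth x j"] by (cases "j = l") (simp_all add: lift_def Yl)
    then have "(\<Sum>i<k. (\<lambda>n. a i *s u i n)) = 0" by (simp add: fun_eq_iff vec_eq_iff Y_def sum_fun_apply)
    from ui[rule_format, OF this] ak i show ?thesis by (cases "i = k") auto
  qed
  ultimately show ?case by blast
qed simp

text \<open>The dual count: the functionals for \<open>M1\<close> composed with
  \<open>reduce\<close>, and the one coefficient that \<open>reduce\<close> loses. For
  \<open>d = 0\<close> the constant term of \<open>M\<close> is invertible, so the coefficients of a
  kernel element vanish successively.\<close>

lemma fps_kernel_upper:
  assumes "fps_nth (det M) d \<noteq> 0" "\<And>i. i < d \<Longrightarrow> fps_nth (det M) i = 0"
  shows "\<exists>L. (\<forall>i<d. Vector_Spaces.linear (\<lambda>a c j. a *s c j) (*) (L i)) \<and>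
    (\<forall>c\<in>fps_kernel M q. (\<forall>i<d. L i c = 0) \<longrightarrow> c = (0 :: nat \<Rightarrow> complex ^ 'n))" using assms
proof (induction d arbitrary: M)
  case 0
  let ?M0 = "\<chi> i j. fps_nth (vec_nth (vec_nth M i) j) 0"
  have nz: "x = 0" if "?M0 *v x = 0" for x
    using 0 that invertible_det_nz[of ?M0] invertible_left_inverse[of ?M0] matrix_left_invertible_ker[of ?M0]
    unfolding fps_nth_det_0 by blast
  have "c = 0" if c: "c \<in> fps_kernel M q" for c
  proof -
    have "c n = 0" for n
    proof (induction n rule: less_induct)
      case (less n)
      show ?case
      proof (cases "n < q")
        case True
        have A: "vec_nth (?M0 *v c n) i = fps_nth (vec_nth (M *v column_fps c) i) n" for i
        proof -
          have "(\<Sum>l\<le>n. fps_nth (vec_nth (vec_nth M i) j) l * vec_nth (c (n - l)) j) =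
              (\<Sum>l\<in>{0}. fps_nth (vec_nth (vec_nth M i) j) l * vec_nth (c (n - l)) j)" for j
            by (rule sum.mono_neutral_right) (use less in auto)
          then show ?thesis by (simp add: matrix_vector_mult_def fps_sum_nth fps_mult_nth atLeast0AtMost)
        qed
        have "fps_nth (vec_nth (M *v column_fps c) i) n = 0" for i
          using c True unfolding fps_kernel_def fps_X_power_dvd_iff by blast
        then have "?M0 *v c n = 0" unfolding vec_eq_iff A by simp
        then show ?thesis by (rule nz)
      qed (use c in \<open>simp add: fps_kernel_def\<close>)
    qed
    then show ?thesis by (intro ext) simp
  qed
  then have "\<forall>c\<in>fps_kernel M q. c = (0 :: nat \<Rightarrow> complex ^ 'n)" by blast
  then show ?case by (simp add: zero_fun_def)
next
  case (Suc d)
  have "fps_nth (det M) 0 = 0" using Suc.prems(2) by simp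
  then obtain v l M1 where "column_reduction M M1 v l" by (rule column_reduction_exists)
  then interpret column_reduction M M1 v l .
  have nth: "fps_nth (det M1) n = vec_nth v l * fps_nth (det M) (Suc n)" for n
    using arg_cong[OF det_reduced, of "\<lambda>f. fps_nth f (Suc n)"] by simp
  have "\<exists>L. (\<forall>i<d. Vector_Spaces.linear (\<lambda>a c j. a *s c j) (*) (L i)) \<and>
      (\<forall>c\<in>fps_kernel M1 q. (\<forall>i<d. L i c = 0) \<longrightarrow> c = (0 :: nat \<Rightarrow> complex ^ 'n))" by (rule Suc.IH) (simp_all add: nth vk Suc.prems)
  then obtain L where L': "\<forall>i<d. Vector_Spaces.linear (\<lambda>a c j. a *s c j) (*) (L i)"
    and L0: "\<forall>c\<in>fps_kernel M1 q. (\<forall>i<d. L i c = 0) \<longrightarrow> c = (0 :: nat \<Rightarrow> complex ^ 'n)"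
    by (elim exE conjE) (rule that, assumption+)
  have L: "Vector_Spaces.linear (\<lambda>a c j. a *s c j) (*) (L i)" if "i < d" for i using L' that by blast
  define L' where "L' = (\<lambda>i c. if i < d then L i (reduce q c) else vec_nth (c (q - 1)) l)"
  have "Vector_Spaces.linear (\<lambda>a c j. a *s c j) (*) (L' i)" for i
  proof (cases "i < d")
    case True
    have "reduce q (c + c') = reduce q c + reduce q c'" for c c'
      by (auto simp: fun_eq_iff reduce_def vec_eq_iff algebra_simps add_divide_distrib)
    moreover have "reduce q (\<lambda>j. a *s c j) = (\<lambda>j. a *s reduce q c j)" for a c
      by (auto simp: fun_eq_iff reduce_def vec_eq_iff algebra_simps add_divide_distrib)
    ultimately show ?thesis using L[OF True] True unfolding Vector_Spaces.linear_iff by (simp add: L'_def)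
  next
    case False
    then show ?thesis using vector_space_coefficients[OF vec.vector_space_axioms]
      unfolding Vector_Spaces.linear_iff by (auto simp: L'_def vector_space_def algebra_simps)
  qed
  moreover have "c = 0" if c: "c \<in> fps_kernel M q" and c0: "\<forall>i<Suc d. L' i c = 0" for c
  proof (rule reduce_eq_0_imp)
    show "reduce q c = 0" by (rule L0[rule_format, OF reduce_in_kernel[OF c]]) (use c0 in \<open>auto simp: L'_def less_Suc_eq\<close>)
    show "vec_nth (c (q - 1)) l = 0" using c0[rule_format, of d] by (simp add: L'_def)
  qed (use c in \<open>auto simp: fps_kernel_def\<close>)
  ultimately show ?case by blast
qed

text \<open>The lower count requires truncation at least \<open>k\<close>, so the supremum is
  reached for large \<open>p\<close>. A zero determinant is divisible by every power and makes the
  supremum infinite.\<close>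

lemma SUP_edim_fps_kernel:
  fixes M :: "complex fps ^ 'n ^ 'n"
  shows "(SUP p. edim (\<lambda>a c j. a *s c j) (fps_kernel M (Suc p))) = (if det M = 0 then \<infinity> else enat (subdegree (det M)))"
proof -
  let ?e = "\<lambda>p. edim (\<lambda>a c j. a *s c j) (fps_kernel M (Suc p))"
  note vs = vector_space_coefficients[OF vec.vector_space_axioms]
  have lower: "enat k \<le> (SUP p. ?e p)" if dvd: "fps_X ^ k dvd det M" for k
  proof -
    have "\<exists>u. (\<forall>i<k. u i \<in> fps_kernel M (Suc k)) \<and> (\<forall>a. (\<Sum>i<k. (\<lambda>n. a i *s u i n)) = 0 \<longrightarrow> (\<forall>i<k. a i = 0))"
      by (rule fps_kernel_lower[OF dvd]) simp
    then obtain u where u: "\<forall>i<k. u i \<in> fps_kernel M (Suc k)"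
      "\<forall>a. (\<Sum>i<k. (\<lambda>n. a i *s u i n)) = 0 \<longrightarrow> (\<forall>i<k. a i = 0)" by (elim exE conjE) (rule that, assumption+)
    have "enat k \<le> ?e k" by (rule edim_ge_independent_family[OF vs subspace_fps_kernel]) (use u in blast)+
    then show ?thesis by (rule SUP_upper2[rotated]) simp
  qed
  show ?thesis
  proof (cases "det M = 0")
    case True
    have "enat k \<le> (SUP p. ?e p)" for k by (rule lower) (simp add: True)
    then have "(SUP p. ?e p) = \<infinity>" by (cases "SUP p. ?e p") (metis enat_ord_simps(1) Suc_n_not_le_n, simp)
    then show ?thesis using True by simp
  next
    case False
    have "?e p \<le> enat (subdegree (det M))" for p
    proof -
      have "\<exists>L. (\<forall>i<subdegree (det M). Vector_Spaces.linear (\<lambda>a c j. a *s c j) (*) (L i)) \<and>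
          (\<forall>c\<in>fps_kernel M (Suc p). (\<forall>i<subdegree (det M). L i c = 0) \<longrightarrow> c = (0 :: nat \<Rightarrow> complex ^ 'n))"
        by (rule fps_kernel_upper) (use False in auto)
      then obtain L where L: "\<forall>i<subdegree (det M). Vector_Spaces.linear (\<lambda>a c j. a *s c j) (*) (L i)"
        "\<forall>c\<in>fps_kernel M (Suc p). (\<forall>i<subdegree (det M). L i c = 0) \<longrightarrow> c = (0 :: nat \<Rightarrow> complex ^ 'n)"
        by (elim exE conjE) (rule that, assumption+)
      show ?thesis by (rule edim_le_separating_functionals[OF vs subspace_fps_kernel, of _ L]) (use L in blast)+
    qed
    then have "(SUP p. ?e p) \<le> enat (subdegree (det M))" by (intro SUP_least)
    moreover have "enat (subdegree (det M)) \<le> (SUP p. ?e p)"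
    proof (rule lower)
      show "fps_X ^ subdegree (det M) dvd det M" unfolding fps_X_power_dvd_iff by (intro allI impI nth_less_subdegree_zero)
    qed
    ultimately show ?thesis using False by simp
  qed
qed

section \<open>Multiplicities of an analytic matrix\<close>

lemma bigo_norm_vec_iff:
  fixes f :: "complex \<Rightarrow> complex ^ 'n" and g :: "complex \<Rightarrow> real"
  shows "(\<lambda>\<mu>. norm (f \<mu>)) \<in> O[F](g) \<longleftrightarrow> (\<forall>i. (\<lambda>\<mu>. norm (vec_nth (f \<mu>) i)) \<in> O[F](g))"
proof
  assume *: "(\<lambda>\<mu>. norm (f \<mu>)) \<in> O[F](g)"
  have "(\<lambda>\<mu>. norm (vec_nth (f \<mu>) i)) \<in> O[F](\<lambda>\<mu>. norm (f \<mu>))" for i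
    by (rule landau_o.big_mono) (simp add: Finite_Cartesian_Product.norm_nth_le)
  then show "\<forall>i. (\<lambda>\<mu>. norm (vec_nth (f \<mu>) i)) \<in> O[F](g)" using * landau_o.big_trans by blast
next
  assume *: "\<forall>i. (\<lambda>\<mu>. norm (vec_nth (f \<mu>) i)) \<in> O[F](g)"
  have "norm (f \<mu>) \<le> (\<Sum>i\<in>UNIV. norm (vec_nth (f \<mu>) i))" for \<mu> unfolding norm_vec_def by (rule L2_set_le_sum) simp
  moreover have "(\<Sum>i\<in>UNIV. norm (vec_nth (f \<mu>) i)) \<ge> 0" for \<mu> by (intro sum_nonneg) auto
  ultimately have "(\<lambda>\<mu>. norm (f \<mu>)) \<in> O[F](\<lambda>\<mu>. \<Sum>i\<in>UNIV. norm (vec_nth (f \<mu>) i))"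
    by (intro landau_o.big_mono always_eventually allI) simp
  moreover have "(\<lambda>\<mu>. \<Sum>i\<in>UNIV. norm (vec_nth (f \<mu>) i)) \<in> O[F](g)" by (rule big_sum_in_bigo) (use * in auto)
  ultimately show "(\<lambda>\<mu>. norm (f \<mu>)) \<in> O[F](g)" by (rule landau_o.big_trans)
qed

lemma has_fps_expansion_polynomial:
  fixes c :: "nat \<Rightarrow> complex"
  shows "\<forall>j>p. c j = 0 \<Longrightarrow> (\<lambda>x. \<Sum>j\<le>p. x ^ j * c j) has_fps_expansion Abs_fps c"
proof -
  assume c: "\<forall>j>p. c j = 0"
  have "Abs_fps c = (\<Sum>j\<le>p. fps_X ^ j * fps_const (c j))"
  proof (rule fps_ext)
    fix n
    have "(\<Sum>j\<le>p. fps_nth (fps_X ^ j * fps_const (c j)) n) = (\<Sum>j\<le>p. if j = n then c j else 0)"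
      by (intro sum.cong) (auto simp: fps_X_power_mult_nth)
    then show "fps_nth (Abs_fps c) n = fps_nth (\<Sum>j\<le>p. fps_X ^ j * fps_const (c j)) n"
      using c by (simp add: fps_sum_nth sum.delta)
  qed
  moreover have "(\<lambda>x. \<Sum>j\<le>p. x ^ j * c j) has_fps_expansion (\<Sum>j\<le>p. fps_X ^ j * fps_const (c j))"
    by (intro has_fps_expansion_sum has_fps_expansion_mult has_fps_expansion_fps_X_power has_fps_expansion_const)
  ultimately show ?thesis by simp
qed

context
  fixes T :: "complex \<Rightarrow> complex ^ 'n \<Rightarrow> complex ^ 'n" and F :: "complex fps ^ 'n ^ 'n" and z :: complex
  assumes T: "\<And>\<mu>. Vector_Spaces.linear (*s) (*s) (T \<mu>)"
    and F: "\<And>i j. (\<lambda>x. vec_nth (vec_nth (matrix (T (z + x))) i) j) has_fps_expansion vec_nth (vec_nth F i) j"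
begin

text \<open>Componentwise, decay of the residual at \<open>z\<close> and divisibility of its power
  series by \<open>fps_X ^ Suc p\<close> are the same condition.\<close>

lemma root_functions_matrix: "root_functions (*s) UNIV norm T z p = fps_kernel F (Suc p)"
proof -
  have "(\<lambda>\<mu>. norm (T \<mu> (\<Sum>j\<le>p. (\<mu> - z) ^ j *s u j))) \<in> O[at z](\<lambda>\<mu>. norm (\<mu> - z) ^ (p + 1)) \<longleftrightarrow>
      (\<forall>i. fps_X ^ Suc p dvd vec_nth (F *v column_fps u) i)" if u: "\<forall>j>p. u j = 0" for u
  proof -
    have "(\<lambda>\<mu>. norm (vec_nth (T \<mu> (\<Sum>j\<le>p. (\<mu> - z) ^ j *s u j)) i)) \<in> O[at z](\<lambda>\<mu>. norm (\<mu> - z) ^ Suc p) \<longleftrightarrow>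
        fps_X ^ Suc p dvd vec_nth (F *v column_fps u) i" for i
    proof -
      define f where "f = (\<lambda>\<mu>. vec_nth (T \<mu> (\<Sum>j\<le>p. (\<mu> - z) ^ j *s u j)) i)"
      have eq: "f (z + x) = (\<Sum>l\<in>UNIV. vec_nth (vec_nth (matrix (T (z + x))) i) l * (\<Sum>j\<le>p. x ^ j * vec_nth (u j) l))" for x
        unfolding f_def by (subst matrix_works[OF T, symmetric]) (simp add: matrix_vector_mult_def)
      have "(\<lambda>x. f (z + x)) has_fps_expansion (\<Sum>l\<in>UNIV. vec_nth (vec_nth F i) l * Abs_fps (\<lambda>j. vec_nth (u j) l))"
        unfolding eq using u by (intro has_fps_expansion_sum has_fps_expansion_mult F has_fps_expansion_polynomial) auto
      then have E: "(\<lambda>x. f (z + x)) has_fps_expansion (vec_nth (F *v column_fps u) i)"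
        by (simp add: matrix_vector_mult_def column_fps_def)
      have "(\<lambda>\<mu>. norm (f \<mu>)) \<in> O[at z](\<lambda>\<mu>. norm (\<mu> - z) ^ Suc p) \<longleftrightarrow> fps_X ^ Suc p dvd vec_nth (F *v column_fps u) i"
        unfolding fps_X_power_dvd_iff fps_order_iff[OF E, symmetric] by (rule bigo_at_iff) simp
      then show ?thesis unfolding f_def .
    qed
    then show ?thesis unfolding bigo_norm_vec_iff by simp
  qed
  then show ?thesis unfolding root_functions_def fps_kernel_def Suc_le_eq by (intro Collect_cong) auto
qed

text \<open>The determinant is polynomial in the entries, so \<open>det F\<close> is its expansion.
  Its subdegree is the order of the zero, and a zero series means that the determinant vanishes near
  \<open>z\<close>.\<close>

lemma alg_mult_matrix: "alg_mult (*s) UNIV norm T z = root_order (\<lambda>\<mu>. det (matrix (T \<mu>))) z"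
proof -
  have "(\<lambda>x. det (matrix (T (z + x)))) has_fps_expansion det F"
  proof -
    have of_int: "fps_const (of_int k) = (of_int k :: complex fps)" for k by (simp add: fps_of_int)
    show ?thesis unfolding det_def of_int[symmetric]
      by (intro has_fps_expansion_sum has_fps_expansion_mult has_fps_expansion_const has_fps_expansion_prod F)
  qed
  note E = this
  have "alg_mult (*s) UNIV norm T z = (if det F = 0 then \<infinity> else enat (subdegree (det F)))"
    unfolding alg_mult_def root_functions_matrix by (rule SUP_edim_fps_kernel)
  also have "\<dots> = root_order (\<lambda>\<mu>. det (matrix (T \<mu>))) z"
  proof -
    have "(\<forall>\<^sub>F \<mu> in nhds z. det (matrix (T \<mu>)) = 0) \<longleftrightarrow> (\<forall>\<^sub>F x in nhds 0. det (matrix (T (z + x))) = 0)"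
      unfolding nhds_to_0[of z] eventually_filtermap by (simp add: add.commute)
    also have "\<dots> \<longleftrightarrow> det F = 0"
    proof
      assume "\<forall>\<^sub>F x in nhds 0. det (matrix (T (z + x))) = 0"
      then have "(\<lambda>x. det (matrix (T (z + x)))) has_fps_expansion 0" by (simp add: has_fps_expansion_0_iff)
      then show "det F = 0" using E fps_expansion_unique_complex by blast
    qed (use E in \<open>simp add: has_fps_expansion_0_iff\<close>)
    finally show ?thesis using has_fps_expansion_zorder[OF E] by (auto simp: root_order_def)
  qed
  finally show ?thesis .
qed

end

section \<open>The matrix pencil\<close>

lemma linear_iota: "Vector_Spaces.linear (*s) (*s) (iota m e wu ws \<mu>)"
  unfolding Vector_Spaces.linear_iff
  by (auto simp: vec.vector_space_axioms iota_def vec.scale_left_distrib sum.distrib vec.scale_sum_right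
    vec.scale_right_diff_distrib algebra_simps)

locale evans_pencil = ode_pencil A Es Eu z \<delta> K C0 +
  RB: half_pencil_basis "\<lambda>\<mu> x. A x \<mu>" Es z \<delta> K C0 "{m+1..CARD('n)}" ws +
  LB: half_pencil_basis "left_coeff A" Eu z \<delta> K C0 "{1..m}" wu
  for A :: "real \<Rightarrow> complex \<Rightarrow> complex ^ 'n ^ 'n" and Es Eu z \<delta> K C0 m wu ws +
  fixes e :: "nat \<Rightarrow> 'n"
  assumes e: "bij_betw e {1..CARD('n)} UNIV" and m: "m \<le> CARD('n)"
begin

definition ei :: "'n \<Rightarrow> nat" where "ei = the_inv_into {1..CARD('n)} e"

lemma inj_e: "inj_on e {1..CARD('n)}" and e_ei: "e (ei i) = i" and ei_range: "ei i \<in> {1..CARD('n)}"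
  and ei_e: "j \<in> {1..CARD('n)} \<Longrightarrow> ei (e j) = j"
proof -
  show inj: "inj_on e {1..CARD('n)}" using e by (simp add: bij_betw_def)
  show "e (ei i) = i" unfolding ei_def by (rule f_the_inv_into_f_bij_betw[OF e]) simp
  show "ei i \<in> {1..CARD('n)}"
    unfolding ei_def by (rule the_inv_into_into[OF inj _ subset_refl]) (use e in \<open>simp add: bij_betw_def\<close>)
  show "ei (e j) = j" if "j \<in> {1..CARD('n)}" unfolding ei_def by (rule the_inv_into_f_f[OF inj that])
qed

lemma sum_split: "(\<Sum>i\<in>UNIV. f i) = (\<Sum>j=1..m. f (e j)) + (\<Sum>j=m+1..CARD('n). f (e j))" for f :: "'n \<Rightarrow> 'b::comm_monoid_add"
proof -
  have "(\<Sum>i\<in>UNIV. f i) = (\<Sum>j=1..CARD('n). f (e j))" by (rule sum.reindex_bij_betw[OF e, symmetric])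
  also have "{1..CARD('n)} = {1..m} \<union> {m+1..CARD('n)}" using m by auto
  also have "(\<Sum>j\<in>\<dots>. f (e j)) = (\<Sum>j=1..m. f (e j)) + (\<Sum>j=m+1..CARD('n). f (e j))" by (rule sum.union_disjoint) auto
  finally show ?thesis .
qed

definition Fi :: "complex fps ^ 'n ^ 'n" where
  "Fi = (\<chi> i j. if ei j \<le> m then fps_expansion (\<lambda>\<mu>. vec_nth (wu (ei j) \<mu>) i) z
    else - fps_expansion (\<lambda>\<mu>. vec_nth (ws (ei j) \<mu>) i) z)"

lemma iota_axis: "iota m e wu ws \<mu> (axis l 1) = (if ei l \<le> m then wu (ei l) \<mu> else - ws (ei l) \<mu>)"
proof -
  have ax: "(\<Sum>j\<in>S. vec_nth (axis l 1) (e j) *s w j) = (if ei l \<in> S then w (ei l) else 0)"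
    if S: "S \<subseteq> {1..CARD('n)}" for S and w :: "nat \<Rightarrow> complex ^ 'n"
  proof -
    have "(\<Sum>j\<in>S. vec_nth (axis l 1) (e j) *s w j) = (\<Sum>j\<in>S. if j = ei l then w j else 0)"
      by (intro sum.cong) (use S ei_e e_ei in \<open>auto simp: axis_def\<close>)
    then show ?thesis using finite_subset[OF S] by (simp add: sum.delta)
  qed
  have "{1..m} \<subseteq> {1..CARD('n)}" "{m+1..CARD('n)} \<subseteq> {1..CARD('n)}" using m by auto
  from ax[OF this(1)] ax[OF this(2)] show ?thesis using ei_range[of l] by (auto simp: iota_def)
qed

lemma Fi_expansion:
  "(\<lambda>x. vec_nth (vec_nth (matrix (iota m e wu ws (z + x))) i) j) has_fps_expansion vec_nth (vec_nth Fi i) j"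
proof -
  have a: "(\<lambda>\<mu>. vec_nth (wu (ei j) \<mu>) i) analytic_on {z}" if "ei j \<le> m" using LB.ana[of "ei j" i] that ei_range[of j] by auto
  have b: "(\<lambda>\<mu>. vec_nth (ws (ei j) \<mu>) i) analytic_on {z}" if "\<not> ei j \<le> m" using RB.ana[of "ei j" i] that ei_range[of j] by auto
  show ?thesis using analytic_at_imp_has_fps_expansion[OF a] has_fps_expansion_minus[OF analytic_at_imp_has_fps_expansion[OF b]]
    by (cases "ei j \<le> m") (simp_all add: matrix_def iota_axis Fi_def)
qed

lemmas alg_mult_iota = alg_mult_matrix[OF linear_iota Fi_expansion]
lemmas root_functions_iota = root_functions_matrix[OF linear_iota Fi_expansion]

abbreviation "coordinates c \<equiv> (\<lambda>k j. vec_nth (c k) (e j))"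

lemma Fi_mult_nth:
  "fps_nth (vec_nth (Fi *v column_fps c) i) n =
    vec_nth (comb_jet {1..m} wu z (coordinates c) n - comb_jet {m+1..CARD('n)} ws z (coordinates c) n) i"
proof -
  have "fps_nth (vec_nth (Fi *v column_fps c) i) n =
      (\<Sum>l\<in>UNIV. \<Sum>k\<le>n. vec_nth (c k) l * fps_nth (vec_nth (vec_nth Fi i) l) (n - k))"
    unfolding matrix_vector_mult_def vec_lambda_beta fps_sum_nth mult.commute[of "vec_nth (vec_nth Fi i) _"]
    by (simp add: fps_mult_nth atLeast0AtMost)
  also have "\<dots> = (\<Sum>j=1..m. \<Sum>k\<le>n. vec_nth (c k) (e j) * fps_nth (vec_nth (vec_nth Fi i) (e j)) (n - k)) +
      (\<Sum>j=m+1..CARD('n). \<Sum>k\<le>n. vec_nth (c k) (e j) * fps_nth (vec_nth (vec_nth Fi i) (e j)) (n - k))" by (rule sum_split)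
  also have "(\<Sum>j=1..m. \<Sum>k\<le>n. vec_nth (c k) (e j) * fps_nth (vec_nth (vec_nth Fi i) (e j)) (n - k)) =
      vec_nth (comb_jet {1..m} wu z (coordinates c) n) i"
    unfolding comb_jet_def sum_component using m by (intro sum.cong refl) (auto simp: Fi_def basis_jet_def ei_e)
  also have "(\<Sum>j=m+1..CARD('n). \<Sum>k\<le>n. vec_nth (c k) (e j) * fps_nth (vec_nth (vec_nth Fi i) (e j)) (n - k)) =
      - vec_nth (comb_jet {m+1..CARD('n)} ws z (coordinates c) n) i" unfolding comb_jet_def sum_component sum_negf[symmetric]
    by (intro sum.cong refl) (auto simp: Fi_def basis_jet_def ei_e)
  finally show ?thesis by simp
qed

lemma kernel_Fi_iff:
  "c \<in> fps_kernel Fi (Suc p) \<longleftrightarrow> (\<forall>j>p. c j = 0) \<and>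
    (\<forall>n\<le>p. comb_jet {1..m} wu z (coordinates c) n = comb_jet {m+1..CARD('n)} ws z (coordinates c) n)"
  unfolding fps_kernel_def fps_X_power_dvd_iff Fi_mult_nth mem_Collect_eq by (auto simp: vec_eq_iff Suc_le_eq less_Suc_eq_le)

text \<open>The jet of the unstable half of the combination. On the kernel it agrees up to order
  \<open>p\<close> with the jet of the stable half, so it is a jet along both bundles.\<close>

definition jet_map :: "nat \<Rightarrow> (nat \<Rightarrow> complex ^ 'n) \<Rightarrow> nat \<Rightarrow> complex ^ 'n" where
  "jet_map p c n = (if n \<le> p then comb_jet {1..m} wu z (coordinates c) n else 0)"

lemma linear_jet_map: "Vector_Spaces.linear (\<lambda>c w j. c *s w j) (\<lambda>c w j. c *s w j) (jet_map p)"
  unfolding Vector_Spaces.linear_iff using vector_space_coefficients[OF vec.vector_space_axioms]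
  by (auto simp: jet_map_def fun_eq_iff comb_jet_def vec.scale_left_distrib sum.distrib vec.scale_sum_right vec.scale_scale)

text \<open>By the kernel condition a zero jet of the unstable half forces a zero jet of the stable
  half; independence of each basis at \<open>z\<close> then kills both groups of
  coordinates.\<close>

lemma inj_jet_map: "inj_on (jet_map p) (fps_kernel Fi (Suc p))"
proof (rule inj_onI)
  interpret J: Vector_Spaces.linear "\<lambda>c w (j::nat). c *s (w j :: complex ^ 'n)" "\<lambda>c w (j::nat). c *s (w j :: complex ^ 'n)" "jet_map p"
    by (rule linear_jet_map)
  fix c d assume cd: "c \<in> fps_kernel Fi (Suc p)" "d \<in> fps_kernel Fi (Suc p)" "jet_map p c = jet_map p d"
  have dK: "c - d \<in> fps_kernel Fi (Suc p)" by (rule J.vs1.subspace_diff[OF subspace_fps_kernel cd(1,2)])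
  have j0: "jet_map p (c - d) = 0" using cd(3) by (simp add: J.diff)
  have u0: "comb_jet {1..m} wu z (coordinates (c - d)) n = 0" if "n < Suc p" for n
    using fun_cong[OF j0, of n] that unfolding jet_map_def zero_fun_apply less_Suc_eq_le by (simp only: if_True)
  have s0: "comb_jet {m+1..CARD('n)} ws z (coordinates (c - d)) n = 0" if "n < Suc p" for n
    using u0[OF that] dK that unfolding kernel_Fi_iff by simp
  have "vec_nth ((c - d) n) i = 0" for n i
  proof (cases "n < Suc p")
    case True
    show ?thesis
    proof (cases "ei i \<le> m")
      case T: True
      have "vec_nth ((c - d) n) (e (ei i)) = 0" by (rule LB.comb_jet_zero_imp[OF u0 True]) (use T ei_range[of i] in auto)
      then show ?thesis by (simp add: e_ei)
    next
      case F: False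
      have "vec_nth ((c - d) n) (e (ei i)) = 0" by (rule RB.comb_jet_zero_imp[OF s0 True]) (use F ei_range[of i] in auto)
      then show ?thesis by (simp add: e_ei)
    qed
  next
    case False
    then show ?thesis using dK unfolding kernel_Fi_iff by simp
  qed
  then have "c - d = 0" by (intro ext) (simp add: vec_eq_iff)
  then show "c = d" by simp
qed

text \<open>A matching jet has coefficients in each of the two bases separately; combined into one
  vector by means of \<open>ei\<close>, they form a kernel element.\<close>

lemma image_jet_map: "jet_map p ` fps_kernel Fi (Suc p) = matching_jets p"
proof (intro equalityI subsetI)
  fix w assume "w \<in> jet_map p ` fps_kernel Fi (Suc p)"
  then obtain c where c: "c \<in> fps_kernel Fi (Suc p)" "w = jet_map p c" by blast
  have "jet_in Eu z (Suc p) w" by (rule LB.jet_in_comb_jet[of _ _ "coordinates c"]) (simp add: c(2) jet_map_def)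
  moreover have "jet_in Es z (Suc p) w"
    by (rule RB.jet_in_comb_jet[of _ _ "coordinates c"]) (use c(1) in \<open>simp add: c(2) jet_map_def kernel_Fi_iff\<close>)
  ultimately show "w \<in> matching_jets p" by (simp add: matching_jets_def c(2) jet_map_def)
next
  fix w assume w: "w \<in> matching_jets p"
  obtain \<alpha> where \<alpha>: "\<forall>n<Suc p. w n = comb_jet {1..m} wu z \<alpha> n"
    using LB.comb_jet_if_jet_in[of "Suc p" w] w unfolding matching_jets_def by blast
  obtain \<beta> where \<beta>: "\<forall>n<Suc p. w n = comb_jet {m+1..CARD('n)} ws z \<beta> n"
    using RB.comb_jet_if_jet_in[of "Suc p" w] w unfolding matching_jets_def by blast
  define c :: "nat \<Rightarrow> complex ^ 'n" where "c = (\<lambda>k. if k \<le> p then \<chi> i. if ei i \<le> m then \<alpha> k (ei i) else \<beta> k (ei i) else 0)"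
  have u: "comb_jet {1..m} wu z (coordinates c) n = w n" if "n \<le> p" for n
    using \<alpha> that m unfolding less_Suc_eq_le by (auto simp: comb_jet_def c_def ei_e intro!: sum.cong)
  have s: "comb_jet {m+1..CARD('n)} ws z (coordinates c) n = w n" if "n \<le> p" for n
    using \<beta> that unfolding less_Suc_eq_le by (auto simp: comb_jet_def c_def ei_e intro!: sum.cong)
  have "c \<in> fps_kernel Fi (Suc p)" using u s unfolding kernel_Fi_iff by (simp add: c_def)
  moreover have "jet_map p c = w" using u w by (auto simp: jet_map_def fun_eq_iff matching_jets_def)
  ultimately show "w \<in> jet_map p ` fps_kernel Fi (Suc p)" by blast
qed

text \<open>The equality holds at every order \<open>p\<close> before taking suprema, both spaces of
  root functions being isomorphic to \<open>matching_jets p\<close>.\<close>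

lemma alg_mult_eq: "alg_mult cscale H1 l2norm (ode_op A) z = alg_mult (*s) UNIV norm (iota m e wu ws) z"
  unfolding alg_mult_def edim_root_functions root_functions_iota
    edim_linear_image[OF linear_jet_map subspace_fps_kernel inj_jet_map, symmetric] image_jet_map ..

text \<open>Both kernels are isomorphic to \<open>Es z \<inter> Eu z\<close>: by evaluation at 0 and
  by the unstable half of the coordinates.\<close>

lemma geom_mult_eq: "geom_mult cscale H1 l2norm (ode_op A) z = geom_mult (*s) UNIV norm (iota m e wu ws) z"
proof -
  let ?K = "pencil_ker UNIV norm (iota m e wu ws) z"
  interpret I: Vector_Spaces.linear "(*s)" "(*s)" "iota m e wu ws z" by (rule linear_iota)
  define \<Psi> where "\<Psi> = (\<lambda>u :: complex ^ 'n. \<Sum>j=1..m. vec_nth u (e j) *s wu j z)"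
  have lin: "Vector_Spaces.linear (*s) (*s) \<Psi>" unfolding Vector_Spaces.linear_iff \<Psi>_def
    by (auto simp: vec.vector_space_axioms vec.scale_left_distrib sum.distrib vec.scale_sum_right)
  interpret P: Vector_Spaces.linear "(*s)" "(*s)" \<Psi> by (rule lin)
  have K: "u \<in> ?K \<longleftrightarrow> \<Psi> u = (\<Sum>j=m+1..CARD('n). vec_nth u (e j) *s ws j z)" for u by (simp add: pencil_ker_def iota_def \<Psi>_def)
  have subK: "vec.subspace ?K" unfolding pencil_ker_def by (rule vec.subspaceI) (auto simp: I.add I.scale I.zero)
  have inj: "inj_on \<Psi> ?K"
  proof (rule inj_onI)
    fix u v assume uv: "u \<in> ?K" "v \<in> ?K" "\<Psi> u = \<Psi> v"
    have d: "u - v \<in> ?K" by (rule vec.subspace_diff[OF subK uv(1,2)])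
    have 0: "\<Psi> (u - v) = 0" using uv(3) by (simp add: P.diff)
    have "vec_nth (u - v) i = 0" for i
    proof (cases "ei i \<le> m")
      case True
      have "vec_nth (u - v) (e (ei i)) = 0"
        by (rule LB.basis_independent[OF 0[unfolded \<Psi>_def]]) (use True ei_range[of i] in auto)
      then show ?thesis by (simp add: e_ei)
    next
      case False
      have "(\<Sum>j=m+1..CARD('n). vec_nth (u - v) (e j) *s ws j z) = 0" using d 0 unfolding K by simp
      then have "vec_nth (u - v) (e (ei i)) = 0" by (rule RB.basis_independent) (use False ei_range[of i] in auto)
      then show ?thesis by (simp add: e_ei)
    qed
    then have "u - v = 0" by (simp add: vec_eq_iff)
    then show "u = v" by simp
  qed
  have img: "\<Psi> ` ?K = Es z \<inter> Eu z"
  proof (intro equalityI subsetI)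
    fix y assume "y \<in> \<Psi> ` ?K"
    then obtain u where u: "u \<in> ?K" "y = \<Psi> u" by blast
    have "y \<in> Eu z" unfolding u(2) \<Psi>_def by (rule LB.basis_comb_in[OF R.center_in_ball])
    moreover have "y \<in> Es z" using u(1)[unfolded K] RB.basis_comb_in[OF R.center_in_ball, of "\<lambda>j. vec_nth u (e j)"] unfolding u(2) by simp
    ultimately show "y \<in> Es z \<inter> Eu z" by blast
  next
    fix y assume y: "y \<in> Es z \<inter> Eu z"
    obtain a where a: "y = (\<Sum>j=1..m. a j *s wu j z)" using LB.in_E_center[of y] y by blast
    obtain b where b: "y = (\<Sum>j=m+1..CARD('n). b j *s ws j z)" using RB.in_E_center[of y] y by blast
    define u :: "complex ^ 'n" where "u = (\<chi> i. if ei i \<le> m then a (ei i) else b (ei i))"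
    have "\<Psi> u = y" unfolding \<Psi>_def a using m by (auto simp: u_def ei_e intro!: sum.cong)
    moreover have "(\<Sum>j=m+1..CARD('n). vec_nth u (e j) *s ws j z) = y" unfolding b by (auto simp: u_def ei_e intro!: sum.cong)
    ultimately show "y \<in> \<Psi> ` ?K" using K[of u] by (metis imageI)
  qed
  have "geom_mult (*s) UNIV norm (iota m e wu ws) z = edim (*s) (Es z \<inter> Eu z)"
    unfolding geom_mult_def img[symmetric] by (rule edim_linear_image[OF lin subK inj, symmetric])
  also have "\<dots> = geom_mult cscale H1 l2norm (ode_op A) z"
    unfolding geom_mult_def pencil_ker_def ker_H1_L2_def[symmetric] edim_vec
    by (rule kernel_ode_op(3)[OF bd[OF R.center_in_ball] R.di[OF R.center_in_ball] L.di[OF R.center_in_ball], symmetric])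
  finally show ?thesis by simp
qed

end

section \<open>Assembling the local hypotheses at a point of the region\<close>

lemma half_Lipschitz_mono:
  assumes "half_Lipschitz B z K \<delta>" "0 < \<delta>'" "\<delta>' \<le> \<delta>" shows "half_Lipschitz B z K \<delta>'"
  using assms unfolding half_Lipschitz_def by (auto simp: subset_eq)

text \<open>The number of basis vectors fixes the dimension of the fibres throughout
  \<open>\<Omega>\<close>; this is the equality of dimensions that \<open>uniform_dichotomy\<close>
  relies on.\<close>

lemma analytic_basis_dim:
  fixes w :: "nat \<Rightarrow> complex \<Rightarrow> complex ^ 'n"
  assumes "is_analytic_basis \<Omega> J w V" "z \<in> \<Omega>" "finite J"
  shows "vec.dim (V z) = card J" "card J \<le> CARD('n)"
proof -
  have ind: "inj_on (\<lambda>j. w j z) J" "vec.independent ((\<lambda>j. w j z) ` J)" "vec.span ((\<lambda>j. w j z) ` J) = V z"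
    using assms by (auto simp: is_analytic_basis_def)
  show d: "vec.dim (V z) = card J"
    unfolding ind(3)[symmetric] vec.dim_span vec.dim_eq_card_independent[OF ind(2)] by (rule card_image[OF ind(1)])
  then show "card J \<le> CARD('n)" using vec.dim_subset_UNIV[of "V z"] by (simp add: vec.dimension_def card_cart_basis)
qed

text \<open>The end at \<open>at_bot\<close> is treated by reflection: the limit matrix becomes
  \<open>- Am\<close>, whose stable space is the unstable space of \<open>Am\<close>.\<close>

lemma dichotomies:
  fixes A :: "real \<Rightarrow> complex \<Rightarrow> complex ^ 'n ^ 'n"
  assumes cont: "continuous_on UNIV (\<lambda>x. A x z)"
    and Ap: "((\<lambda>x. A x z) \<longlongrightarrow> Ap) at_top" and Am: "((\<lambda>x. A x z) \<longlongrightarrow> Am) at_bot"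
    and fr: "fredholm_H1_L2 (ode_op A z)"
    and Es: "transported_family (\<lambda>x. A x z) at_top (stable_space Ap) Es"
    and Eu: "transported_family (\<lambda>x. A x z) at_bot (unstable_space Am) Eu"
  shows "dichotomy (\<lambda>x. A x z) (Es 0)" "dichotomy (left_coeff A z) (Eu 0)"
proof -
  have Lt: "(left_coeff A z \<longlongrightarrow> - Am) at_top"
    unfolding left_coeff_def[abs_def] by (intro tendsto_minus filterlim_compose[OF Am filterlim_uminus_at_bot_at_top])
  have Lb: "(left_coeff A z \<longlongrightarrow> - Ap) at_bot"
    unfolding left_coeff_def[abs_def] by (intro tendsto_minus filterlim_compose[OF Ap filterlim_uminus_at_top_at_bot])
  have Lc: "continuous_on UNIV (left_coeff A z)" unfolding left_coeff_def[abs_def]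
    by (intro continuous_on_minus continuous_on_compose2[OF cont, of UNIV uminus]) (auto intro: continuous_intros)
  obtain \<beta> where \<beta>: "bounded_coeff \<beta> (\<lambda>x. A x z)" by (rule bounded_coeff_if_limits[OF cont Ap Am])
  obtain \<beta>' where \<beta>': "bounded_coeff \<beta>' (left_coeff A z)" by (rule bounded_coeff_if_limits[OF Lc Lt Lb])
  have hyp: "hyperbolic Ap" "hyperbolic (- Am)" by (rule hyperbolic_limits[OF fr \<beta> \<beta>' Ap Lt])+
  have R: "transported_half (\<lambda>x. A x z) Es (stable_space Ap)" by (rule transported_half_right[OF Es])
  have L: "transported_half (left_coeff A z) (\<lambda>x. Eu (- x)) (stable_space (- Am))"
    unfolding stable_space_uminus by (rule transported_half_left[where A = A and z = z and E = Eu, OF Eu])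
  have s: "vec.subspace (Es 0)" "vec.subspace (Eu 0)" using Es Eu by (auto simp: transported_family_def)
  show "dichotomy (\<lambda>x. A x z) (Es 0)" unfolding dichotomy_def
  proof (intro conjI s exI[where P = "\<lambda>\<beta>. bounded_coeff \<beta> _", OF \<beta>])
    obtain C where "C \<ge> 0"
      "\<And>e. e \<in> Es 0 \<Longrightarrow> \<exists>u g. half u g \<and> (\<forall>x. residual (\<lambda>x. A x z) u g x = 0) \<and> u 0 = e"
      "\<And>u g. half u g \<Longrightarrow> \<exists>e\<in>Es 0. norm (u 0 - e) \<le> C * l2norm (residual (\<lambda>x. A x z) u g)"
      "\<And>u g. half u g \<Longrightarrow> l2norm u \<le> C * (norm (u 0) + l2norm (residual (\<lambda>x. A x z) u g))"
      by (rule half_line_dichotomy[OF \<beta> Ap hyp(1) R]) (rule that, assumption+)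
    then show "\<exists>C\<ge>0. (\<forall>e\<in>Es 0. \<exists>u g. half u g \<and> (\<forall>x. residual (\<lambda>x. A x z) u g x = 0) \<and> u 0 = e) \<and>
        (\<forall>u g. half u g \<longrightarrow> (\<exists>e\<in>Es 0. norm (u 0 - e) \<le> C * l2norm (residual (\<lambda>x. A x z) u g))) \<and>
        (\<forall>u g. half u g \<longrightarrow> l2norm u \<le> C * (norm (u 0) + l2norm (residual (\<lambda>x. A x z) u g)))"
      by (intro exI[of _ C] conjI) simp_all
  qed
  show "dichotomy (left_coeff A z) (Eu 0)" unfolding dichotomy_def
  proof (intro conjI s exI[where P = "\<lambda>\<beta>. bounded_coeff \<beta> _", OF \<beta>'])
    obtain C where "C \<ge> 0"
      "\<And>e. e \<in> Eu (- 0) \<Longrightarrow> \<exists>u g. half u g \<and> (\<forall>x. residual (left_coeff A z) u g x = 0) \<and> u 0 = e"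
      "\<And>u g. half u g \<Longrightarrow> \<exists>e\<in>Eu (- 0). norm (u 0 - e) \<le> C * l2norm (residual (left_coeff A z) u g)"
      "\<And>u g. half u g \<Longrightarrow> l2norm u \<le> C * (norm (u 0) + l2norm (residual (left_coeff A z) u g))"
      by (rule half_line_dichotomy[OF \<beta>' Lt hyp(2) L]) (rule that, assumption+)
    then show "\<exists>C\<ge>0. (\<forall>e\<in>Eu 0. \<exists>u g. half u g \<and> (\<forall>x. residual (left_coeff A z) u g x = 0) \<and> u 0 = e) \<and>
        (\<forall>u g. half u g \<longrightarrow> (\<exists>e\<in>Eu 0. norm (u 0 - e) \<le> C * l2norm (residual (left_coeff A z) u g))) \<and>
        (\<forall>u g. half u g \<longrightarrow> l2norm u \<le> C * (norm (u 0) + l2norm (residual (left_coeff A z) u g)))"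
      unfolding minus_zero by (intro exI[of _ C] conjI) simp_all
  qed
qed

theorem proposition2p6:
  fixes A :: "real \<Rightarrow> complex \<Rightarrow> complex ^ 'n ^ 'n"
    and Ap Am :: "complex \<Rightarrow> complex ^ 'n ^ 'n"
    and \<Omega> :: "complex set"
    and m :: nat
    and Es Eu :: "real \<Rightarrow> complex \<Rightarrow> (complex ^ 'n) set"
    and wu ws :: "nat \<Rightarrow> complex \<Rightarrow> complex ^ 'n"
    and e :: "nat \<Rightarrow> 'n"
  assumes region: "open \<Omega>" "connected \<Omega>"
    and A_cont: "\<And>z. z \<in> \<Omega> \<Longrightarrow> continuous_on UNIV (\<lambda>x. A x z)"
    and A_analytic: "\<And>x i j. (\<lambda>z. A x z $ i $ j) analytic_on \<Omega>"
    and A_plus: "\<And>z. z \<in> \<Omega> \<Longrightarrow> ((\<lambda>x. A x z) \<longlongrightarrow> Ap z) at_top"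
    and A_minus: "\<And>z. z \<in> \<Omega> \<Longrightarrow> ((\<lambda>x. A x z) \<longlongrightarrow> Am z) at_bot"
    and pencil: "analytic_pencil_H1_L2 (ode_op A) \<Omega>"
    and fredholm: "\<And>z. z \<in> \<Omega> \<Longrightarrow> fredholm_H1_L2 (ode_op A z)"
    and index0: "\<And>z. z \<in> \<Omega> \<Longrightarrow> fredholm_index (ode_op A z) = 0"
    and morse_plus: "\<And>z. z \<in> \<Omega> \<Longrightarrow> morse_index (Ap z) = m"
    and morse_minus: "\<And>z. z \<in> \<Omega> \<Longrightarrow> morse_index (Am z) = m"
    and Es: "\<And>z. z \<in> \<Omega> \<Longrightarrow>
      transported_family (\<lambda>x. A x z) at_top (stable_space (Ap z)) (\<lambda>x. Es x z)"
    and Eu: "\<And>z. z \<in> \<Omega> \<Longrightarrow>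
      transported_family (\<lambda>x. A x z) at_bot (unstable_space (Am z)) (\<lambda>x. Eu x z)"
    and wu: "is_analytic_basis \<Omega> {1..m} wu (Eu 0)"
    and ws: "is_analytic_basis \<Omega> {m+1..CARD('n)} ws (Es 0)"
    and e: "bij_betw e {1..CARD('n)} UNIV"
  shows "\<forall>z0\<in>\<Omega>.
      geom_mult cscale H1 l2norm (ode_op A) z0 = geom_mult (*s) UNIV norm (iota m e wu ws) z0 \<and>
      alg_mult cscale H1 l2norm (ode_op A) z0 = alg_mult (*s) UNIV norm (iota m e wu ws) z0 \<and>
      (is_eigenvalue H1 l2norm (ode_op A) z0 \<longrightarrow>
        alg_mult cscale H1 l2norm (ode_op A) z0 = root_order (evans m e wu ws) z0)"
proof
  fix z assume z: "z \<in> \<Omega>"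
  have di: "dichotomy (\<lambda>x. A x \<mu>) (Es 0 \<mu>)" "dichotomy (left_coeff A \<mu>) (Eu 0 \<mu>)" if "\<mu> \<in> \<Omega>" for \<mu>
    by (rule dichotomies[OF A_cont A_plus A_minus fredholm Es Eu]; fact that)+
  have mN: "m \<le> CARD('n)" using analytic_basis_dim(2)[OF wu z] by simp
  have dims: "vec.dim (Eu 0 \<mu>) = m" "vec.dim (Es 0 \<mu>) = CARD('n) - m" if "\<mu> \<in> \<Omega>" for \<mu>
    using analytic_basis_dim(1)[OF wu that] analytic_basis_dim(1)[OF ws that] by auto
  obtain K \<delta> where \<delta>: "ball z \<delta> \<subseteq> \<Omega>"
    and LR: "half_Lipschitz (\<lambda>\<mu> x. A x \<mu>) z K \<delta>" and LL: "half_Lipschitz (left_coeff A) z K \<delta>"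
    by (rule half_Lipschitz_if_pencil[OF pencil region(1) z]) (rule that, assumption+)
  have in\<Omega>: "\<mu> \<in> \<Omega>" if "\<mu> \<in> ball z \<delta>" for \<mu> using \<delta> that by blast
  obtain C1 \<delta>1 where 1: "C1 \<ge> 0" "\<delta>1 > 0" "\<delta>1 \<le> \<delta>"
    "\<And>\<mu> u g. \<mu> \<in> ball z \<delta>1 \<Longrightarrow> half u g \<Longrightarrow> \<exists>e\<in>Es 0 \<mu>. norm (u 0 - e) \<le> C1 * l2norm (residual (\<lambda>x. A x \<mu>) u g)"
    "\<And>\<mu> u g. \<mu> \<in> ball z \<delta>1 \<Longrightarrow> half u g \<Longrightarrow> l2norm u \<le> C1 * (norm (u 0) + l2norm (residual (\<lambda>x. A x \<mu>) u g))"
    by (rule uniform_dichotomy[of z \<delta> "\<lambda>\<mu> x. A x \<mu>" "Es 0", OF di(1)[OF in\<Omega>] LR dims(2)[OF in\<Omega>]]) (assumption, assumption, rule that, assumption+)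
  obtain C2 \<delta>2 where 2: "C2 \<ge> 0" "\<delta>2 > 0" "\<delta>2 \<le> \<delta>"
    "\<And>\<mu> u g. \<mu> \<in> ball z \<delta>2 \<Longrightarrow> half u g \<Longrightarrow> \<exists>e\<in>Eu 0 \<mu>. norm (u 0 - e) \<le> C2 * l2norm (residual (left_coeff A \<mu>) u g)"
    "\<And>\<mu> u g. \<mu> \<in> ball z \<delta>2 \<Longrightarrow> half u g \<Longrightarrow> l2norm u \<le> C2 * (norm (u 0) + l2norm (residual (left_coeff A \<mu>) u g))"
    by (rule uniform_dichotomy[of z \<delta> "left_coeff A" "Eu 0", OF di(2)[OF in\<Omega>] LL dims(1)[OF in\<Omega>]]) (assumption, assumption, rule that, assumption+)
  \<comment> \<open>One radius and one constant for both half-lines, since the two instances share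
    their parameters.\<close>
  define r where "r = min \<delta>1 \<delta>2"
  define C where "C = max C1 C2"
  have r: "r > 0" "r \<le> \<delta>" using 1 2 by (auto simp: r_def)
  have C: "C1 \<le> C" "C2 \<le> C" "C \<ge> 0" using 1 2 by (auto simp: C_def)
  have rb: "\<mu> \<in> \<Omega>" if "\<mu> \<in> ball z r" for \<mu> using in\<Omega> that r by auto
  have hol: "(\<lambda>\<mu>. A x \<mu> $ i $ j) holomorphic_on ball z r" for x i j
    using A_analytic analytic_on_subset[of _ \<Omega> "ball z r"] rb analytic_imp_holomorphic by blast
  have solv: "\<exists>u1 g1 u2 g2. half u1 g1 \<and> (AE x in lborel. residual (\<lambda>x. A x z) u1 g1 x = right_part f x) \<and>
      half u2 g2 \<and> (AE x in lborel. residual (left_coeff A z) u2 g2 x = left_part f x)" if f: "f \<in> L2" for f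
  proof -
    have "vec.dim (Es 0 z) + vec.dim (Eu 0 z) = CARD('n)" using dims[OF z] mN by simp
    then obtain u1 g1 u2 g2 where "half u1 g1" "AE x in lborel. residual (\<lambda>x. A x z) u1 g1 x = right_part f x"
      "half u2 g2" "AE x in lborel. residual (left_coeff A z) u2 g2 x = left_part f x"
      by (rule half_problems_solvable[OF fredholm[OF z] index0[OF z] di[OF z] _ f])
    then show ?thesis by (intro exI conjI)
  qed
  have anau: "(\<lambda>\<mu>. wu j \<mu> $ i) analytic_on {z}" if "j \<in> {1..m}" for i j
    using wu that z analytic_on_subset[of _ \<Omega> "{z}"] unfolding is_analytic_basis_def by blast
  have anas: "(\<lambda>\<mu>. ws j \<mu> $ i) analytic_on {z}" if "j \<in> {m+1..CARD('n)}" for i j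
    using ws that z analytic_on_subset[of _ \<Omega> "{z}"] unfolding is_analytic_basis_def by blast
  have R: "half_pencil (\<lambda>\<mu> x. A x \<mu>) (Es 0) z r K C"
  proof
    show "half_Lipschitz (\<lambda>\<mu> x. A x \<mu>) z K r" by (rule half_Lipschitz_mono[OF LR r])
    fix \<mu> and u g :: "real \<Rightarrow> complex ^ 'n" assume \<mu>: "\<mu> \<in> ball z r" and h: "half u g"
    have \<mu>1: "\<mu> \<in> ball z \<delta>1" using \<mu> by (simp add: r_def)
    show "\<exists>e\<in>Es 0 \<mu>. norm (u 0 - e) \<le> C * l2norm (residual (\<lambda>x. A x \<mu>) u g)"
      using 1(4)[OF \<mu>1 h] mult_right_mono[OF C(1) l2norm_nonneg] by (meson order_trans)
    have "C1 * (norm (u 0) + l2norm (residual (\<lambda>x. A x \<mu>) u g)) \<le> C * (norm (u 0) + l2norm (residual (\<lambda>x. A x \<mu>) u g))"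
      by (intro mult_right_mono C add_nonneg_nonneg norm_ge_zero l2norm_nonneg)
    with 1(5)[OF \<mu>1 h] show "l2norm u \<le> C * (norm (u 0) + l2norm (residual (\<lambda>x. A x \<mu>) u g))" by (rule order_trans)
  next
    fix f :: "real \<Rightarrow> complex ^ 'n" assume f: "f \<in> L2" "\<And>x. x < 0 \<Longrightarrow> f x = 0"
    have "right_part f = f" using f(2) by (auto simp: right_part_def fun_eq_iff)
    then show "\<exists>u g. half u g \<and> (AE x in lborel. residual (\<lambda>x. A x z) u g x = f x)" using solv[OF f(1)] by auto
  qed (use di(1) rb C hol in auto)
  have L: "half_pencil (left_coeff A) (Eu 0) z r K C"
  proof
    show "half_Lipschitz (left_coeff A) z K r" by (rule half_Lipschitz_mono[OF LL r])
    fix \<mu> and u g :: "real \<Rightarrow> complex ^ 'n" assume \<mu>: "\<mu> \<in> ball z r" and h: "half u g"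
    have \<mu>2: "\<mu> \<in> ball z \<delta>2" using \<mu> by (simp add: r_def)
    show "\<exists>e\<in>Eu 0 \<mu>. norm (u 0 - e) \<le> C * l2norm (residual (left_coeff A \<mu>) u g)"
      using 2(4)[OF \<mu>2 h] mult_right_mono[OF C(2) l2norm_nonneg] by (meson order_trans)
    have "C2 * (norm (u 0) + l2norm (residual (left_coeff A \<mu>) u g)) \<le> C * (norm (u 0) + l2norm (residual (left_coeff A \<mu>) u g))"
      by (intro mult_right_mono C add_nonneg_nonneg norm_ge_zero l2norm_nonneg)
    with 2(5)[OF \<mu>2 h] show "l2norm u \<le> C * (norm (u 0) + l2norm (residual (left_coeff A \<mu>) u g))" by (rule order_trans)
  next
    fix f :: "real \<Rightarrow> complex ^ 'n" assume f: "f \<in> L2" "\<And>x. x < 0 \<Longrightarrow> f x = 0"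
    \<comment> \<open>The right-hand side on the line whose left part is \<open>f\<close> is the
      reflection of \<open>f\<close>.\<close>
    have "left_part (\<lambda>x. f (- x)) = f" using f(2) by (auto simp: left_part_def fun_eq_iff)
    then show "\<exists>u g. half u g \<and> (AE x in lborel. residual (left_coeff A z) u g x = f x)"
      using solv[OF L2_reflect[OF f(1)]] by auto
  next
    fix x i j
    show "(\<lambda>\<mu>. left_coeff A \<mu> x $ i $ j) holomorphic_on ball z r"
      unfolding left_coeff_def using hol by (simp add: holomorphic_on_minus)
  qed (use di(2) rb C in auto)
  interpret evans_pencil A "Es 0" "Eu 0" z r K C m wu ws e
  proof (intro evans_pencil.intro ode_pencil.intro half_pencil_basis.intro R L)
    show "ode_pencil_axioms A z r" by unfold_locales (use fredholm rb in \<open>auto simp: fredholm_H1_L2_def\<close>)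
    show "half_pencil_basis_axioms (Es 0) z r {m+1..CARD('n)} ws"
      by unfold_locales (use ws rb z anas in \<open>auto simp: is_analytic_basis_def\<close>)
    show "half_pencil_basis_axioms (Eu 0) z r {1..m} wu"
      by unfold_locales (use wu rb z anau in \<open>auto simp: is_analytic_basis_def\<close>)
    show "evans_pencil_axioms m e" by unfold_locales (rule e, rule mN)
  qed
  show "geom_mult cscale H1 l2norm (ode_op A) z = geom_mult (*s) UNIV norm (iota m e wu ws) z \<and>
      alg_mult cscale H1 l2norm (ode_op A) z = alg_mult (*s) UNIV norm (iota m e wu ws) z \<and>
      (is_eigenvalue H1 l2norm (ode_op A) z \<longrightarrow>
        alg_mult cscale H1 l2norm (ode_op A) z = root_order (evans m e wu ws) z)"
    unfolding alg_mult_eq alg_mult_iota by (simp add: geom_mult_eq evans_def[abs_def])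
qed

end
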